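(* Let $\mathfrak{g}=\mathfrak{sl}_2(\mathbb{C})$ and $\mathfrak{L}^4=\mathfrak{g}\ltimes L(4)$, where $L(4)$ is an abelian ideal. Let $\mathcal{F}$ be the semi-simple additive category generated by the simple subquotients of the Enright-Arkhipov completions $\mathbf{EA}(\mathbf{L}(\lambda))$ of simple highest weight $\mathfrak{L}^4$-modules $\mathbf{L}(\lambda)$. (a) For each $\tilde\lambda\in\mathbb{C}\setminus\{0\}$ and each $i\in\mathbb{Z}_{>0}$, there is a unique, up to isomorphism, simple object $V(i,\tilde\lambda)$ in $\mathcal{F}$ on which $C_j$, for $j=2,3$, acts via $\tilde\lambda^j$ and which has $\mathfrak{g}$-types $L(i),L(i+2),L(i+4),\dots$, each with multiplicity one. (b) For each $\tilde\lambda\in\mathbb{C}\setminus\{0\}$, there is a unique, up to isomorphism, simple object $V'(0,\tilde\lambda)$ in $\mathcal{F}$ on which $C_j$, for $j=2,3$, acts via $\tilde\lambda^j$ and which has $\mathfrak{g}$-types $L(0),L(4),L(8),\dots$, each with multiplicity one. (c) For each $\tilde\lambda\in\mathbb{C}\setminus\{0\}$, there is a unique, up to isomorphism, simple object $V'(2,\tilde\lambda)$ in $\mathcal{F}$ on which $C_j$, for $j=2,3$, acts via $\tilde\lambda^j$ and which has $\mathfrak{g}$-types $L(2),L(6),L(10),\dots$, each with multiplicity one. (d) The modules in (a), (b), (c) provide a complete and irredundant list of representatives of isomorphism classes of simple objects in $\mathcal{F}$. (e) Let $V$ be a simple $\mathfrak{g}$-Harish-Chandra module for $\mathfrak{L}^4$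 on which $C_j$, for $j=2,3$, acts via $\tilde\lambda^j$, for some $\tilde\lambda\in\mathbb{C}\setminus\{0\}$. Then $V$ belongs to $\mathcal{F}$.
   Context: Everything is over $\mathbb{C}$. $\mathfrak{g}=\mathfrak{sl}_2$ has standard basis $f,h,e$; $L(n)$ is the simple $\mathfrak{g}$-module of dimension $n+1$. In $\mathfrak{L}^4=\mathfrak{g}\ltimes L(4)$ write $\mathfrak{r}=L(4)$, with basis $v_4,v_2,v_0,v_{-2},v_{-4}$ of weight vectors, $[h,v_i]=iv_i$, normalized by $[e,v_{4-2i}]=(5-i)v_{6-2i}$ for $i=1,2,3,4$. The algebra of $\mathfrak{g}$-invariants $\operatorname{Sym}(\mathfrak{r})^{\mathfrak{g}}$ (central in the universal enveloping algebra $U(\mathfrak{L}^4)$) is generated by the algebraically independent elements \[ C_2=v_0^2-3v_{-2}v_2+12v_{-4}v_4,\] \[ C_3=v_0^3-\tfrac92 v_{-2}v_0v_2+\tfrac{27}{2}v_{-2}^2v_4+\tfrac{27}{2}v_{-4}v_2^2-36v_{-4}v_0v_4.\] An $\mathfrak{L}^4$-module is a $\mathfrak{g}$-Harish-Chandra module if its restriction to $\mathfrak{g}$ is a direct sum of simple finite-dimensional $\mathfrak{g}$-modules, each isomorphism class occurring with finite multiplicity; the simple $\mathfrak{g}$-submodules are its $\mathfrak{g}$-types. Highest weight modules: let $\tilde{\mathfrak{h}}=\mathrm{span}\{h,v_0\}$ and $\tilde{\mathfrak{n}}_+=\mathrm{span}\{e,v_2,v_4\}$. For $\lambda\in\tilde{\mathfrak{h}}^*$,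 $\Delta(\lambda)=U(\mathfrak{L}^4)\otimes_{U(\tilde{\mathfrak{h}}\oplus\tilde{\mathfrak{n}}_+)}\mathbb{C}_\lambda$, where $\tilde{\mathfrak{h}}$ acts on the one-dimensional module $\mathbb{C}_\lambda$ by $\lambda$ and $\tilde{\mathfrak{n}}_+$ by $0$; $\mathbf{L}(\lambda)$ is the unique simple quotient of $\Delta(\lambda)$. Completion functor: let $U=U(\mathfrak{L}^4)$, let $U_{(f)}$ be the Ore localization of $U$ at the powers of $f$, and $S_f:=U_{(f)}/U$, a $U$-$U$-bimodule. For an $\mathfrak{L}^4$-module $M$, $\mathbf{EA}(M)$ is the submodule of $S_f\otimes_U M$ consisting of all $m$ with $\dim\mathbb{C}[e]m<\infty$.
   Formalization: In (d), completeness is claimed only for simple objects of F on which L(4) does not act by zero: if λ(v_0)=0 and λ(h)=-n-2, then EA(L(λ)) is L(n) with L(4) acting by zero, a simple object of F on which C_2=C_3=0, so it is not among the modules in (a)-(c). *)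

theory Defs
  imports Complex_Main "HOL-Library.Poly_Mapping" "HOL-Algebra.Module" "HOL-Algebra.AbelCoset"
begin

section \<open>Lie algebras with a finite basis\<close>

text \<open>A finite-dimensional complex Lie algebra is given by a finite type of basis vectors and its
  structure constants: \<open>[x, y] = (\<Sum>z. sc x y z \<cdot> z)\<close> for basis vectors \<open>x, y\<close>.\<close>

class lie_basis = finite +
  fixes sc :: "'a \<Rightarrow> 'a \<Rightarrow> 'a \<Rightarrow> complex"
  assumes sc_alt: "sc x x z = 0"
    and sc_skew: "sc x y z = - sc y x z"
    and sc_jacobi:
      "(\<Sum>u\<in>UNIV. sc x y u * sc u z t + sc y z u * sc u x t + sc z x u * sc u y t) = 0"

datatype sl2 = sl2_e | sl2_h | sl2_f

datatype rad = V4 | V2 | V0 | Vm2 | Vm4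

datatype l4 = Lg sl2 | Lr rad

lemma UNIV_sl2: "UNIV = {sl2_e, sl2_h, sl2_f}"
  using sl2.exhaust by auto

lemma UNIV_rad: "UNIV = {V4, V2, V0, Vm2, Vm4}"
  using rad.exhaust by auto

lemma UNIV_l4: "UNIV = range Lg \<union> range Lr"
  by (auto, rename_tac x, case_tac x, auto)

instance sl2 :: finite
  by standard (simp add: UNIV_sl2)

instance rad :: finite
  by standard (simp add: UNIV_rad)

instance l4 :: finite
  by standard (simp add: UNIV_l4)

lemma sum_sl2: "(\<Sum>z\<in>UNIV. g z) = g sl2_e + g sl2_h + (g sl2_f :: 'a :: comm_monoid_add)"
  by (simp add: UNIV_sl2 add.assoc)

lemma sum_rad:
  "(\<Sum>z\<in>UNIV. g z) = g V4 + g V2 + g V0 + g Vm2 + (g Vm4 :: 'a :: comm_monoid_add)"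
  by (simp add: UNIV_rad add.assoc)

lemma sum_l4: "(\<Sum>z\<in>UNIV. g z) = (\<Sum>x\<in>UNIV. g (Lg x)) + (\<Sum>v\<in>UNIV. g (Lr v) :: 'a :: comm_monoid_add)"
  unfolding UNIV_l4
  by (subst sum.union_disjoint) (auto simp: sum.reindex inj_on_def)

text \<open>\<open>[e, f] = h\<close>, \<open>[h, e] = 2e\<close>, \<open>[h, f] = -2f\<close>.\<close>

fun sl2_sc :: "sl2 \<Rightarrow> sl2 \<Rightarrow> sl2 \<Rightarrow> complex" where
  "sl2_sc sl2_e sl2_f sl2_h = 1"
| "sl2_sc sl2_f sl2_e sl2_h = -1"
| "sl2_sc sl2_h sl2_e sl2_e = 2"
| "sl2_sc sl2_e sl2_h sl2_e = -2"
| "sl2_sc sl2_h sl2_f sl2_f = -2"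
| "sl2_sc sl2_f sl2_h sl2_f = 2"
| "sl2_sc _ _ _ = 0"

text \<open>The action of \<open>sl2\<close> on \<open>L(4)\<close>: \<open>x\<close> sends \<open>v\<close> to \<open>\<Sum>w. rad_act x v w \<cdot> w\<close>.  The
  normalisation of \<open>e\<close> forces \<open>f\<close> to send \<open>v\<^bsub>4-2i\<^esub>\<close> to \<open>(i+1) v\<^bsub>2-2i\<^esub>\<close>.\<close>

fun rad_act :: "sl2 \<Rightarrow> rad \<Rightarrow> rad \<Rightarrow> complex" where
  "rad_act sl2_h v w =
    (if v \<noteq> w then 0 else case v of V4 \<Rightarrow> 4 | V2 \<Rightarrow> 2 | V0 \<Rightarrow> 0 | Vm2 \<Rightarrow> -2 | Vm4 \<Rightarrow> -4)"
| "rad_act sl2_e v w =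
    (if (v, w) = (V2, V4) then 4 else if (v, w) = (V0, V2) then 3
     else if (v, w) = (Vm2, V0) then 2 else if (v, w) = (Vm4, Vm2) then 1 else 0)"
| "rad_act sl2_f v w =
    (if (v, w) = (V4, V2) then 1 else if (v, w) = (V2, V0) then 2
     else if (v, w) = (V0, Vm2) then 3 else if (v, w) = (Vm2, Vm4) then 4 else 0)"

text \<open>The semi-direct product of \<open>sl2\<close> with the abelian ideal \<open>L(4)\<close>.\<close>

fun l4_sc :: "l4 \<Rightarrow> l4 \<Rightarrow> l4 \<Rightarrow> complex" where
  "l4_sc (Lg x) (Lg y) (Lg z) = sl2_sc x y z"
| "l4_sc (Lg x) (Lr v) (Lr w) = rad_act x v w"
| "l4_sc (Lr v) (Lg x) (Lr w) = - rad_act x v w"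
| "l4_sc _ _ _ = 0"

lemma sl2_sc_skew: "sl2_sc x y z = - sl2_sc y x z"
  by (cases x; cases y; cases z; simp)

lemma sl2_sc_alt: "sl2_sc x x z = 0"
  by (cases x; cases z; simp)

lemma sl2_sc_jacobi: "(\<Sum>u\<in>UNIV. sl2_sc x y u * sl2_sc u z t + sl2_sc y z u * sl2_sc u x t
    + sl2_sc z x u * sl2_sc u y t) = 0"
  by (cases x; cases y; cases z; cases t; simp add: sum_sl2)

lemma rad_act_rep: "(\<Sum>u\<in>UNIV. sl2_sc x y u * rad_act u v w)
    = (\<Sum>u\<in>UNIV. rad_act y v u * rad_act x u w - rad_act x v u * rad_act y u w)"
  by (cases x; cases y; cases v; cases w; simp add: sum_sl2 sum_rad)

instantiation sl2 :: lie_basis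
begin
definition "sc = sl2_sc"
instance
proof
  fix x y z t :: sl2
  show "sc x x z = 0" by (simp add: sc_sl2_def sl2_sc_alt)
  show "sc x y z = - sc y x z" unfolding sc_sl2_def by (rule sl2_sc_skew)
  show "(\<Sum>u\<in>UNIV. sc x y u * sc u z t + sc y z u * sc u x t + sc z x u * sc u y t) = 0"
    unfolding sc_sl2_def by (rule sl2_sc_jacobi)
qed
end

instantiation l4 :: lie_basis
begin
definition "sc = l4_sc"
instance
proof
  fix x y z t :: l4
  show "sc x x z = 0"
    by (cases x; cases z; simp add: sc_l4_def sl2_sc_alt)
  show skew: "sc x y z = - sc y x z" for x y z :: l4
    unfolding sc_l4_def by (cases x; cases y; cases z; simp; rule sl2_sc_skew)
  show "(\<Sum>u\<in>UNIV. sc x y u * sc u z t + sc y z u * sc u x t + sc z x u * sc u y t) = 0"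
    unfolding sc_l4_def
    using sl2_sc_jacobi
    by (cases x; cases y; cases z; cases t)
       (simp_all add: sum_l4 sum_subtractf sum_negf sum.distrib rad_act_rep)
qed
end

text \<open>The subalgebra spanned by \<open>h, v\<^sub>0, e, v\<^sub>2, v\<^sub>4\<close>.\<close>

datatype bor = Bh | B0 | Be | B2 | B4

fun bor_incl :: "bor \<Rightarrow> l4" where
  "bor_incl Bh = Lg sl2_h"
| "bor_incl B0 = Lr V0"
| "bor_incl Be = Lg sl2_e"
| "bor_incl B2 = Lr V2"
| "bor_incl B4 = Lr V4"

lemma UNIV_bor: "UNIV = {Bh, B0, Be, B2, B4}"
  using bor.exhaust by auto

instance bor :: finite
  by standard (simp add: UNIV_bor)

lemma inj_bor_incl: "inj bor_incl"
  unfolding inj_def by (intro allI; rename_tac x y; case_tac x; case_tac y; simp)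

lemma bor_closed: "z \<notin> range bor_incl \<Longrightarrow> sc (bor_incl x) (bor_incl y) z = 0"
proof (cases z)
  case (Lg w)
  then show "z \<notin> range bor_incl \<Longrightarrow> ?thesis"
    by (cases w; cases x; cases y; auto simp: sc_l4_def UNIV_bor)
next
  case (Lr w)
  then show "z \<notin> range bor_incl \<Longrightarrow> ?thesis"
    by (cases w; cases x; cases y; auto simp: sc_l4_def UNIV_bor)
qed

instantiation bor :: lie_basis
begin
definition "sc x y z = sc (bor_incl x) (bor_incl y) (bor_incl z)"
instance
proof
  fix x y z t :: bor
  show "sc x x z = 0" unfolding sc_bor_def by (rule sc_alt)
  show "sc x y z = - sc y x z" unfolding sc_bor_def by (rule sc_skew)
  let ?f = "\<lambda>u. sc (bor_incl x) (bor_incl y) u * sc u (bor_incl z) (bor_incl t)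
      + sc (bor_incl y) (bor_incl z) u * sc u (bor_incl x) (bor_incl t)
      + sc (bor_incl z) (bor_incl x) u * sc u (bor_incl y) (bor_incl t)"
  have "(\<Sum>u\<in>UNIV. sc x y u * sc u z t + sc y z u * sc u x t + sc z x u * sc u y t)
      = (\<Sum>u\<in>range bor_incl. ?f u)"
    unfolding sc_bor_def by (simp add: sum.reindex[OF inj_bor_incl])
  also have "\<dots> = (\<Sum>u\<in>UNIV. ?f u)"
    by (rule sum.mono_neutral_left) (auto simp: bor_closed)
  also have "\<dots> = 0" by (rule sc_jacobi)
  finally show "(\<Sum>u\<in>UNIV. sc x y u * sc u z t + sc y z u * sc u x t + sc z x u * sc u y t) = 0" .
qed
end

section \<open>Universal enveloping algebras\<close>

text \<open>Words form a monoid under concatenation, so \<open>'a word \<Rightarrow>\<^sub>0 complex\<close> with its convolution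
  product is the free associative algebra on \<open>'a\<close>.\<close>

datatype 'a word = Word (letters: "'a list")

instantiation word :: (type) monoid_add
begin
definition "0 = Word []"
definition "v + w = Word (letters v @ letters w)"
instance
  by standard (auto simp: zero_word_def plus_word_def word.expand)
end

lemma letters_simps [simp]: "letters 0 = []" "letters (v + w) = letters v @ letters w"
  by (auto simp: zero_word_def plus_word_def)

type_synonym 'a free_alg = "'a word \<Rightarrow>\<^sub>0 complex"

abbreviation fscal :: "complex \<Rightarrow> 'a free_alg" where
  "fscal c \<equiv> Poly_Mapping.single 0 c"

abbreviation fgen :: "'a \<Rightarrow> 'a free_alg" where
  "fgen x \<equiv> Poly_Mapping.single (Word [x]) 1"

definition lie_relator :: "'a::lie_basis \<Rightarrow> 'a \<Rightarrow> 'a free_alg" where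
  "lie_relator x y =
    fgen x * fgen y - fgen y * fgen x - (\<Sum>z\<in>UNIV. fscal (sc x y z) * fgen z)"

inductive_set uea_ideal :: "'a::lie_basis free_alg set" where
  uea_ideal_0: "0 \<in> uea_ideal"
| uea_ideal_rel: "a * lie_relator x y * b \<in> uea_ideal"
| uea_ideal_add: "p \<in> uea_ideal \<Longrightarrow> q \<in> uea_ideal \<Longrightarrow> p + q \<in> uea_ideal"

lemma uea_ideal_left: "p \<in> uea_ideal \<Longrightarrow> c * p \<in> uea_ideal"
proof (induction rule: uea_ideal.induct)
  case (uea_ideal_rel a x y b)
  show ?case using uea_ideal.uea_ideal_rel[of "c * a" x y b] by (simp add: mult.assoc)
qed (auto simp: distrib_left intro: uea_ideal.intros)

lemma uea_ideal_right: "p \<in> uea_ideal \<Longrightarrow> p * c \<in> uea_ideal"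
proof (induction rule: uea_ideal.induct)
  case (uea_ideal_rel a x y b)
  show ?case using uea_ideal.uea_ideal_rel[of a x y "b * c"] by (simp add: mult.assoc)
qed (auto simp: distrib_right intro: uea_ideal.intros)

lemma uea_ideal_uminus: "p \<in> uea_ideal \<Longrightarrow> - p \<in> uea_ideal"
  using uea_ideal_left[of p "- 1"] by simp

lemma uea_ideal_diff: "p \<in> uea_ideal \<Longrightarrow> q \<in> uea_ideal \<Longrightarrow> p - q \<in> uea_ideal"
  using uea_ideal_add[OF _ uea_ideal_uminus, of p q] by simp

lemma free_alg_induct [case_names single add]:
  fixes p :: "'b free_alg"
  assumes "\<And>w c. P (Poly_Mapping.single w c)" "\<And>p q. P p \<Longrightarrow> P q \<Longrightarrow> P (p + q)"
  shows "P p"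
proof (induction p rule: update_induct)
  case const
  show ?case using assms(1)[of 0 0] by simp
next
  case (update p w c)
  have "Poly_Mapping.update w c p = p + Poly_Mapping.single w c"
    using update(1) by (intro poly_mapping_eqI) (auto simp: lookup_update lookup_add lookup_single in_keys_iff)
  then show ?case using update assms by simp
qed

text \<open>The homomorphism from the free algebra extending \<open>\<sigma>\<close> on scalars and \<open>\<phi>\<close> on generators.\<close>

definition free_eval :: "(complex \<Rightarrow> 'r::ring_1) \<Rightarrow> ('a \<Rightarrow> 'r) \<Rightarrow> 'a free_alg \<Rightarrow> 'r" where
  "free_eval \<sigma> \<phi> p =
    (\<Sum>w\<in>Poly_Mapping.keys p. \<sigma> (Poly_Mapping.lookup p w) * prod_list (map \<phi> (letters w)))"

locale scalar_hom =
  fixes \<sigma> :: "complex \<Rightarrow> 'r::ring_1"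
  assumes scalar_add: "\<sigma> (a + b) = \<sigma> a + \<sigma> b"
    and scalar_mult: "\<sigma> (a * b) = \<sigma> a * \<sigma> b"
    and scalar_one: "\<sigma> 1 = 1"
    and scalar_central: "\<sigma> a * r = r * \<sigma> a"
begin

lemma scalar_zero: "\<sigma> 0 = 0"
  using scalar_add[of 0 0] by simp

lemma free_eval_superset:
  assumes "finite K" "Poly_Mapping.keys p \<subseteq> K"
  shows "free_eval \<sigma> \<phi> p =
    (\<Sum>w\<in>K. \<sigma> (Poly_Mapping.lookup p w) * prod_list (map \<phi> (letters w)))"
  unfolding free_eval_def
  by (rule sum.mono_neutral_left) (use assms in \<open>auto simp: in_keys_iff scalar_zero\<close>)

lemma free_eval_single:
  "free_eval \<sigma> \<phi> (Poly_Mapping.single w c) = \<sigma> c * prod_list (map \<phi> (letters w))"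
  by (subst free_eval_superset[of "{w}"]) auto

lemma free_eval_0: "free_eval \<sigma> \<phi> 0 = 0"
  by (simp add: free_eval_def)

lemma free_eval_add: "free_eval \<sigma> \<phi> (p + q) = free_eval \<sigma> \<phi> p + free_eval \<sigma> \<phi> q"
proof -
  let ?K = "Poly_Mapping.keys p \<union> Poly_Mapping.keys q"
  have "Poly_Mapping.keys (p + q) \<subseteq> ?K" by (rule Poly_Mapping.keys_add)
  then show ?thesis
    by (simp add: free_eval_superset[of ?K] lookup_add scalar_add distrib_right sum.distrib)
qed

lemma free_eval_uminus: "free_eval \<sigma> \<phi> (- p) = - free_eval \<sigma> \<phi> p"
  using free_eval_add[of \<phi> p "- p"] by (simp add: free_eval_0 eq_neg_iff_add_eq_0 add.commute)

lemma free_eval_diff: "free_eval \<sigma> \<phi> (p - q) = free_eval \<sigma> \<phi> p - free_eval \<sigma> \<phi> q"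
  using free_eval_add[of \<phi> p "- q"] by (simp add: free_eval_uminus)

lemma free_eval_mult: "free_eval \<sigma> \<phi> (p * q) = free_eval \<sigma> \<phi> p * free_eval \<sigma> \<phi> q"
proof (induction p rule: free_alg_induct)
  case (single v a)
  show ?case
  proof (induction q rule: free_alg_induct)
    case (single w b)
    have "\<sigma> a * (\<sigma> b * (x * y)) = \<sigma> a * (x * (\<sigma> b * y))" for x y
      by (metis mult.assoc scalar_central)
    then show ?case
      by (simp add: mult_single free_eval_single scalar_mult mult.assoc)
  qed (simp add: distrib_left free_eval_add)
qed (simp add: distrib_right free_eval_add)

lemma free_eval_sum: "free_eval \<sigma> \<phi> (\<Sum>i\<in>I. g i) = (\<Sum>i\<in>I. free_eval \<sigma> \<phi> (g i))"
  by (induction I rule: infinite_finite_induct) (auto simp: free_eval_0 free_eval_add)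

lemma free_eval_ideal:
  assumes "\<And>x y. \<phi> x * \<phi> y - \<phi> y * \<phi> x = (\<Sum>z\<in>UNIV. \<sigma> (sc x y z) * \<phi> z)" "p \<in> uea_ideal"
  shows "free_eval \<sigma> \<phi> p = 0"
  using assms(2)
  by (induction rule: uea_ideal.induct)
     (simp_all add: assms(1) lie_relator_def free_eval_0 free_eval_add free_eval_mult free_eval_diff
       free_eval_sum free_eval_single scalar_one)

end

lemma scalar_hom_id: "scalar_hom id"
  by unfold_locales (auto simp: algebra_simps)

quotient_type (overloaded) 'a uea = "'a::lie_basis free_alg" / "\<lambda>p q. p - q \<in> uea_ideal"
proof (rule equivpI)
  show "reflp (\<lambda>p q :: 'a::lie_basis free_alg. p - q \<in> uea_ideal)"
    by (rule reflpI) (simp add: uea_ideal_0)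
  show "symp (\<lambda>p q :: 'a::lie_basis free_alg. p - q \<in> uea_ideal)"
    by (metis (no_types, lifting) minus_diff_eq sympI uea_ideal_uminus)
  show "transp (\<lambda>p q :: 'a::lie_basis free_alg. p - q \<in> uea_ideal)"
    by (rule transpI, drule (1) uea_ideal_add) simp
qed

lemma uea_repr: "\<exists>p. u = abs_uea p"
  by (rule exI[of _ "rep_uea u"]) (simp add: Quotient3_abs_rep[OF Quotient3_uea])

instantiation uea :: (lie_basis) ring_1
begin

lift_definition zero_uea :: "'a uea" is 0 .
lift_definition one_uea :: "'a uea" is 1 .

lift_definition plus_uea :: "'a uea \<Rightarrow> 'a uea \<Rightarrow> 'a uea" is "(+)"
  by (drule (1) uea_ideal_add) (simp add: algebra_simps)

lift_definition minus_uea :: "'a uea \<Rightarrow> 'a uea \<Rightarrow> 'a uea" is "(-)"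
  by (drule (1) uea_ideal_diff) (simp add: algebra_simps)

lift_definition uminus_uea :: "'a uea \<Rightarrow> 'a uea" is uminus
  by (drule uea_ideal_uminus) simp

lift_definition times_uea :: "'a uea \<Rightarrow> 'a uea \<Rightarrow> 'a uea" is "(*)"
proof -
  fix p p' q q' :: "'a free_alg"
  assume "p - p' \<in> uea_ideal" "q - q' \<in> uea_ideal"
  then have "(p - p') * q + p' * (q - q') \<in> uea_ideal"
    by (intro uea_ideal_add uea_ideal_left uea_ideal_right)
  then show "p * q - p' * q' \<in> uea_ideal" by (simp add: algebra_simps)
qed

instance
proof
  interpret scalar_hom "id :: complex \<Rightarrow> complex" by (rule scalar_hom_id)
  have "free_eval id (\<lambda>_. 0) (1 :: 'a free_alg) = 1"
    using free_eval_single[of "\<lambda>_. 0" "0 :: 'a word" 1] by simp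
  moreover have "free_eval id (\<lambda>_. 0) p = 0" if "p \<in> uea_ideal" for p :: "'a free_alg"
    by (rule free_eval_ideal[OF _ that]) simp
  ultimately have "(1 :: 'a free_alg) \<notin> uea_ideal"
    by (metis zero_neq_one)
  then have "(1 - 0 :: 'a free_alg) \<notin> uea_ideal"
    by simp
  then have "(1 :: 'a uea) \<noteq> 0"
    by (simp only: zero_uea_def one_uea_def uea.abs_eq_iff not_False_eq_True)
  then show "(0 :: 'a uea) \<noteq> 1"
    by (rule not_sym)
next
  fix a b c :: "'a uea"
  obtain p q r where reps: "a = abs_uea p" "b = abs_uea q" "c = abs_uea r"
    using uea_repr by metis
  note uea = reps zero_uea_def one_uea_def plus_uea.abs_eq minus_uea.abs_eq uminus_uea.abs_eq
    times_uea.abs_eq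
  show "a + b + c = a + (b + c)" by (simp add: uea add.assoc)
  show "a + b = b + a" by (simp add: uea add.commute)
  show "0 + a = a" by (simp add: uea)
  show "- a + a = 0" by (simp add: uea)
  show "a - b = a + - b" by (simp add: uea)
  show "a * b * c = a * (b * c)" by (simp add: uea mult.assoc)
  show "1 * a = a" by (simp add: uea)
  show "a * 1 = a" by (simp add: uea)
  show "(a + b) * c = a * c + b * c" by (simp add: uea distrib_right)
  show "a * (b + c) = a * b + a * c" by (simp add: uea distrib_left)
qed

end

lift_definition scal :: "complex \<Rightarrow> 'a::lie_basis uea" is fscal .

lift_definition gen :: "'a::lie_basis \<Rightarrow> 'a uea" is fgen .

lemma gen_commutator:
  "gen x * gen y - gen y * gen x = (\<Sum>z\<in>UNIV. scal (sc x y z) * gen z)"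
proof -
  have sum: "abs_uea (\<Sum>z\<in>I. g z) = (\<Sum>z\<in>I. abs_uea (g z))" for g :: "'b \<Rightarrow> 'a free_alg" and I
    by (induction I rule: infinite_finite_induct)
       (auto simp: zero_uea.abs_eq[symmetric] plus_uea.abs_eq[symmetric])
  have "lie_relator x y \<in> uea_ideal" using uea_ideal_rel[of 1 x y 1] by simp
  then have "abs_uea (fgen x * fgen y - fgen y * fgen x)
      = abs_uea (\<Sum>z\<in>UNIV. fscal (sc x y z) * fgen z)"
    by (simp add: uea.abs_eq_iff lie_relator_def)
  then show ?thesis
    by (simp add: sum gen.abs_eq scal.abs_eq times_uea.abs_eq minus_uea.abs_eq)
qed

interpretation scal: scalar_hom "scal :: complex \<Rightarrow> 'a::lie_basis uea"
proof
  fix a b :: complex and r :: "'a uea"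
  show "scal (a + b) = (scal a + scal b :: 'a uea)"
    by transfer (simp add: single_add uea_ideal_0)
  show "scal (a * b) = (scal a * scal b :: 'a uea)"
    by transfer (simp add: mult_single uea_ideal_0)
  show "scal 1 = (1 :: 'a uea)"
    by transfer (simp add: uea_ideal_0)
  show "scal a * r = r * scal a"
  proof transfer
    fix a and r :: "'a free_alg"
    have "fscal a * r = r * fscal a"
      by (induction r rule: free_alg_induct)
         (auto simp: mult_single mult.commute distrib_left distrib_right)
    then show "fscal a * r - r * fscal a \<in> uea_ideal" by (simp add: uea_ideal_0)
  qed
qed

text \<open>The universal property; \<open>uea_lift \<sigma> \<phi>\<close> is meaningful when \<open>\<phi>\<close> respects the bracket.\<close>

definition uea_lift :: "(complex \<Rightarrow> 'r::ring_1) \<Rightarrow> ('a::lie_basis \<Rightarrow> 'r) \<Rightarrow> 'a uea \<Rightarrow> 'r" where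
  "uea_lift \<sigma> \<phi> u = free_eval \<sigma> \<phi> (rep_uea u)"

locale uea_rep = scalar_hom \<sigma> for \<sigma> :: "complex \<Rightarrow> 'r::ring_1" +
  fixes \<phi> :: "'a::lie_basis \<Rightarrow> 'r"
  assumes rep_bracket: "\<phi> x * \<phi> y - \<phi> y * \<phi> x = (\<Sum>z\<in>UNIV. \<sigma> (sc x y z) * \<phi> z)"
begin

lemma uea_lift_abs: "uea_lift \<sigma> \<phi> (abs_uea p) = free_eval \<sigma> \<phi> p"
proof -
  have "rep_uea (abs_uea p) - p \<in> uea_ideal"
    by (metis uea.abs_eq_iff Quotient3_abs_rep Quotient3_uea)
  then show ?thesis
    using free_eval_ideal[OF rep_bracket] free_eval_diff unfolding uea_lift_def by (metis eq_iff_diff_eq_0)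
qed

lemma uea_lift_add: "uea_lift \<sigma> \<phi> (u + v) = uea_lift \<sigma> \<phi> u + uea_lift \<sigma> \<phi> v"
  using uea_repr[of u] uea_repr[of v] by (auto simp: plus_uea.abs_eq uea_lift_abs free_eval_add)

lemma uea_lift_mult: "uea_lift \<sigma> \<phi> (u * v) = uea_lift \<sigma> \<phi> u * uea_lift \<sigma> \<phi> v"
  using uea_repr[of u] uea_repr[of v] by (auto simp: times_uea.abs_eq uea_lift_abs free_eval_mult)

lemma uea_lift_scal: "uea_lift \<sigma> \<phi> (scal c) = \<sigma> c"
  by (simp add: scal.abs_eq uea_lift_abs free_eval_single)

lemma uea_lift_gen: "uea_lift \<sigma> \<phi> (gen x) = \<phi> x"
  by (simp add: gen.abs_eq uea_lift_abs free_eval_single scalar_one)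

lemma uea_lift_one: "uea_lift \<sigma> \<phi> 1 = 1"
  using uea_lift_scal[of 1] by (simp add: scal.scalar_one scalar_one)

end

text \<open>The maps \<open>U(sl2) \<rightarrow> U(L)\<close> and \<open>U(b) \<rightarrow> U(L)\<close> induced by the inclusions of \<open>sl2\<close> and of the
  Borel-like subalgebra \<open>b\<close> into \<open>L = sl2 \<ltimes> L(4)\<close>.\<close>

definition sl2_emb :: "sl2 uea \<Rightarrow> l4 uea" where
  "sl2_emb = uea_lift scal (\<lambda>x. gen (Lg x))"

definition bor_emb :: "bor uea \<Rightarrow> l4 uea" where
  "bor_emb = uea_lift scal (\<lambda>x. gen (bor_incl x))"

interpretation sl2_emb: uea_rep scal "\<lambda>x. gen (Lg x)"
proof
  fix x y
  have "sc (Lg x) (Lg y) (Lr v) = 0" for v by (simp add: sc_l4_def)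
  moreover have "sc (Lg x) (Lg y) (Lg z) = sc x y z" for z by (simp add: sc_l4_def sc_sl2_def)
  ultimately show "gen (Lg x) * gen (Lg y) - gen (Lg y) * gen (Lg x)
      = (\<Sum>z\<in>UNIV. scal (sc x y z) * gen (Lg z))"
    by (simp add: gen_commutator sum_l4 scal.scalar_zero)
qed

interpretation bor_emb: uea_rep scal "\<lambda>x. gen (bor_incl x)"
proof
  fix x y
  have "(\<Sum>z\<in>UNIV. scal (sc (bor_incl x) (bor_incl y) z) * gen z)
      = (\<Sum>z\<in>range bor_incl. scal (sc (bor_incl x) (bor_incl y) z) * gen z)"
    by (rule sum.mono_neutral_right) (auto simp: bor_closed scal.scalar_zero)
  then show "gen (bor_incl x) * gen (bor_incl y) - gen (bor_incl y) * gen (bor_incl x)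
      = (\<Sum>z\<in>UNIV. scal (sc x y z) * gen (bor_incl z))"
    by (simp add: gen_commutator sc_bor_def sum.reindex[OF inj_bor_incl])
qed

text \<open>The weight \<open>\<lambda>\<close> is given by \<open>a = \<lambda>(h)\<close> and \<open>c = \<lambda>(v\<^sub>0)\<close>.\<close>

fun bor_weight :: "complex \<Rightarrow> complex \<Rightarrow> bor \<Rightarrow> complex" where
  "bor_weight a c Bh = a"
| "bor_weight a c B0 = c"
| "bor_weight a c _ = 0"

definition bor_char :: "complex \<Rightarrow> complex \<Rightarrow> bor uea \<Rightarrow> complex" where
  "bor_char a c = uea_lift id (bor_weight a c)"

interpretation bor_char: uea_rep id "bor_weight a c" for a c
proof -
  interpret scalar_hom "id :: complex \<Rightarrow> complex" by (rule scalar_hom_id)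
  show "uea_rep id (bor_weight a c)"
  proof
    fix x y
    have "sc x y Bh = 0" "sc x y B0 = 0"
      by (cases x; cases y; simp add: sc_bor_def sc_l4_def)+
    then show "bor_weight a c x * bor_weight a c y - bor_weight a c y * bor_weight a c x
        = (\<Sum>z\<in>UNIV. id (sc x y z) * bor_weight a c z)"
      by (simp add: UNIV_bor)
  qed
qed

abbreviation "uf \<equiv> gen (Lg sl2_f) :: l4 uea"

section \<open>Ore localization\<close>

definition ad_f :: "l4 uea \<Rightarrow> l4 uea" where
  "ad_f u = uf * u - u * uf"

definition ad_nil :: "l4 uea \<Rightarrow> bool" where
  "ad_nil u \<longleftrightarrow> (\<exists>n. (ad_f ^^ n) u = 0)"

lemma uea_induct [case_names scal gen add mult]:
  fixes u :: "'a::lie_basis uea"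
  assumes "\<And>c. P (scal c)" "\<And>x. P (gen x)"
    "\<And>u v. P u \<Longrightarrow> P v \<Longrightarrow> P (u + v)" "\<And>u v. P u \<Longrightarrow> P v \<Longrightarrow> P (u * v)"
  shows "P u"
proof -
  obtain p where abs_uea: "u = abs_uea p" using uea_repr by blast
  have word: "P (abs_uea (Poly_Mapping.single (Word xs) 1))" for xs
  proof (induction xs)
    case Nil
    have "abs_uea (Poly_Mapping.single (Word []) 1) = (scal 1 :: 'a uea)"
      by (simp add: scal.abs_eq zero_word_def)
    then show ?case using assms(1) by metis
  next
    case (Cons x xs)
    have "abs_uea (Poly_Mapping.single (Word (x # xs)) 1)
        = gen x * abs_uea (Poly_Mapping.single (Word xs) 1)"
      by (simp add: gen.abs_eq times_uea.abs_eq mult_single plus_word_def)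
    then show ?case using assms(2,4) Cons by metis
  qed
  have "P (abs_uea p)"
  proof (induction p rule: free_alg_induct)
    case (single w c)
    have "abs_uea (Poly_Mapping.single w c) = scal c * abs_uea (Poly_Mapping.single (Word (letters w)) 1)"
      by (simp add: scal.abs_eq times_uea.abs_eq mult_single)
    then show ?case using assms(1,4) word by metis
  next
    case (add p q)
    then show ?case using assms(3) by (metis plus_uea.abs_eq)
  qed
  then show ?thesis using abs_uea by simp
qed

lemma ad_f_add: "ad_f (u + v) = ad_f u + ad_f v"
  by (simp add: ad_f_def algebra_simps)

lemma ad_f_mult: "ad_f (u * v) = ad_f u * v + u * ad_f v"
  by (simp add: ad_f_def algebra_simps)

lemma ad_f_pow_add: "(ad_f ^^ n) (u + v) = (ad_f ^^ n) u + (ad_f ^^ n) v"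
  by (induction n) (auto simp: ad_f_add)

lemma ad_f_pow_0: "(ad_f ^^ n) 0 = 0"
  by (induction n) (auto simp: ad_f_def)

lemma ad_f_pow_mono: "(ad_f ^^ n) u = 0 \<Longrightarrow> n \<le> m \<Longrightarrow> (ad_f ^^ m) u = 0"
  by (metis (no_types, lifting) ad_f_pow_0 comp_apply funpow_add le_add_diff_inverse2)

lemma ad_f_pow_mult: "(ad_f ^^ a) u = 0 \<Longrightarrow> (ad_f ^^ b) v = 0 \<Longrightarrow> (ad_f ^^ (a + b)) (u * v) = 0"
proof (induction "a + b" arbitrary: a b u v)
  case (Suc n)
  show ?case
  proof (cases "a = 0 \<or> b = 0")
    case True
    then show ?thesis using Suc.prems by (auto simp: ad_f_pow_0)
  next
    case False
    then obtain a' b' where ab: "a = Suc a'" "b = Suc b'" by (metis not0_implies_Suc)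
    have d: "(ad_f ^^ a') (ad_f u) = 0" "(ad_f ^^ b') (ad_f v) = 0"
      using Suc.prems ab by (simp_all add: funpow_swap1)
    have "(ad_f ^^ (a' + b)) (ad_f u * v) = 0"
      by (rule Suc.hyps(1)) (use d Suc ab in auto)
    moreover have "(ad_f ^^ (a + b')) (u * ad_f v) = 0"
      by (rule Suc.hyps(1)) (use d Suc ab in auto)
    moreover have "a + b = Suc (a' + b)" "a + b' = a' + b" using ab by auto
    ultimately show ?thesis
      by (simp only: funpow_Suc_right comp_apply ad_f_mult ad_f_pow_add) simp
  qed
qed auto

lemma ad_nil_scal: "ad_nil (scal c)"
  unfolding ad_nil_def by (rule exI[of _ 1]) (simp add: ad_f_def scal.scalar_central)

lemma ad_nil_add:
  assumes "ad_nil u" "ad_nil v"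
  shows "ad_nil (u + v)"
proof -
  obtain m n where "(ad_f ^^ m) u = 0" "(ad_f ^^ n) v = 0" using assms unfolding ad_nil_def by blast
  then have "(ad_f ^^ (m + n)) (u + v) = 0"
    by (simp add: ad_f_pow_add ad_f_pow_mono[of m u] ad_f_pow_mono[of n v])
  then show ?thesis unfolding ad_nil_def by blast
qed

lemma ad_nil_mult: "ad_nil u \<Longrightarrow> ad_nil v \<Longrightarrow> ad_nil (u * v)"
  unfolding ad_nil_def using ad_f_pow_mult by blast

lemma ad_nil_step: "ad_nil (ad_f u) \<Longrightarrow> ad_nil u"
proof -
  assume "ad_nil (ad_f u)"
  then obtain n where "(ad_f ^^ n) (ad_f u) = 0" unfolding ad_nil_def by blast
  then have "(ad_f ^^ Suc n) u = 0" by (simp only: funpow_Suc_right comp_apply)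
  then show "ad_nil u" unfolding ad_nil_def by blast
qed

lemma ad_nil_step_scal: "ad_f u = scal c * v \<Longrightarrow> ad_nil v \<Longrightarrow> ad_nil u"
  by (rule ad_nil_step) (simp add: ad_nil_mult ad_nil_scal)

lemma ad_nil_gen: "ad_nil (gen x)"
proof -
  note ad = ad_f_def gen_commutator sum_l4 sum_sl2 sum_rad sc_l4_def scal.scalar_zero
  have "ad_nil 0" unfolding ad_nil_def by (rule exI[of _ 0]) simp
  moreover have "ad_f uf = 0" by (simp add: ad)
  ultimately have f: "ad_nil uf" using ad_nil_step[of uf] by simp
  have "ad_f (gen (Lg sl2_h)) = scal 2 * gen (Lg sl2_f)" by (simp add: ad)
  then have h: "ad_nil (gen (Lg sl2_h))" by (rule ad_nil_step_scal) (rule f)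
  have "ad_f (gen (Lg sl2_e)) = scal (-1) * gen (Lg sl2_h)" by (simp add: ad)
  then have e: "ad_nil (gen (Lg sl2_e))" by (rule ad_nil_step_scal) (rule h)
  have "ad_f (gen (Lr Vm4)) = 0" by (simp add: ad)
  then have m4: "ad_nil (gen (Lr Vm4))" using ad_nil_step[of "gen (Lr Vm4)"] \<open>ad_nil 0\<close> by simp
  have "ad_f (gen (Lr Vm2)) = scal 4 * gen (Lr Vm4)" by (simp add: ad)
  then have m2: "ad_nil (gen (Lr Vm2))" by (rule ad_nil_step_scal) (rule m4)
  have "ad_f (gen (Lr V0)) = scal 3 * gen (Lr Vm2)" by (simp add: ad)
  then have v0: "ad_nil (gen (Lr V0))" by (rule ad_nil_step_scal) (rule m2)
  have "ad_f (gen (Lr V2)) = scal 2 * gen (Lr V0)" by (simp add: ad)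
  then have v2: "ad_nil (gen (Lr V2))" by (rule ad_nil_step_scal) (rule v0)
  have "ad_f (gen (Lr V4)) = scal 1 * gen (Lr V2)" by (simp add: ad)
  then have v4: "ad_nil (gen (Lr V4))" by (rule ad_nil_step_scal) (rule v2)
  show ?thesis
  proof (cases x)
    case (Lg y)
    then show ?thesis using e f h by (cases y) auto
  next
    case (Lr y)
    then show ?thesis using v4 v2 v0 m2 m4 by (cases y) auto
  qed
qed

lemma ad_nil: "ad_nil u"
  by (induction u rule: uea_induct) (auto intro: ad_nil_scal ad_nil_gen ad_nil_add ad_nil_mult)

lemma ad_nil_induct [case_names zero step]:
  assumes "P 0" "\<And>u. P (ad_f u) \<Longrightarrow> P u"
  shows "P u"
proof -
  have "(ad_f ^^ n) u = 0 \<Longrightarrow> P u" for n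
  proof (induction n arbitrary: u)
    case (Suc n)
    then show ?case using assms(2) by (simp only: funpow_Suc_right comp_apply)
  qed (use assms in auto)
  then show ?thesis using ad_nil unfolding ad_nil_def by blast
qed

text \<open>The powers of \<open>f\<close> form a left denominator set: the left Ore condition and left
  reversibility.\<close>

lemma f_pow_commute: "uf ^ k * u = u * uf ^ k + (\<Sum>i<k. uf ^ i * ad_f u * uf ^ (k - 1 - i))"
proof (induction k)
  case (Suc k)
  have "uf ^ i * ad_f u * uf ^ (k - i) = uf ^ i * ad_f u * uf ^ (k - 1 - i) * uf" if "i < k" for i
  proof -
    have "k - i = Suc (k - 1 - i)" using that by simp
    then show ?thesis by (simp only: power_Suc2 mult.assoc)
  qed
  then have "(\<Sum>i<k. uf ^ i * ad_f u * uf ^ (k - i)) = (\<Sum>i<k. uf ^ i * ad_f u * uf ^ (k - 1 - i)) * uf"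
    by (simp add: sum_distrib_right)
  moreover have "uf ^ Suc k * u = uf ^ k * ad_f u + uf ^ k * u * uf"
    by (simp only: ad_f_def power_Suc2) (simp add: algebra_simps)
  ultimately show ?case
    by (simp add: Suc distrib_right power_Suc2 mult.assoc del: power_Suc)
qed auto

lemma ore_left: "\<exists>k u'. uf ^ k * u = u' * uf ^ n"
proof (induction u rule: ad_nil_induct)
  case zero
  show ?case by (intro exI[of _ 0]) simp
next
  case (step u)
  then obtain m y where my: "uf ^ m * ad_f u = y * uf ^ n" by blast
  have "\<exists>t. uf ^ i * ad_f u * uf ^ (m + n - 1 - i) = t * uf ^ n" if "i < m + n" for i
  proof (cases "i < m")
    case True
    then have "m + n - 1 - i = (m - 1 - i) + n" using that by auto
    then have "uf ^ i * ad_f u * uf ^ (m + n - 1 - i) = (uf ^ i * ad_f u * uf ^ (m - 1 - i)) * uf ^ n"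
      by (simp only: power_add mult.assoc)
    then show ?thesis by blast
  next
    case False
    then have i: "i = (i - m) + m" by simp
    have "uf ^ i * ad_f u = uf ^ (i - m) * (uf ^ m * ad_f u)"
      by (subst i) (simp only: power_add mult.assoc)
    also have "\<dots> = uf ^ (i - m) * y * uf ^ n"
      by (simp only: my mult.assoc)
    finally have "uf ^ i * ad_f u * uf ^ (m + n - 1 - i)
        = (uf ^ (i - m) * y * uf ^ (m + n - 1 - i)) * uf ^ n"
      by (simp only: mult.assoc power_add[symmetric] add.commute)
    then show ?thesis by blast
  qed
  then obtain t where t: "uf ^ i * ad_f u * uf ^ (m + n - 1 - i) = t i * uf ^ n" if "i < m + n" for i
    by metis
  have "(\<Sum>i<m + n. uf ^ i * ad_f u * uf ^ (m + n - 1 - i)) = (\<Sum>i<m + n. t i * uf ^ n)"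
    by (rule sum.cong) (simp_all only: t lessThan_iff)
  then have "uf ^ (m + n) * u = u * uf ^ m * uf ^ n + (\<Sum>i<m + n. t i * uf ^ n)"
    by (subst f_pow_commute) (simp only: power_add mult.assoc)
  then have "uf ^ (m + n) * u = (u * uf ^ m + (\<Sum>i<m + n. t i)) * uf ^ n"
    by (simp only: distrib_right sum_distrib_right)
  then show ?case by blast
qed

lemma ore_cancel1: "u * uf = 0 \<Longrightarrow> \<exists>k. uf ^ k * u = 0"
proof (induction u rule: ad_nil_induct)
  case (step u)
  have "ad_f u * uf = 0" using step.prems by (simp add: ad_f_def left_diff_distrib mult.assoc)
  then obtain k where "uf ^ k * ad_f u = 0" using step.IH by blast
  then have "uf ^ Suc k * u = 0"
    using step.prems by (simp add: ad_f_def power_Suc2 mult.assoc del: power_Suc)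
  then show ?case by blast
qed auto

lemma ore_cancel: "u * uf ^ n = 0 \<Longrightarrow> \<exists>k. uf ^ k * u = 0"
proof (induction n arbitrary: u)
  case 0
  then show ?case by (intro exI[of _ 0]) simp
next
  case (Suc n)
  then have "u * uf * uf ^ n = 0" by (simp add: mult.assoc)
  then obtain k where "uf ^ k * (u * uf) = 0" using Suc.IH by blast
  then have "(uf ^ k * u) * uf = 0" by (simp only: mult.assoc)
  then obtain j where "uf ^ j * (uf ^ k * u) = 0" using ore_cancel1 by blast
  then have "uf ^ (j + k) * u = 0" by (simp only: power_add mult.assoc)
  then show ?case by blast
qed

lemma ore_cancel_eq:
  assumes "u * uf ^ n = v * uf ^ n"
  shows "\<exists>k. uf ^ k * u = uf ^ k * v"
proof -
  have "(u - v) * uf ^ n = 0" using assms by (simp only: left_diff_distrib) simp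
  then obtain k where "uf ^ k * (u - v) = 0" using ore_cancel by blast
  then have "uf ^ k * u = uf ^ k * v" by (simp only: right_diff_distrib) simp
  then show ?thesis by blast
qed

text \<open>The pair \<open>(n, u)\<close> stands for the left fraction \<open>f\<^sup>-\<^sup>n u\<close>.\<close>

definition ore_rel :: "nat \<times> l4 uea \<Rightarrow> nat \<times> l4 uea \<Rightarrow> bool" where
  "ore_rel x y \<longleftrightarrow> (\<exists>k. uf ^ (k + fst y) * snd x = uf ^ (k + fst x) * snd y)"

lemma ore_shift: "uf ^ a * u = uf ^ b * v \<Longrightarrow> uf ^ (c + a) * u = uf ^ (c + b) * v"
  by (simp only: power_add mult.assoc)

lemma ore_rel_trans: "ore_rel x y \<Longrightarrow> ore_rel y z \<Longrightarrow> ore_rel x z"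
proof -
  obtain n u m v p w where xyz: "x = (n, u)" "y = (m, v)" "z = (p, w)"
    by (cases x; cases y; cases z)
  assume "ore_rel x y" "ore_rel y z"
  then obtain k l where "uf ^ (k + m) * u = uf ^ (k + n) * v" "uf ^ (l + p) * v = uf ^ (l + m) * w"
    unfolding ore_rel_def xyz by auto
  from ore_shift[OF this(1), of "l + p"] ore_shift[OF this(2), of "k + n"]
  have "uf ^ ((k + l + m) + p) * u = uf ^ ((k + l + m) + n) * w" by (simp add: ac_simps)
  then show "ore_rel x z" unfolding ore_rel_def xyz by auto
qed

quotient_type uloc = "nat \<times> l4 uea" / ore_rel
proof (rule equivpI)
  show "reflp ore_rel" by (rule reflpI) (simp add: ore_rel_def)
  show "symp ore_rel" unfolding symp_def ore_rel_def by (blast intro: sym)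
  show "transp ore_rel" using ore_rel_trans by (rule transpI)
qed

definition fr :: "nat \<Rightarrow> l4 uea \<Rightarrow> uloc" where
  "fr n u = abs_uloc (n, u)"

lemma fr_eq_iff: "fr n u = fr m v \<longleftrightarrow> (\<exists>k. uf ^ (k + m) * u = uf ^ (k + n) * v)"
  by (simp add: fr_def uloc.abs_eq_iff ore_rel_def)

lemma fr_expand: "fr n u = fr (k + n) (uf ^ k * u)"
proof -
  have "uf ^ (0 + (k + n)) * u = uf ^ (0 + n) * (uf ^ k * u)"
    by (simp only: add_0 mult.assoc[symmetric] power_add[symmetric] add.commute)
  then show ?thesis unfolding fr_eq_iff by blast
qed

lemma fr_cases: obtains n u where "x = fr n u"
proof -
  obtain n u where "rep_uloc x = (n, u)" by fastforce
  moreover have "abs_uloc (rep_uloc x) = x" by (rule Quotient3_abs_rep[OF Quotient3_uloc])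
  ultimately have "x = fr n u" by (simp add: fr_def)
  then show ?thesis by (rule that)
qed

lemma fr_common: obtains n u v where "x = fr n u" "y = fr n v"
proof -
  obtain n u where x: "x = fr n u" by (rule fr_cases)
  obtain m v where y: "y = fr m v" by (rule fr_cases)
  show ?thesis
  proof (rule that)
    show "x = fr (m + n) (uf ^ m * u)" unfolding x by (rule fr_expand)
    show "y = fr (m + n) (uf ^ n * v)" unfolding y add.commute[of m n] by (rule fr_expand)
  qed
qed

lemma fr_common3: obtains n u v w where "x = fr n u" "y = fr n v" "z = fr n w"
proof -
  obtain n u v where x: "x = fr n u" and y: "y = fr n v" by (rule fr_common)
  obtain m w where z: "z = fr m w" by (rule fr_cases)
  show ?thesis
  proof (rule that)
    show "x = fr (m + n) (uf ^ m * u)" unfolding x by (rule fr_expand)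
    show "y = fr (m + n) (uf ^ m * v)" unfolding y by (rule fr_expand)
    show "z = fr (m + n) (uf ^ n * w)" unfolding z add.commute[of m n] by (rule fr_expand)
  qed
qed

definition ore_pair :: "l4 uea \<Rightarrow> nat \<Rightarrow> nat \<times> l4 uea" where
  "ore_pair u m = (SOME p. uf ^ fst p * u = snd p * uf ^ m)"

lemma ore_pair: "uf ^ fst (ore_pair u m) * u = snd (ore_pair u m) * uf ^ m"
proof -
  obtain k u' where "uf ^ k * u = u' * uf ^ m" using ore_left by blast
  then have "uf ^ fst (k, u') * u = snd (k, u') * uf ^ m" by simp
  then show ?thesis unfolding ore_pair_def by (rule someI)
qed

lemma ore_mult_indep:
  assumes k: "uf ^ k * u = u' * uf ^ m" and l: "uf ^ l * u2 = u2' * uf ^ m2"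
    and a: "uf ^ (a + n2) * u = uf ^ (a + n) * u2" and b: "uf ^ (b + m2) * v = uf ^ (b + m) * v2"
  shows "\<exists>K. uf ^ (K + (l + n2)) * (u' * v) = uf ^ (K + (k + n)) * (u2' * v2)"
proof -
  obtain p w where p: "uf ^ p * u' = w * uf ^ (b + m2)" using ore_left by blast
  obtain q w2 where q: "uf ^ q * u2' = w2 * uf ^ (b + m)" using ore_left by blast
  let ?M = "b + m2 + m"
  have "uf ^ (p + k) * u = uf ^ p * u' * uf ^ m" by (simp only: power_add mult.assoc k)
  then have w: "uf ^ (p + k) * u = w * uf ^ ?M" by (simp only: p power_add mult.assoc)
  have "uf ^ (q + l) * u2 = uf ^ q * u2' * uf ^ m2" by (simp only: power_add mult.assoc l)
  then have "uf ^ (q + l) * u2 = w2 * uf ^ (b + m + m2)" by (simp only: q power_add mult.assoc)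
  moreover have "b + m + m2 = ?M" by simp
  ultimately have w2: "uf ^ (q + l) * u2 = w2 * uf ^ ?M" by (simp only:)
  have "uf ^ (q + l + a + n2) * w * uf ^ ?M = uf ^ (q + l + a + n2 + (p + k)) * u"
    by (simp only: mult.assoc w[symmetric]) (simp only: power_add mult.assoc)
  also have "\<dots> = uf ^ (q + l + p + k + (a + n2)) * u" by (simp add: ac_simps)
  also have "\<dots> = uf ^ (q + l + p + k + (a + n)) * u2" by (rule ore_shift[OF a])
  also have "\<dots> = uf ^ (p + k + a + n + (q + l)) * u2" by (simp add: ac_simps)
  also have "\<dots> = uf ^ (p + k + a + n) * w2 * uf ^ ?M"
    by (simp only: mult.assoc w2[symmetric]) (simp only: power_add mult.assoc)
  finally obtain j where
    j: "uf ^ j * (uf ^ (q + l + a + n2) * w) = uf ^ j * (uf ^ (p + k + a + n) * w2)"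
    using ore_cancel_eq by blast
  let ?K = "j + q + a + p"
  have "uf ^ (?K + (l + n2)) * (u' * v) = uf ^ (j + (q + l + a + n2) + p) * (u' * v)"
    by (simp add: ac_simps)
  also have "\<dots> = uf ^ j * (uf ^ (q + l + a + n2) * ((uf ^ p * u') * v))"
    by (simp only: power_add mult.assoc)
  also have "\<dots> = uf ^ j * (uf ^ (q + l + a + n2) * w) * (uf ^ (b + m2) * v)"
    by (simp only: p mult.assoc)
  also have "\<dots> = uf ^ j * (uf ^ (p + k + a + n) * w2) * (uf ^ (b + m) * v2)"
    by (simp only: j b)
  also have "\<dots> = uf ^ j * (uf ^ (p + k + a + n) * ((w2 * uf ^ (b + m)) * v2))"
    by (simp only: mult.assoc)
  also have "\<dots> = uf ^ j * (uf ^ (p + k + a + n) * ((uf ^ q * u2') * v2))"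
    by (simp only: q)
  also have "\<dots> = uf ^ (j + (p + k + a + n) + q) * (u2' * v2)"
    by (simp only: power_add mult.assoc)
  also have "\<dots> = uf ^ (?K + (k + n)) * (u2' * v2)" by (simp add: ac_simps)
  finally show ?thesis by blast
qed

lemma ore_add_cong:
  assumes a: "uf ^ (a + n2) * u = uf ^ (a + n) * u2" and b: "uf ^ (b + m2) * v = uf ^ (b + m) * v2"
  shows "\<exists>K. uf ^ (K + (n2 + m2)) * (uf ^ m * u + uf ^ n * v)
    = uf ^ (K + (n + m)) * (uf ^ m2 * u2 + uf ^ n2 * v2)"
proof -
  have pw: "uf ^ i * (uf ^ j * x) = uf ^ (i + j) * x" for i j x by (simp only: power_add mult.assoc)
  have "uf ^ (a + b + (n2 + m2)) * (uf ^ m * u) = uf ^ (a + b + (n + m)) * (uf ^ m2 * u2)"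
    using ore_shift[OF a, of "b + m2 + m"] by (simp add: pw ac_simps)
  moreover have "uf ^ (a + b + (n2 + m2)) * (uf ^ n * v) = uf ^ (a + b + (n + m)) * (uf ^ n2 * v2)"
    using ore_shift[OF b, of "a + n2 + n"] by (simp add: pw ac_simps)
  ultimately show ?thesis by (intro exI[of _ "a + b"]) (simp only: distrib_left)
qed

instantiation uloc :: "{zero, one, plus, minus, uminus, times}"
begin

lift_definition zero_uloc :: uloc is "(0, 0)" .
lift_definition one_uloc :: uloc is "(0, 1)" .

lift_definition uminus_uloc :: "uloc \<Rightarrow> uloc" is "\<lambda>(n, u). (n, - u)"
  by (auto simp: ore_rel_def)

lift_definition plus_uloc :: "uloc \<Rightarrow> uloc \<Rightarrow> uloc"
  is "\<lambda>(n, u) (m, v). (n + m, uf ^ m * u + uf ^ n * v)"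
  by (clarsimp simp only: ore_rel_def split_beta fst_conv snd_conv) (rule ore_add_cong)

definition "x - y = x + (- y :: uloc)"

lift_definition times_uloc :: "uloc \<Rightarrow> uloc \<Rightarrow> uloc"
  is "\<lambda>(n, u) (m, v). (fst (ore_pair u m) + n, snd (ore_pair u m) * v)"
  by (clarsimp simp only: ore_rel_def split_beta fst_conv snd_conv)
     (rule ore_mult_indep[OF ore_pair ore_pair])

instance ..

end

lemma zero_fr: "0 = fr n 0"
  by (simp add: zero_uloc_def fr_eq_iff flip: fr_def)

lemma one_fr: "1 = fr 0 1"
  by (simp add: one_uloc_def fr_def)

lemma uminus_fr: "- fr n u = fr n (- u)"
  by (simp add: fr_def uminus_uloc.abs_eq)

lemma add_fr: "fr n u + fr n v = fr n (u + v)"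
proof -
  have "fr n u + fr n v = fr (n + n) (uf ^ n * u + uf ^ n * v)"
    by (simp add: fr_def plus_uloc.abs_eq)
  also have "\<dots> = fr (n + n) (uf ^ n * (u + v))" by (simp only: distrib_left)
  also have "\<dots> = fr n (u + v)" by (rule fr_expand[symmetric])
  finally show ?thesis .
qed

lemma mult_fr:
  assumes "uf ^ k * u = u' * uf ^ m"
  shows "fr n u * fr m v = fr (k + n) (u' * v)"
proof -
  have "fr n u * fr m v = fr (fst (ore_pair u m) + n) (snd (ore_pair u m) * v)"
    by (simp add: fr_def times_uloc.abs_eq)
  also have "\<dots> = fr (k + n) (u' * v)"
    unfolding fr_eq_iff by (rule ore_mult_indep[OF ore_pair assms, where a = 0 and b = 0]) simp_all
  finally show ?thesis .
qed

instance uloc :: "{ring, monoid_mult}"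
proof
  fix x y z :: uloc
  show "x + y + z = x + (y + z)"
    by (rule fr_common3[of x y z]) (simp add: add_fr add.assoc)
  show "x + y = y + x"
    by (rule fr_common[of x y]) (simp add: add_fr add.commute)
  show "0 + x = x"
  proof (rule fr_cases[of x])
    fix n u assume "x = fr n u"
    then show ?thesis by (simp add: zero_fr[of n] add_fr)
  qed
  show "- x + x = 0"
  proof (rule fr_cases[of x])
    fix n u assume "x = fr n u"
    then show ?thesis by (simp add: zero_fr[of n] uminus_fr add_fr)
  qed
  show "x - y = x + - y" by (rule minus_uloc_def)
  show "1 * x = x"
  proof -
    obtain m v where x: "x = fr m v" by (rule fr_cases)
    have "fr 0 1 * fr m v = fr (m + 0) (1 * v)" by (rule mult_fr) (simp only: mult_1_left mult_1_right)
    then show ?thesis unfolding x one_fr by (simp only: mult_1_left add_0_right)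
  qed
  show "x * 1 = x"
  proof -
    obtain n u where x: "x = fr n u" by (rule fr_cases)
    have "fr n u * fr 0 1 = fr (0 + n) (u * 1)"
      by (rule mult_fr) (simp only: power_0 mult_1_left mult_1_right)
    then show ?thesis unfolding x one_fr by (simp only: mult_1_right add_0_left)
  qed
  show "(x * y) * z = x * (y * z)"
  proof -
    obtain n u where x: "x = fr n u" by (rule fr_cases)
    obtain m v where y: "y = fr m v" by (rule fr_cases)
    obtain p w where z: "z = fr p w" by (rule fr_cases)
    note xyz = x y z
    obtain a v' where a: "uf ^ a * v = v' * uf ^ p" using ore_left by blast
    obtain b s where b: "uf ^ b * u = s * uf ^ (a + m)" using ore_left by blast
    have yz: "y * z = fr (a + m) (v' * w)" unfolding xyz by (rule mult_fr[OF a])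
    have r: "x * (y * z) = fr (b + n) (s * (v' * w))" unfolding yz unfolding xyz by (rule mult_fr[OF b])
    have "uf ^ b * u = (s * uf ^ a) * uf ^ m" by (simp only: b power_add mult.assoc)
    then have xy: "x * y = fr (b + n) (s * uf ^ a * v)" unfolding xyz by (rule mult_fr)
    have "uf ^ 0 * (s * uf ^ a * v) = (s * v') * uf ^ p" by (simp add: mult.assoc a)
    from mult_fr[OF this] have "(x * y) * z = fr (0 + (b + n)) (s * v' * w)" unfolding xy z .
    then show ?thesis by (simp add: r mult.assoc)
  qed
  show "(x + y) * z = x * z + y * z"
  proof -
    obtain n u v where x: "x = fr n u" and y: "y = fr n v" by (rule fr_common)
    obtain m w where z: "z = fr m w" by (rule fr_cases)
    note xyz = x y z
    obtain k u' where k: "uf ^ k * u = u' * uf ^ m" using ore_left by blast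
    obtain l v' where l: "uf ^ l * v = v' * uf ^ m" using ore_left by blast
    have k': "uf ^ (l + k) * u = (uf ^ l * u') * uf ^ m" by (simp only: power_add mult.assoc k)
    have "uf ^ (k + l) * v = (uf ^ k * v') * uf ^ m" by (simp only: power_add mult.assoc l)
    then have l': "uf ^ (l + k) * v = (uf ^ k * v') * uf ^ m" by (simp only: add.commute)
    have uv: "uf ^ (l + k) * (u + v) = (uf ^ l * u' + uf ^ k * v') * uf ^ m"
      by (simp only: distrib_left distrib_right k' l')
    show ?thesis
      unfolding xyz add_fr mult_fr[OF uv] mult_fr[OF k'] mult_fr[OF l'] by (simp only: distrib_right)
  qed
  show "z * (x + y) = z * x + z * y"
  proof -
    obtain n u v where x: "x = fr n u" and y: "y = fr n v" by (rule fr_common)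
    obtain m w where z: "z = fr m w" by (rule fr_cases)
    note xyz = x y z
    obtain k w' where k: "uf ^ k * w = w' * uf ^ n" using ore_left by blast
    show ?thesis
      unfolding xyz add_fr mult_fr[OF k] by (simp only: add_fr distrib_left)
  qed
qed

definition loc :: "l4 uea \<Rightarrow> uloc" where
  "loc u = fr 0 u"

text \<open>The characterising properties of the Ore localization of \<open>U\<close> at \<open>{f\<^sup>n | n}\<close>.\<close>

lemma loc_add: "loc (u + v) = loc u + loc v"
  by (simp add: loc_def add_fr)

lemma loc_mult: "loc (u * v) = loc u * loc v"
proof -
  have "uf ^ 0 * u = u * uf ^ 0" by simp
  from mult_fr[OF this, of 0 v] show ?thesis by (simp add: loc_def)
qed

lemma loc_one: "loc 1 = 1"
  by (simp add: loc_def one_fr)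

lemma fr_eq_quotient: "loc (uf ^ n) * fr n u = loc u" "fr n 1 * loc u = fr n u"
proof -
  have "uf ^ 0 * uf ^ n = 1 * uf ^ n" by simp
  from mult_fr[OF this, of 0 u] show "loc (uf ^ n) * fr n u = loc u" by (simp add: loc_def)
  have "uf ^ 0 * 1 = 1 * uf ^ 0" by simp
  from mult_fr[OF this, of n u] show "fr n 1 * loc u = fr n u" by (simp add: loc_def)
qed

lemma fr_inverse: "loc (uf ^ n) * fr n 1 = 1" "fr n 1 * loc (uf ^ n) = 1"
proof -
  show "loc (uf ^ n) * fr n 1 = 1" by (simp add: fr_eq_quotient(1) loc_one)
  have "fr n (uf ^ n) = fr 0 1" unfolding fr_eq_iff by (rule exI[of _ 0]) simp
  then show "fr n 1 * loc (uf ^ n) = 1" by (simp add: fr_eq_quotient(2) one_fr)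
qed

lemma loc_eq_0_iff: "loc u = 0 \<longleftrightarrow> (\<exists>k. uf ^ k * u = 0)"
  by (simp add: loc_def zero_fr[of 0] fr_eq_iff)

text \<open>The bimodule \<open>U\<^sub>(\<^sub>f\<^sub>) / U\<close>.\<close>

lemma range_loc_diff: "x \<in> range loc \<Longrightarrow> y \<in> range loc \<Longrightarrow> x - y \<in> range loc"
proof -
  assume "x \<in> range loc" "y \<in> range loc"
  then obtain u v where "x = loc u" "y = loc v" by auto
  moreover have "loc u = loc (u - v) + loc v" by (simp flip: loc_add)
  ultimately show ?thesis by simp
qed

lemma range_loc_0: "0 \<in> range loc"
  using range_loc_diff[of "loc 0" "loc 0"] by simp

lemma range_loc_uminus: "x \<in> range loc \<Longrightarrow> - x \<in> range loc"
  using range_loc_diff[OF range_loc_0, of x] by simp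

lemma range_loc_add: "x \<in> range loc \<Longrightarrow> y \<in> range loc \<Longrightarrow> x + y \<in> range loc"
  using range_loc_diff[OF _ range_loc_uminus, of x y] by simp

quotient_type sf = uloc / "\<lambda>x y. x - y \<in> range loc"
proof (rule equivpI)
  show "reflp (\<lambda>x y. x - y \<in> range loc)"
    by (rule reflpI) (simp add: range_loc_0)
  show "symp (\<lambda>x y. x - y \<in> range loc)"
    by (rule sympI, drule range_loc_uminus) simp
  show "transp (\<lambda>x y. x - y \<in> range loc)"
    by (rule transpI, drule (1) range_loc_add) simp
qed

lemma sf_repr: "\<exists>p. x = abs_sf p"
  by (rule exI[of _ "rep_sf x"]) (simp add: Quotient3_abs_rep[OF Quotient3_sf])

instantiation sf :: ab_group_add
begin

lift_definition zero_sf :: sf is 0 .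

lift_definition plus_sf :: "sf \<Rightarrow> sf \<Rightarrow> sf" is "(+)"
  by (drule (1) range_loc_add) (simp add: algebra_simps)

lift_definition minus_sf :: "sf \<Rightarrow> sf \<Rightarrow> sf" is "(-)"
  by (drule (1) range_loc_diff) (simp add: algebra_simps)

lift_definition uminus_sf :: "sf \<Rightarrow> sf" is uminus
  by (drule range_loc_uminus) simp

instance
proof
  fix a b c :: sf
  obtain p q r where reps: "a = abs_sf p" "b = abs_sf q" "c = abs_sf r"
    using sf_repr[of a] sf_repr[of b] sf_repr[of c] by auto
  note sf = reps zero_sf_def plus_sf.abs_eq minus_sf.abs_eq uminus_sf.abs_eq
  show "a + b + c = a + (b + c)" by (simp add: sf add.assoc)
  show "a + b = b + a" by (simp add: sf add.commute)
  show "0 + a = a" by (simp add: sf)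
  show "- a + a = 0" by (simp add: sf)
  show "a - b = a + - b" by (simp add: sf)
qed

end

lift_definition sf_lmult :: "l4 uea \<Rightarrow> sf \<Rightarrow> sf" is "\<lambda>u x. loc u * x"
proof -
  fix u x y assume "x - y \<in> range loc"
  then obtain v where "x - y = loc v" by auto
  then have "loc u * x - loc u * y = loc (u * v)" by (simp add: loc_mult flip: right_diff_distrib)
  then show "loc u * x - loc u * y \<in> range loc" by simp
qed

lift_definition sf_rmult :: "sf \<Rightarrow> l4 uea \<Rightarrow> sf" is "\<lambda>x u. x * loc u"
proof -
  fix x y u assume "x - y \<in> range loc"
  then obtain v where "x - y = loc v" by auto
  then have "x * loc u - y * loc u = loc (v * u)" by (simp add: loc_mult flip: left_diff_distrib)
  then show "x * loc u - y * loc u \<in> range loc" by simp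
qed

section \<open>Modules over noncommutative rings\<close>

text \<open>Modules use the record \<^typ>\<open>('r, 'a) module\<close> of HOL-Algebra over a ring type \<open>'r\<close>; its
  fields \<^const>\<open>mult\<close> and \<^const>\<open>one\<close> play no role.  The locale \<^locale>\<open>module\<close> itself
  requires a commutative ring.\<close>

locale lmodule = abelian_group M for M :: "('r::ring_1, 'a, 'm) module_scheme" (structure) +
  assumes smult_closed: "x \<in> carrier M \<Longrightarrow> r \<odot> x \<in> carrier M"
    and smult_add_left: "x \<in> carrier M \<Longrightarrow> (r + s) \<odot> x = r \<odot> x \<oplus> s \<odot> x"
    and smult_add_right:
      "x \<in> carrier M \<Longrightarrow> y \<in> carrier M \<Longrightarrow> r \<odot> (x \<oplus> y) = r \<odot> x \<oplus> r \<odot> y"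
    and smult_mult: "x \<in> carrier M \<Longrightarrow> (r * s) \<odot> x = r \<odot> (s \<odot> x)"
    and smult_one: "x \<in> carrier M \<Longrightarrow> 1 \<odot> x = x"

definition lsubmodule :: "'a set \<Rightarrow> ('r::ring_1, 'a, 'm) module_scheme \<Rightarrow> bool" where
  "lsubmodule N M \<longleftrightarrow> N \<subseteq> carrier M \<and> \<zero>\<^bsub>M\<^esub> \<in> N \<and>
    (\<forall>x\<in>N. \<forall>y\<in>N. x \<oplus>\<^bsub>M\<^esub> y \<in> N) \<and> (\<forall>r. \<forall>x\<in>N. r \<odot>\<^bsub>M\<^esub> x \<in> N)"

text \<open>The submodule \<open>N\<close> of \<open>M\<close>, as a module.\<close>

abbreviation lsub :: "('r::ring_1, 'a) module \<Rightarrow> 'a set \<Rightarrow> ('r, 'a) module" where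
  "lsub M N \<equiv> M\<lparr>carrier := N\<rparr>"

definition lquot :: "('r::ring_1, 'a) module \<Rightarrow> 'a set \<Rightarrow> ('r, 'a set) module" where
  "lquot M N = \<lparr>carrier = a_rcosets\<^bsub>M\<^esub> N, mult = undefined, one = undefined, zero = N,
    add = (\<lambda>X Y. X <+>\<^bsub>M\<^esub> Y), smult = (\<lambda>r X. \<Union>x\<in>X. N +>\<^bsub>M\<^esub> (r \<odot>\<^bsub>M\<^esub> x))\<rparr>"

definition lmod_iso :: "('r::ring_1, 'a) module \<Rightarrow> ('r, 'b) module \<Rightarrow> bool" where
  "lmod_iso M N \<longleftrightarrow> (\<exists>\<phi>. bij_betw \<phi> (carrier M) (carrier N) \<and>
    (\<forall>x\<in>carrier M. \<forall>y\<in>carrier M. \<phi> (x \<oplus>\<^bsub>M\<^esub> y) = \<phi> x \<oplus>\<^bsub>N\<^esub> \<phi> y) \<and>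
    (\<forall>r. \<forall>x\<in>carrier M. \<phi> (r \<odot>\<^bsub>M\<^esub> x) = r \<odot>\<^bsub>N\<^esub> \<phi> x))"

definition simple_lmodule :: "('r::ring_1, 'a) module \<Rightarrow> bool" where
  "simple_lmodule M \<longleftrightarrow> lmodule M \<and> carrier M \<noteq> {\<zero>\<^bsub>M\<^esub>} \<and>
    (\<forall>N. lsubmodule N M \<longrightarrow> N = {\<zero>\<^bsub>M\<^esub>} \<or> N = carrier M)"

definition is_subquotient :: "('r::ring_1, 'a) module \<Rightarrow> ('r, 'b) module \<Rightarrow> bool" where
  "is_subquotient S M \<longleftrightarrow>
    (\<exists>N K. lsubmodule N M \<and> lsubmodule K (lsub M N) \<and> lmod_iso S (lquot (lsub M N) K))"

text \<open>\<open>M\<close> is the internal direct sum of the submodules in \<open>D\<close>: every element is in a unique way a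
  finite sum of components.\<close>

definition internal_direct_sum :: "('r::ring_1, 'a) module \<Rightarrow> 'a set set \<Rightarrow> bool" where
  "internal_direct_sum M D \<longleftrightarrow> (\<forall>N\<in>D. lsubmodule N M) \<and>
    (\<forall>m\<in>carrier M. \<exists>!x. x \<in> (\<Pi>\<^sub>E N\<in>D. N) \<and> finite {N \<in> D. x N \<noteq> \<zero>\<^bsub>M\<^esub>} \<and>
      m = (\<Oplus>\<^bsub>M\<^esub>N\<in>{N \<in> D. x N \<noteq> \<zero>\<^bsub>M\<^esub>}. x N))"

definition pullback :: "('s::ring_1 \<Rightarrow> 'r::ring_1) \<Rightarrow> ('r, 'a) module \<Rightarrow> ('s, 'a) module" where
  "pullback \<phi> M = \<lparr>carrier = carrier M, mult = mult M, one = one M, zero = zero M, add = add M,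
    smult = (\<lambda>s. smult M (\<phi> s))\<rparr>"

subsection \<open>Tensor products\<close>

record ('s, 'r, 'a) bimodule = "('s, 'a) module" +
  rsmult :: "'a \<Rightarrow> 'r \<Rightarrow> 'a"

locale bimodule = lmodule B for B :: "('s::ring_1, 'r::ring_1, 'a) bimodule" (structure) +
  assumes rsmult_closed: "x \<in> carrier B \<Longrightarrow> rsmult B x r \<in> carrier B"
    and rsmult_add_right:
      "x \<in> carrier B \<Longrightarrow> rsmult B x (r + s) = rsmult B x r \<oplus> rsmult B x s"
    and rsmult_add_left: "x \<in> carrier B \<Longrightarrow> y \<in> carrier B \<Longrightarrow>
      rsmult B (x \<oplus> y) r = rsmult B x r \<oplus> rsmult B y r"
    and rsmult_mult: "x \<in> carrier B \<Longrightarrow> rsmult B x (r * s) = rsmult B (rsmult B x r) s"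
    and rsmult_one: "x \<in> carrier B \<Longrightarrow> rsmult B x 1 = x"
    and smult_rsmult: "x \<in> carrier B \<Longrightarrow> t \<odot> rsmult B x r = rsmult B (t \<odot> x) r"

text \<open>The relations of \<open>B \<otimes> M\<close> in the free abelian group on \<open>B \<times> M\<close>.\<close>

inductive_set tensor_rel ::
    "('s::ring_1, 'r::ring_1, 'a) bimodule \<Rightarrow> ('r, 'b) module \<Rightarrow> ('a \<times> 'b \<Rightarrow>\<^sub>0 int) set"
  for B M where
  tensor_rel_0: "0 \<in> tensor_rel B M"
| tensor_rel_diff: "p \<in> tensor_rel B M \<Longrightarrow> q \<in> tensor_rel B M \<Longrightarrow> p - q \<in> tensor_rel B M"
| tensor_rel_left: "x \<in> carrier B \<Longrightarrow> x' \<in> carrier B \<Longrightarrow> y \<in> carrier M \<Longrightarrow>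
    frag_of (x \<oplus>\<^bsub>B\<^esub> x', y) - frag_of (x, y) - frag_of (x', y) \<in> tensor_rel B M"
| tensor_rel_right: "x \<in> carrier B \<Longrightarrow> y \<in> carrier M \<Longrightarrow> y' \<in> carrier M \<Longrightarrow>
    frag_of (x, y \<oplus>\<^bsub>M\<^esub> y') - frag_of (x, y) - frag_of (x, y') \<in> tensor_rel B M"
| tensor_rel_balanced: "x \<in> carrier B \<Longrightarrow> y \<in> carrier M \<Longrightarrow>
    frag_of (rsmult B x r, y) - frag_of (x, r \<odot>\<^bsub>M\<^esub> y) \<in> tensor_rel B M"

definition tensor_class ::
    "('s::ring_1, 'r::ring_1, 'a) bimodule \<Rightarrow> ('r, 'b) module \<Rightarrow>
      ('a \<times> 'b \<Rightarrow>\<^sub>0 int) \<Rightarrow> ('a \<times> 'b \<Rightarrow>\<^sub>0 int) set" where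
  "tensor_class B M p = {q. q - p \<in> tensor_rel B M}"

definition tensor ::
    "('s::ring_1, 'r::ring_1, 'a) bimodule \<Rightarrow> ('r, 'b) module \<Rightarrow>
      ('s, ('a \<times> 'b \<Rightarrow>\<^sub>0 int) set) module" where
  "tensor B M = \<lparr>
    carrier = tensor_class B M ` {p. Poly_Mapping.keys p \<subseteq> carrier B \<times> carrier M},
    mult = undefined, one = undefined,
    zero = tensor_class B M 0,
    add = (\<lambda>X Y. \<Union>p\<in>X. \<Union>q\<in>Y. tensor_class B M (p + q)),
    smult = (\<lambda>s X. \<Union>p\<in>X. tensor_class B M (frag_extend (\<lambda>(x, y). frag_of (s \<odot>\<^bsub>B\<^esub> x, y)) p))\<rparr>"

subsection \<open>Complex dimension\<close>

definition cspan :: "('b::lie_basis uea, 'a) module \<Rightarrow> 'a set \<Rightarrow> 'a set" where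
  "cspan M X = {\<Oplus>\<^bsub>M\<^esub>x\<in>A. scal (c x) \<odot>\<^bsub>M\<^esub> x | A c. finite A \<and> A \<subseteq> X}"

definition cindep :: "('b::lie_basis uea, 'a) module \<Rightarrow> 'a set \<Rightarrow> bool" where
  "cindep M X \<longleftrightarrow> (\<forall>A c. finite A \<longrightarrow> A \<subseteq> X \<longrightarrow>
    (\<Oplus>\<^bsub>M\<^esub>x\<in>A. scal (c x) \<odot>\<^bsub>M\<^esub> x) = \<zero>\<^bsub>M\<^esub> \<longrightarrow> (\<forall>x\<in>A. c x = 0))"

definition has_cdim :: "('b::lie_basis uea, 'a) module \<Rightarrow> 'a set \<Rightarrow> nat \<Rightarrow> bool" where
  "has_cdim M W n \<longleftrightarrow>
    (\<exists>X. finite X \<and> card X = n \<and> X \<subseteq> carrier M \<and> cindep M X \<and> cspan M X = W)"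

definition finite_cdim :: "('b::lie_basis uea, 'a) module \<Rightarrow> 'a set \<Rightarrow> bool" where
  "finite_cdim M W \<longleftrightarrow> (\<exists>n. has_cdim M W n)"

section \<open>Restriction to \<open>sl2\<close>\<close>

definition is_L :: "nat \<Rightarrow> (sl2 uea, 'a) module \<Rightarrow> bool" where
  "is_L n M \<longleftrightarrow> simple_lmodule M \<and> has_cdim M (carrier M) (n + 1)"

definition sl2_decomposition :: "(l4 uea, 'a) module \<Rightarrow> 'a set set \<Rightarrow> bool" where
  "sl2_decomposition M D \<longleftrightarrow>
    (let M' = pullback sl2_emb M in
      internal_direct_sum M' D \<and>
      (\<forall>N\<in>D. simple_lmodule (lsub M' N) \<and> finite_cdim M' N))"

definition sl2_isotypic :: "(l4 uea, 'a) module \<Rightarrow> 'a set set \<Rightarrow> nat \<Rightarrow> 'a set set" where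
  "sl2_isotypic M D n = {N \<in> D. is_L n (lsub (pullback sl2_emb M) N)}"

definition harish_chandra :: "(l4 uea, 'a) module \<Rightarrow> bool" where
  "harish_chandra M \<longleftrightarrow> lmodule M \<and>
    (\<exists>D. sl2_decomposition M D \<and> (\<forall>n. finite (sl2_isotypic M D n)))"

text \<open>The \<open>sl2\<close>-types are the \<open>L(n)\<close> with \<open>n \<in> T\<close>, each with multiplicity one.\<close>

definition sl2_types_once :: "(l4 uea, 'a) module \<Rightarrow> nat set \<Rightarrow> bool" where
  "sl2_types_once M T \<longleftrightarrow>
    (\<exists>D. sl2_decomposition M D \<and>
      (\<forall>n. finite (sl2_isotypic M D n) \<and> card (sl2_isotypic M D n) = (if n \<in> T then 1 else 0)))"

section \<open>Highest weight modules and their completions\<close>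

definition U_bimodule :: "(l4 uea, bor uea, l4 uea) bimodule" where
  "U_bimodule = \<lparr>carrier = UNIV, mult = undefined, one = undefined, zero = 0, add = (+),
    smult = (*), rsmult = (\<lambda>u b. u * bor_emb b)\<rparr>"

definition C_weight :: "complex \<Rightarrow> complex \<Rightarrow> (bor uea, complex) module" where
  "C_weight a c = \<lparr>carrier = UNIV, mult = undefined, one = undefined, zero = 0, add = (+),
    smult = (\<lambda>b z. bor_char a c b * z)\<rparr>"

type_synonym verma_elt = "(l4 uea \<times> complex \<Rightarrow>\<^sub>0 int) set"

definition verma :: "complex \<Rightarrow> complex \<Rightarrow> (l4 uea, verma_elt) module" where
  "verma a c = tensor U_bimodule (C_weight a c)"

definition simple_hw :: "complex \<Rightarrow> complex \<Rightarrow> (l4 uea, verma_elt set) module" where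
  "simple_hw a c = lquot (verma a c)
    (THE N. lsubmodule N (verma a c) \<and> simple_lmodule (lquot (verma a c) N))"

definition Sf_bimodule :: "(l4 uea, l4 uea, sf) bimodule" where
  "Sf_bimodule = \<lparr>carrier = UNIV, mult = undefined, one = undefined, zero = 0, add = (+),
    smult = sf_lmult, rsmult = sf_rmult\<rparr>"

definition EA :: "(l4 uea, 'a) module \<Rightarrow> (l4 uea, (sf \<times> 'a \<Rightarrow>\<^sub>0 int) set) module" where
  "EA M = (let T = tensor Sf_bimodule M in
    lsub T {m \<in> carrier T. finite_cdim T (cspan T (range (\<lambda>k. gen (Lg sl2_e) ^ k \<odot>\<^bsub>T\<^esub> m)))})"

type_synonym ea_elt = "(sf \<times> verma_elt set \<Rightarrow>\<^sub>0 int) set"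

section \<open>The category F\<close>

definition F_generator :: "(l4 uea, 'a) module \<Rightarrow> bool" where
  "F_generator S \<longleftrightarrow> simple_lmodule S \<and> (\<exists>a c. is_subquotient S (EA (simple_hw a c)))"

text \<open>The objects are the finite direct sums of generators.\<close>

definition in_F :: "(l4 uea, 'a) module \<Rightarrow> bool" where
  "in_F M \<longleftrightarrow> lmodule M \<and>
    (\<exists>D. finite D \<and> internal_direct_sum M D \<and> (\<forall>N\<in>D. F_generator (lsub M N)))"

definition C2 :: "l4 uea" where
  "C2 = gen (Lr V0) ^ 2 - 3 * gen (Lr Vm2) * gen (Lr V2) + 12 * gen (Lr Vm4) * gen (Lr V4)"

definition C3 :: "l4 uea" where
  "C3 = gen (Lr V0) ^ 3 - scal (9/2) * gen (Lr Vm2) * gen (Lr V0) * gen (Lr V2)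
    + scal (27/2) * gen (Lr Vm2) ^ 2 * gen (Lr V4) + scal (27/2) * gen (Lr Vm4) * gen (Lr V2) ^ 2
    - 36 * gen (Lr Vm4) * gen (Lr V0) * gen (Lr V4)"

definition central_char :: "(l4 uea, 'a) module \<Rightarrow> complex \<Rightarrow> bool" where
  "central_char M z \<longleftrightarrow> (\<forall>m\<in>carrier M.
    C2 \<odot>\<^bsub>M\<^esub> m = scal (z ^ 2) \<odot>\<^bsub>M\<^esub> m \<and> C3 \<odot>\<^bsub>M\<^esub> m = scal (z ^ 3) \<odot>\<^bsub>M\<^esub> m)"

text \<open>The simple objects of the category with the given central character and \<open>sl2\<close>-types.\<close>

definition F_simple :: "complex \<Rightarrow> nat set \<Rightarrow> (l4 uea, 'a) module \<Rightarrow> bool" where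
  "F_simple z T M \<longleftrightarrow>
    in_F M \<and> simple_lmodule M \<and> central_char M z \<and> sl2_types_once M T"

text \<open>Modules on which the radical acts by zero.  If \<open>\<lambda>(v\<^sub>0) = 0\<close> then the radical acts by zero on
  \<open>L(\<lambda>)\<close>, and the completion of \<open>L(\<lambda>)\<close> for \<open>\<lambda>(h) = -n-2\<close>, \<open>n \<in> \<nat>\<close>, is \<open>L(n)\<close> with the radical
  acting by zero.\<close>

definition rad_trivial :: "(l4 uea, 'a) module \<Rightarrow> bool" where
  "rad_trivial M \<longleftrightarrow> (\<forall>v. \<forall>m\<in>carrier M. gen (Lr v) \<odot>\<^bsub>M\<^esub> m = \<zero>\<^bsub>M\<^esub>)"

subsection \<open>Consistency of the constructions\<close>

lemma tensor_rel_uminus: "p \<in> tensor_rel B M \<Longrightarrow> - p \<in> tensor_rel B M"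
  using tensor_rel_diff[OF tensor_rel_0, of p B M] by simp

lemma tensor_rel_add: "p \<in> tensor_rel B M \<Longrightarrow> q \<in> tensor_rel B M \<Longrightarrow> p + q \<in> tensor_rel B M"
  using tensor_rel_diff[OF _ tensor_rel_uminus, of p B M q] by simp

lemma tensor_class_eq_iff: "tensor_class B M p = tensor_class B M q \<longleftrightarrow> p - q \<in> tensor_rel B M"
proof
  assume "tensor_class B M p = tensor_class B M q"
  moreover have "p \<in> tensor_class B M p" by (simp add: tensor_class_def tensor_rel_0)
  ultimately have "p \<in> tensor_class B M q" by blast
  then show "p - q \<in> tensor_rel B M" by (simp add: tensor_class_def)
next
  assume pq: "p - q \<in> tensor_rel B M"
  have "r - p \<in> tensor_rel B M \<longleftrightarrow> r - q \<in> tensor_rel B M" for r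
    using tensor_rel_add[OF _ pq, of "r - p"] tensor_rel_diff[OF _ pq, of "r - q"] by auto
  then show "tensor_class B M p = tensor_class B M q" by (auto simp: tensor_class_def)
qed

lemma tensor_class_self: "p \<in> tensor_class B M p"
  by (simp add: tensor_class_def tensor_rel_0)

lemma tensor_add_class:
  "tensor_class B M p \<oplus>\<^bsub>tensor B M\<^esub> tensor_class B M q = tensor_class B M (p + q)"
proof -
  have "tensor_class B M (p' + q') = tensor_class B M (p + q)"
    if "p' \<in> tensor_class B M p" "q' \<in> tensor_class B M q" for p' q'
  proof -
    have "(p' - p) + (q' - q) \<in> tensor_rel B M"
      by (rule tensor_rel_add) (use that in \<open>simp_all add: tensor_class_def\<close>)
    moreover have "(p' - p) + (q' - q) = (p' + q') - (p + q)" by simp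
    ultimately show ?thesis by (simp only: tensor_class_eq_iff)
  qed
  then have "(\<Union>p'\<in>tensor_class B M p. \<Union>q'\<in>tensor_class B M q. tensor_class B M (p' + q'))
      = (\<Union>p'\<in>tensor_class B M p. \<Union>q'\<in>tensor_class B M q. tensor_class B M (p + q))"
    by (intro SUP_cong refl)
  also have "\<dots> = tensor_class B M (p + q)"
    using tensor_class_self[of p B M] tensor_class_self[of q B M] by blast
  finally show ?thesis by (simp only: tensor_def ring.simps)
qed

definition tensor_smult ::
    "('s::ring_1, 'r::ring_1, 'a) bimodule \<Rightarrow> 's \<Rightarrow> ('a \<times> 'b \<Rightarrow>\<^sub>0 int) \<Rightarrow> ('a \<times> 'b \<Rightarrow>\<^sub>0 int)" where
  "tensor_smult B s = frag_extend (\<lambda>(x, y). frag_of (s \<odot>\<^bsub>B\<^esub> x, y))"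

context bimodule
begin

lemma tensor_smult_rel: "p \<in> tensor_rel B M \<Longrightarrow> tensor_smult B s p \<in> tensor_rel B M"
proof (induction rule: tensor_rel.induct)
  case tensor_rel_0
  show ?case by (simp add: tensor_smult_def tensor_rel.tensor_rel_0)
next
  case (tensor_rel_diff p q)
  then show ?case by (simp add: tensor_smult_def frag_extend_diff tensor_rel.tensor_rel_diff)
next
  case (tensor_rel_left x x' y)
  then show ?case
    using tensor_rel.tensor_rel_left[of "s \<odot> x" B "s \<odot> x'" y M]
    by (simp add: tensor_smult_def frag_extend_diff smult_add_right smult_closed)
next
  case (tensor_rel_right x y y')
  then show ?case
    using tensor_rel.tensor_rel_right[of "s \<odot> x" B y M y']
    by (simp add: tensor_smult_def frag_extend_diff smult_closed)
next
  case (tensor_rel_balanced x y r)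
  then show ?case
    using tensor_rel.tensor_rel_balanced[of "s \<odot> x" B y M r]
    by (simp add: tensor_smult_def frag_extend_diff smult_closed smult_rsmult)
qed

lemma tensor_smult_class:
  "s \<odot>\<^bsub>tensor B M\<^esub> tensor_class B M p = tensor_class B M (tensor_smult B s p)"
proof -
  have "tensor_class B M (tensor_smult B s q) = tensor_class B M (tensor_smult B s p)"
    if "q \<in> tensor_class B M p" for q
  proof -
    have "tensor_smult B s (q - p) \<in> tensor_rel B M"
      by (rule tensor_smult_rel) (use that in \<open>simp add: tensor_class_def\<close>)
    then show ?thesis by (simp only: tensor_class_eq_iff tensor_smult_def frag_extend_diff)
  qed
  then have "(\<Union>q\<in>tensor_class B M p. tensor_class B M (tensor_smult B s q))
      = (\<Union>q\<in>tensor_class B M p. tensor_class B M (tensor_smult B s p))"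
    by (intro SUP_cong refl)
  also have "\<dots> = tensor_class B M (tensor_smult B s p)"
    using tensor_class_self[of p B M] by blast
  finally show ?thesis by (simp only: tensor_def module.simps tensor_smult_def)
qed

lemma tensor_smult_keys:
  "Poly_Mapping.keys p \<subseteq> carrier B \<times> Y \<Longrightarrow>
    Poly_Mapping.keys (tensor_smult B s p) \<subseteq> carrier B \<times> Y"
  using keys_frag_extend[of "\<lambda>(x, y). frag_of (s \<odot> x, y)" p]
  unfolding tensor_smult_def by (fastforce simp: smult_closed)

lemma tensor_lmodule: "lmodule (tensor B M)"
proof -
  let ?T = "tensor B M" and ?K = "carrier B \<times> carrier M"
  have carrierI: "tensor_class B M p \<in> carrier ?T" if "Poly_Mapping.keys p \<subseteq> ?K" for p
    using that by (auto simp: tensor_def)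
  have carrierE: "\<exists>p. X = tensor_class B M p \<and> Poly_Mapping.keys p \<subseteq> ?K" if "X \<in> carrier ?T" for X
    using that by (auto simp: tensor_def)
  have zero: "\<zero>\<^bsub>?T\<^esub> = tensor_class B M 0" by (simp add: tensor_def)
  have rel: "tensor_smult B (r + s) p - (tensor_smult B r p + tensor_smult B s p) \<in> tensor_rel B M"
    "tensor_smult B 1 p - p \<in> tensor_rel B M"
    "tensor_smult B (r * s) p = tensor_smult B r (tensor_smult B s p)"
    if "Poly_Mapping.keys p \<subseteq> ?K" for r s p
  proof -
    show "tensor_smult B (r + s) p - (tensor_smult B r p + tensor_smult B s p) \<in> tensor_rel B M"
      using that
    proof (induction p rule: frag_induction)
      case (diff p q)
      from tensor_rel_diff[OF diff] show ?case
        by (simp add: tensor_smult_def frag_extend_diff algebra_simps)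
    next
      case (one xy)
      obtain x y where xy: "xy = (x, y)" by fastforce
      then show ?case
        using tensor_rel_left[of "r \<odot> x" B "s \<odot> x" y M] one
        by (simp add: tensor_smult_def smult_add_left smult_closed diff_diff_add)
    qed (simp add: tensor_smult_def tensor_rel_0)
    show "tensor_smult B 1 p - p \<in> tensor_rel B M"
      using that
    proof (induction p rule: frag_induction)
      case (diff p q)
      from tensor_rel_diff[OF diff] show ?case
        by (simp add: tensor_smult_def frag_extend_diff algebra_simps)
    qed (auto simp: tensor_smult_def tensor_rel_0 smult_one)
    show "tensor_smult B (r * s) p = tensor_smult B r (tensor_smult B s p)"
      using that
      by (induction p rule: frag_induction)
        (auto simp: tensor_smult_def frag_extend_diff smult_mult)
  qed
  have add: "X \<oplus>\<^bsub>?T\<^esub> Y \<in> carrier ?T" "X \<oplus>\<^bsub>?T\<^esub> Y = Y \<oplus>\<^bsub>?T\<^esub> X"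
    "r \<odot>\<^bsub>?T\<^esub> (X \<oplus>\<^bsub>?T\<^esub> Y) = r \<odot>\<^bsub>?T\<^esub> X \<oplus>\<^bsub>?T\<^esub> r \<odot>\<^bsub>?T\<^esub> Y"
    if XY: "X \<in> carrier ?T" "Y \<in> carrier ?T" for X Y r
  proof -
    obtain p where p: "X = tensor_class B M p" "Poly_Mapping.keys p \<subseteq> ?K"
      using carrierE[OF XY(1)] by (elim exE conjE)
    obtain q where q: "Y = tensor_class B M q" "Poly_Mapping.keys q \<subseteq> ?K"
      using carrierE[OF XY(2)] by (elim exE conjE)
    have "Poly_Mapping.keys (p + q) \<subseteq> ?K" by (rule order_trans[OF Poly_Mapping.keys_add Un_least[OF p(2) q(2)]])
    then show "X \<oplus>\<^bsub>?T\<^esub> Y \<in> carrier ?T"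
      unfolding p(1) q(1) tensor_add_class by (rule carrierI)
    show "X \<oplus>\<^bsub>?T\<^esub> Y = Y \<oplus>\<^bsub>?T\<^esub> X"
      unfolding p(1) q(1) tensor_add_class by (simp only: add.commute)
    show "r \<odot>\<^bsub>?T\<^esub> (X \<oplus>\<^bsub>?T\<^esub> Y) = r \<odot>\<^bsub>?T\<^esub> X \<oplus>\<^bsub>?T\<^esub> r \<odot>\<^bsub>?T\<^esub> Y"
      unfolding p(1) q(1) tensor_add_class tensor_smult_class
      by (simp only: tensor_smult_def frag_extend_add)
  qed
  have assoc: "X \<oplus>\<^bsub>?T\<^esub> Y \<oplus>\<^bsub>?T\<^esub> Z = X \<oplus>\<^bsub>?T\<^esub> (Y \<oplus>\<^bsub>?T\<^esub> Z)"
    if XY: "X \<in> carrier ?T" "Y \<in> carrier ?T" "Z \<in> carrier ?T" for X Y Z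
  proof -
    obtain p where p: "X = tensor_class B M p" using carrierE[OF XY(1)] by (elim exE conjE)
    obtain q where q: "Y = tensor_class B M q" using carrierE[OF XY(2)] by (elim exE conjE)
    obtain r where r: "Z = tensor_class B M r" using carrierE[OF XY(3)] by (elim exE conjE)
    show ?thesis unfolding p q r tensor_add_class by (simp only: add.assoc)
  qed
  have zero_closed: "\<zero>\<^bsub>?T\<^esub> \<in> carrier ?T" unfolding zero by (rule carrierI) simp
  have single: "\<zero>\<^bsub>?T\<^esub> \<oplus>\<^bsub>?T\<^esub> X = X" "\<exists>Y\<in>carrier ?T. Y \<oplus>\<^bsub>?T\<^esub> X = \<zero>\<^bsub>?T\<^esub>"
    "r \<odot>\<^bsub>?T\<^esub> X \<in> carrier ?T" "(r + s) \<odot>\<^bsub>?T\<^esub> X = r \<odot>\<^bsub>?T\<^esub> X \<oplus>\<^bsub>?T\<^esub> s \<odot>\<^bsub>?T\<^esub> X"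
    "(r * s) \<odot>\<^bsub>?T\<^esub> X = r \<odot>\<^bsub>?T\<^esub> (s \<odot>\<^bsub>?T\<^esub> X)" "1 \<odot>\<^bsub>?T\<^esub> X = X"
    if X: "X \<in> carrier ?T" for X r s
  proof -
    obtain p where p: "X = tensor_class B M p" "Poly_Mapping.keys p \<subseteq> ?K"
      using carrierE[OF X] by (elim exE conjE)
    show "\<zero>\<^bsub>?T\<^esub> \<oplus>\<^bsub>?T\<^esub> X = X" unfolding p(1) zero tensor_add_class by (simp only: add_0)
    have "tensor_class B M (- p) \<in> carrier ?T" by (rule carrierI) (use p in simp)
    moreover have "tensor_class B M (- p) \<oplus>\<^bsub>?T\<^esub> X = \<zero>\<^bsub>?T\<^esub>"
      unfolding p(1) zero tensor_add_class by simp
    ultimately show "\<exists>Y\<in>carrier ?T. Y \<oplus>\<^bsub>?T\<^esub> X = \<zero>\<^bsub>?T\<^esub>" by blast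
    show "r \<odot>\<^bsub>?T\<^esub> X \<in> carrier ?T"
      unfolding p(1) tensor_smult_class by (rule carrierI) (rule tensor_smult_keys[OF p(2)])
    show "(r + s) \<odot>\<^bsub>?T\<^esub> X = r \<odot>\<^bsub>?T\<^esub> X \<oplus>\<^bsub>?T\<^esub> s \<odot>\<^bsub>?T\<^esub> X"
      unfolding p(1) tensor_smult_class tensor_add_class tensor_class_eq_iff by (rule rel(1)[OF p(2)])
    show "(r * s) \<odot>\<^bsub>?T\<^esub> X = r \<odot>\<^bsub>?T\<^esub> (s \<odot>\<^bsub>?T\<^esub> X)"
      unfolding p(1) tensor_smult_class by (simp only: rel(3)[OF p(2)])
    show "1 \<odot>\<^bsub>?T\<^esub> X = X"
      unfolding p(1) tensor_smult_class tensor_class_eq_iff by (rule rel(2)[OF p(2)])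
  qed
  have "abelian_group ?T"
    by (rule abelian_groupI[OF add(1) zero_closed assoc add(2) single(1,2)])
  moreover have "lmodule_axioms ?T"
    by (rule lmodule_axioms.intro[OF single(3,4) add(3) single(5,6)])
  ultimately show ?thesis by (rule lmodule.intro)
qed

end

lemma abelian_group_UNIV:
  fixes M :: "('a::ab_group_add, 'm) ring_scheme"
  assumes "carrier M = UNIV" "zero M = 0" "add M = (+)"
  shows "abelian_group M"
proof (rule abelian_groupI)
  fix x assume "x \<in> carrier M"
  show "\<exists>y\<in>carrier M. y \<oplus>\<^bsub>M\<^esub> x = \<zero>\<^bsub>M\<^esub>"
    by (rule bexI[of _ "- x"]) (simp_all add: assms)
qed (simp_all add: assms ac_simps)

lemma bimodule_U: "bimodule U_bimodule"
proof -
  have "abelian_group U_bimodule"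
    by (rule abelian_group_UNIV) (simp_all add: U_bimodule_def)
  then have "lmodule U_bimodule"
    by (rule lmodule.intro) (unfold_locales, auto simp: U_bimodule_def algebra_simps)
  then show ?thesis
    by (rule bimodule.intro) (unfold_locales, auto simp: U_bimodule_def bor_emb_def algebra_simps
      bor_emb.uea_lift_add bor_emb.uea_lift_mult bor_emb.uea_lift_one)
qed

lemma lmodule_C_weight: "lmodule (C_weight a c)"
proof -
  have "abelian_group (C_weight a c)"
    by (rule abelian_group_UNIV) (simp_all add: C_weight_def)
  then show ?thesis
    by (rule lmodule.intro) (unfold_locales, auto simp: C_weight_def bor_char_def algebra_simps
      bor_char.uea_lift_add bor_char.uea_lift_mult bor_char.uea_lift_one)
qed

lemma sf_mult_abs:
  "sf_lmult u (abs_sf x) = abs_sf (loc u * x)" "sf_rmult (abs_sf x) u = abs_sf (x * loc u)"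
  "abs_sf x + abs_sf y = abs_sf (x + y)"
  by (simp_all add: sf_lmult.abs_eq sf_rmult.abs_eq plus_sf.abs_eq)

lemma bimodule_Sf: "bimodule Sf_bimodule"
proof -
  have "abelian_group Sf_bimodule"
    by (rule abelian_group_UNIV) (simp_all add: Sf_bimodule_def)
  moreover have "sf_lmult (r + s) x = sf_lmult r x + sf_lmult s x"
    "sf_lmult r (x + y) = sf_lmult r x + sf_lmult r y"
    "sf_lmult (r * s) x = sf_lmult r (sf_lmult s x)" "sf_lmult 1 x = x"
    "sf_rmult x (r + s) = sf_rmult x r + sf_rmult x s"
    "sf_rmult (x + y) r = sf_rmult x r + sf_rmult y r"
    "sf_rmult x (r * s) = sf_rmult (sf_rmult x r) s" "sf_rmult x 1 = x"
    "sf_lmult r (sf_rmult x s) = sf_rmult (sf_lmult r x) s" for r s x y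
  proof -
    obtain p where p: "x = abs_sf p" using sf_repr by blast
    obtain q where q: "y = abs_sf q" using sf_repr by blast
    show "sf_lmult (r + s) x = sf_lmult r x + sf_lmult s x"
      "sf_lmult r (x + y) = sf_lmult r x + sf_lmult r y"
      "sf_lmult (r * s) x = sf_lmult r (sf_lmult s x)" "sf_lmult 1 x = x"
      "sf_rmult x (r + s) = sf_rmult x r + sf_rmult x s"
      "sf_rmult (x + y) r = sf_rmult x r + sf_rmult y r"
      "sf_rmult x (r * s) = sf_rmult (sf_rmult x r) s" "sf_rmult x 1 = x"
      "sf_lmult r (sf_rmult x s) = sf_rmult (sf_lmult r x) s"
      unfolding p q sf_mult_abs loc_add loc_mult loc_one
      by (simp_all only: distrib_left distrib_right mult.assoc mult_1_left mult_1_right)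
  qed
  note sf = this
  ultimately have "lmodule Sf_bimodule"
    by (intro lmodule.intro) (assumption, unfold_locales, simp_all add: Sf_bimodule_def)
  then show ?thesis
    by (rule bimodule.intro) (unfold_locales, simp_all add: Sf_bimodule_def sf)
qed

lemma lmodule_verma: "lmodule (verma a c)"
  unfolding verma_def by (rule bimodule.tensor_lmodule[OF bimodule_U])

end

theory Submission
  imports Defs "HOL-Computational_Algebra.Fundamental_Theorem_Algebra" "HOL-Analysis.Continuum_Not_Denumerable"
begin

section \<open>The enveloping algebra\<close>

text \<open>A linear form on the radical is a binary quartic, so a module lives over the space of
  quartics. For z nonzero, a quartic on which C2 and C3 take the values z^2 and z^3 has a multiple
  root, and the closed \<open>SL2\<close>-orbit among these quartics consists of multiples of
  squares of quadratic forms with two distinct roots. It is \<open>SL2/N(T)\<close>, with T the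
  torus of \<open>h\<close>, and \<open>point z\<close> is its base point. A simple module that
  contains the lowest weight vector of a finite-dimensional \<open>sl2\<close>-type turns out to
  have a nonzero fibre at \<open>point z\<close>, hence to consist of sections of a line bundle on
  \<open>SL2/T\<close>, given by a weight m of T that may be taken natural by means of the Weyl
  group. By Frobenius reciprocity these sections contain \<open>L(n)\<close> once for n = m, m + 2,
  .... For m > 0 all of them are reached from one lowest weight vector. For m = 0 the Weyl group
  element that swaps the two roots splits the functions into even and odd ones, with types 0, 4, 8,
  ... and 2, 6, 10, ....

  The modules are made explicit in two coordinates u, s on the big cell (\<open>opI\<close>,
  \<open>act\<close>), with the powers of s (\<open>yv\<close>) as lowest weight vectors.
  \<open>act_low2\<close>, \<open>act_low4\<close> and \<open>act_Vm4_yv\<close> move between these,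
  \<open>reach_yv\<close> then gives simplicity, and for m = 0 \<open>parity_reach\<close> keeps
  even and odd apart by their values at two points over the same quartic. Simple modules are
  compared through maximal left ideals: a module that is \<open>cyc\<close> for J is
  \<open>U/J\<close>, and the models have the ideals \<open>annB\<close>.

  Uniqueness is \<open>ideal_eq_annB\<close>. \<open>U/J\<close> is finitely generated over the
  symmetric algebra of the radical (\<open>rad_span\<close>), so Zorn's lemma and Dixmier's form of
  Schur's lemma give a functional on which the radical acts by some quartic
  (\<open>eigenfun_exists\<close>). As \<open>e\<close> and \<open>f\<close> act locally
  nilpotently, their exponentials move this quartic within its orbit
  (\<open>eigenfun_normal_form\<close>); a weight argument specialises it to \<open>point z\<close>
  (\<open>rad_ideal_UNIV\<close>), where \<open>h\<close> can be diagonalised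
  (\<open>weightfun_exists\<close>) and its weight reversed (\<open>weightfun_flip\<close>). Such a
  functional is determined by its Taylor coefficients (\<open>lfun_unique\<close>), and these
  identify J.

  For existence, the same formulas with negative k realise highest weight modules
  (\<open>hw_fun\<close>). There \<open>f\<close> is a shift in k and becomes invertible, which maps
  the tensor product with the bimodule of the completion to functions (\<open>tau_eval\<close>);
  \<open>EA_standard\<close> then finds every model as a subquotient of a completion. Conversely, a
  simple subquotient of a completion has a lowest weight vector and a central character c, and c = 0
  forces the radical to act by zero (\<open>F_generator_properties\<close>); completeness of the
  list concerns the other simple objects. A simple Harish-Chandra module has a lowest weight vector
  too, hence is one of the models. The models are told apart by their central character and by their
  set of types, which does not depend on a decomposition
  (\<open>sl2_types_lowest_vec\<close>).\<close>

lemma scal_of_nat: "scal (of_nat n) = (of_nat n :: 'b::lie_basis uea)"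
  by (induction n) (simp_all add: scal.scalar_zero scal.scalar_add scal.scalar_one)

lemma scal_numeral: "scal (numeral n) = (numeral n :: 'b::lie_basis uea)"
  using scal_of_nat[of "numeral n"] by simp

lemma scal_uminus: "scal (- a) = (- scal a :: 'b::lie_basis uea)"
  using scal.scalar_add[of "- a" a] by (simp add: scal.scalar_zero eq_neg_iff_add_eq_0)

lemma scal_diff: "scal (a - b) = (scal a - scal b :: 'b::lie_basis uea)"
  using scal.scalar_add[of a "- b"] by (simp add: scal_uminus)

lemmas scal_simps = scal.scalar_zero scal.scalar_one scal.scalar_add scal.scalar_mult scal_uminus
  scal_diff scal_of_nat scal_numeral

lemma scal_scal: "scal a * (scal b * u) = scal (a * b) * u"
  by (simp add: scal.scalar_mult mult.assoc)

lemma scal_left_commute: "u * (scal a * v) = scal a * (u * v)"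
  by (metis mult.assoc scal.scalar_central)

lemma scal_collect: "scal a * (u + scal b) + (u + scal c) = scal (a + 1) * u + scal (a * b + c)"
  by (simp only: scal.scalar_add scal.scalar_mult scal.scalar_one distrib_left distrib_right mult_1_left add_ac)

lemma scal_commutes:
  "gen x * scal a = scal a * gen x" "gen x * (scal a * v) = scal a * (gen x * v)"
  "gen x ^ k * scal a = scal a * gen x ^ k" "gen x ^ k * (scal a * v) = scal a * (gen x ^ k * v)"
  by (rule scal.scalar_central[symmetric] scal_left_commute)+

abbreviation "ue \<equiv> gen (Lg sl2_e) :: l4 uea"
abbreviation "uh \<equiv> gen (Lg sl2_h) :: l4 uea"
abbreviation "uv v \<equiv> gen (Lr v) :: l4 uea"

lemma gen_swap: "gen x * gen y = gen y * gen x + (\<Sum>z\<in>UNIV. scal (sc x y z) * gen z)"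
  using gen_commutator[of x y] by (simp add: algebra_simps)

lemma comm_ef: "ue * uf = uf * ue + uh"
  and comm_he: "uh * ue = ue * uh + 2 * ue"
  and comm_hf: "uh * uf = uf * uh - 2 * uf"
  by (subst gen_swap, simp add: sum_l4 sum_sl2 sum_rad sc_l4_def scal_simps)+

lemma comm_gv: "gen (Lg g) * uv v = uv v * gen (Lg g) + (\<Sum>w\<in>UNIV. scal (rad_act g v w) * uv w)"
  by (subst gen_swap) (simp add: sum_l4 sc_l4_def scal_simps)

lemma comm_ev:
  "ue * uv V4 = uv V4 * ue" "ue * uv V2 = uv V2 * ue + 4 * uv V4" "ue * uv V0 = uv V0 * ue + 3 * uv V2"
  "ue * uv Vm2 = uv Vm2 * ue + 2 * uv V0" "ue * uv Vm4 = uv Vm4 * ue + uv Vm2"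
  by (subst comm_gv, simp add: sum_rad scal_simps)+

lemma comm_fv:
  "uf * uv V4 = uv V4 * uf + uv V2" "uf * uv V2 = uv V2 * uf + 2 * uv V0"
  "uf * uv V0 = uv V0 * uf + 3 * uv Vm2"
  "uf * uv Vm2 = uv Vm2 * uf + 4 * uv Vm4" "uf * uv Vm4 = uv Vm4 * uf"
  by (subst comm_gv, simp add: sum_rad scal_simps)+

lemma comm_hv:
  "uh * uv V4 = uv V4 * uh + 4 * uv V4" "uh * uv V2 = uv V2 * uh + 2 * uv V2"
  "uh * uv V0 = uv V0 * uh" "uh * uv Vm2 = uv Vm2 * uh - 2 * uv Vm2"
  "uh * uv Vm4 = uv Vm4 * uh - 4 * uv Vm4"
  by (subst comm_gv, simp add: sum_rad scal_simps)+

lemma comm_vv: "uv v * uv w = uv w * uv v"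
  by (subst gen_swap) (simp add: sum_l4 sc_l4_def scal_simps)

lemma comm_vv_left: "uv v * (uv w * x) = uv w * (uv v * x)"
  by (metis comm_vv mult.assoc)

fun rwt :: "rad \<Rightarrow> int" where
  "rwt V4 = 4" | "rwt V2 = 2" | "rwt V0 = 0" | "rwt Vm2 = -2" | "rwt Vm4 = -4"

lemma comm_hv': "uh * uv v = uv v * uh + scal (of_int (rwt v)) * uv v"
  by (cases v) (simp_all add: comm_hv scal_simps)

lemma comm_left: "x * y = y * x + (z :: 'r::ring_1) \<Longrightarrow> x * (y * t) = y * (x * t) + z * t"
  by (metis distrib_right mult.assoc)

lemma comm_left_minus: "x * y = y * x - (z :: 'r::ring_1) \<Longrightarrow> x * (y * t) = y * (x * t) - z * t"
  by (metis left_diff_distrib mult.assoc)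

lemma comm_left_0: "x * y = y * (x :: 'r::ring_1) \<Longrightarrow> x * (y * t) = y * (x * t)"
  by (metis mult.assoc)

lemma numeral_central: "x * numeral n = numeral n * (x :: 'r::ring_1)"
  by (metis mult_of_nat_commute of_nat_numeral)

lemma numeral_central_left: "x * (numeral n * y) = numeral n * (x * (y :: 'r::ring_1))"
  by (metis numeral_central mult.assoc)

lemmas comm_v_all = comm_ev comm_fv comm_hv
  comm_ev(1)[THEN comm_left_0] comm_ev(2-5)[THEN comm_left]
  comm_fv(1-4)[THEN comm_left] comm_fv(5)[THEN comm_left_0]
  comm_hv(1,2)[THEN comm_left] comm_hv(3)[THEN comm_left_0] comm_hv(4,5)[THEN comm_left_minus]

subsection \<open>Polynomials in one element\<close>

definition pev :: "complex poly \<Rightarrow> 'b::lie_basis uea \<Rightarrow> 'b uea" where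
  "pev p g = (\<Sum>i\<le>degree p. scal (coeff p i) * g ^ i)"

lemma pev_bound: "degree p \<le> n \<Longrightarrow> pev p g = (\<Sum>i\<le>n. scal (coeff p i) * g ^ i)"
  unfolding pev_def
  by (rule sum.mono_neutral_left) (auto simp: coeff_eq_0 scal_simps)

lemma pev_0 [simp]: "pev 0 g = 0"
  by (simp add: pev_def scal_simps)

lemma pev_pCons [simp]: "pev (pCons a p) g = scal a + g * pev p g"
proof -
  have "pev (pCons a p) g = (\<Sum>i\<le>Suc (degree p). scal (coeff (pCons a p) i) * g ^ i)"
    by (rule pev_bound) (simp add: degree_pCons_le)
  also have "\<dots> = scal a + (\<Sum>i\<le>degree p. scal (coeff p i) * g ^ Suc i)"
    by (simp only: sum.atMost_Suc_shift) simp
  also have "(\<Sum>i\<le>degree p. scal (coeff p i) * g ^ Suc i) = g * pev p g"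
    by (simp add: pev_def sum_distrib_left scal_left_commute)
  finally show ?thesis .
qed

lemma pev_add: "pev (p + q) g = pev p g + pev q g"
proof (induction p arbitrary: q)
  case (pCons a p)
  show ?case
  proof (cases q)
    case (pCons b r)
    show ?thesis unfolding pCons by (simp add: pCons.IH scal_simps algebra_simps)
  qed
qed simp

lemma pev_smult: "pev (smult a p) g = scal a * pev p g"
  by (induction p) (simp_all add: scal_simps distrib_left scal_left_commute)

lemma pev_commute: "g * pev p g = pev p g * g"
proof (induction p)
  case (pCons a p)
  have "g * (g * pev p g) = g * pev p g * g" by (metis mult.assoc pCons.IH)
  then show ?case by (simp add: distrib_left distrib_right scal.scalar_central)
qed simp

lemma pev_mult: "pev (p * q) g = pev p g * pev q g"
  by (induction p) (simp_all add: pev_add pev_smult distrib_right mult.assoc scal_simps)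

lemma pev_1 [simp]: "pev 1 g = 1"
  by (simp add: one_pCons scal_simps)

lemma pev_linear: "pev [:- a, 1:] g = g - scal a"
  by (simp add: scal_simps)

text \<open>As the complex numbers are algebraically closed, a statement about
  \<open>pev p g\<close> can be proved one factor \<open>g - scal a\<close> at a time; this is how
  eigenvectors are extracted from annihilating polynomials.\<close>

lemma poly_roots_induct [consumes 1, case_names const root]:
  fixes p :: "complex poly"
  assumes "p \<noteq> 0" "\<And>a. a \<noteq> 0 \<Longrightarrow> P [:a:]" "\<And>a q. q \<noteq> 0 \<Longrightarrow> P q \<Longrightarrow> P ([:- a, 1:] * q)"
  shows "P p"
  using assms(1)
proof (induction "degree p" arbitrary: p rule: less_induct)
  case less
  show ?case
  proof (cases "degree p = 0")
    case True
    then obtain a where "p = [:a:]" by (rule degree_eq_zeroE)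
    then show ?thesis using assms(2) less.prems by simp
  next
    case False
    then obtain z where "poly p z = 0"
      using fundamental_theorem_of_algebra constant_degree by metis
    then obtain q where q: "p = [:- z, 1:] * q" by (metis poly_eq_0_iff_dvd dvdE)
    then have "q \<noteq> 0" using less.prems by auto
    moreover have "degree q < degree p" using \<open>q \<noteq> 0\<close> q by (simp add: degree_mult_eq del: mult_pCons_left)
    ultimately have "P ([:- z, 1:] * q)" by (intro assms(3) less.hyps)
    then show ?thesis by (simp only: q)
  qed
qed

subsection \<open>Left ideals\<close>

definition left_ideal :: "'r::ring_1 set \<Rightarrow> bool" where
  "left_ideal J \<longleftrightarrow> 0 \<in> J \<and> (\<forall>x\<in>J. \<forall>y\<in>J. x + y \<in> J) \<and> (\<forall>r. \<forall>x\<in>J. r * x \<in> J)"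

definition usubspace :: "'b::lie_basis uea set \<Rightarrow> bool" where
  "usubspace Q \<longleftrightarrow> 0 \<in> Q \<and> (\<forall>x\<in>Q. \<forall>y\<in>Q. x + y \<in> Q) \<and> (\<forall>a. \<forall>x\<in>Q. scal a * x \<in> Q)"

lemma left_idealD:
  assumes "left_ideal J"
  shows "0 \<in> J" "x \<in> J \<Longrightarrow> y \<in> J \<Longrightarrow> x + y \<in> J" "x \<in> J \<Longrightarrow> r * x \<in> J"
    "x \<in> J \<Longrightarrow> - x \<in> J" "x \<in> J \<Longrightarrow> y \<in> J \<Longrightarrow> x - y \<in> J"
proof -
  show *: "0 \<in> J" "x \<in> J \<Longrightarrow> y \<in> J \<Longrightarrow> x + y \<in> J" "x \<in> J \<Longrightarrow> r * x \<in> J" for x y r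
    using assms by (auto simp: left_ideal_def)
  show **: "x \<in> J \<Longrightarrow> - x \<in> J" for x using *(3)[of x "-1"] by simp
  show "x \<in> J \<Longrightarrow> y \<in> J \<Longrightarrow> x - y \<in> J" using *(2)[of x "- y"] **[of y] by simp
qed

lemma usubspaceD:
  assumes "usubspace Q"
  shows "0 \<in> Q" "x \<in> Q \<Longrightarrow> y \<in> Q \<Longrightarrow> x + y \<in> Q" "x \<in> Q \<Longrightarrow> scal a * x \<in> Q"
    "x \<in> Q \<Longrightarrow> - x \<in> Q" "x \<in> Q \<Longrightarrow> y \<in> Q \<Longrightarrow> x - y \<in> Q"
proof -
  show *: "0 \<in> Q" "x \<in> Q \<Longrightarrow> y \<in> Q \<Longrightarrow> x + y \<in> Q" "x \<in> Q \<Longrightarrow> scal a * x \<in> Q" for x y a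
    using assms by (auto simp: usubspace_def)
  show **: "x \<in> Q \<Longrightarrow> - x \<in> Q" for x using *(3)[of x "-1"] by (simp add: scal_simps)
  show "x \<in> Q \<Longrightarrow> y \<in> Q \<Longrightarrow> x - y \<in> Q" using *(2)[of x "- y"] **[of y] by simp
qed

lemma usubspace_scal_iff: "usubspace Q \<Longrightarrow> a \<noteq> 0 \<Longrightarrow> scal a * x \<in> Q \<longleftrightarrow> x \<in> Q"
  using usubspaceD(3)[of Q "scal a * x" "1 / a"] usubspaceD(3)[of Q x a]
  by (auto simp flip: mult.assoc scal.scalar_mult simp: scal.scalar_one)

lemma usubspace_sum: "usubspace Q \<Longrightarrow> (\<And>i. i \<in> I \<Longrightarrow> f i \<in> Q) \<Longrightarrow> sum f I \<in> Q"
  by (induction I rule: infinite_finite_induct) (auto simp: usubspaceD)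

lemma left_ideal_usubspace: "left_ideal J \<Longrightarrow> usubspace J"
  by (auto simp: usubspace_def left_idealD)

lemma usubspace_cong: "usubspace Q \<Longrightarrow> x - y \<in> Q \<Longrightarrow> x \<in> Q \<longleftrightarrow> y \<in> Q"
  using usubspaceD(5)[of Q x "x - y"] usubspaceD(2)[of Q "x - y" y] by auto

lemma usubspace_left_idealI:
  assumes Q: "usubspace Q" "\<And>x y. y \<in> Q \<Longrightarrow> gen x * y \<in> Q"
  shows "left_ideal Q"
proof -
  have "\<forall>y\<in>Q. u * y \<in> Q" for u
    by (induction u rule: uea_induct)
       (use Q in \<open>auto simp: usubspaceD distrib_right mult.assoc\<close>)
  then show ?thesis using Q by (auto simp: left_ideal_def usubspaceD)
qed

lemma left_ideal_1: "left_ideal J \<Longrightarrow> 1 \<in> J \<Longrightarrow> J = UNIV"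
  using left_idealD(3)[of J 1] by (auto simp: set_eq_iff)

lemma l4_sl2_cases: "P (Lg sl2_e) \<Longrightarrow> P (Lg sl2_h) \<Longrightarrow> P (Lg sl2_f) \<Longrightarrow> (\<And>v. P (Lr v)) \<Longrightarrow> P x"
  by (metis l4.exhaust sl2.exhaust)

lemma pev_eigen:
  assumes Q: "usubspace Q" "\<And>x. x \<in> Q \<Longrightarrow> g * x \<in> Q" and u: "g * u - scal a * u \<in> Q"
  shows "pev p g * u - scal (poly p a) * u \<in> Q"
proof (induction p)
  case 0
  then show ?case using Q by (simp add: usubspaceD scal_simps)
next
  case (pCons b p)
  have "pev (pCons b p) g * u - scal (poly (pCons b p) a) * u =
     g * (pev p g * u - scal (poly p a) * u) + scal (poly p a) * (g * u - scal a * u)"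
    using scal_left_commute[of g "poly p a" u]
    by (simp add: algebra_simps scal.scalar_add scal_scal)
  then show ?case using Q pCons u by (simp add: usubspaceD)
qed

lemma pev_closed:
  assumes "usubspace Q" "\<And>x. x \<in> Q \<Longrightarrow> g * x \<in> Q" "x \<in> Q"
  shows "pev p g * x \<in> Q"
  using assms by (induction p) (simp_all add: usubspaceD distrib_right mult.assoc)

subsection \<open>Local nilpotency and weights\<close>

text \<open>For a left ideal \<open>J\<close>, the vectors of the quotient by \<open>J\<close> on
  which \<open>g\<close> is nilpotent.\<close>

definition nilset :: "'r::ring_1 \<Rightarrow> 'r set \<Rightarrow> 'r set" where
  "nilset g J = {u. \<exists>N. g ^ N * u \<in> J}"

lemma nilset_mono:
  assumes "left_ideal J" "g ^ N * u \<in> J" "N \<le> M"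
  shows "g ^ M * u \<in> J"
proof -
  have "g ^ M * u = g ^ (M - N) * (g ^ N * u)"
    using assms(3) by (simp flip: power_add mult.assoc)
  then show ?thesis using assms by (simp add: left_idealD)
qed

lemma nilset_add: "left_ideal J \<Longrightarrow> u \<in> nilset g J \<Longrightarrow> v \<in> nilset g J \<Longrightarrow> u + v \<in> nilset g J"
proof -
  assume J: "left_ideal J" and "u \<in> nilset g J" "v \<in> nilset g J"
  then obtain M N where "g ^ M * u \<in> J" "g ^ N * v \<in> J" by (auto simp: nilset_def)
  then have "g ^ (M + N) * u \<in> J" "g ^ (M + N) * v \<in> J"
    using nilset_mono[OF J] by (auto intro: le_add1 le_add2)
  then have "g ^ (M + N) * (u + v) \<in> J" by (simp add: distrib_left left_idealD(2)[OF J])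
  then show ?thesis by (auto simp: nilset_def)
qed

lemma nilset_step:
  assumes "left_ideal J" "g * u \<in> nilset g J"
  shows "u \<in> nilset g J"
proof -
  obtain N where "g ^ N * (g * u) \<in> J" using assms by (auto simp: nilset_def)
  then have "g ^ Suc N * u \<in> J" by (simp only: power_Suc2 mult.assoc)
  then show ?thesis unfolding nilset_def by (intro CollectI exI)
qed

text \<open>Induction on the exponent: \<open>g * (y * u)\<close> is \<open>y * (g * u)\<close>,
  where the exponent has dropped, plus \<open>z * u\<close>. It is applied to generators in an order
  in which the commutator z has been treated before y.\<close>

lemma nilset_mult:
  assumes J: "left_ideal J" and comm: "g * y = y * g + z"
    and z: "\<And>u. u \<in> nilset g J \<Longrightarrow> z * u \<in> nilset g J" and u: "u \<in> nilset g J"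
  shows "y * u \<in> nilset g J"
proof -
  obtain N where "g ^ N * u \<in> J" using u by (auto simp: nilset_def)
  then show ?thesis
  proof (induction N arbitrary: u)
    case 0
    then show ?case using J by (auto simp: nilset_def left_idealD intro: exI[of _ 0])
  next
    case (Suc N)
    then have "g ^ N * (g * u) \<in> J" by (simp only: power_Suc2 mult.assoc)
    then have "y * (g * u) \<in> nilset g J" by (rule Suc.IH)
    moreover have "z * u \<in> nilset g J" unfolding nilset_def by (rule z[unfolded nilset_def]) (intro CollectI exI, rule Suc.prems)
    moreover have "g * (y * u) = y * (g * u) + z * u" by (rule comm_left[OF comm])
    ultimately have "g * (y * u) \<in> nilset g J" using nilset_add[OF J] by simp
    then show ?case by (rule nilset_step[OF J])
  qed
qed

lemma nilset_central: "left_ideal J \<Longrightarrow> g * y = y * g \<Longrightarrow> u \<in> nilset g J \<Longrightarrow> y * u \<in> nilset g J"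
  by (rule nilset_mult[of J g y 0]) (auto simp: nilset_def left_idealD)

lemma nilset_numeral: "left_ideal J \<Longrightarrow> (\<And>u. u \<in> nilset g J \<Longrightarrow> y * u \<in> nilset g J) \<Longrightarrow>
    u \<in> nilset g J \<Longrightarrow> numeral n * y * u \<in> nilset g J"
  by (metis mult.assoc nilset_central numeral_central)

lemma nilset_scal: "left_ideal J \<Longrightarrow> u \<in> nilset g J \<Longrightarrow> scal a * u \<in> nilset g J"
  by (rule nilset_central) (simp_all add: scal.scalar_central)

lemma nilset_uminus: "left_ideal J \<Longrightarrow> u \<in> nilset g J \<Longrightarrow> - u \<in> nilset g J"
  using nilset_central[of J g "-1" u] by simp

text \<open>\<open>ad e\<close> and \<open>ad f\<close> are nilpotent on the Lie algebra, so the
  generators can be ordered such that each commutator involves earlier ones only: e, h, f and the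
  radical by decreasing weight for \<open>e\<close>, the reverse for \<open>f\<close>.\<close>

lemma nilset_left_ideal:
  assumes J: "left_ideal J" and g: "g = ue \<or> g = uf"
  shows "left_ideal (nilset g J)"
proof (rule usubspace_left_idealI)
  show "usubspace (nilset g J)"
    using J by (auto simp: usubspace_def nilset_add nilset_scal)
       (auto simp: nilset_def left_idealD)
  have "\<forall>u\<in>nilset g J. gen x * u \<in> nilset g J" for x
    using g
  proof
    assume g: "g = ue"
    note step = nilset_mult[OF J] and num = nilset_numeral[OF J] and cen = nilset_central[OF J]
    have e: "\<forall>u\<in>nilset g J. ue * u \<in> nilset g J" using cen[of g ue] g by auto
    have h: "\<forall>u\<in>nilset g J. uh * u \<in> nilset g J"
    proof
      fix u assume u: "u \<in> nilset g J"
      have "g * uh = uh * g + - (2 * ue)" using comm_he g by (simp add: algebra_simps)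
      then show "uh * u \<in> nilset g J"
        by (rule step) (use e num nilset_uminus[OF J] u in auto)
    qed
    have f: "\<forall>u\<in>nilset g J. uf * u \<in> nilset g J" using step[of g uf uh] comm_ef g h by auto
    have v4: "\<forall>u\<in>nilset g J. uv V4 * u \<in> nilset g J" using cen[of g "uv V4"] comm_ev g by auto
    have v2: "\<forall>u\<in>nilset g J. uv V2 * u \<in> nilset g J"
      using step[of g "uv V2" "4 * uv V4"] comm_ev g v4 num by auto
    have v0: "\<forall>u\<in>nilset g J. uv V0 * u \<in> nilset g J"
      using step[of g "uv V0" "3 * uv V2"] comm_ev g v2 num by auto
    have m2: "\<forall>u\<in>nilset g J. uv Vm2 * u \<in> nilset g J"
      using step[of g "uv Vm2" "2 * uv V0"] comm_ev g v0 num by auto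
    have m4: "\<forall>u\<in>nilset g J. uv Vm4 * u \<in> nilset g J"
      using step[of g "uv Vm4" "uv Vm2"] comm_ev g m2 by auto
    have v: "\<forall>u\<in>nilset g J. uv v * u \<in> nilset g J" for v
      using v4 v2 v0 m2 m4 by (cases v) simp_all
    show ?thesis
      by (rule l4_sl2_cases[of "\<lambda>x. \<forall>u\<in>nilset g J. gen x * u \<in> nilset g J"]; rule e h f v)
  next
    assume g: "g = uf"
    note step = nilset_mult[OF J] and num = nilset_numeral[OF J] and cen = nilset_central[OF J]
    have f: "\<forall>u\<in>nilset g J. uf * u \<in> nilset g J" using cen[of g uf] g by auto
    have h: "\<forall>u\<in>nilset g J. uh * u \<in> nilset g J"
    proof
      fix u assume u: "u \<in> nilset g J"
      have "g * uh = uh * g + 2 * uf" using comm_hf g by (simp add: algebra_simps)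
      then show "uh * u \<in> nilset g J"
        by (rule step) (use f num u in auto)
    qed
    have e: "\<forall>u\<in>nilset g J. ue * u \<in> nilset g J"
    proof
      fix u assume u: "u \<in> nilset g J"
      have "g * ue = ue * g + - uh" using comm_ef g by (simp add: algebra_simps)
      then show "ue * u \<in> nilset g J"
        by (rule step) (use h nilset_uminus[OF J] u in auto)
    qed
    have m4: "\<forall>u\<in>nilset g J. uv Vm4 * u \<in> nilset g J" using cen[of g "uv Vm4"] comm_fv g by auto
    have m2: "\<forall>u\<in>nilset g J. uv Vm2 * u \<in> nilset g J"
      using step[of g "uv Vm2" "4 * uv Vm4"] comm_fv g m4 num by auto
    have v0: "\<forall>u\<in>nilset g J. uv V0 * u \<in> nilset g J"
      using step[of g "uv V0" "3 * uv Vm2"] comm_fv g m2 num by auto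
    have v2: "\<forall>u\<in>nilset g J. uv V2 * u \<in> nilset g J"
      using step[of g "uv V2" "2 * uv V0"] comm_fv g v0 num by auto
    have v4: "\<forall>u\<in>nilset g J. uv V4 * u \<in> nilset g J"
      using step[of g "uv V4" "uv V2"] comm_fv g v2 by auto
    have v: "\<forall>u\<in>nilset g J. uv v * u \<in> nilset g J" for v
      using v4 v2 v0 m2 m4 by (cases v) simp_all
    show ?thesis
      by (rule l4_sl2_cases[of "\<lambda>x. \<forall>u\<in>nilset g J. gen x * u \<in> nilset g J"]; rule e h f v)
  qed
  then show "y \<in> nilset g J \<Longrightarrow> gen x * y \<in> nilset g J" for x y by blast
qed

lemma nilpotent_all:
  assumes "left_ideal J" "g = ue \<or> g = uf" "g ^ N \<in> J"
  obtains M where "g ^ M * u \<in> J"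
proof -
  have "1 \<in> nilset g J" using assms(3) by (auto simp: nilset_def)
  then have "u \<in> nilset g J" using left_ideal_1[OF nilset_left_ideal[OF assms(1,2)]] by simp
  then show ?thesis using that by (auto simp: nilset_def)
qed

text \<open>Sums of weight vectors of \<open>U/J\<close>. As the generators of U are weight vectors
  for \<open>ad h\<close>, this is everything as soon as 1 is a weight vector
  (\<open>wspan_all\<close>).\<close>

inductive_set wspan :: "l4 uea set \<Rightarrow> l4 uea set" for J where
  wspan_weight: "uh * u - scal a * u \<in> J \<Longrightarrow> u \<in> wspan J"
| wspan_add: "u \<in> wspan J \<Longrightarrow> v \<in> wspan J \<Longrightarrow> u + v \<in> wspan J"

fun l4wt :: "l4 \<Rightarrow> int" where
  "l4wt (Lg sl2_e) = 2" | "l4wt (Lg sl2_h) = 0" | "l4wt (Lg sl2_f) = -2" | "l4wt (Lr v) = rwt v"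

lemma comm_h_gen: "uh * gen x = gen x * uh + scal (of_int (l4wt x)) * gen x"
proof (cases x)
  case (Lg g)
  then show ?thesis by (cases g) (simp_all add: comm_he comm_hf scal_simps)
qed (simp add: comm_hv')

lemma weight_gen:
  assumes "left_ideal J" "uh * u - scal a * u \<in> J"
  shows "uh * (gen x * u) - scal (a + of_int (l4wt x)) * (gen x * u) \<in> J"
proof -
  have "uh * (gen x * u) - scal (a + of_int (l4wt x)) * (gen x * u) = gen x * (uh * u - scal a * u)"
    by (simp add: comm_left[OF comm_h_gen] scal_simps algebra_simps scal_commutes)
  then show ?thesis using assms by (simp add: left_idealD)
qed

lemma wspan_left_ideal:
  assumes J: "left_ideal J"
  shows "left_ideal (wspan J)"
proof (rule usubspace_left_idealI)
  have "scal b * u \<in> wspan J" if "u \<in> wspan J" for b u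
    using that
  proof (induction rule: wspan.induct)
    case (wspan_weight u a)
    have "uh * (scal b * u) - scal a * (scal b * u) = scal b * (uh * u - scal a * u)"
      by (simp add: scal_commutes scal_scal right_diff_distrib mult.commute)
    then show ?case using wspan.wspan_weight[of "scal b * u" a J] wspan_weight J
      by (simp add: left_idealD)
  qed (simp add: distrib_left wspan.wspan_add)
  moreover have "0 \<in> wspan J"
    by (rule wspan.wspan_weight[of _ 0]) (simp add: J left_idealD)
  ultimately show "usubspace (wspan J)" by (auto simp: usubspace_def wspan_add)
  show "gen x * y \<in> wspan J" if "y \<in> wspan J" for x y
    using that
  proof (induction rule: wspan.induct)
    case (wspan_weight u a)
    show ?case by (rule wspan.wspan_weight[OF weight_gen[OF J wspan_weight]])
  qed (simp add: distrib_left wspan.wspan_add)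
qed

lemma wspan_all:
  assumes "left_ideal J" "uh - scal a \<in> J"
  shows "u \<in> wspan J"
proof -
  have "1 \<in> wspan J" by (rule wspan_weight[of 1 a]) (use assms in simp)
  then show ?thesis using left_ideal_1[OF wspan_left_ideal[OF assms(1)]] by simp
qed

lemma comm_h_e_pow: "uh * ue ^ k = ue ^ k * (uh + scal (2 * of_nat k))"
proof (induction k)
  case (Suc k)
  have "uh * ue ^ Suc k = (ue * uh + 2 * ue) * ue ^ k" by (simp add: comm_he flip: mult.assoc)
  also have "\<dots> = ue ^ Suc k * (uh + scal (2 * of_nat k)) + 2 * ue ^ Suc k"
    by (simp add: distrib_right mult.assoc Suc)
  also have "\<dots> = ue ^ Suc k * (uh + scal (2 * of_nat (Suc k)))"
    by (simp only: scal_simps of_nat_Suc) (simp add: distrib_left numeral_central)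
  finally show ?case .
qed (simp add: scal_simps)

lemma comm_h_f_pow: "uh * uf ^ k = uf ^ k * (uh - scal (2 * of_nat k))"
proof (induction k)
  case (Suc k)
  have "uh * uf ^ Suc k = (uf * uh - 2 * uf) * uf ^ k" by (simp add: comm_hf flip: mult.assoc)
  also have "\<dots> = uf ^ Suc k * (uh - scal (2 * of_nat k)) - 2 * uf ^ Suc k"
    by (simp add: left_diff_distrib mult.assoc Suc)
  also have "\<dots> = uf ^ Suc k * (uh - scal (2 * of_nat (Suc k)))"
    by (simp only: scal_simps of_nat_Suc) (simp add: distrib_left right_diff_distrib numeral_central)
  finally show ?case .
qed (simp add: scal_simps)

lemma comm_f_e_pow: "uf * ue ^ Suc k = ue ^ Suc k * uf - scal (of_nat (Suc k)) * ue ^ k * (uh + scal (of_nat k))"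
proof (induction k)
  case 0
  show ?case using comm_ef by (simp add: scal_simps algebra_simps)
next
  case (Suc k)
  have fe: "uf * ue = ue * uf - uh" using comm_ef by (simp add: algebra_simps)
  have "uf * ue ^ Suc (Suc k) = ue * (uf * ue ^ Suc k) - uh * ue ^ Suc k"
    using comm_left_minus[OF fe, of "ue ^ Suc k"] by (simp only: power_Suc[of ue "Suc k"])
  also have "\<dots> = ue ^ Suc (Suc k) * uf - scal (of_nat (Suc k)) * ue ^ Suc k * (uh + scal (of_nat k))
      - ue ^ Suc k * (uh + scal (2 * of_nat (Suc k)))"
    by (simp only: Suc comm_h_e_pow) (simp add: algebra_simps scal_commutes)
  also have "\<dots> = ue ^ Suc (Suc k) * uf - ue ^ Suc k *
     (scal (of_nat (Suc k)) * (uh + scal (of_nat k)) + (uh + scal (2 * of_nat (Suc k))))"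
    by (simp add: algebra_simps scal_commutes)
  also have "scal (of_nat (Suc k)) * (uh + scal (of_nat k)) + (uh + scal (2 * of_nat (Suc k)))
     = scal (of_nat (Suc (Suc k))) * (uh + scal (of_nat (Suc k)))"
    unfolding scal_collect
    unfolding distrib_left scal.scalar_mult[symmetric]
    by (intro arg_cong2[of _ _ _ _ plus] arg_cong2[of _ _ _ _ times] arg_cong[of _ _ scal] refl)
       (simp_all add: algebra_simps)
  finally show ?case by (simp add: algebra_simps scal_commutes)
qed

lemma comm_e_f_pow: "ue * uf ^ Suc k = uf ^ Suc k * ue + scal (of_nat (Suc k)) * uf ^ k * (uh - scal (of_nat k))"
proof (induction k)
  case 0
  show ?case using comm_ef by (simp add: scal_simps algebra_simps)
next
  case (Suc k)
  have "ue * uf ^ Suc (Suc k) = uf * (ue * uf ^ Suc k) + uh * uf ^ Suc k"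
    using comm_left[OF comm_ef, of "uf ^ Suc k"] by (simp only: power_Suc[of uf "Suc k"])
  also have "\<dots> = uf ^ Suc (Suc k) * ue + uf ^ Suc k *
     (scal (of_nat (Suc k)) * (uh - scal (of_nat k)) + (uh - scal (2 * of_nat (Suc k))))"
    by (simp only: Suc comm_h_f_pow) (simp add: algebra_simps scal_commutes)
  also have "scal (of_nat (Suc k)) * (uh - scal (of_nat k)) + (uh - scal (2 * of_nat (Suc k)))
     = scal (of_nat (Suc (Suc k))) * (uh - scal (of_nat (Suc k)))"
    unfolding diff_conv_add_uminus scal_uminus[symmetric] scal_collect
    unfolding distrib_left scal.scalar_mult[symmetric]
    by (intro arg_cong2[of _ _ _ _ plus] arg_cong2[of _ _ _ _ times] arg_cong[of _ _ scal] refl)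
       (simp_all add: algebra_simps)
  finally show ?case by (simp add: algebra_simps scal_commutes)
qed

section \<open>Local models: sections of line bundles on \<open>SL2/T\<close> in two
  coordinates\<close>

section \<open>A family of modules of functions\<close>

text \<open>Linear operators on functions of two integers, made a type so that the universal
  property \<open>uea_lift\<close> can have them as its target ring.\<close>

typedef lendo = "{T :: (int \<Rightarrow> int \<Rightarrow> complex) \<Rightarrow> int \<Rightarrow> int \<Rightarrow> complex.
  (\<forall>G H. T (\<lambda>k l. G k l + H k l) = (\<lambda>k l. T G k l + T H k l)) \<and>
  (\<forall>a G. T (\<lambda>k l. a * G k l) = (\<lambda>k l. a * T G k l))}"
  by (rule exI[of _ "\<lambda>G. G"]) simp

setup_lifting type_definition_lendo

instantiation lendo :: ring_1
begin

lift_definition zero_lendo :: lendo is "\<lambda>G k l. 0" by simp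
lift_definition one_lendo :: lendo is "\<lambda>G. G" by simp
lift_definition plus_lendo :: "lendo \<Rightarrow> lendo \<Rightarrow> lendo" is "\<lambda>S T G k l. S G k l + T G k l"
  by (simp add: fun_eq_iff algebra_simps)
lift_definition minus_lendo :: "lendo \<Rightarrow> lendo \<Rightarrow> lendo" is "\<lambda>S T G k l. S G k l - T G k l"
  by (simp add: fun_eq_iff algebra_simps)
lift_definition uminus_lendo :: "lendo \<Rightarrow> lendo" is "\<lambda>S G k l. - S G k l"
  by (simp add: fun_eq_iff algebra_simps)
lift_definition times_lendo :: "lendo \<Rightarrow> lendo \<Rightarrow> lendo" is "\<lambda>S T G. S (T G)"
  by simp

instance
proof
  fix a b c :: lendo
  show "(0 :: lendo) \<noteq> 1"
    by transfer (auto simp: fun_eq_iff intro: exI[of _ "\<lambda>_ _. 1"])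
qed (transfer; simp add: fun_eq_iff algebra_simps)+

end

lift_definition lscal :: "complex \<Rightarrow> lendo" is "\<lambda>a G k l. a * G k l"
  by (simp add: fun_eq_iff algebra_simps)

text \<open>The value \<open>G k l\<close> is the coefficient of \<open>(u\<^sup>k / k!) (s\<^sup>l / l!)\<close> of a function on the big cell of
  \<open>G/T\<close>, so that \<open>u\<close> and \<open>s\<close> multiply \<open>G (k - 1) l\<close> by \<open>k\<close> and \<open>G k (l - 1)\<close> by \<open>l\<close>.  Here \<open>f\<close> is
  \<open>\<partial>/\<partial>u\<close> and the radical acts by multiplication with the coefficients of the square of the quadratic
  form with roots \<open>- u\<close> and \<open>- u - 1/s\<close>.  Negative \<open>k\<close> stands for derivatives of the delta function
  at \<open>u = 0\<close>.\<close>

fun opI :: "complex \<Rightarrow> complex \<Rightarrow> l4 \<Rightarrow> (int \<Rightarrow> int \<Rightarrow> complex) \<Rightarrow> int \<Rightarrow> int \<Rightarrow> complex" where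
  "opI m c (Lg sl2_f) G k l = G (k + 1) l"
| "opI m c (Lg sl2_h) G k l = (2 * of_int k - 2 * of_int l - m) * G k l"
| "opI m c (Lg sl2_e) G k l =
    G k (l + 1) + of_int k * (2 * of_int l - of_int k + 1 + m) * G (k - 1) l"
| "opI m c (Lr V4) G k l = c * (of_int (k * (k - 1)) * G (k - 2) l
    + of_int (2 * k * (k - 1) * (k - 2) * l) * G (k - 3) (l - 1)
    + of_int (k * (k - 1) * (k - 2) * (k - 3) * l * (l - 1)) * G (k - 4) (l - 2))"
| "opI m c (Lr V2) G k l = c * (of_int (2 * k) * G (k - 1) l
    + of_int (6 * k * (k - 1) * l) * G (k - 2) (l - 1)
    + of_int (4 * k * (k - 1) * (k - 2) * l * (l - 1)) * G (k - 3) (l - 2))"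
| "opI m c (Lr V0) G k l = c * (G k l
    + of_int (6 * k * l) * G (k - 1) (l - 1)
    + of_int (6 * k * (k - 1) * l * (l - 1)) * G (k - 2) (l - 2))"
| "opI m c (Lr Vm2) G k l = c * (of_int (2 * l) * G k (l - 1)
    + of_int (4 * k * l * (l - 1)) * G (k - 1) (l - 2))"
| "opI m c (Lr Vm4) G k l = c * (of_int (l * (l - 1)) * G k (l - 2))"

lift_definition lop :: "complex \<Rightarrow> complex \<Rightarrow> l4 \<Rightarrow> lendo" is opI
proof -
  fix m c x
  show "(\<forall>G H. opI m c x (\<lambda>k l. G k l + H k l) = (\<lambda>k l. opI m c x G k l + opI m c x H k l)) \<and>
     (\<forall>a G. opI m c x (\<lambda>k l. a * G k l) = (\<lambda>k l. a * opI m c x G k l))"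
    by (rule l4_sl2_cases[of _ x]) (simp_all add: fun_eq_iff algebra_simps,
      case_tac v, simp_all add: algebra_simps)
qed

lemma scalar_hom_lscal: "scalar_hom lscal"
  by unfold_locales (transfer; simp add: fun_eq_iff algebra_simps)+

definition mul_u :: "(int \<Rightarrow> int \<Rightarrow> complex) \<Rightarrow> int \<Rightarrow> int \<Rightarrow> complex" where
  "mul_u G k l = of_int k * G (k - 1) l"

definition mul_s :: "(int \<Rightarrow> int \<Rightarrow> complex) \<Rightarrow> int \<Rightarrow> int \<Rightarrow> complex" where
  "mul_s G k l = of_int l * G k (l - 1)"

lemma opI_mul:
  "opI m c (Lr V4) G = (\<lambda>k l. c * (mul_u (mul_u G) k l + 2 * mul_u (mul_u (mul_u (mul_s G))) k l
     + mul_u (mul_u (mul_u (mul_u (mul_s (mul_s G))))) k l))"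
  "opI m c (Lr V2) G = (\<lambda>k l. c * (2 * mul_u G k l + 6 * mul_u (mul_u (mul_s G)) k l
     + 4 * mul_u (mul_u (mul_u (mul_s (mul_s G)))) k l))"
  "opI m c (Lr V0) G = (\<lambda>k l. c * (G k l + 6 * mul_u (mul_s G) k l
     + 6 * mul_u (mul_u (mul_s (mul_s G))) k l))"
  "opI m c (Lr Vm2) G = (\<lambda>k l. c * (2 * mul_s G k l + 4 * mul_u (mul_s (mul_s G)) k l))"
  "opI m c (Lr Vm4) G = (\<lambda>k l. c * mul_s (mul_s G) k l)"
  by (simp_all add: fun_eq_iff mul_u_def mul_s_def algebra_simps)

lemma opI_linear:
  "opI m c x (\<lambda>k l. G k l + H k l) = (\<lambda>k l. opI m c x G k l + opI m c x H k l)"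
  "opI m c x (\<lambda>k l. a * G k l) = (\<lambda>k l. a * opI m c x G k l)"
  using Rep_lendo[of "lop m c x"] by (simp_all add: lop.rep_eq)

lemma opI_mul_commute:
  "opI m c (Lr v) (mul_u G) = mul_u (opI m c (Lr v) G)"
  "opI m c (Lr v) (mul_s G) = mul_s (opI m c (Lr v) G)"
  by (cases v; simp add: fun_eq_iff mul_u_def mul_s_def algebra_simps)+

text \<open>The radical acts by polynomials in the operators \<open>mul_u\<close> and
  \<open>mul_s\<close>, and every operator of the radical commutes with these two.\<close>

lemma opI_Lr_commute: "opI m c (Lr v) (opI m c (Lr w) G) = opI m c (Lr w) (opI m c (Lr v) G)"
  by (cases w) (simp_all only: opI_mul(1-5)[of m c G] opI_mul(1-5)[of m c "opI m c (Lr v) G"]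
    opI_linear opI_mul_commute)

lemma opI_bracket:
  "opI m c x (opI m c y G) k l - opI m c y (opI m c x G) k l
    = (\<Sum>z\<in>UNIV. sc x y z * opI m c z G k l)"
proof -
  have gg: "?thesis" if "x = Lg g" "y = Lg g'" for g g'
    unfolding that by (cases g; cases g'; simp add: sum_l4 sum_sl2 sc_l4_def algebra_simps)
  have gv: "opI m c (Lg g) (opI m c (Lr v) G) k l - opI m c (Lr v) (opI m c (Lg g) G) k l
    = (\<Sum>w\<in>UNIV. rad_act g v w * opI m c (Lr w) G k l)" for g v
    by (cases g; cases v; simp add: sum_rad algebra_simps)
  have vv: "opI m c (Lr v) (opI m c (Lr w) G) k l = opI m c (Lr w) (opI m c (Lr v) G) k l" for v w
    by (rule opI_Lr_commute[THEN fun_cong, THEN fun_cong])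
  show ?thesis
  proof (cases x)
    case (Lg g)
    show ?thesis
    proof (cases y)
      case Lg': (Lg g')
      then show ?thesis using gg Lg by blast
    next
      case (Lr v)
      then show ?thesis using gv[of g v] Lg by (simp add: sum_l4 sc_l4_def)
    qed
  next
    case (Lr v)
    show ?thesis
    proof (cases y)
      case (Lg g)
      then show ?thesis using gv[of g v] Lr
        by (simp add: sum_l4 sc_l4_def sum_negf algebra_simps)
    next
      case Lr': (Lr w)
      then show ?thesis using vv[of v w] Lr by (simp add: sum_l4 sc_l4_def)
    qed
  qed
qed

lemma Rep_lendo_sum: "Rep_lendo (\<Sum>z\<in>A. f z) G k l = (\<Sum>z\<in>A. Rep_lendo (f z) G k l)"
  by (induction A rule: infinite_finite_induct) (auto simp: zero_lendo.rep_eq plus_lendo.rep_eq)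

interpretation lop: uea_rep lscal "lop m c" for m c
proof -
  interpret scalar_hom lscal by (rule scalar_hom_lscal)
  show "uea_rep lscal (lop m c)"
  proof
    fix x y
    show "lop m c x * lop m c y - lop m c y * lop m c x = (\<Sum>z\<in>UNIV. lscal (sc x y z) * lop m c z)"
      by (subst Rep_lendo_inject[symmetric])
         (simp add: fun_eq_iff Rep_lendo_sum minus_lendo.rep_eq times_lendo.rep_eq lscal.rep_eq
           lop.rep_eq opI_bracket)
  qed
qed

definition actI :: "complex \<Rightarrow> complex \<Rightarrow> l4 uea \<Rightarrow> (int \<Rightarrow> int \<Rightarrow> complex) \<Rightarrow> int \<Rightarrow> int \<Rightarrow> complex"
  where "actI m c u = Rep_lendo (uea_lift lscal (lop m c) u)"

lemma actI_simps:
  "actI m c (u + v) G = (\<lambda>k l. actI m c u G k l + actI m c v G k l)"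
  "actI m c (u * v) G = actI m c u (actI m c v G)"
  "actI m c 1 G = G"
  "actI m c (scal a) G = (\<lambda>k l. a * G k l)"
  "actI m c (gen x) G = opI m c x G"
  by (simp_all add: actI_def lop.uea_lift_add lop.uea_lift_mult lop.uea_lift_one lop.uea_lift_scal
    lop.uea_lift_gen plus_lendo.rep_eq times_lendo.rep_eq one_lendo.rep_eq lscal.rep_eq lop.rep_eq)

lemma actI_linear:
  "actI m c u (\<lambda>k l. G k l + H k l) = (\<lambda>k l. actI m c u G k l + actI m c u H k l)"
  "actI m c u (\<lambda>k l. a * G k l) = (\<lambda>k l. a * actI m c u G k l)"
  using Rep_lendo[of "uea_lift lscal (lop m c) u"] by (simp_all add: actI_def)

lemma actI_0: "actI m c 0 G = (\<lambda>k l. 0)"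
  using actI_simps(4)[of m c 0 G] by (simp add: scal.scalar_zero)

lemma actI_zero: "actI m c u (\<lambda>k l. 0) = (\<lambda>k l. 0)"
  using actI_linear(2)[of m c u 0] by simp

text \<open>The coefficients with \<open>l \<ge> 0\<close>, and those with \<open>k, l \<ge> 0\<close>, form quotient modules.\<close>

definition agree :: "bool \<Rightarrow> (int \<Rightarrow> int \<Rightarrow> complex) \<Rightarrow> (int \<Rightarrow> int \<Rightarrow> complex) \<Rightarrow> bool" where
  "agree b G H \<longleftrightarrow> (\<forall>k l. l \<ge> 0 \<longrightarrow> (b \<longrightarrow> k \<ge> 0) \<longrightarrow> G k l = H k l)"

text \<open>A term that reads a value outside the half plane or quadrant from a position inside has
  a coefficient such as k (k - 1) or l, which vanishes at that position.\<close>

lemma agree_op: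
  assumes "agree b G H"
  shows "agree b (opI m c x G) (opI m c x H)"
proof -
  have a: "a = 0 \<or> G k l = H k l"
    if "l < 0 \<or> b \<and> k < 0 \<Longrightarrow> a = (0 :: complex)" for k l a
    using assms that unfolding agree_def by (meson not_le)
  have *: "a * G k l = a * H k l" if "l < 0 \<or> b \<and> k < 0 \<Longrightarrow> a = (0 :: complex)" for k l a
    using a[OF that] by auto
  show ?thesis unfolding agree_def
  proof (intro allI impI)
    fix k l :: int assume l: "l \<ge> 0" and k: "b \<longrightarrow> k \<ge> 0"
    have k': "b \<Longrightarrow> k < 1 \<Longrightarrow> k = 0" "b \<Longrightarrow> k < 2 \<Longrightarrow> k = 0 \<or> k = 1"
      "b \<Longrightarrow> k < 3 \<Longrightarrow> k = 0 \<or> k = 1 \<or> k = 2" "b \<Longrightarrow> k < 4 \<Longrightarrow> k = 0 \<or> k = 1 \<or> k = 2 \<or> k = 3"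
      using k by auto
    have l': "l < 1 \<Longrightarrow> l = 0" "l < 2 \<Longrightarrow> l = 0 \<or> l = 1" using l by auto
    have g: "G k l = H k l" "G (k + 1) l = H (k + 1) l" "G k (l + 1) = H k (l + 1)"
      using assms l k by (auto simp: agree_def)
    show "opI m c x G k l = opI m c x H k l"
    proof (rule l4_sl2_cases[of _ x])
      fix v
      show "opI m c (Lr v) G k l = opI m c (Lr v) H k l"
        by (cases v; simp only: opI.simps g;
            intro arg_cong2[of _ _ _ _ plus] arg_cong[of _ _ "times c"] refl *;
            use k' l' in auto)
    qed (use *[of l "k - 1" "of_int k * (2 * of_int l - of_int k + 1 + m)"] k' l' g l in auto)
  qed
qed

lemma agree_act: "agree b G H \<Longrightarrow> agree b (actI m c u G) (actI m c u H)"
proof (induction u arbitrary: G H rule: uea_induct)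
  case (scal a)
  then show ?case by (auto simp: actI_simps agree_def)
next
  case (gen x)
  then show ?case by (simp add: actI_simps agree_op)
next
  case (add u v)
  from add.IH[OF add.prems] show ?case by (simp add: actI_simps agree_def)
next
  case (mult u v)
  then show ?case by (simp add: actI_simps)
qed

text \<open>Extension by zero picks a representative for the quotient module on the quadrant; by
  \<open>agree_act\<close> the action does not depend on this choice.\<close>

definition ext :: "(nat \<Rightarrow> nat \<Rightarrow> complex) \<Rightarrow> int \<Rightarrow> int \<Rightarrow> complex" where
  "ext G k l = (if k \<ge> 0 \<and> l \<ge> 0 then G (nat k) (nat l) else 0)"

definition restr :: "(int \<Rightarrow> int \<Rightarrow> complex) \<Rightarrow> nat \<Rightarrow> nat \<Rightarrow> complex" where
  "restr G k l = G (int k) (int l)"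

definition act :: "complex \<Rightarrow> complex \<Rightarrow> l4 uea \<Rightarrow> (nat \<Rightarrow> nat \<Rightarrow> complex) \<Rightarrow> nat \<Rightarrow> nat \<Rightarrow> complex" where
  "act m c u G = restr (actI m c u (ext G))"

lemma restr_ext [simp]: "restr (ext G) = G"
  by (simp add: fun_eq_iff restr_def ext_def)

lemma restr_agree: "agree True G H \<Longrightarrow> restr G = restr H"
  by (simp add: fun_eq_iff restr_def agree_def)

lemma agree_ext_restr: "agree True (ext (restr G)) G"
  by (simp add: restr_def agree_def ext_def)

lemma act_restr: "act m c u (restr G) = restr (actI m c u G)"
  unfolding act_def by (rule restr_agree, rule agree_act, rule agree_ext_restr)

lemma act_simps:
  "act m c (u + v) G = (\<lambda>k l. act m c u G k l + act m c v G k l)"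
  "act m c (u * v) G = act m c u (act m c v G)"
  "act m c 1 G = G"
  "act m c (scal a) G = (\<lambda>k l. a * G k l)"
proof -
  show "act m c (u * v) G = act m c u (act m c v G)"
    unfolding act_restr act_def[of m c v] by (simp add: act_def actI_simps)
qed (simp_all add: act_def actI_simps, simp_all add: fun_eq_iff restr_def ext_def)

lemma act_linear:
  "act m c u (\<lambda>k l. G k l + H k l) = (\<lambda>k l. act m c u G k l + act m c u H k l)"
  "act m c u (\<lambda>k l. a * G k l) = (\<lambda>k l. a * act m c u G k l)"
proof -
  have "ext (\<lambda>k l. G k l + H k l) = (\<lambda>k l. ext G k l + ext H k l)"
    "ext (\<lambda>k l. a * G k l) = (\<lambda>k l. a * ext G k l)"
    by (auto simp: fun_eq_iff ext_def)
  then show "act m c u (\<lambda>k l. G k l + H k l) = (\<lambda>k l. act m c u G k l + act m c u H k l)"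
    "act m c u (\<lambda>k l. a * G k l) = (\<lambda>k l. a * act m c u G k l)"
    by (simp_all add: act_def actI_linear) (simp_all add: fun_eq_iff restr_def)
qed

lemma act_zero [simp]: "act m c u (\<lambda>k l. 0) = (\<lambda>k l. 0)"
  using act_linear(2)[of m c u 0] by simp

lemma act_0 [simp]: "act m c 0 G = (\<lambda>k l. 0)"
  using act_simps(4)[of m c 0 G] by (simp add: scal.scalar_zero)

lemma act_uminus: "act m c (- u) G = (\<lambda>k l. - act m c u G k l)"
proof -
  have "- u = scal (- 1) * u" by (simp add: scal_uminus scal.scalar_one)
  then show ?thesis by (simp only: act_simps) simp
qed

lemma act_diff: "act m c (u - v) G = (\<lambda>k l. act m c u G k l - act m c v G k l)"
  using act_simps(1)[of m c u "- v" G] by (simp add: act_uminus)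

lemma act_numeral: "act m c (numeral n) G = (\<lambda>k l. numeral n * G k l)"
  using act_simps(4)[of m c "numeral n" G] by (simp add: scal_numeral)

lemma act_f: "act m c uf G k l = G (Suc k) l"
  by (simp add: act_def actI_simps restr_def ext_def nat_add_distrib)

lemma act_f_pow: "act m c (uf ^ i) G k l = G (k + i) l"
  by (induction i arbitrary: k) (simp_all add: act_simps act_f)

lemma act_h: "act m c uh G k l = (2 * of_nat k - 2 * of_nat l - m) * G k l"
  by (simp add: act_def actI_simps restr_def ext_def)

lemma act_e: "act m c ue G k l =
    G k (Suc l) + of_nat k * (2 * of_nat l - of_nat k + 1 + m) * G (k - 1) l"
  by (cases k) (simp_all add: act_def actI_simps restr_def ext_def nat_add_distrib)

lemma act_e_pow_0: "act m c (ue ^ i) G 0 l = G 0 (l + i)"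
  by (induction i arbitrary: l) (simp_all add: act_simps act_e)

lemma act_gen: "act m c (gen x) G k l = opI m c x (ext G) (int k) (int l)"
  by (simp add: act_def actI_simps restr_def)

lemma act_v_0:
  "act m c (uv V4) G 0 l = 0" "act m c (uv V2) G 0 l = 0" "act m c (uv V0) G 0 l = c * G 0 l"
  "act m c (uv Vm2) G 0 l = c * (2 * of_nat l * G 0 (l - 1))"
proof -
  have 1: "ext G 0 (int l) = G 0 l" by (simp add: ext_def)
  have 2: "of_nat l * ext G 0 (int l - 1) = of_nat l * G 0 (l - 1)"
    by (cases l) (simp_all add: ext_def)
  show "act m c (uv Vm2) G 0 l = c * (2 * of_nat l * G 0 (l - 1))"
    using 2 by (simp add: act_gen)
  show "act m c (uv V4) G 0 l = 0" "act m c (uv V2) G 0 l = 0" "act m c (uv V0) G 0 l = c * G 0 l"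
    using 1 by (simp_all add: act_gen)
qed

lemma act_Vm4: "act m c (uv Vm4) G k l = c * (of_nat (l * (l - 1)) * G k (l - 2))"
proof -
  consider "l = 0" | "l = 1" | i where "l = i + 2" by (metis One_nat_def add_2_eq_Suc' not0_implies_Suc)
  then show ?thesis
  proof cases
    case (3 i)
    then have "ext G (int k) (int l - 2) = G k i" by (simp add: ext_def)
    moreover have "int l * (int l - 1) = int ((i + 2) * (i + 1))" using 3 by (simp add: algebra_simps)
    ultimately show ?thesis unfolding act_gen opI.simps by (simp add: 3)
  qed (simp_all add: act_gen)
qed

text \<open>The function s^j / j!. It does not depend on u, so \<open>f\<close> kills it; for
  natural m it is the lowest weight vector of a type \<open>L(m + 2 j)\<close>.\<close>

definition yv :: "nat \<Rightarrow> nat \<Rightarrow> nat \<Rightarrow> complex" where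
  "yv j k l = (if k = 0 \<and> l = j then 1 else 0)"

lemma act_f_yv: "act m c uf (yv j) = (\<lambda>k l. 0)"
  by (simp add: fun_eq_iff act_f yv_def)

lemma act_h_yv: "act m c uh (yv j) = (\<lambda>k l. (- m - 2 * of_nat j) * yv j k l)"
  by (simp add: fun_eq_iff act_h yv_def)

lemma act_Vm4_yv: "act m c (uv Vm4) (yv j) = (\<lambda>k l. c * of_nat ((j + 2) * (j + 1)) * yv (j + 2) k l)"
proof (intro HOL.ext)
  fix k l :: nat
  consider "l = j + 2" | "l - 2 \<noteq> j" "l \<noteq> j + 2" | "l * (l - 1) = 0" "l \<noteq> j + 2" by force
  then show "act m c (uv Vm4) (yv j) k l = c * of_nat ((j + 2) * (j + 1)) * yv (j + 2) k l"
  proof cases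
    case 1
    then show ?thesis by (simp add: act_Vm4 yv_def del: of_nat_mult of_nat_add of_nat_Suc)
  qed (simp_all only: act_Vm4 yv_def, simp_all)
qed


subsection \<open>The module generated by a lowest weight vector\<close>

text \<open>The coefficients of a function are the values of its translates at the base point (u, s)
  = (0, 0). Hence functions can be compared through the single functional that evaluates
  there.\<close>

lemma act_coord: "act m c (ue ^ l * uf ^ k) G 0 0 = G k l"
  by (simp add: act_simps act_e_pow_0 act_f_pow)

lemma act_f_e_pow_yv:
  "act m c uf (act m c (ue ^ Suc i) (yv j)) =
    (\<lambda>k l. of_nat (Suc i) * (m + 2 * of_nat j - of_nat i) * act m c (ue ^ i) (yv j) k l)"
proof -
  have "act m c uf (act m c (ue ^ Suc i) (yv j)) = act m c (uf * ue ^ Suc i) (yv j)"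
    by (simp only: act_simps)
  also have "\<dots> = (\<lambda>k l. - (of_nat (Suc i) * act m c (ue ^ i) (act m c (uh + scal (of_nat i)) (yv j)) k l))"
    unfolding comm_f_e_pow act_diff by (simp only: act_simps act_f_yv act_zero mult.assoc) simp
  also have "act m c (uh + scal (of_nat i)) (yv j) = (\<lambda>k l. (of_nat i - m - 2 * of_nat j) * yv j k l)"
    by (simp add: act_simps act_h_yv algebra_simps)
  finally show ?thesis by (simp only: act_linear(2)) (simp add: fun_eq_iff algebra_simps)
qed

lemma act_f_e_pow_yv':
  assumes "i > 0"
  shows "act m c uf (act m c (ue ^ i) (yv j)) =
    (\<lambda>k l. of_nat i * (m + 2 * of_nat j - of_nat i + 1) * act m c (ue ^ (i - 1)) (yv j) k l)"
  using act_f_e_pow_yv[of m c "i - 1" j] assms by (simp add: algebra_simps of_nat_diff)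

lemma act_fv:
  "act m c uf (act m c (uv V4) G) = (\<lambda>k l. act m c (uv V4) (act m c uf G) k l + act m c (uv V2) G k l)"
  "act m c uf (act m c (uv V2) G) = (\<lambda>k l. act m c (uv V2) (act m c uf G) k l + 2 * act m c (uv V0) G k l)"
  "act m c uf (act m c (uv V0) G) = (\<lambda>k l. act m c (uv V0) (act m c uf G) k l + 3 * act m c (uv Vm2) G k l)"
  "act m c uf (act m c (uv Vm2) G) = (\<lambda>k l. act m c (uv Vm2) (act m c uf G) k l + 4 * act m c (uv Vm4) G k l)"
  "act m c uf (act m c (uv Vm4) G) = act m c (uv Vm4) (act m c uf G)"
  by (simp_all only: act_simps(2)[symmetric] comm_fv, simp_all only: act_simps act_numeral)

text \<open>The lowest weight vectors of the components of highest weight \<open>n - 4\<close> and \<open>n - 2\<close> in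
  \<open>L(4) \<otimes> L(n)\<close>.\<close>

definition low4 :: "complex \<Rightarrow> l4 uea" where
  "low4 n = scal (n * (n - 1) * (n - 2) * (n - 3)) * uv V4
    - scal ((n - 1) * (n - 2) * (n - 3)) * (uv V2 * ue)
    + scal ((n - 2) * (n - 3)) * (uv V0 * ue ^ 2)
    - scal (n - 3) * (uv Vm2 * ue ^ 3) + uv Vm4 * ue ^ 4"

definition low2 :: "complex \<Rightarrow> l4 uea" where
  "low2 n = scal 4 * (uv Vm4 * ue ^ 3) - scal (3 * (n - 2)) * (uv Vm2 * ue ^ 2)
    + scal (2 * (n - 1) * (n - 2)) * (uv V0 * ue) - scal (n * (n - 1) * (n - 2)) * uv V2"

lemma act_low_row:
  assumes "act m c uf G = (\<lambda>k l. 0)"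
  shows "G (Suc k) l = 0"
  using fun_cong[OF fun_cong[OF assms], of k l] by (simp add: act_f)

text \<open>\<open>low4\<close> turns a lowest weight vector into a vector killed by
  \<open>f\<close>, that is, a function of s alone, so only the row k = 0 has to be computed. There
  \<open>e\<close> is a shift in l and the radical acts as at u = 0.\<close>

lemma act_low4:
  assumes "j \<ge> 2"
  shows "act m c (low4 (m + 2 * of_nat j)) (yv j) =
    (\<lambda>k l. c * (m + of_nat j) * (m + of_nat j - 1) * yv (j - 2) k l)"
proof -
  define n where "n = m + 2 * of_nat j"
  define x where "x i = act m c (ue ^ i) (yv j)" for i
  define G where "G = act m c (low4 n) (yv j)"
  have G: "G = (\<lambda>k l. n * (n - 1) * (n - 2) * (n - 3) * act m c (uv V4) (x 0) k l
    - (n - 1) * (n - 2) * (n - 3) * act m c (uv V2) (x 1) k l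
    + (n - 2) * (n - 3) * act m c (uv V0) (x 2) k l
    - (n - 3) * act m c (uv Vm2) (x 3) k l + act m c (uv Vm4) (x 4) k l)"
    unfolding G_def low4_def x_def by (simp add: act_simps act_diff)
  have f0: "act m c uf (x 0) = (\<lambda>k l. 0)" by (simp add: x_def act_simps act_f_yv)
  have f: "act m c uf (x 1) = (\<lambda>k l. n * x 0 k l)"
    "act m c uf (x 2) = (\<lambda>k l. 2 * (n - 1) * x 1 k l)"
    "act m c uf (x 3) = (\<lambda>k l. 3 * (n - 2) * x 2 k l)"
    "act m c uf (x 4) = (\<lambda>k l. 4 * (n - 3) * x 3 k l)"
    unfolding x_def n_def by (subst act_f_e_pow_yv'; simp)+
  have FG: "act m c uf G = (\<lambda>k l. n * (n - 1) * (n - 2) * (n - 3) * act m c uf (act m c (uv V4) (x 0)) k l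
    - (n - 1) * (n - 2) * (n - 3) * act m c uf (act m c (uv V2) (x 1)) k l
    + (n - 2) * (n - 3) * act m c uf (act m c (uv V0) (x 2)) k l
    - (n - 3) * act m c uf (act m c (uv Vm2) (x 3)) k l + act m c uf (act m c (uv Vm4) (x 4)) k l)"
    by (simp only: fun_eq_iff act_f) (simp add: G)
  \<comment> \<open>The coefficients of \<open>low4\<close> are such that the terms from moving
    \<open>f\<close> past the radical cancel those from moving it past the powers of
    \<open>e\<close>.\<close>
  have "act m c uf G = (\<lambda>k l. 0)"
    unfolding FG by (simp only: act_fv f f0 act_linear act_zero) (simp add: fun_eq_iff algebra_simps)
  then have row: "G (Suc k) l = 0" for k l by (rule act_low_row)
  have x0: "x i 0 l = (if l + i = j then 1 else 0)" for i l
    by (simp add: x_def act_e_pow_0 yv_def)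
  have G0: "G 0 l = c * (m + of_nat j) * (m + of_nat j - 1) * yv (j - 2) 0 l" for l
  proof (cases "l + 2 = j")
    case True
    then have j: "j = l + 2" "j - 2 = l" by simp_all
    consider "l = 0" | "l = 1" | i where "l = i + 2" by (metis One_nat_def add_2_eq_Suc' not0_implies_Suc)
    then show ?thesis unfolding G
      by cases (simp_all add: act_v_0 act_Vm4 x0 j n_def yv_def algebra_simps)
  next
    case False
    consider "l = 0" | "l = 1" | i where "l = i + 2" by (metis One_nat_def add_2_eq_Suc' not0_implies_Suc)
    then show ?thesis unfolding G
      by cases (use False assms in \<open>auto simp: act_v_0 act_Vm4 x0 yv_def\<close>)
  qed
  show ?thesis
  proof (intro HOL.ext)
    fix k l
    show "act m c (low4 (m + 2 * of_nat j)) (yv j) k l =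
        c * (m + of_nat j) * (m + of_nat j - 1) * yv (j - 2) k l"
      using G0[of l] row[of "k - 1" l] by (cases k) (simp_all add: G_def n_def yv_def)
  qed
qed

text \<open>As for \<open>low4\<close>. The factor m in the result is why m = 0 is special: there
  this step lowers nothing, and only the steps of two by \<open>low4\<close> remain.\<close>

lemma act_low2:
  assumes "j \<ge> 1"
  shows "act m c (low2 (m + 2 * of_nat j)) (yv j) =
    (\<lambda>k l. 2 * c * m * (m + of_nat j) * yv (j - 1) k l)"
proof -
  define n where "n = m + 2 * of_nat j"
  define x where "x i = act m c (ue ^ i) (yv j)" for i
  define G where "G = act m c (low2 n) (yv j)"
  have G: "G = (\<lambda>k l. 4 * act m c (uv Vm4) (x 3) k l - 3 * (n - 2) * act m c (uv Vm2) (x 2) k l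
    + 2 * (n - 1) * (n - 2) * act m c (uv V0) (x 1) k l
    - n * (n - 1) * (n - 2) * act m c (uv V2) (x 0) k l)"
    unfolding G_def low2_def x_def by (simp add: act_simps act_diff)
  have f0: "act m c uf (x 0) = (\<lambda>k l. 0)" by (simp add: x_def act_simps act_f_yv)
  have f: "act m c uf (x 1) = (\<lambda>k l. n * x 0 k l)"
    "act m c uf (x 2) = (\<lambda>k l. 2 * (n - 1) * x 1 k l)"
    "act m c uf (x 3) = (\<lambda>k l. 3 * (n - 2) * x 2 k l)"
    unfolding x_def n_def by (subst act_f_e_pow_yv'; simp)+
  have FG: "act m c uf G = (\<lambda>k l. 4 * act m c uf (act m c (uv Vm4) (x 3)) k l
    - 3 * (n - 2) * act m c uf (act m c (uv Vm2) (x 2)) k l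
    + 2 * (n - 1) * (n - 2) * act m c uf (act m c (uv V0) (x 1)) k l
    - n * (n - 1) * (n - 2) * act m c uf (act m c (uv V2) (x 0)) k l)"
    by (simp only: fun_eq_iff act_f) (simp add: G)
  have "act m c uf G = (\<lambda>k l. 0)"
    unfolding FG by (simp only: act_fv f f0 act_linear act_zero) (simp add: fun_eq_iff algebra_simps)
  then have row: "G (Suc k) l = 0" for k l by (rule act_low_row)
  have x0: "x i 0 l = (if l + i = j then 1 else 0)" for i l
    by (simp add: x_def act_e_pow_0 yv_def)
  have G0: "G 0 l = 2 * c * m * (m + of_nat j) * yv (j - 1) 0 l" for l
  proof (cases "l + 1 = j")
    case True
    then have j: "j = l + 1" "j - 1 = l" by simp_all
    consider "l = 0" | "l = 1" | i where "l = i + 2" by (metis One_nat_def add_2_eq_Suc' not0_implies_Suc)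
    then show ?thesis unfolding G
      by cases (simp_all add: act_v_0 act_Vm4 x0 j n_def yv_def algebra_simps)
  next
    case False
    consider "l = 0" | "l = 1" | i where "l = i + 2" by (metis One_nat_def add_2_eq_Suc' not0_implies_Suc)
    then show ?thesis unfolding G
      by cases (use False assms in \<open>auto simp: act_v_0 act_Vm4 x0 yv_def\<close>)
  qed
  show ?thesis
  proof (intro HOL.ext)
    fix k l
    show "act m c (low2 (m + 2 * of_nat j)) (yv j) k l = 2 * c * m * (m + of_nat j) * yv (j - 1) k l"
      using G0[of l] row[of "k - 1" l] by (cases k) (simp_all add: G_def n_def yv_def)
  qed
qed

lemma act_div:
  assumes "act m c u G = (\<lambda>k l. a * H k l)" "a \<noteq> 0"
  shows "act m c (scal (1 / a) * u) G = H"
  using assms by (simp add: act_simps)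

lemma reach_0:
  assumes "m > 0" "c \<noteq> 0"
  shows "\<exists>u. act (of_nat m) c u (yv j) = yv 0"
proof (induction j)
  case 0
  show ?case by (intro exI[of _ 1]) (simp add: act_simps)
next
  case (Suc j)
  obtain u where u: "act (of_nat m) c u (yv j) = yv 0" using Suc by blast
  have "of_nat m + of_nat (Suc j) \<noteq> (0 :: complex)"
    by (metis add_is_0 nat.distinct(1) of_nat_add of_nat_eq_0_iff)
  then have "2 * c * of_nat m * (of_nat m + of_nat (Suc j)) \<noteq> 0" using assms by simp
  from act_div[OF act_low2 this] obtain u' where "act (of_nat m) c u' (yv (Suc j)) = yv j" by auto
  then have "act (of_nat m) c (u * u') (yv (Suc j)) = yv 0" using u by (simp add: act_simps)
  then show ?case by blast
qed

lemma reach_parity: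
  assumes "c \<noteq> 0"
  shows "\<exists>u. act 0 c u (yv j) = yv (j mod 2)"
proof (induction j rule: less_induct)
  case (less j)
  show ?case
  proof (cases "j \<ge> 2")
    case True
    have "of_nat j \<noteq> (0 :: complex)" "of_nat j - 1 \<noteq> (0 :: complex)"
      using True of_nat_eq_iff[of j 1, where 'a = complex] by auto
    then have "c * (0 + of_nat j) * (0 + of_nat j - 1) \<noteq> 0" using assms by simp
    from act_div[OF act_low4[OF True, of 0 c] this] obtain u' where
      "act 0 c u' (yv j) = yv (j - 2)" by auto
    moreover obtain u where "act 0 c u (yv (j - 2)) = yv ((j - 2) mod 2)"
      using less[of "j - 2"] True by auto
    moreover have "(j - 2) mod 2 = j mod 2" by (metis True le_add_diff_inverse2 mod_add_self2)
    ultimately have "act 0 c (u * u') (yv j) = yv (j mod 2)" by (simp only: act_simps(2))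
    then show ?thesis by blast
  next
    case False
    then have "j mod 2 = j" by auto
    then have "act 0 c 1 (yv j) = yv (j mod 2)" by (simp only: act_simps)
    then show ?thesis by blast
  qed
qed

text \<open>The left ideal that presents the module generated by s^j / j!; unlike the module, it can
  be compared with modules on any carrier type.\<close>

definition annB :: "complex \<Rightarrow> complex \<Rightarrow> nat \<Rightarrow> l4 uea set" where
  "annB m c j = {u. act m c u (yv j) = (\<lambda>k l. 0)}"

lemma annB_left_ideal: "left_ideal (annB m c j)"
  by (auto simp: left_ideal_def annB_def act_simps)

lemma annB_f: "uf \<in> annB m c j"
  by (simp add: annB_def act_f_yv)

lemma annB_h: "uh + scal (m + 2 * of_nat j) \<in> annB m c j"
  by (simp add: annB_def act_simps act_h_yv fun_eq_iff algebra_simps)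

lemma yv_nonzero: "yv j \<noteq> (\<lambda>k l. 0)"
  by (auto simp: yv_def fun_eq_iff)

lemma annB_1: "1 \<notin> annB m c j"
  using yv_nonzero by (simp add: annB_def act_simps)

lemma act_pev_h: "act m c (pev p uh) G k l = poly p (2 * of_nat k - 2 * of_nat l - m) * G k l"
  by (induction p arbitrary: G k l) (simp_all add: act_simps act_h algebra_simps)

text \<open>Each generator enlarges the support in l by at most two. So the functions generated by
  s^j are polynomial in s, and \<open>reach_yv\<close> has only finitely many weights to
  separate.\<close>

lemma finite_l_support: "\<exists>L. \<forall>k l. l \<ge> L \<longrightarrow> act m c u (yv j) k l = 0"
proof -
  have step: "\<exists>L. \<forall>k l. l \<ge> L \<longrightarrow> act m c (gen x) G k l = 0"
    if L: "\<forall>k l. l \<ge> L \<longrightarrow> G k l = 0" for x G L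
  proof (intro exI[of _ "L + 2"] allI impI)
    fix k l :: nat assume l: "l \<ge> L + 2"
    have 0: "ext G k' l' = 0" if "l' \<ge> int l - 2" for k' l'
      using L l that by (auto simp: ext_def)
    show "act m c (gen x) G k l = 0" unfolding act_gen
    proof (rule l4_sl2_cases[of _ x])
      fix v show "opI m c (Lr v) (ext G) (int k) (int l) = 0"
        by (cases v) (simp_all add: 0)
    qed (simp_all add: 0)
  qed
  have main: "(\<exists>L. \<forall>k l. l \<ge> L \<longrightarrow> G k l = 0) \<Longrightarrow> \<exists>L. \<forall>k l. l \<ge> L \<longrightarrow> act m c u G k l = 0" for G
  proof (induction u arbitrary: G rule: uea_induct)
    case (scal a)
    then show ?case by (auto simp: act_simps)
  next
    case (gen x)
    then show ?case using step by blast
  next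
    case (add u v)
    obtain L where L: "\<forall>k l. l \<ge> L \<longrightarrow> act m c u G k l = 0" using add.IH(1)[OF add.prems] by blast
    obtain L' where L': "\<forall>k l. l \<ge> L' \<longrightarrow> act m c v G k l = 0" using add.IH(2)[OF add.prems] by blast
    show ?case by (rule exI[of _ "max L L'"]) (use L L' in \<open>simp add: act_simps\<close>)
  next
    case (mult u v)
    then show ?case by (simp add: act_simps)
  qed
  have "\<exists>L. \<forall>k l. l \<ge> L \<longrightarrow> yv j k l = 0" by (rule exI[of _ "Suc j"]) (auto simp: yv_def)
  then show ?thesis by (rule main)
qed

text \<open>Differentiate with respect to u as often as possible without getting zero: the result
  depends on s only. The powers of s have different weights, so a polynomial in \<open>h\<close>
  isolates one of them.\<close>

lemma reach_yv:
  assumes "act m c u (yv j) \<noteq> (\<lambda>k l. 0)"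
  shows "\<exists>u' l. act m c (u' * u) (yv j) = yv l"
proof -
  define G where "G = act m c u (yv j)"
  obtain M where "uf ^ M * u \<in> annB m c j"
    using nilpotent_all[OF annB_left_ideal, of uf 1 m c j u] annB_f by auto
  then have M: "G (k + M) l = 0" for k l
    by (auto simp: annB_def act_simps G_def fun_eq_iff simp flip: act_f_pow[of m c])
  have "\<exists>K. (\<exists>l. G K l \<noteq> 0) \<and> (\<forall>k>K. \<forall>l. G k l = 0)"
  proof -
    have ex: "\<exists>k l. G k l \<noteq> 0" using assms by (auto simp: G_def fun_eq_iff)
    have bd: "\<forall>k. (\<exists>l. G k l \<noteq> 0) \<longrightarrow> k \<le> M" using M by (metis le_add_diff_inverse2 nat_le_linear)
    define K where "K = (GREATEST k. \<exists>l. G k l \<noteq> 0)"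
    have "\<exists>l. G K l \<noteq> 0" unfolding K_def by (rule GreatestI_ex_nat[OF ex]) (use bd in blast)
    moreover have "k \<le> K" if "G k l \<noteq> 0" for k l
      unfolding K_def by (rule Greatest_le_nat[where b = M]) (use that bd in auto)
    then have "\<forall>k>K. \<forall>l. G k l = 0" using leD by blast
    ultimately show ?thesis by blast
  qed
  then obtain K l0 where K: "G K l0 \<noteq> 0" "\<And>k l. k > K \<Longrightarrow> G k l = 0" by blast
  obtain L where L: "\<And>k l. l \<ge> L \<Longrightarrow> G k l = 0"
    using finite_l_support[of m c u j] unfolding G_def by blast
  \<comment> \<open>The roots are the weights of the powers of s below L other than l0.\<close>
  define p where "p = (\<Prod>l\<in>{..<L} - {l0}. [:m + 2 * of_nat l, 1:])"
  have p0: "poly p (- 2 * of_nat l - m) = 0" if "l < L" "l \<noteq> l0" for l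
    unfolding p_def poly_prod by (rule prod_zero) (use that in \<open>auto intro!: bexI[of _ l]\<close>)
  have p1: "poly p (- 2 * of_nat l0 - m) \<noteq> 0"
    unfolding p_def poly_prod by (auto simp: algebra_simps)
  have row: "act m c (pev p uh * uf ^ K) G k l = (poly p (- 2 * of_nat l0 - m) * G K l0) * yv l0 k l" for k l
  proof (cases "k = 0")
    case True
    then show ?thesis using p0[of l] L[of l K] K(1)
      by (cases "l < L") (auto simp: act_simps act_pev_h act_f_pow yv_def)
  next
    case False
    then show ?thesis using K(2)[of "k + K" l] by (simp add: act_simps act_pev_h act_f_pow yv_def)
  qed
  have "act m c (scal (1 / (poly p (- 2 * of_nat l0 - m) * G K l0)) * (pev p uh * uf ^ K)) G = yv l0"
    by (rule act_div) (use row p1 K(1) in auto)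
  then have "act m c ((scal (1 / (poly p (- 2 * of_nat l0 - m) * G K l0)) * (pev p uh * uf ^ K)) * u) (yv j) = yv l0"
    by (simp only: act_simps(2) G_def)
  then show ?thesis by blast
qed

definition maximal_left_ideal :: "'r::ring_1 set \<Rightarrow> bool" where
  "maximal_left_ideal J \<longleftrightarrow> left_ideal J \<and> 1 \<notin> J \<and> (\<forall>J'. left_ideal J' \<longrightarrow> J \<subseteq> J' \<longrightarrow> J' = J \<or> 1 \<in> J')"

text \<open>By \<open>reach_yv\<close> every nonzero submodule contains some s^l / l!, from which
  the assumption leads back to the generator.\<close>

lemma annB_maximalI:
  assumes "\<And>u l. act m c u (yv j) = yv l \<Longrightarrow> \<exists>u. act m c u (yv l) = yv j"
  shows "maximal_left_ideal (annB m c j)"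
  unfolding maximal_left_ideal_def
proof (intro conjI allI impI annB_left_ideal annB_1)
  fix J' assume J': "left_ideal J'" "annB m c j \<subseteq> J'"
  show "J' = annB m c j \<or> 1 \<in> J'"
  proof (rule disjCI)
    assume "1 \<notin> J'"
    have "u \<in> annB m c j" if "u \<in> J'" for u
    proof (rule ccontr)
      assume "u \<notin> annB m c j"
      then obtain u' l where u': "act m c (u' * u) (yv j) = yv l"
        using reach_yv[of m c u j] by (auto simp: annB_def)
      then obtain u'' where "act m c u'' (yv l) = yv j" using assms by blast
      then have "act m c (u'' * (u' * u)) (yv j) = yv j" by (simp only: act_simps(2)[of m c u''] u')
      then have "u'' * (u' * u) - 1 \<in> annB m c j" by (simp add: annB_def act_diff act_simps)
      then have 1: "u'' * (u' * u) - 1 \<in> J'" using J'(2) by (rule rev_subsetD)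
      have "u'' * (u' * u) \<in> J'" by (intro left_idealD(3) J'(1) that)
      from left_idealD(5)[OF J'(1) this 1] have "1 \<in> J'" by simp
      then show False using \<open>1 \<notin> J'\<close> by simp
    qed
    then show "J' = annB m c j" using J' by blast
  qed
qed

lemma annB_maximal_pos: "m > 0 \<Longrightarrow> c \<noteq> 0 \<Longrightarrow> maximal_left_ideal (annB (of_nat m) c 0)"
  by (rule annB_maximalI) (rule reach_0)

subsection \<open>The central elements\<close>

lemma numeral_gen: "gen x * (numeral n * y) = numeral n * (gen x * y)"
  by (rule numeral_central_left)

lemma comm_add: "x * y = y * x + d \<Longrightarrow> x * y' = y' * x + d' \<Longrightarrow> x * (y + y') = (y + y') * x + (d + d' :: 'r::ring_1)"
  by (simp add: distrib_left distrib_right)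

lemma comm_diff: "x * y = y * x + d \<Longrightarrow> x * y' = y' * x + d' \<Longrightarrow> x * (y - y') = (y - y') * x + (d - d' :: 'r::ring_1)"
  by (simp add: algebra_simps)

lemma comm_scal: "x * y = y * x + d \<Longrightarrow> x * (scal a * y) = (scal a * y) * x + scal a * d"
  by (simp add: scal_left_commute distrib_left mult.assoc)

lemmas comm_v_norm = comm_v_all distrib_left distrib_right mult.assoc comm_vv comm_vv_left
  numeral_gen power2_eq_square power3_eq_cube

lemma C2_alt: "C2 = uv V0 ^ 2 - scal 3 * (uv Vm2 * uv V2) + scal 12 * (uv Vm4 * uv V4)"
  by (simp add: C2_def scal_numeral mult.assoc)

lemma C3_alt: "C3 = uv V0 ^ 3 - scal (9/2) * (uv Vm2 * uv V0 * uv V2)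
    + scal (27/2) * (uv Vm2 ^ 2 * uv V4) + scal (27/2) * (uv Vm4 * uv V2 ^ 2)
    - scal 36 * (uv Vm4 * uv V0 * uv V4)"
  by (simp add: C3_def scal_numeral mult.assoc)

text \<open>The commutators are kept as sums of a few monomials, so that invariance of
  \<open>C2\<close> becomes the linear identity \<open>scal_quad_cancel\<close>; in degree three
  \<open>scal_cubic_cancel\<close> has the same purpose.\<close>

lemma comm_e_quad:
  "ue * uv V0 ^ 2 = uv V0 ^ 2 * ue + (3 * (uv V2 * uv V0) + 3 * (uv V2 * uv V0))"
  "ue * (uv Vm2 * uv V2) = (uv Vm2 * uv V2) * ue + (2 * (uv V2 * uv V0) + 4 * (uv Vm2 * uv V4))"
  "ue * (uv Vm4 * uv V4) = (uv Vm4 * uv V4) * ue + uv Vm2 * uv V4"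
  by (simp_all add: comm_v_norm)

lemma comm_f_quad:
  "uf * uv V0 ^ 2 = uv V0 ^ 2 * uf + (3 * (uv Vm2 * uv V0) + 3 * (uv Vm2 * uv V0))"
  "uf * (uv Vm2 * uv V2) = (uv Vm2 * uv V2) * uf + (2 * (uv Vm2 * uv V0) + 4 * (uv Vm4 * uv V2))"
  "uf * (uv Vm4 * uv V4) = (uv Vm4 * uv V4) * uf + uv Vm4 * uv V2"
  by (simp_all add: comm_v_norm)

lemma comm_e_cubic:
  "ue * uv V0 ^ 3 = uv V0 ^ 3 * ue + (3 * (uv V2 * (uv V0 * uv V0)) + 3 * (uv V2 * (uv V0 * uv V0))
     + 3 * (uv V2 * (uv V0 * uv V0)))"
  "ue * (uv Vm2 * uv V0 * uv V2) = (uv Vm2 * uv V0 * uv V2) * ue + (2 * (uv V2 * (uv V0 * uv V0))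
     + 3 * (uv Vm2 * (uv V2 * uv V2)) + 4 * (uv Vm2 * (uv V0 * uv V4)))"
  "ue * (uv Vm2 ^ 2 * uv V4) = (uv Vm2 ^ 2 * uv V4) * ue + (2 * (uv Vm2 * (uv V0 * uv V4))
     + 2 * (uv Vm2 * (uv V0 * uv V4)))"
  "ue * (uv Vm4 * uv V2 ^ 2) = (uv Vm4 * uv V2 ^ 2) * ue + (uv Vm2 * (uv V2 * uv V2)
     + 4 * (uv Vm4 * (uv V2 * uv V4)) + 4 * (uv Vm4 * (uv V2 * uv V4)))"
  "ue * (uv Vm4 * uv V0 * uv V4) = (uv Vm4 * uv V0 * uv V4) * ue + (uv Vm2 * (uv V0 * uv V4)
     + 3 * (uv Vm4 * (uv V2 * uv V4)))"
  by (simp_all add: comm_v_norm add_ac)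

lemma comm_f_cubic:
  "uf * uv V0 ^ 3 = uv V0 ^ 3 * uf + (3 * (uv Vm2 * (uv V0 * uv V0)) + 3 * (uv Vm2 * (uv V0 * uv V0))
     + 3 * (uv Vm2 * (uv V0 * uv V0)))"
  "uf * (uv Vm2 * uv V0 * uv V2) = (uv Vm2 * uv V0 * uv V2) * uf + (2 * (uv Vm2 * (uv V0 * uv V0))
     + 3 * (uv V2 * (uv Vm2 * uv Vm2)) + 4 * (uv Vm4 * (uv V0 * uv V2)))"
  "uf * (uv Vm2 ^ 2 * uv V4) = (uv Vm2 ^ 2 * uv V4) * uf + (uv V2 * (uv Vm2 * uv Vm2)
     + 4 * (uv Vm4 * (uv Vm2 * uv V4)) + 4 * (uv Vm4 * (uv Vm2 * uv V4)))"
  "uf * (uv Vm4 * uv V2 ^ 2) = (uv Vm4 * uv V2 ^ 2) * uf + (2 * (uv Vm4 * (uv V0 * uv V2))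
     + 2 * (uv Vm4 * (uv V0 * uv V2)))"
  "uf * (uv Vm4 * uv V0 * uv V4) = (uv Vm4 * uv V0 * uv V4) * uf + (uv Vm4 * (uv V0 * uv V2)
     + 3 * (uv Vm4 * (uv Vm2 * uv V4)))"
  by (simp_all add: comm_v_norm add_ac)

lemma scal_quad_cancel:
  "(3 * A + 3 * A) - scal 3 * (2 * A + 4 * B) + scal 12 * B = (0 :: l4 uea)"
proof -
  have "(3 * A + 3 * A) - scal 3 * (2 * A + 4 * B) + scal 12 * B
    = scal (3 + 3 - 3 * 2) * A + scal (12 - 3 * 4) * B"
    unfolding scal_numeral[symmetric] scal_diff scal.scalar_add scal.scalar_mult
    by (simp only: distrib_left distrib_right left_diff_distrib mult.assoc) (simp only: algebra_simps)
  then show ?thesis by (simp add: scal.scalar_zero)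
qed

lemma scal_cubic_cancel:
  "(3 * A + 3 * A + 3 * A) - scal (9/2) * (2 * A + 3 * B + 4 * C) + scal (27/2) * (2 * C + 2 * C)
    + scal (27/2) * (B + 4 * D + 4 * D) - scal 36 * (C + 3 * D) = (0 :: l4 uea)"
proof -
  have "(3 * A + 3 * A + 3 * A) - scal (9/2) * (2 * A + 3 * B + 4 * C) + scal (27/2) * (2 * C + 2 * C)
    + scal (27/2) * (B + 4 * D + 4 * D) - scal 36 * (C + 3 * D)
    = scal (3 + 3 + 3 - 9/2 * 2) * A + scal (27/2 - 9/2 * 3) * B
     + scal (27/2 * 2 + 27/2 * 2 - 9/2 * 4 - 36) * C + scal (27/2 * 4 + 27/2 * 4 - 36 * 3) * D"
    unfolding scal_numeral[symmetric] scal_diff scal.scalar_add scal.scalar_mult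
    by (simp only: distrib_left distrib_right left_diff_distrib mult.assoc) (simp only: algebra_simps)
  then show ?thesis by (simp add: scal.scalar_zero)
qed

lemma weight_mult:
  assumes "uh * x = x * uh + scal a * x" "uh * y = y * uh + scal b * y"
  shows "uh * (x * y) = (x * y) * uh + scal (a + b) * (x * y)"
  using comm_left[OF assms(1), of y] assms(2)
  by (simp add: distrib_left distrib_right mult.assoc scal.scalar_add scal_left_commute[of x])

lemma C2_gen: "gen x * C2 = C2 * gen x"
proof (rule l4_sl2_cases[of _ x])
  show "ue * C2 = C2 * ue"
    unfolding C2_alt
    using comm_add[OF comm_diff[OF comm_e_quad(1) comm_scal[OF comm_e_quad(2), of 3]]
      comm_scal[OF comm_e_quad(3), of 12]] scal_quad_cancel by simp
  show "uf * C2 = C2 * uf"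
    unfolding C2_alt
    using comm_add[OF comm_diff[OF comm_f_quad(1) comm_scal[OF comm_f_quad(2), of 3]]
      comm_scal[OF comm_f_quad(3), of 12]] scal_quad_cancel by simp
  show "uh * C2 = C2 * uh"
    by (simp add: C2_def comm_v_norm right_diff_distrib left_diff_distrib)
  show "uv v * C2 = C2 * uv v" for v
    by (simp add: C2_def comm_v_norm right_diff_distrib left_diff_distrib)
qed

lemma C3_gen: "gen x * C3 = C3 * gen x"
proof (rule l4_sl2_cases[of _ x])
  show "ue * C3 = C3 * ue"
    unfolding C3_alt
    using comm_diff[OF comm_add[OF comm_add[OF comm_diff[OF comm_e_cubic(1)
      comm_scal[OF comm_e_cubic(2), of "9/2"]] comm_scal[OF comm_e_cubic(3), of "27/2"]]
      comm_scal[OF comm_e_cubic(4), of "27/2"]] comm_scal[OF comm_e_cubic(5), of 36]]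
      scal_cubic_cancel[of "uv V2 * (uv V0 * uv V0)"] by simp
  have *: "(3 * A + 3 * A + 3 * A) - scal (9/2) * (2 * A + 3 * B + 4 * C) + scal (27/2) * (B + 4 * D + 4 * D)
    + scal (27/2) * (2 * C + 2 * C) - scal 36 * (C + 3 * D) = (0 :: l4 uea)" for A B C D
    using scal_cubic_cancel[of A B C D] by (simp add: algebra_simps)
  show "uf * C3 = C3 * uf"
    unfolding C3_alt
    using comm_diff[OF comm_add[OF comm_add[OF comm_diff[OF comm_f_cubic(1)
      comm_scal[OF comm_f_cubic(2), of "9/2"]] comm_scal[OF comm_f_cubic(3), of "27/2"]]
      comm_scal[OF comm_f_cubic(4), of "27/2"]] comm_scal[OF comm_f_cubic(5), of 36]]
      *[of "uv Vm2 * (uv V0 * uv V0)"] by simp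
  note w = weight_mult comm_hv'
  have "uh * uv V0 ^ 3 = uv V0 ^ 3 * uh + 0"
    using w(1)[OF w(1)[OF w(2)[of V0] w(2)[of V0]] w(2)[of V0]]
    by (simp add: scal.scalar_zero power3_eq_cube)
  moreover have "uh * (uv Vm2 * uv V0 * uv V2) = (uv Vm2 * uv V0 * uv V2) * uh + 0"
    using w(1)[OF w(1)[OF w(2)[of Vm2] w(2)[of V0]] w(2)[of V2]] by (simp add: scal.scalar_zero)
  moreover have "uh * (uv Vm2 ^ 2 * uv V4) = (uv Vm2 ^ 2 * uv V4) * uh + 0"
    using w(1)[OF w(1)[OF w(2)[of Vm2] w(2)[of Vm2]] w(2)[of V4]]
    by (simp add: scal.scalar_zero power2_eq_square)
  moreover have "uh * (uv Vm4 * uv V2 ^ 2) = (uv Vm4 * uv V2 ^ 2) * uh + 0"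
    using w(1)[OF w(2)[of Vm4] w(1)[OF w(2)[of V2] w(2)[of V2]]]
    by (simp add: scal.scalar_zero power2_eq_square)
  moreover have "uh * (uv Vm4 * uv V0 * uv V4) = (uv Vm4 * uv V0 * uv V4) * uh + 0"
    using w(1)[OF w(1)[OF w(2)[of Vm4] w(2)[of V0]] w(2)[of V4]] by (simp add: scal.scalar_zero)
  ultimately show "uh * C3 = C3 * uh"
    unfolding C3_alt by (simp add: distrib_left distrib_right right_diff_distrib left_diff_distrib
      scal_left_commute[of uh] mult.assoc)
  show "uv v * C3 = C3 * uv v" for v
    by (simp add: C3_def comm_v_norm right_diff_distrib left_diff_distrib scal_commutes)
qed

lemma central_gen: "(\<And>x. gen x * c = c * gen x) \<Longrightarrow> u * c = c * u"
proof (induction u rule: uea_induct)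
  case (scal a)
  show ?case by (rule scal.scalar_central)
next
  case (add u v)
  then show ?case by (simp add: distrib_left distrib_right)
next
  case (mult u v)
  then show ?case by (simp add: mult.assoc) (simp flip: mult.assoc)
qed simp

lemma C2_central: "u * C2 = C2 * u" by (rule central_gen) (rule C2_gen)

lemma C3_central: "u * C3 = C3 * u" by (rule central_gen) (rule C3_gen)

subsection \<open>Functionals on the enveloping algebra\<close>

definition lfun :: "(l4 uea \<Rightarrow> complex) \<Rightarrow> bool" where
  "lfun t \<longleftrightarrow> (\<forall>u v. t (u + v) = t u + t v) \<and> (\<forall>a u. t (scal a * u) = a * t u)"

lemma lfunD:
  assumes "lfun t"
  shows "t (u + v) = t u + t v" "t (scal a * u) = a * t u" "t 0 = 0" "t (- u) = - t u"
    "t (u - v) = t u - t v" "t (numeral n * u) = numeral n * t u"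
proof -
  show 1: "t (u + v) = t u + t v" "t (scal a * u) = a * t u" for u v a
    using assms by (auto simp: lfun_def)
  show "t 0 = 0" using 1(2)[of 0 0] by simp
  show 2: "t (- u) = - t u" for u using 1(2)[of "-1" u] by (simp add: scal_uminus scal.scalar_one)
  show "t (u - v) = t u - t v" using 1(1)[of u "- v"] 2 by simp
  show "t (numeral n * u) = numeral n * t u" using 1(2)[of "numeral n" u] by (simp only: scal_numeral)
qed

lemma lfun_ker: "lfun t \<Longrightarrow> usubspace {u. t u = 0}"
  by (auto simp: usubspace_def lfunD)

text \<open>For nonzero z this quartic has double roots at zero and infinity, and its stabiliser in
  \<open>sl2\<close> is spanned by \<open>h\<close>.\<close>

definition point :: "complex \<Rightarrow> rad \<Rightarrow> complex" where
  "point z v = (if v = V0 then z else 0)"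

text \<open>A functional satisfying the eigenvalue equations for \<open>h\<close> and the radical is determined by its
  values on the monomials \<open>e\<^sup>l f\<^sup>k\<close>, because these generate the enveloping algebra as a left module over
  the subalgebra generated by \<open>h\<close> and the radical.\<close>

lemma lfun_unique:
  assumes t: "lfun t" and v: "\<And>v u. t (uv v * u) = p v * t u" and h: "\<And>u. t (uh * u) = a * t u"
    and ef: "\<And>k l. t (ue ^ l * uf ^ k) = 0"
  shows "t u = 0"
proof -
  \<comment> \<open>\<open>X\<close> is the smallest subspace that contains the monomials and is
    stable under \<open>h\<close> and the radical. Once it is seen to be stable under
    \<open>e\<close> and \<open>f\<close> as well, it is a left ideal containing 1.\<close>
  define \<X> where "\<X> = {X. usubspace X \<and> (\<forall>x\<in>X. uh * x \<in> X) \<and> (\<forall>v. \<forall>x\<in>X. uv v * x \<in> X) \<and>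
    (\<forall>k l. ue ^ l * uf ^ k \<in> X)}"
  define X where "X = \<Inter>\<X>"
  have X: "usubspace X" "\<And>x. x \<in> X \<Longrightarrow> uh * x \<in> X" "\<And>v x. x \<in> X \<Longrightarrow> uv v * x \<in> X"
    "\<And>k l. ue ^ l * uf ^ k \<in> X"
    by (auto simp: X_def \<X>_def usubspace_def)
  have XI: "Y \<in> \<X> \<Longrightarrow> X \<subseteq> Y" for Y by (auto simp: X_def)
  have hX: "uh * x + scal b * x \<in> X" if "x \<in> X" for x b using that X by (simp add: usubspaceD)
  have pw: "gen g * x \<in> X" if g: "g = Lg sl2_e \<or> g = Lg sl2_f" and x: "x \<in> X" for g x
  proof -
    have "X \<subseteq> {x\<in>X. gen g * x \<in> X}"
    proof (rule XI, unfold \<X>_def, rule CollectI, intro conjI allI ballI)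
      show "usubspace {x \<in> X. gen g * x \<in> X}"
        using X(1) by (auto simp: usubspace_def distrib_left scal_commutes)
      fix x assume x: "x \<in> {x \<in> X. gen g * x \<in> X}"
      have "gen g * (uh * x) = uh * (gen g * x) - scal (of_int (l4wt g)) * (gen g * x)"
        by (simp add: comm_left[OF comm_h_gen] mult.assoc)
      then show "uh * x \<in> {x \<in> X. gen g * x \<in> X}" using x X by (simp add: usubspaceD)
    next
      fix v x assume x: "x \<in> {x \<in> X. gen g * x \<in> X}"
      obtain g' where "g = Lg g'" using g by auto
      then have "gen g * (uv v * x) = uv v * (gen g * x) + (\<Sum>w\<in>UNIV. scal (rad_act g' v w) * (uv w * x))"
        by (simp add: comm_left[OF comm_gv] sum_distrib_right mult.assoc)
      moreover have "(\<Sum>w\<in>UNIV. scal (rad_act g' v w) * (uv w * x)) \<in> X"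
        using x X by (intro usubspace_sum) (auto simp: usubspaceD)
      ultimately show "uv v * x \<in> {x \<in> X. gen g * x \<in> X}" using x X by (simp add: usubspaceD)
    next
      fix k l
      show "ue ^ l * uf ^ k \<in> {x \<in> X. gen g * x \<in> X}"
      proof (cases "g = Lg sl2_e")
        case True
        then show ?thesis using X(4)[of "Suc l" k] X(4)[of l k] by (simp add: mult.assoc)
      next
        case False
        then have g: "g = Lg sl2_f" using g by simp
        show ?thesis
        proof (cases l)
          case 0
          then show ?thesis using X(4)[of 0 "Suc k"] X(4)[of 0 k] g by simp
        next
          case (Suc i)
          have "uf * ue ^ Suc i = ue ^ Suc i * uf - scal (of_nat (Suc i)) * (ue ^ i * (uh + scal (of_nat i)))"
            by (simp only: comm_f_e_pow mult.assoc)
          also have "ue ^ i * (uh + scal (of_nat i)) = uh * ue ^ i + scal (of_nat i - 2 * of_nat i) * ue ^ i"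
            by (simp only: comm_h_e_pow scal_diff)
               (simp add: algebra_simps scal_commutes)
          finally have "uf * (ue ^ l * uf ^ k) = ue ^ l * uf ^ Suc k
             - scal (of_nat (Suc i)) * (uh * (ue ^ i * uf ^ k) + scal (of_nat i - 2 * of_nat i) * (ue ^ i * uf ^ k))"
            unfolding Suc by (simp only: mult.assoc[symmetric] power_Suc2[symmetric])
               (simp add: left_diff_distrib distrib_right mult.assoc flip: power_Suc2)
          moreover have "\<dots> \<in> X" using X hX[of "ue ^ i * uf ^ k"] by (simp add: usubspaceD del: power_Suc)
          ultimately show ?thesis using X(4) g by simp
        qed
      qed
    qed
    then show ?thesis using x by blast
  qed
  have "left_ideal X"
    by (rule usubspace_left_idealI[OF X(1)], rule_tac x = x in l4_sl2_cases) (use X pw in auto)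
  then have "X = UNIV" by (rule left_ideal_1) (use X(4)[of 0 0] in simp)
  moreover have "X \<subseteq> {u. t u = 0}"
    by (rule XI) (use v h ef t in \<open>auto simp: \<X>_def lfun_ker\<close>)
  ultimately show ?thesis by blast
qed

subsection \<open>Exponentials acting on functionals\<close>

text \<open>\<open>pl g t u\<close> is the polynomial \<open>\<tau> \<mapsto> t (exp (\<tau> g) u)\<close>.\<close>

definition pl :: "l4 uea \<Rightarrow> (l4 uea \<Rightarrow> complex) \<Rightarrow> l4 uea \<Rightarrow> complex poly" where
  "pl g t u = Abs_poly (\<lambda>k. t (g ^ k * u) / fact k)"

text \<open>A functional \<open>t\<close> on \<open>U/J\<close> and an element \<open>g\<close> that
  is locally nilpotent there: exp(a g) is defined on \<open>U/J\<close>, and \<open>texp a\<close>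
  is its composite with \<open>t\<close>.\<close>

locale nil_fun =
  fixes J :: "l4 uea set" and g t
  assumes J: "left_ideal J" and nilp: "\<exists>N. g ^ N * u \<in> J"
    and t: "lfun t" and tJ: "u \<in> J \<Longrightarrow> t u = 0"
begin

lemma coeff_pl: "coeff (pl g t u) k = t (g ^ k * u) / fact k"
proof -
  obtain N where N: "g ^ N * u \<in> J" using nilp by blast
  have "t (g ^ k * u) = 0" if "k > N" for k
    by (rule tJ, rule nilset_mono[OF J N]) (use that in simp)
  then show ?thesis unfolding pl_def by (subst coeff_Abs_poly[of N]) auto
qed

lemma pl_add: "pl g t (u + v) = pl g t u + pl g t v"
  by (rule poly_eqI) (simp add: coeff_pl distrib_left lfunD[OF t] add_divide_distrib)

lemma pl_scal: "pl g t (scal a * u) = smult a (pl g t u)"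
  by (rule poly_eqI) (simp add: coeff_pl scal_left_commute lfunD[OF t])

lemma pl_numeral: "pl g t (numeral n * u) = smult (numeral n) (pl g t u)"
  using pl_scal[of "numeral n" u] by (simp only: scal_numeral)

lemma pl_0: "pl g t 0 = 0"
  by (rule poly_eqI) (simp add: coeff_pl lfunD[OF t])

lemma pl_uminus: "pl g t (- u) = - pl g t u"
  by (rule poly_eqI) (simp add: coeff_pl lfunD[OF t])

lemma pl_sum: "pl g t (sum f I) = (\<Sum>i\<in>I. pl g t (f i))"
  by (induction I rule: infinite_finite_induct) (simp_all add: pl_0 pl_add)

lemma pl_ideal: "u \<in> J \<Longrightarrow> pl g t u = 0"
  by (rule poly_eqI) (simp add: coeff_pl tJ left_idealD[OF J])

lemma pderiv_pl: "pderiv (pl g t u) = pl g t (g * u)"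
proof (rule poly_eqI)
  fix k
  have "g ^ Suc k * u = g ^ k * (g * u)" by (simp only: power_Suc2 mult.assoc)
  then show "coeff (pderiv (pl g t u)) k = coeff (pl g t (g * u)) k"
    by (simp only: coeff_pderiv coeff_pl fact_Suc) (simp del: of_nat_Suc)
qed

text \<open>Each derivative is again a member of the family, so the vanishing of all constant
  coefficients propagates to all Taylor coefficients.\<close>

lemma deriv_family_zero:
  assumes "\<And>u. pderiv (D u) = D (g * u)" "\<And>u. coeff (D u) 0 = 0"
  shows "D u = (0 :: complex poly)"
proof (rule poly_eqI)
  fix k
  show "coeff (D u) k = coeff 0 k"
  proof (induction k arbitrary: u)
    case (Suc k)
    have "of_nat (Suc k) * coeff (D u) (Suc k) = 0"
      using Suc[of "g * u"] assms(1)[of u] coeff_pderiv[of "D u" k] by simp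
    then show ?case by (simp del: of_nat_Suc)
  qed (simp add: assms)
qed

definition "texp a u = poly (pl g t u) a"

lemma lfun_texp: "lfun (texp a)"
  by (simp add: lfun_def texp_def pl_add pl_scal)

lemma texp_ideal: "u \<in> J \<Longrightarrow> texp a u = 0"
  by (simp add: texp_def pl_ideal)

text \<open>The exponential is invertible. By induction on the nilpotency order the derivative of
  \<open>pl g t u\<close> is zero, so this polynomial is constant, equal to its value at a.\<close>

lemma texp_zero: "(\<And>u. texp a u = 0) \<Longrightarrow> t u = 0"
proof -
  assume z: "\<And>u. texp a u = 0"
  have "pl g t u = 0" if "g ^ N * u \<in> J" for N u
    using that
  proof (induction N arbitrary: u)
    case 0
    then show ?case by (simp add: pl_ideal)
  next
    case (Suc N)
    then have "g ^ N * (g * u) \<in> J" by (simp only: power_Suc2 mult.assoc)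
    then have "pderiv (pl g t u) = 0" by (simp add: pderiv_pl Suc.IH)
    then obtain b where b: "pl g t u = [:b:]" using pderiv_eq_0_iff degree_eq_zeroE by metis
    then show ?case using z[of u] by (simp add: texp_def)
  qed
  then have "pl g t u = 0" using nilp by blast
  then show "t u = 0" using coeff_pl[of u 0] by simp
qed

lemma texp_eval: "g ^ Suc N * u \<in> J \<Longrightarrow> texp a u = (\<Sum>k\<le>N. t (g ^ k * u) / fact k * a ^ k)"
proof -
  assume N: "g ^ Suc N * u \<in> J"
  have "degree (pl g t u) \<le> N"
    by (rule degree_le) (use tJ[OF nilset_mono[OF J N]] in \<open>auto simp: coeff_pl Suc_le_eq\<close>)
  then have "(\<Sum>k\<le>degree (pl g t u). coeff (pl g t u) k * a ^ k) = (\<Sum>k\<le>N. coeff (pl g t u) k * a ^ k)"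
    by (intro sum.mono_neutral_left) (auto simp: coeff_eq_0)
  then show ?thesis by (simp only: texp_def poly_altdef coeff_pl)
qed

text \<open>exp(a g) moves an eigenfunctional at the quartic p to one at the translated quartic,
  whose coordinates \<open>Y\<close> solve the linear differential equation given by the action of
  \<open>g\<close> on the radical.\<close>

lemma texp_rad:
  assumes g: "g = gen (Lg x)" and v: "\<And>v u. t (uv v * u) = p v * t u"
    and Y: "\<And>v. coeff (Y v) 0 = p v"
      "\<And>v. pderiv (Y v) = (\<Sum>w\<in>UNIV. smult (rad_act x v w) (Y w))"
  shows "texp a (uv v * u) = poly (Y v) a * texp a u"
proof -
  have "coeff (pl g t (uv v * u) - Y v * pl g t u) k = 0" for k v u
  proof (induction k arbitrary: u v)
    case 0
    show ?case by (simp add: coeff_pl v Y coeff_mult)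
  next
    case (Suc k)
    let ?D = "\<lambda>v u. pl g t (uv v * u) - Y v * pl g t u"
    have "g * (uv v * u) = uv v * (g * u) + (\<Sum>w\<in>UNIV. scal (rad_act x v w) * (uv w * u))"
      unfolding g by (simp add: comm_left[OF comm_gv] sum_distrib_right mult.assoc)
    then have "pderiv (?D v u) = ?D v (g * u) + (\<Sum>w\<in>UNIV. smult (rad_act x v w) (?D w u))"
      by (simp add: pderiv_diff pderiv_mult pderiv_pl pl_add pl_sum pl_scal Y smult_diff_right
        sum_subtractf sum_distrib_left sum_distrib_right mult.commute algebra_simps)
    then have "coeff (pderiv (?D v u)) k = 0" by (simp add: Suc coeff_sum del: coeff_diff)
    then show ?case unfolding coeff_pderiv by (simp del: of_nat_Suc coeff_diff)
  qed
  then have "pl g t (uv v * u) - Y v * pl g t u = 0" by (intro poly_eqI) simp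
  then show ?thesis by (simp add: texp_def)
qed

text \<open>Transport of an eigenvalue equation for an element of \<open>sl2\<close>, which moves in its adjoint orbit.\<close>

lemma texp_sl2:
  assumes g: "(g = ue \<and> pderiv a = - d \<and> pderiv b = smult 2 a \<and> pderiv d = 0) \<or>
     (g = uf \<and> pderiv a = b \<and> pderiv d = smult (-2) a \<and> pderiv b = 0)"
    and eig: "\<And>u. coeff a 0 * t (uh * u) + coeff b 0 * t (ue * u) + coeff d 0 * t (uf * u) = i * t u"
  shows "poly a \<tau> * texp \<tau> (uh * u) + poly b \<tau> * texp \<tau> (ue * u) + poly d \<tau> * texp \<tau> (uf * u) = i * texp \<tau> u"
proof -
  define D where "D u = a * pl g t (uh * u) + b * pl g t (ue * u) + d * pl g t (uf * u) - smult i (pl g t u)" for u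
  have "D u = 0"
  proof (rule deriv_family_zero)
    fix u
    show "coeff (D u) 0 = 0" using eig[of u] by (simp add: D_def coeff_mult coeff_pl)
    have eh: "ue * (uh * u) = uh * (ue * u) + - (2 * (ue * u))"
      by (simp add: comm_left[OF comm_he] mult.assoc)
    have fh: "uf * (uh * u) = uh * (uf * u) + 2 * (uf * u)"
      by (simp add: comm_left_minus[OF comm_hf] mult.assoc)
    have ef: "ue * (uf * u) = uf * (ue * u) + uh * u" by (rule comm_left[OF comm_ef])
    then have fe: "uf * (ue * u) = ue * (uf * u) + - (uh * u)" by simp
    show "pderiv (D u) = D (g * u)"
      using g
    proof (elim disjE conjE)
      assume e: "g = ue" and d: "pderiv a = - d" "pderiv b = smult 2 a" "pderiv d = 0"
      have gs: "g * (uh * u) = uh * (g * u) + - (2 * (g * u))" "g * (ue * u) = ue * (g * u)"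
        "g * (uf * u) = uf * (g * u) + uh * u" "pl g t (g * u) = pl g t (ue * u)"
        using eh ef by (simp_all add: e)
      show ?thesis unfolding D_def
        by (simp only: pderiv_add pderiv_diff pderiv_mult pderiv_smult pderiv_pl d gs pl_add
          pl_uminus pl_numeral) (simp add: algebra_simps)
    next
      assume f: "g = uf" and d: "pderiv a = b" "pderiv d = smult (-2) a" "pderiv b = 0"
      have gs: "g * (uh * u) = uh * (g * u) + 2 * (g * u)" "g * (uf * u) = uf * (g * u)"
        "g * (ue * u) = ue * (g * u) + - (uh * u)" "pl g t (g * u) = pl g t (uf * u)"
        using fh fe by (simp_all add: f)
      show ?thesis unfolding D_def
        by (simp only: pderiv_add pderiv_diff pderiv_mult pderiv_smult pderiv_pl d gs pl_add
          pl_uminus pl_numeral) (simp add: algebra_simps)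
    qed
  qed
  then have "poly (D u) \<tau> = 0" by simp
  then show ?thesis by (simp add: D_def texp_def)
qed

end

section \<open>From a simple module to a quartic: functionals on which the radical acts by
  scalars\<close>

section \<open>Eigenfunctionals of the radical\<close>

abbreviation (input) "uscale \<equiv> (\<lambda>a (u :: l4 uea). scal a * u)"

lemma vector_space_uea: "vector_space uscale"
  by unfold_locales
    (simp_all add: distrib_left distrib_right scal.scalar_add scal.scalar_mult scal.scalar_one mult.assoc)

lemma functional_extension:
  assumes "usubspace Q" "y \<notin> Q"
  obtains t where "lfun t" "\<And>x. x \<in> Q \<Longrightarrow> t x = 0" "t y = 1"
proof -
  interpret uea_vs: vector_space uscale by (rule vector_space_uea)
  interpret uea_pair: vector_space_pair uscale "(*) :: complex \<Rightarrow> complex \<Rightarrow> complex"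
    by unfold_locales (simp_all add: algebra_simps)
  have Q: "uea_vs.subspace Q" using assms(1) by (auto simp: uea_vs.subspace_def usubspace_def)
  obtain B where B: "B \<subseteq> Q" "uea_vs.independent B" "Q \<subseteq> uea_vs.span B"
    using uea_vs.maximal_independent_subset by blast
  then have "uea_vs.span B = Q" using Q by (metis uea_vs.span_minimal subset_antisym)
  then have ind: "uea_vs.independent (insert y B)"
    using B assms(2) by (intro uea_vs.independent_insertI) auto
  obtain t where t: "Vector_Spaces.linear (\<lambda>a u. scal a * u) (*) t"
    "\<forall>x\<in>insert y B. t x = (if x = y then 1 else 0)"
    using uea_pair.linear_independent_extend[OF ind, of "\<lambda>x. if x = y then 1 else 0"] by blast
  have lf: "lfun t"
    using t(1) by (auto simp: lfun_def Vector_Spaces.linear_iff)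
  have "Q \<subseteq> {u. t u = 0}"
  proof -
    have "B \<subseteq> {u. t u = 0}" using t(2) B(1) assms(2) by auto
    moreover have "uea_vs.subspace {u. t u = 0}"
      using lfun_ker[OF lf] by (auto simp: uea_vs.subspace_def usubspace_def)
    ultimately show ?thesis using uea_vs.span_minimal \<open>uea_vs.span B = Q\<close> by blast
  qed
  then show ?thesis using that[OF lf] t(2) by auto
qed

definition uword :: "l4 list \<Rightarrow> l4 uea" where
  "uword xs = abs_uea (Poly_Mapping.single (Word xs) 1)"

lemma uword_span: "u \<in> module.span uscale (range uword)"
proof -
  interpret uea_vs: vector_space uscale by (rule vector_space_uea)
  obtain p where p: "u = abs_uea p" using uea_repr by blast
  have "abs_uea p \<in> uea_vs.span (range uword)"
  proof (induction p rule: free_alg_induct)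
    case (single w c)
    have "abs_uea (Poly_Mapping.single w c) = scal c * uword (letters w)"
      by (simp add: uword_def scal.abs_eq times_uea.abs_eq mult_single)
    then show ?case using uea_vs.span_scale[OF uea_vs.span_base[of "uword (letters w)" "range uword"]]
      by simp
  next
    case (add p q)
    then show ?case by (simp add: plus_uea.abs_eq[symmetric] uea_vs.span_add)
  qed
  then show ?thesis using p by simp
qed

lemma pev_sum: "pev (sum f A) g = (\<Sum>i\<in>A. pev (f i) g)"
  by (induction A rule: infinite_finite_induct) (simp_all add: pev_add)

text \<open>The dimension of \<open>U\<close> is countable, so there is no independent family indexed by the reals.\<close>

lemma no_real_independent_family:
  fixes y :: "real \<Rightarrow> l4 uea"
  assumes "\<And>A c. finite A \<Longrightarrow> (\<Sum>r\<in>A. scal (c r) * y r) = 0 \<Longrightarrow> \<forall>r\<in>A. c r = 0"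
  shows False
proof -
  interpret uea_vs: vector_space uscale by (rule vector_space_uea)
  have inj: "inj y"
  proof (rule injI, rule ccontr)
    fix r s assume "y r = y s" "r \<noteq> s"
    then have "(\<Sum>x\<in>{r, s}. scal (if x = r then 1 else -1) * y x) = 0"
      by (simp add: scal_uminus scal.scalar_one)
    from assms[OF _ this] show False by auto
  qed
  have ind: "uea_vs.independent (y ` A)" if "finite A" for A
  proof (rule uea_vs.independent_if_scalars_zero)
    fix f x assume s: "(\<Sum>x\<in>y ` A. scal (f x) * x) = 0" and x: "x \<in> y ` A"
    have "(\<Sum>r\<in>A. scal (f (y r)) * y r) = 0"
      using s by (subst (asm) sum.reindex) (auto intro: inj_on_subset[OF inj])
    from assms[OF that this] show "f x = 0" using x by auto
  qed (use that in simp)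
  have "\<exists>F. finite F \<and> F \<subseteq> (UNIV :: l4 list set) \<and> y r \<in> uea_vs.span (uword ` F)" for r
  proof -
    obtain S t where S: "finite S" "S \<subseteq> range uword" "y r = (\<Sum>a\<in>S. scal (t a) * a)"
      using uword_span[of "y r"] unfolding uea_vs.span_explicit by blast
    obtain F where "finite F" "S = uword ` F" using S(1,2) finite_subset_image by metis
    moreover have "y r \<in> uea_vs.span S" unfolding S(3)
      by (intro uea_vs.span_sum uea_vs.span_scale uea_vs.span_base)
    ultimately show ?thesis by auto
  qed
  then obtain F where F: "\<And>r. finite (F r)" "\<And>r. y r \<in> uea_vs.span (uword ` F r)" by metis
  have "countable (lists (UNIV :: l4 set))" by (intro countable_lists countable_finite) simp
  then have "countable {X. finite X \<and> X \<subseteq> (UNIV :: l4 list set)}"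
    by (intro countable_Collect_finite_subset) (simp add: lists_UNIV)
  then have cnt: "countable (Collect finite :: l4 list set set)" by simp
  \<comment> \<open>There are uncountably many indices but countably many finite sets of words, so
    one finite set of words serves infinitely many of the vectors.\<close>
  have "\<exists>X\<in>range F. infinite (F -` {X})"
  proof (rule ccontr)
    assume "\<not> ?thesis"
    then have "countable (\<Union>X\<in>range F. F -` {X})"
      by (intro countable_UN countable_subset[OF _ cnt]) (auto simp: F(1) intro: countable_finite)
    moreover have "(\<Union>X\<in>range F. F -` {X}) = UNIV" by auto
    ultimately show False using uncountable_UNIV_real by simp
  qed
  then obtain X where X: "X \<in> range F" "infinite (F -` {X})" by blast
  then obtain A where A: "A \<subseteq> F -` {X}" "finite A" "card A = Suc (card (uword ` X))"
    using infinite_arbitrarily_large[OF X(2), of "Suc (card (uword ` X))"] by metis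
  have "finite X" using X(1) F(1) by auto
  have "y ` A \<subseteq> uea_vs.span (uword ` X)" using A(1) F(2) by auto
  then have "card (y ` A) \<le> card (uword ` X)"
    using uea_vs.independent_span_bound[OF _ ind[OF A(2)]] \<open>finite X\<close> by auto
  moreover have "card (y ` A) = card A" by (rule card_image, rule inj_on_subset[OF inj]) simp
  ultimately show False using A(3) by simp
qed

text \<open>Submodules of U over the symmetric algebra of the radical.\<close>

definition rad_stable :: "l4 uea set \<Rightarrow> bool" where
  "rad_stable X \<longleftrightarrow> usubspace X \<and> (\<forall>v. \<forall>x\<in>X. uv v * x \<in> X)"

lemma usubspace_cong_mem: "usubspace Q \<Longrightarrow> x - y \<in> Q \<Longrightarrow> y \<in> Q \<Longrightarrow> x \<in> Q"
  using usubspace_cong by blast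

text \<open>\<open>U/J\<close> is generated by the lowest weight vector of an
  \<open>sl2\<close>-type \<open>L(n)\<close>.\<close>

locale lowest_weight =
  fixes J :: "l4 uea set" and n :: nat
  assumes J: "left_ideal J" and fJ: "uf \<in> J" and hJ: "uh + scal (of_nat n) \<in> J"
    and eJ: "ue ^ Suc n \<in> J" and J1: "1 \<notin> J"
begin

lemma weight_e: "uh * ue ^ k - scal (2 * of_nat k - of_nat n) * ue ^ k \<in> J"
proof -
  have "uh * ue ^ k - scal (2 * of_nat k - of_nat n) * ue ^ k = ue ^ k * (uh + scal (of_nat n))"
    by (simp only: comm_h_e_pow scal_diff) (simp add: algebra_simps scal_commutes)
  then show ?thesis using left_idealD(3)[OF J hJ] by simp
qed

lemma f_e: "uf * ue ^ Suc k - scal (of_nat (Suc k) * (of_nat n - of_nat k)) * ue ^ k \<in> J"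
proof -
  have "uf * ue ^ Suc k - scal (of_nat (Suc k) * (of_nat n - of_nat k)) * ue ^ k
    = ue ^ Suc k * uf - scal (of_nat (Suc k)) * (ue ^ k * (uh + scal (of_nat n)))"
    by (simp only: comm_f_e_pow scal.scalar_mult scal_diff)
       (simp add: algebra_simps scal_commutes del: power_Suc of_nat_Suc)
  then show ?thesis using J fJ hJ by (simp add: left_idealD del: power_Suc of_nat_Suc)
qed

lemma nilp_e: "\<exists>N. ue ^ N * u \<in> J"
proof -
  obtain M where "ue ^ M * u \<in> J" by (rule nilpotent_all[OF J disjI1[OF refl] eJ])
  then show ?thesis by (rule exI)
qed

lemma nilp_f: "\<exists>N. uf ^ N * u \<in> J"
proof -
  have "uf ^ 1 \<in> J" using fJ by simp
  obtain M where "uf ^ M * u \<in> J" by (rule nilpotent_all[OF J disjI2[OF refl] \<open>uf ^ 1 \<in> J\<close>])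
  then show ?thesis by (rule exI)
qed

lemma e_pow_mem: "k > n \<Longrightarrow> ue ^ k \<in> J"
  using nilset_mono[OF J, of ue "Suc n" 1 k] eJ by simp

text \<open>U is the product of the symmetric algebra of the radical and of \<open>U(sl2)\<close>,
  and modulo \<open>J\<close> the latter is spanned by the first n + 1 powers of \<open>e\<close>:
  these generate \<open>U/J\<close> over the symmetric algebra. The proof shows that the smallest
  candidate \<open>Y\<close> is a left ideal.\<close>

lemma rad_span:
  assumes X: "rad_stable X" "J \<subseteq> X" "\<And>k. k \<le> n \<Longrightarrow> ue ^ k \<in> X"
  shows "X = UNIV"
proof -
  define \<X> where "\<X> = {X. rad_stable X \<and> J \<subseteq> X \<and> (\<forall>k\<le>n. ue ^ k \<in> X)}"
  define Y where "Y = \<Inter>\<X>"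
  have Y: "usubspace Y" "\<And>v x. x \<in> Y \<Longrightarrow> uv v * x \<in> Y" "J \<subseteq> Y"
    by (auto simp: Y_def \<X>_def rad_stable_def usubspace_def)
  have Ye: "ue ^ k \<in> Y" for k
    using e_pow_mem[of k] Y(3) by (cases "k \<le> n") (auto simp: Y_def \<X>_def)
  have "Y \<subseteq> {x\<in>Y. \<forall>g. gen (Lg g) * x \<in> Y}"
    unfolding Y_def
  proof (rule Inter_lower, fold Y_def, unfold \<X>_def, rule CollectI, intro conjI allI impI)
    show "rad_stable {x \<in> Y. \<forall>g. gen (Lg g) * x \<in> Y}"
      unfolding rad_stable_def
    proof (intro conjI allI ballI)
      show "usubspace {x \<in> Y. \<forall>g. gen (Lg g) * x \<in> Y}"
        using Y(1) by (auto simp: usubspace_def distrib_left scal_commutes)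
      fix v x assume x: "x \<in> {x \<in> Y. \<forall>g. gen (Lg g) * x \<in> Y}"
      have "gen (Lg g) * (uv v * x) \<in> Y" for g
      proof -
        have "gen (Lg g) * (uv v * x) = uv v * (gen (Lg g) * x) + (\<Sum>w\<in>UNIV. scal (rad_act g v w) * (uv w * x))"
          by (simp add: comm_left[OF comm_gv] sum_distrib_right mult.assoc)
        moreover have "(\<Sum>w\<in>UNIV. scal (rad_act g v w) * (uv w * x)) \<in> Y"
          using x Y by (intro usubspace_sum) (auto simp: usubspaceD)
        ultimately show ?thesis using x Y by (simp add: usubspaceD)
      qed
      then show "uv v * x \<in> {x \<in> Y. \<forall>g. gen (Lg g) * x \<in> Y}" using x Y by simp
    qed
    show "J \<subseteq> {x \<in> Y. \<forall>g. gen (Lg g) * x \<in> Y}" using Y(3) left_idealD(3)[OF J] by blast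
    fix k
    have "gen (Lg g) * ue ^ k \<in> Y" for g
    proof (cases g)
      case sl2_e
      then show ?thesis using Ye[of "Suc k"] by simp
    next
      case sl2_h
      have "uh * ue ^ k \<in> Y"
        by (rule usubspace_cong_mem[OF Y(1) subsetD[OF Y(3) weight_e] usubspaceD(3)[OF Y(1) Ye]])
      then show ?thesis by (simp only: sl2_h)
    next
      case sl2_f
      then show ?thesis
      proof (cases k)
        case 0
        then show ?thesis using sl2_f fJ Y(3) by auto
      next
        case (Suc i)
        have "uf * ue ^ Suc i \<in> Y"
          by (rule usubspace_cong_mem[OF Y(1) subsetD[OF Y(3) f_e] usubspaceD(3)[OF Y(1) Ye]])
        then show ?thesis by (simp only: sl2_f Suc)
      qed
    qed
    then show "ue ^ k \<in> {x \<in> Y. \<forall>g. gen (Lg g) * x \<in> Y}" using Ye by simp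
  qed
  then have *: "gen (Lg g) * x \<in> Y" if "x \<in> Y" for g x using that by blast
  have "left_ideal Y"
  proof (rule usubspace_left_idealI[OF Y(1)])
    fix x y assume "y \<in> Y"
    then show "gen x * y \<in> Y" using * Y(2) by (cases x) auto
  qed
  then have "Y = UNIV" by (rule left_ideal_1) (use Ye[of 0] in simp)
  moreover have "Y \<subseteq> X" using X by (auto simp: Y_def \<X>_def)
  ultimately show ?thesis by blast
qed

lemma J_rad_stable: "rad_stable J"
  by (simp add: rad_stable_def left_ideal_usubspace[OF J] left_idealD[OF J])

text \<open>Zorn's lemma applies because of finite generation: if the union of a chain contains the
  finitely many generators from \<open>rad_span\<close>, so does a member of the chain.\<close>

lemma maximal_rad_stable:
  obtains P where "rad_stable P" "J \<subseteq> P" "P \<noteq> UNIV"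
    "\<And>X. rad_stable X \<Longrightarrow> P \<subseteq> X \<Longrightarrow> X \<noteq> UNIV \<Longrightarrow> X = P"
proof -
  define \<A> where "\<A> = {X. rad_stable X \<and> J \<subseteq> X \<and> X \<noteq> UNIV}"
  have "\<exists>M\<in>\<A>. \<forall>X\<in>\<A>. M \<subseteq> X \<longrightarrow> X = M"
  proof (rule subset_Zorn_nonempty)
    show "\<A> \<noteq> {}" using J_rad_stable J1 by (auto simp: \<A>_def)
    fix \<C> assume ne: "\<C> \<noteq> {}" and ch: "subset.chain \<A> \<C>"
    have sub: "X \<in> \<C> \<Longrightarrow> rad_stable X \<and> J \<subseteq> X \<and> X \<noteq> UNIV" for X
      using ch by (auto simp: subset_chain_def \<A>_def)
    have "\<Union>\<C> \<noteq> UNIV"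
    proof
      assume "\<Union>\<C> = UNIV"
      then obtain B where "B \<in> \<C>" "(\<lambda>k. ue ^ k) ` {..n} \<subseteq> B"
        using finite_subset_Union_chain[OF _ _ ne ch, of "(\<lambda>k. ue ^ k) ` {..n}"] by auto
      then show False using rad_span[of B] sub[of B] by auto
    qed
    moreover have "rad_stable (\<Union>\<C>)"
      unfolding rad_stable_def usubspace_def
    proof (intro conjI ballI allI)
      show "0 \<in> \<Union>\<C>" using ne sub by (auto simp: rad_stable_def usubspace_def)
      fix x y assume xy: "x \<in> \<Union>\<C>" "y \<in> \<Union>\<C>"
      then obtain B where "B \<in> \<C>" "{x, y} \<subseteq> B"
        using finite_subset_Union_chain[OF _ _ ne ch, of "{x, y}"] by auto
      then have "x + y \<in> B" using sub[of B] by (auto simp: rad_stable_def usubspace_def)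
      then show "x + y \<in> \<Union>\<C>" using \<open>B \<in> \<C>\<close> by blast
    next
      fix a x assume "x \<in> \<Union>\<C>"
      then obtain B where "B \<in> \<C>" "x \<in> B" by blast
      then have "scal a * x \<in> B" using sub[of B] by (auto simp: rad_stable_def usubspace_def)
      then show "scal a * x \<in> \<Union>\<C>" using \<open>B \<in> \<C>\<close> by blast
    next
      fix v x assume "x \<in> \<Union>\<C>"
      then obtain B where "B \<in> \<C>" "x \<in> B" by blast
      then have "uv v * x \<in> B" using sub[of B] by (auto simp: rad_stable_def)
      then show "uv v * x \<in> \<Union>\<C>" using \<open>B \<in> \<C>\<close> by blast
    qed
    ultimately show "\<Union>\<C> \<in> \<A>" using ne sub by (auto simp: \<A>_def)
  qed
  then obtain M where M: "M \<in> \<A>" "\<And>X. X \<in> \<A> \<Longrightarrow> M \<subseteq> X \<Longrightarrow> X = M" by blast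
  show ?thesis
  proof (rule that[of M])
    show "rad_stable M" "J \<subseteq> M" "M \<noteq> UNIV" using M(1) by (simp_all add: \<A>_def)
    then show "X = M" if "rad_stable X" "M \<subseteq> X" "X \<noteq> UNIV" for X
      using that by (intro M(2)) (auto simp: \<A>_def)
  qed
qed

text \<open>The radical acts by scalars on the simple quotient, by Schur's lemma in the form of Dixmier: otherwise
  the resolvents of \<open>v\<close> would give an uncountable independent family.\<close>

lemma schur_dixmier:
  assumes P: "rad_stable P" "J \<subseteq> P" "P \<noteq> UNIV"
    and max: "\<And>X. rad_stable X \<Longrightarrow> P \<subseteq> X \<Longrightarrow> X \<noteq> UNIV \<Longrightarrow> X = P"
  shows "\<exists>a. \<forall>x. uv v * x - scal a * x \<in> P"
proof (rule ccontr)
  assume no: "\<not> ?thesis"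
  have Ps: "usubspace P" "\<And>v x. x \<in> P \<Longrightarrow> uv v * x \<in> P" using P(1) by (auto simp: rad_stable_def)
  note PD = usubspaceD[OF Ps(1)]
  define T where "T a x = uv v * x - scal a * x" for a x
  have T: "T a (x + y) = T a x + T a y" "T a (scal b * x) = scal b * T a x" "T a 0 = 0"
    "T a (uv w * x) = uv w * T a x" for a b w x y
    by (simp_all add: T_def algebra_simps scal_commutes scal_scal comm_vv_left)
  have TP: "x \<in> P \<Longrightarrow> T a x \<in> P" for a x using PD Ps(2) by (simp add: T_def)
  \<comment> \<open>\<open>T a\<close> commutes with the radical, so its kernel and its image on the
    simple quotient by \<open>P\<close> are stable. As it is not zero there, it is
    bijective.\<close>
  have inj: "T a x \<in> P \<Longrightarrow> x \<in> P" for a x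
  proof -
    have "{x. T a x \<in> P} = P"
    proof (rule max)
      show "rad_stable {x. T a x \<in> P}" using PD Ps(2) by (auto simp: rad_stable_def usubspace_def T)
      show "P \<subseteq> {x. T a x \<in> P}" using TP by blast
      show "{x. T a x \<in> P} \<noteq> UNIV" using no unfolding T_def by blast
    qed
    then show "T a x \<in> P \<Longrightarrow> x \<in> P" by blast
  qed
  have surj: "\<exists>x. T a x - y \<in> P" for a y
  proof -
    let ?R = "{y. \<exists>x. T a x - y \<in> P}"
    have RI: "y \<in> ?R" if "T a x - y \<in> P" for x y using that by blast
    have "rad_stable ?R"
      unfolding rad_stable_def usubspace_def
    proof (intro conjI ballI allI)
      show "0 \<in> ?R" by (rule RI[of 0]) (simp add: T PD)
      fix y y' assume "y \<in> ?R" "y' \<in> ?R"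
      then obtain x x' where "T a x - y \<in> P" "T a x' - y' \<in> P" by blast
      then have "T a (x + x') - (y + y') \<in> P" using PD(2) by (force simp: T algebra_simps)
      then show "y + y' \<in> ?R" by (rule RI)
    next
      fix b y assume "y \<in> ?R"
      then obtain x where "T a x - y \<in> P" by blast
      then have "T a (scal b * x) - scal b * y \<in> P"
        using PD(3)[of "T a x - y" b] by (simp add: T right_diff_distrib)
      then show "scal b * y \<in> ?R" by (rule RI)
    next
      fix w y assume "y \<in> ?R"
      then obtain x where "T a x - y \<in> P" by blast
      then have "T a (uv w * x) - uv w * y \<in> P"
        using Ps(2)[of "T a x - y" w] by (simp add: T right_diff_distrib)
      then show "uv w * y \<in> ?R" by (rule RI)
    qed
    moreover have "P \<subseteq> ?R"
    proof
      fix y assume "y \<in> P"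
      then show "y \<in> ?R" by (intro RI[of 0]) (simp add: T PD)
    qed
    moreover obtain x where "T a x \<notin> P" using no unfolding T_def by blast
    then have "?R \<noteq> P" using RI[of x "T a x"] PD(1) by auto
    ultimately have "?R = UNIV" using max by blast
    then show ?thesis by blast
  qed
  have pevP: "x \<in> P" if "p \<noteq> 0" "pev p (uv v) * x \<in> P" for p x
    using that
  proof (induction p arbitrary: x rule: poly_roots_induct)
    case (const a)
    then show ?case using usubspace_scal_iff[OF Ps(1), of a x] by (simp add: scal.scalar_zero)
  next
    case (root a q)
    have "pev ([:- a, 1:] * q) (uv v) * x = T a (pev q (uv v) * x)"
      by (simp only: pev_mult pev_linear T_def) (simp add: left_diff_distrib mult.assoc)
    then show ?case using root inj by metis
  qed
  obtain x0 where x0: "x0 \<notin> P" using P(3) by blast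
  have "\<forall>a. \<exists>x. T a x - x0 \<in> P" using surj by blast
  then obtain y where y: "\<And>a. T a (y a) - x0 \<in> P" using choice[of "\<lambda>a x. T a x - x0 \<in> P"] by blast
  show False
  proof (rule no_real_independent_family[of "\<lambda>r. y (of_real r)"])
    fix A :: "real set" and c
    assume A: "finite A" and sum0: "(\<Sum>r\<in>A. scal (c r) * y (of_real r)) = 0"
    \<comment> \<open>Multiplication by the common denominator \<open>F\<close> turns the resolvents
      into the polynomials \<open>Q s\<close> applied to x0. The resulting combination
      \<open>R\<close> has to be zero, and its value at s isolates \<open>c s\<close>.\<close>
    define Q where "Q s = (\<Prod>r\<in>A - {s}. [:- complex_of_real r, 1:])" for s
    define R where "R = (\<Sum>s\<in>A. smult (c s) (Q s))"
    define F where "F = (\<Prod>r\<in>A. [:- complex_of_real r, 1:])"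
    have F: "pev F (uv v) * y (of_real s) - pev (Q s) (uv v) * x0 \<in> P" if "s \<in> A" for s
    proof -
      have "F = Q s * [:- complex_of_real s, 1:]"
        unfolding F_def Q_def by (subst prod.remove[OF A that]) (rule mult.commute)
      then have "pev F (uv v) * y (of_real s) - pev (Q s) (uv v) * x0
          = pev (Q s) (uv v) * (T (of_real s) (y (of_real s)) - x0)"
        by (simp only: pev_mult pev_linear T_def) (simp add: right_diff_distrib left_diff_distrib mult.assoc)
      then show ?thesis using pev_closed[OF Ps(1) Ps(2) y] by simp
    qed
    have "(\<Sum>s\<in>A. scal (c s) * (pev F (uv v) * y (of_real s) - pev (Q s) (uv v) * x0)) \<in> P"
      by (intro usubspace_sum Ps(1) PD(3) F)
    moreover have "(\<Sum>s\<in>A. scal (c s) * (pev F (uv v) * y (of_real s) - pev (Q s) (uv v) * x0))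
      = pev F (uv v) * (\<Sum>s\<in>A. scal (c s) * y (of_real s)) - pev R (uv v) * x0"
      by (simp add: R_def pev_sum pev_smult right_diff_distrib sum_subtractf sum_distrib_left
        sum_distrib_right scal_left_commute[of "pev F (uv v)"] mult.assoc)
    ultimately have "pev R (uv v) * x0 \<in> P" using PD(4) by (fastforce simp: sum0)
    then have R0: "R = 0" using pevP x0 by blast
    show "\<forall>s\<in>A. c s = 0"
    proof
      fix s assume s: "s \<in> A"
      have "poly (Q r) (of_real s) = 0" if "r \<in> A" "r \<noteq> s" for r
        unfolding Q_def poly_prod by (rule prod_zero) (use A s that in auto)
      then have "poly R (of_real s) = (\<Sum>r\<in>A. if r = s then c s * poly (Q s) (of_real s) else 0)"
        unfolding R_def poly_sum by (intro sum.cong) auto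
      also have "\<dots> = c s * poly (Q s) (of_real s)" using A s by simp
      finally have "c s * poly (Q s) (of_real s) = 0" using R0 by simp
      moreover have "poly (Q s) (of_real s) \<noteq> 0"
        unfolding Q_def poly_prod using A by (subst prod_zero_iff) auto
      ultimately show "c s = 0" by simp
    qed
  qed
qed

text \<open>A nonzero functional on \<open>U/J\<close> supported at the quartic p.\<close>

definition eigenfun :: "(l4 uea \<Rightarrow> complex) \<Rightarrow> (rad \<Rightarrow> complex) \<Rightarrow> bool" where
  "eigenfun t p \<longleftrightarrow> lfun t \<and> (\<forall>u\<in>J. t u = 0) \<and> (\<exists>u. t u \<noteq> 0) \<and> (\<forall>v u. t (uv v * u) = p v * t u)"

text \<open>Modulo a maximal \<open>P\<close> the whole radical acts by scalars, so every functional
  that vanishes on \<open>P\<close> is an eigenvector of it.\<close>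

lemma eigenfun_exists: "\<exists>t p. eigenfun t p"
proof -
  obtain P where P: "rad_stable P" "J \<subseteq> P" "P \<noteq> UNIV"
    and max: "\<And>X. rad_stable X \<Longrightarrow> P \<subseteq> X \<Longrightarrow> X \<noteq> UNIV \<Longrightarrow> X = P"
    by (rule maximal_rad_stable) blast
  obtain p where p: "\<And>v x. uv v * x - scal (p v) * x \<in> P"
    using schur_dixmier[OF P max] by metis
  obtain x0 where "x0 \<notin> P" using P(3) by blast
  then obtain t where t: "lfun t" "\<And>x. x \<in> P \<Longrightarrow> t x = 0" "t x0 = 1"
    using functional_extension[of P] P(1) unfolding rad_stable_def by metis
  have "t (uv v * x) = p v * t x" for v x
    using t(2)[OF p[of v x]] by (simp add: lfunD[OF t(1)])
  then have "eigenfun t p" using t P(2) by (auto simp: eigenfun_def intro!: exI[of _ x0])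
  then show ?thesis by blast
qed

lemma nil_funI: "eigenfun t p \<Longrightarrow> g = ue \<or> g = uf \<Longrightarrow> nil_fun J g t"
  by unfold_locales (use J nilp_e nilp_f in \<open>auto simp: eigenfun_def\<close>)

text \<open>The coordinates of p translated by exp(a e), as polynomials in a; \<open>orbit_f\<close>
  is the same for \<open>f\<close>. The polynomial \<open>orbit_f p V4\<close> is p in an affine
  coordinate: its roots are the translations that make the coordinate \<open>V4\<close>
  vanish.\<close>

fun orbit_e :: "(rad \<Rightarrow> complex) \<Rightarrow> rad \<Rightarrow> complex poly" where
  "orbit_e p Vm4 = [:p Vm4, p Vm2, p V0, p V2, p V4:]"
| "orbit_e p Vm2 = [:p Vm2, 2 * p V0, 3 * p V2, 4 * p V4:]"
| "orbit_e p V0 = [:p V0, 3 * p V2, 6 * p V4:]"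
| "orbit_e p V2 = [:p V2, 4 * p V4:]"
| "orbit_e p V4 = [:p V4:]"

fun orbit_f :: "(rad \<Rightarrow> complex) \<Rightarrow> rad \<Rightarrow> complex poly" where
  "orbit_f p V4 = [:p V4, p V2, p V0, p Vm2, p Vm4:]"
| "orbit_f p V2 = [:p V2, 2 * p V0, 3 * p Vm2, 4 * p Vm4:]"
| "orbit_f p V0 = [:p V0, 3 * p Vm2, 6 * p Vm4:]"
| "orbit_f p Vm2 = [:p Vm2, 4 * p Vm4:]"
| "orbit_f p Vm4 = [:p Vm4:]"

lemma eigenfun_e:
  assumes "eigenfun t p"
  shows "eigenfun (nil_fun.texp ue t a) (\<lambda>v. poly (orbit_e p v) a)"
proof -
  interpret nil_fun J ue t by (rule nil_funI[OF assms]) simp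
  have "texp a (uv v * u) = poly (orbit_e p v) a * texp a u" for v u
  proof (rule texp_rad[of sl2_e])
    show "t (uv v * u) = p v * t u" for v u using assms by (simp add: eigenfun_def)
    show "coeff (orbit_e p v) 0 = p v" for v by (cases v) simp_all
    show "pderiv (orbit_e p v) = (\<Sum>w\<in>UNIV. smult (rad_act sl2_e v w) (orbit_e p w))" for v
      by (cases v) (simp_all add: sum_rad pderiv_pCons)
  qed simp
  moreover have "\<exists>u. texp a u \<noteq> 0" using texp_zero[of a] assms unfolding eigenfun_def by blast
  ultimately show ?thesis by (simp add: eigenfun_def lfun_texp texp_ideal)
qed

lemma eigenfun_f:
  assumes "eigenfun t p"
  shows "eigenfun (nil_fun.texp uf t a) (\<lambda>v. poly (orbit_f p v) a)"
proof -
  interpret nil_fun J uf t by (rule nil_funI[OF assms]) simp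
  have "texp a (uv v * u) = poly (orbit_f p v) a * texp a u" for v u
  proof (rule texp_rad[of sl2_f])
    show "t (uv v * u) = p v * t u" for v u using assms by (simp add: eigenfun_def)
    show "coeff (orbit_f p v) 0 = p v" for v by (cases v) simp_all
    show "pderiv (orbit_f p v) = (\<Sum>w\<in>UNIV. smult (rad_act sl2_f v w) (orbit_f p w))" for v
      by (cases v) (simp_all add: sum_rad pderiv_pCons)
  qed simp
  moreover have "\<exists>u. texp a u \<noteq> 0" using texp_zero[of a] assms unfolding eigenfun_def by blast
  ultimately show ?thesis by (simp add: eigenfun_def lfun_texp texp_ideal)
qed

end

text \<open>The values of the invariants make the discriminant vanish, and x is a common root of the
  quartic and its derivative. The two conditions express \<open>pm * p2\<close> and
  \<open>pmm * p2^2\<close> through d = p0 - z and z, after which both claims are linear identities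
  in d and z.\<close>

lemma double_root:
  fixes p0 pm pmm p2 z :: complex
  assumes "p0\<^sup>2 - 3 * pm * p2 = z\<^sup>2"
    and "p0 ^ 3 - 9/2 * pm * p0 * p2 + 27/2 * pmm * p2\<^sup>2 = z ^ 3" and "p0 \<noteq> z"
  defines "x \<equiv> - 3 * p2 / (p0 - z)"
  shows "p2 * x + p0 * x\<^sup>2 + pm * x ^ 3 + pmm * x ^ 4 = 0" "p2 + 2 * p0 * x + 3 * pm * x\<^sup>2 + 4 * pmm * x ^ 3 = 0"
proof -
  define d where "d = p0 - z"
  have d: "d \<noteq> 0" "p0 = d + z" using assms(3) by (auto simp: d_def)
  have mv: "Y - X = Z \<Longrightarrow> X = Y - Z" "Y - X + W = Z \<Longrightarrow> W = Z - Y + X" for X Y Z W :: complex by auto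
  have "3 * (pm * p2) = p0\<^sup>2 - z\<^sup>2" using mv(1)[OF assms(1)] by (simp only: mult.assoc)
  also have "\<dots> = d * (d + 2 * z)" unfolding d(2) by (simp add: power2_eq_square algebra_simps)
  finally have pm: "3 * (pm * p2) = d * (d + 2 * z)" .
  have "27 * (pmm * p2\<^sup>2) = 2 * (27/2 * pmm * p2\<^sup>2)" by simp
  also have "\<dots> = 2 * z ^ 3 - 2 * p0 ^ 3 + 3 * (3 * (pm * p2)) * p0"
    unfolding mv(2)[OF assms(2)] by (simp add: algebra_simps)
  also have "\<dots> = d\<^sup>2 * (d + 3 * z)"
    unfolding pm unfolding d(2) by (simp add: power2_eq_square power3_eq_cube algebra_simps)
  finally have pmm: "27 * (pmm * p2\<^sup>2) = d\<^sup>2 * (d + 3 * z)" .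
  define y where "y = p2 / d"
  have x: "x = - 3 * y" and p2: "p2 = y * d" using d(1) by (simp_all add: x_def y_def d_def)
  have "d * (3 * (pm * y)) = d * (d + 2 * z)"
    unfolding pm[symmetric] p2 by (simp only: mult_ac)
  then have pm': "3 * (pm * y) = d + 2 * z" using d(1) by simp
  have "d\<^sup>2 * (27 * (pmm * y\<^sup>2)) = d\<^sup>2 * (d + 3 * z)"
    unfolding pmm[symmetric] p2 by (simp only: power_mult_distrib mult_ac)
  then have pmm': "27 * (pmm * y\<^sup>2) = d + 3 * z" using d(1) by simp
  have "p2 + p0 * x + pm * x\<^sup>2 + pmm * x ^ 3 = y * (d - 3 * p0 + 3 * (3 * (pm * y)) - 27 * (pmm * y\<^sup>2))"
    unfolding x p2 by (simp add: power2_eq_square power3_eq_cube algebra_simps)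
  then have 1: "p2 + p0 * x + pm * x\<^sup>2 + pmm * x ^ 3 = 0" unfolding pm' pmm' d(2) by (simp add: algebra_simps)
  have "p2 * x + p0 * x\<^sup>2 + pm * x ^ 3 + pmm * x ^ 4 = x * (p2 + p0 * x + pm * x\<^sup>2 + pmm * x ^ 3)"
    by (simp add: eval_nat_numeral algebra_simps)
  then show "p2 * x + p0 * x\<^sup>2 + pm * x ^ 3 + pmm * x ^ 4 = 0" by (simp only: 1) simp
  have "p2 + 2 * p0 * x + 3 * pm * x\<^sup>2 + 4 * pmm * x ^ 3
      = y * (d - 6 * p0 + 9 * (3 * (pm * y)) - 4 * (27 * (pmm * y\<^sup>2)))"
    unfolding x p2 by (simp add: power2_eq_square power3_eq_cube algebra_simps)
  then show "p2 + 2 * p0 * x + 3 * pm * x\<^sup>2 + 4 * pmm * x ^ 3 = 0"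
    unfolding pm' pmm' d(2) by (simp add: algebra_simps)
qed

section \<open>Moving the quartic to a normal form, specialising it to the closed orbit, and weights
  of the torus\<close>

locale lowest_central = lowest_weight +
  fixes z :: complex
  assumes C2J: "C2 * u - scal (z ^ 2) * u \<in> J" and C3J: "C3 * u - scal (z ^ 3) * u \<in> J"
    and z0: "z \<noteq> 0"
begin

lemma eigenfun_central:
  assumes "eigenfun t p"
  shows "(p V0)\<^sup>2 - 3 * p Vm2 * p V2 + 12 * p Vm4 * p V4 = z\<^sup>2"
    "p V0 ^ 3 - 9/2 * p Vm2 * p V0 * p V2 + 27/2 * (p Vm2)\<^sup>2 * p V4 + 27/2 * p Vm4 * (p V2)\<^sup>2
      - 36 * p Vm4 * p V0 * p V4 = z ^ 3"
proof -
  have t: "lfun t" "\<And>v u. t (uv v * u) = p v * t u" "\<And>u. u \<in> J \<Longrightarrow> t u = 0"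
    using assms by (auto simp: eigenfun_def)
  obtain u where u: "t u \<noteq> 0" using assms by (auto simp: eigenfun_def)
  have "t (C2 * u) = z\<^sup>2 * t u" using t(3)[OF C2J[of u]] by (simp add: lfunD[OF t(1)])
  moreover have "t (C2 * u) = ((p V0)\<^sup>2 - 3 * p Vm2 * p V2 + 12 * p Vm4 * p V4) * t u"
    by (simp add: C2_alt distrib_right left_diff_distrib mult.assoc lfunD[OF t(1)] t(2) power2_eq_square)
  ultimately show "(p V0)\<^sup>2 - 3 * p Vm2 * p V2 + 12 * p Vm4 * p V4 = z\<^sup>2" using u by simp
  have "t (C3 * u) = z ^ 3 * t u" using t(3)[OF C3J[of u]] by (simp add: lfunD[OF t(1)])
  moreover have "t (C3 * u) = (p V0 ^ 3 - 9/2 * p Vm2 * p V0 * p V2 + 27/2 * (p Vm2)\<^sup>2 * p V4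
      + 27/2 * p Vm4 * (p V2)\<^sup>2 - 36 * p Vm4 * p V0 * p V4) * t u"
    by (simp add: C3_alt distrib_right left_diff_distrib mult.assoc lfunD[OF t(1)] t(2)
      power2_eq_square power3_eq_cube)
  ultimately show "p V0 ^ 3 - 9/2 * p Vm2 * p V0 * p V2 + 27/2 * (p Vm2)\<^sup>2 * p V4 + 27/2 * p Vm4 * (p V2)\<^sup>2
      - 36 * p Vm4 * p V0 * p V4 = z ^ 3" using u by simp
qed

text \<open>A point of the radical with these values of \<open>C2\<close> and \<open>C3\<close> is a quartic with a double root, which
  \<open>SL2\<close> moves to \<open>0\<close>.\<close>

lemma eigenfun_normal_form:
  "\<exists>t p. eigenfun t p \<and> p V4 = 0 \<and> p V2 = 0 \<and> p V0 = z \<and> p Vm2 = 0"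
proof -
  obtain t p where 0: "eigenfun t p" using eigenfun_exists by blast
  \<comment> \<open>If this polynomial were zero, all coordinates of p would vanish, against the
    value of C2. A nonzero coordinate \<open>Vm4\<close> is the leading coefficient of the quartic
    that needs a root next.\<close>
  have "orbit_e p Vm4 \<noteq> 0"
    using eigenfun_central(1)[OF 0] z0 by auto
  then obtain a where a: "poly (orbit_e p Vm4) a \<noteq> 0" using poly_all_0_iff_0 by blast
  from a obtain t p where 1: "eigenfun t p" "p Vm4 \<noteq> 0"
    using eigenfun_e[OF 0, of a] by blast
  have "\<not> constant (poly (orbit_f p V4))" using 1(2) by (simp add: constant_degree)
  then obtain a where a: "poly (orbit_f p V4) a = 0" using fundamental_theorem_of_algebra by blast
  have "poly (orbit_f p Vm4) a \<noteq> 0" using 1(2) by simp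
  with a obtain t p where 2: "eigenfun t p" "p V4 = 0" "p Vm4 \<noteq> 0"
    using eigenfun_f[OF 1(1), of a] by blast
  note c2 = eigenfun_central[OF 2(1)]
  have "\<exists>t p. eigenfun t p \<and> p V4 = 0 \<and> p V2 = 0"
  \<comment> \<open>The quartic now has a root at zero. If \<open>p V0 = z\<close> this root is
    double already; otherwise the one from \<open>double_root\<close> is moved there.\<close>
  proof (cases "p V0 = z")
    case True
    then have "p Vm2 * p V2 = 0" using c2(1) 2(2) by simp
    moreover have "p Vm4 * (p V2)\<^sup>2 = 0" using c2(2) 2(2) True \<open>p Vm2 * p V2 = 0\<close> by auto
    ultimately have "p V2 = 0" using 2(3) by simp
    then show ?thesis using 2 by blast
  next
    case False
    define x where "x = - 3 * p V2 / (p V0 - z)"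
    have "poly (orbit_f p V4) x = 0" "poly (orbit_f p V2) x = 0"
      using double_root[of "p V0" "p Vm2" "p V2" z "p Vm4", folded x_def] c2 2(2) False
      by (simp_all add: eval_nat_numeral algebra_simps)
    then show ?thesis using eigenfun_f[OF 2(1), of x] by blast
  qed
  then obtain t p where 3: "eigenfun t p" "p V4 = 0" "p V2 = 0" by blast
  have sq: "(p V0)\<^sup>2 = z\<^sup>2" and cu: "p V0 ^ 3 = z ^ 3" using eigenfun_central[OF 3(1)] 3 by simp_all
  have "z\<^sup>2 * p V0 = (p V0)\<^sup>2 * p V0" by (simp only: sq)
  also have "\<dots> = p V0 ^ 3" by (simp add: power3_eq_cube power2_eq_square)
  also have "\<dots> = z\<^sup>2 * z" unfolding cu by (simp add: power3_eq_cube power2_eq_square)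
  finally have V0: "p V0 = z" using z0 by simp
  \<comment> \<open>With \<open>V4\<close> and \<open>V2\<close> gone, exp(x e) fixes the coordinate
    \<open>V0\<close> and adds 2 z x to \<open>Vm2\<close>.\<close>
  define x where "x = - p Vm2 / (2 * z)"
  have "poly (orbit_e p V4) x = 0" "poly (orbit_e p V2) x = 0" "poly (orbit_e p V0) x = z"
    "poly (orbit_e p Vm2) x = 0"
    using 3 V0 z0 by (simp_all add: x_def)
  then show ?thesis using eigenfun_e[OF 3(1), of x] by blast
qed

definition weightfun :: "(l4 uea \<Rightarrow> complex) \<Rightarrow> complex \<Rightarrow> bool" where
  "weightfun t a \<longleftrightarrow> eigenfun t (point z) \<and> (\<forall>u. t (uh * u) = a * t u)"

text \<open>\<open>J\<close> with the equations that give the coordinates in \<open>A\<close> their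
  values at \<open>point z\<close>. For \<open>A = UNIV\<close> the quotient is the fibre of
  \<open>U/J\<close> at this quartic.\<close>

definition rad_ideal :: "rad set \<Rightarrow> l4 uea set" where
  "rad_ideal A = \<Inter>{Q. usubspace Q \<and> J \<subseteq> Q \<and> (\<forall>v\<in>A. \<forall>x. uv v * x - scal (point z v) * x \<in> Q)}"

lemma rad_ideal:
  "usubspace (rad_ideal A)" "J \<subseteq> rad_ideal A"
  "v \<in> A \<Longrightarrow> uv v * x - scal (point z v) * x \<in> rad_ideal A"
  by (auto simp: rad_ideal_def usubspace_def)

lemma rad_idealI:
  assumes "usubspace Q" "J \<subseteq> Q" "\<And>v x. v \<in> A \<Longrightarrow> uv v * x - scal (point z v) * x \<in> Q"
  shows "rad_ideal A \<subseteq> Q"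
  using assms by (auto simp: rad_ideal_def)

text \<open>\<open>h\<close> preserves the equations because it fixes \<open>point z\<close>, where
  only the coordinate of weight zero can be nonzero.\<close>

lemma rad_ideal_closed:
  assumes "x \<in> rad_ideal A"
  shows "uh * x \<in> rad_ideal A" "uv w * x \<in> rad_ideal A"
proof -
  note R = rad_ideal[where A = A] usubspaceD[OF rad_ideal(1)[where A = A]]
  have "rad_ideal A \<subseteq> {x. uh * x \<in> rad_ideal A}"
  proof (rule rad_idealI)
    show "usubspace {x. uh * x \<in> rad_ideal A}"
      using R by (auto simp: usubspace_def distrib_left scal_commutes)
    show "J \<subseteq> {x. uh * x \<in> rad_ideal A}" using R(2) left_idealD(3)[OF J] by blast
    fix v x assume v: "v \<in> A"
    have "uh * (uv v * x - scal (point z v) * x)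
      = (uv v * (uh * x) - scal (point z v) * (uh * x)) + scal (of_int (rwt v)) * (uv v * x - scal (point z v) * x)"
      by (cases "v = V0") (simp_all add: comm_left[OF comm_hv'] algebra_simps scal_commutes point_def
        scal.scalar_zero)
    then show "uv v * x - scal (point z v) * x \<in> {x. uh * x \<in> rad_ideal A}"
      using R(3)[OF v, of "uh * x"] R(3)[OF v, of x] R by simp
  qed
  then show "uh * x \<in> rad_ideal A" using assms by blast
  have "rad_ideal A \<subseteq> {x. uv w * x \<in> rad_ideal A}"
  proof (rule rad_idealI)
    show "usubspace {x. uv w * x \<in> rad_ideal A}"
      using R by (auto simp: usubspace_def distrib_left scal_commutes)
    show "J \<subseteq> {x. uv w * x \<in> rad_ideal A}" using R(2) left_idealD(3)[OF J] by blast
    fix v x assume v: "v \<in> A"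
    have "uv w * (uv v * x - scal (point z v) * x) = uv v * (uv w * x) - scal (point z v) * (uv w * x)"
      by (simp add: right_diff_distrib comm_vv_left scal_commutes)
    then show "uv v * x - scal (point z v) * x \<in> {x. uv w * x \<in> rad_ideal A}"
      using R(3)[OF v, of "uv w * x"] by simp
  qed
  then show "uv w * x \<in> rad_ideal A" using assms by blast
qed

text \<open>If \<open>U\<close> were spanned by \<open>v\<^sub>-\<^sub>4 U\<close> modulo the other equations, it would be so by \<open>v\<^sub>-\<^sub>4\<^sup>k U\<close> for every \<open>k\<close>,
  whose weights are smaller than those of the generators \<open>e\<^sup>i\<close>.\<close>

lemma rad_ideal_UNIV:
  assumes "eigenfun t p" "p V4 = 0" "p V2 = 0" "p V0 = z" "p Vm2 = 0"
  shows "rad_ideal UNIV \<noteq> UNIV"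
proof
  assume U: "rad_ideal UNIV = UNIV"
  define Q where "Q = rad_ideal (- {Vm4})"
  note Q = rad_ideal[where A = "- {Vm4}", folded Q_def]
  note Qc = rad_ideal_closed[where A = "- {Vm4}", folded Q_def]
  note QD = usubspaceD[OF Q(1)]
  have t: "lfun t" "\<And>v u. t (uv v * u) = p v * t u" "\<And>u. u \<in> J \<Longrightarrow> t u = 0"
    using assms(1) by (auto simp: eigenfun_def)
  have pz: "p v = point z v" if "v \<noteq> Vm4" for v using assms that by (cases v) (auto simp: point_def)
  have "Q \<subseteq> {u. t u = 0}" unfolding Q_def
  proof (rule rad_idealI)
    show "J \<subseteq> {u. t u = 0}" using t(3) by blast
  qed (simp_all add: lfun_ker t lfunD[OF t(1)] pz)
  moreover obtain u where "t u \<noteq> 0" using assms(1) by (auto simp: eigenfun_def)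
  ultimately have Q_neq: "Q \<noteq> UNIV" by blast
  have Q_rad: "uv v * x - scal (point z v) * x \<in> Q" if "v \<noteq> Vm4" for v x
    using Q(3)[of v x] that by simp
  have Qst: "rad_stable Q" using Q(1) Qc(2) by (simp add: rad_stable_def)
  \<comment> \<open>If the fibre at \<open>point z\<close> is zero, multiplication by
    \<open>Vm4\<close> is surjective modulo \<open>Q\<close>.\<close>
  have step: "\<exists>y. x - uv Vm4 * y \<in> Q" for x
  proof -
    let ?X = "{x. \<exists>y. x - uv Vm4 * y \<in> Q}"
    have XI: "x \<in> ?X" if "x - uv Vm4 * y \<in> Q" for x y using that by blast
    have "rad_ideal UNIV \<subseteq> ?X"
    proof (rule rad_idealI)
      show "usubspace ?X" unfolding usubspace_def
      proof (intro conjI ballI allI)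
        show "0 \<in> ?X" by (rule XI[of _ 0]) (simp add: QD)
        fix x x' assume "x \<in> ?X" "x' \<in> ?X"
        then obtain y y' where "x - uv Vm4 * y \<in> Q" "x' - uv Vm4 * y' \<in> Q" by blast
        then have "(x + x') - uv Vm4 * (y + y') \<in> Q" using QD(2) by (force simp: algebra_simps)
        then show "x + x' \<in> ?X" by (rule XI)
      next
        fix a x assume "x \<in> ?X"
        then obtain y where "x - uv Vm4 * y \<in> Q" by blast
        then have "scal a * x - uv Vm4 * (scal a * y) \<in> Q"
          using QD(3)[of "x - uv Vm4 * y" a] by (simp add: right_diff_distrib scal_commutes)
        then show "scal a * x \<in> ?X" by (rule XI)
      qed
      show "J \<subseteq> ?X" using Q(2) XI[of _ 0] by auto
      fix v x
      show "uv v * x - scal (point z v) * x \<in> ?X"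
      proof (cases "v = Vm4")
        case True
        show ?thesis by (rule XI[of _ x]) (simp add: True point_def scal.scalar_zero QD)
      next
        case False
        show ?thesis by (rule XI[of _ 0]) (use Q_rad[OF False] in simp)
      qed
    qed
    then show ?thesis using U by blast
  qed
  have pow: "\<exists>y. x - uv Vm4 ^ k * y \<in> Q" for k x
  proof (induction k)
    case 0
    then show ?case using QD(1) by (auto intro!: exI[of _ x])
  next
    case (Suc k)
    then obtain y where y: "x - uv Vm4 ^ k * y \<in> Q" by blast
    obtain y' where y': "y - uv Vm4 * y' \<in> Q" using step by blast
    have "uv Vm4 ^ k * q \<in> Q" if "q \<in> Q" for q k
      using that by (induction k) (simp_all add: Qc mult.assoc)
    then have "(x - uv Vm4 ^ k * y) + uv Vm4 ^ k * (y - uv Vm4 * y') \<in> Q" using y y' QD by simp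
    then have "x - uv Vm4 ^ Suc k * y' \<in> Q" by (simp add: right_diff_distrib power_commutes flip: mult.assoc)
    then show ?case by blast
  qed
  have "ue ^ i \<in> Q" if i: "i \<le> n" for i
  proof -
    define \<mu> :: complex where "\<mu> = 2 * of_nat i - of_nat n"
    \<comment> \<open>The elements that have no component of weight \<mu> modulo \<open>Q\<close>.
      More than n factors \<open>Vm4\<close> push all weights below -n, hence below \<mu>, so such
      products lie in \<open>W\<close>.\<close>
    define W where "W = {x. \<exists>r. poly r \<mu> \<noteq> 0 \<and> pev r uh * x \<in> Q}"
    have WI: "x \<in> W" if "poly r \<mu> \<noteq> 0" "pev r uh * x \<in> Q" for r x using that by (auto simp: W_def)
    have QW: "x \<in> W" if "x \<in> Q" for x by (rule WI[of 1]) (simp_all add: that)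
    have pQ: "pev r uh * x \<in> Q" if "x \<in> Q" for r x by (rule pev_closed[OF Q(1) Qc(1) that])
    have Ws: "usubspace W" unfolding usubspace_def
    proof (intro conjI ballI allI)
      show "0 \<in> W" by (rule QW) (rule QD)
      fix x y assume "x \<in> W" "y \<in> W"
      then obtain r s where rs: "poly r \<mu> \<noteq> 0" "pev r uh * x \<in> Q" "poly s \<mu> \<noteq> 0" "pev s uh * y \<in> Q"
        by (auto simp: W_def)
      have "pev (r * s) uh * (x + y) = pev s uh * (pev r uh * x) + pev r uh * (pev s uh * y)"
        by (simp add: distrib_left mult.commute[of r s] pev_mult[symmetric] mult.assoc[symmetric])
      also have "\<dots> \<in> Q" using rs pQ QD by simp
      finally show "x + y \<in> W" by (rule WI[rotated]) (use rs in simp)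
    next
      fix a x assume "x \<in> W"
      then obtain r where r: "poly r \<mu> \<noteq> 0" "pev r uh * x \<in> Q" by (auto simp: W_def)
      then have "pev r uh * (scal a * x) \<in> Q" using QD(3) by (simp add: scal_left_commute[of "pev r uh"])
      then show "scal a * x \<in> W" by (rule WI[OF r(1)])
    qed
    note WD = usubspaceD[OF Ws]
    have "{x. \<forall>k>n. uv Vm4 ^ k * x \<in> W} = UNIV"
    proof (rule rad_span)
      show "rad_stable {x. \<forall>k>n. uv Vm4 ^ k * x \<in> W}"
        unfolding rad_stable_def
      proof (intro conjI allI ballI)
        show "usubspace {x. \<forall>k>n. uv Vm4 ^ k * x \<in> W}"
          using WD by (auto simp: usubspace_def distrib_left scal_commutes)
        fix v x assume x: "x \<in> {x. \<forall>k>n. uv Vm4 ^ k * x \<in> W}"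
        show "uv v * x \<in> {x. \<forall>k>n. uv Vm4 ^ k * x \<in> W}"
        proof (rule CollectI, intro allI impI)
          fix k assume k: "k > n"
          show "uv Vm4 ^ k * (uv v * x) \<in> W"
          proof (cases "v = Vm4")
            case True
            have "uv Vm4 ^ k * (uv v * x) = uv Vm4 ^ Suc k * x"
              unfolding True by (simp only: power_Suc2 mult.assoc)
            then show ?thesis using x k by (auto simp del: power_Suc)
          next
            case False
            have c: "uv Vm4 ^ k * (uv v * x) = uv v * (uv Vm4 ^ k * x)" for k
              by (induction k) (simp_all add: mult.assoc comm_vv_left)
            have d: "uv v * (uv Vm4 ^ k * x) - scal (point z v) * (uv Vm4 ^ k * x) \<in> W"
              by (rule QW, rule Q_rad[OF False])
            have "uv Vm4 ^ k * x \<in> W" using x k by blast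
            then show ?thesis unfolding c by (rule usubspace_cong_mem[OF Ws d WD(3)])
          qed
        qed
      qed
      show "J \<subseteq> {x. \<forall>k>n. uv Vm4 ^ k * x \<in> W}" using Q(2) QW left_idealD(3)[OF J] by blast
      fix i' assume i': "i' \<le> n"
      show "ue ^ i' \<in> {x. \<forall>k>n. uv Vm4 ^ k * x \<in> W}"
      proof (rule CollectI, intro allI impI)
        fix k assume k: "k > n"
        define \<nu> :: complex where "\<nu> = 2 * of_nat i' - of_nat n - 4 * of_nat k"
        have w: "uh * (uv Vm4 ^ k * u) = uv Vm4 ^ k * (uh * u) - scal (4 * of_nat k) * (uv Vm4 ^ k * u)" for k u
        proof (induction k)
          case (Suc k)
          have "uh * (uv Vm4 ^ Suc k * u) = uv Vm4 * (uh * (uv Vm4 ^ k * u)) - 4 * (uv Vm4 ^ Suc k * u)"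
            by (simp add: mult.assoc comm_left_minus[OF comm_hv(5)])
          also have "4 * (uv Vm4 ^ Suc k * u) = scal 4 * (uv Vm4 ^ Suc k * u)" by (simp add: scal_numeral)
          finally show ?case unfolding Suc of_nat_Suc distrib_left
            by (simp add: scal.scalar_add algebra_simps scal_commutes)
        qed (simp add: scal.scalar_zero)
        have "uh * (uv Vm4 ^ k * ue ^ i') - scal \<nu> * (uv Vm4 ^ k * ue ^ i')
          = uv Vm4 ^ k * (uh * ue ^ i' - scal (2 * of_nat i' - of_nat n) * ue ^ i')"
          unfolding w \<nu>_def by (simp add: scal_diff scal.scalar_add algebra_simps scal_commutes)
        also have "\<dots> \<in> J" by (rule left_idealD(3)[OF J weight_e])
        finally have "pev [:- \<nu>, 1:] uh * (uv Vm4 ^ k * ue ^ i') \<in> Q"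
          using Q(2) by (simp only: pev_linear left_diff_distrib) blast
        moreover have "\<mu> \<noteq> \<nu>"
        proof
          assume "\<mu> = \<nu>"
          then have "of_nat (2 * i + 4 * k) = (of_nat (2 * i') :: complex)"
            by (simp add: \<mu>_def \<nu>_def algebra_simps)
          then have "2 * i + 4 * k = 2 * i'" by (simp only: of_nat_eq_iff)
          then show False using k i' by simp
        qed
        ultimately show "uv Vm4 ^ k * ue ^ i' \<in> W" by (intro WI[of "[:- \<nu>, 1:]"]) auto
      qed
    qed
    then have W: "uv Vm4 ^ Suc n * x \<in> W" for x by blast
    obtain y where y: "ue ^ i - uv Vm4 ^ Suc n * y \<in> Q" using pow by blast
    then have "ue ^ i \<in> W" using usubspace_cong_mem[OF Ws QW[OF y] W] by simp
    then obtain r where r: "poly r \<mu> \<noteq> 0" "pev r uh * ue ^ i \<in> Q" by (auto simp: W_def)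
    have "pev r uh * ue ^ i - scal (poly r \<mu>) * ue ^ i \<in> Q"
      by (rule pev_eigen[OF Q(1) Qc(1)]) (use weight_e[of i] Q(2) in \<open>auto simp: \<mu>_def\<close>)
    then have "scal (poly r \<mu>) * ue ^ i \<in> Q" using r(2) usubspace_cong[OF Q(1)] by blast
    then show ?thesis using usubspace_scal_iff[OF Q(1) r(1)] by blast
  qed
  then show False using rad_span[OF Qst Q(2)] Q_neq by blast
qed

text \<open>The fibre at \<open>point z\<close> is nonzero and spanned by powers of
  \<open>e\<close>, which are weight vectors. A functional that is nonzero on one of them is
  composed with a polynomial in \<open>h\<close> that projects to its weight.\<close>

lemma weightfun_exists: "\<exists>t i. i \<le> n \<and> weightfun t (2 * of_nat i - of_nat n)"
proof -
  define Q where "Q = rad_ideal UNIV"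
  note Q = rad_ideal[where A = UNIV, folded Q_def]
  note Qc = rad_ideal_closed[where A = UNIV, folded Q_def]
  note QD = usubspaceD[OF Q(1)]
  have "Q \<noteq> UNIV" using eigenfun_normal_form rad_ideal_UNIV unfolding Q_def by blast
  moreover have Qst: "rad_stable Q" using Q(1) Qc(2) by (simp add: rad_stable_def)
  ultimately obtain i where i: "i \<le> n" "ue ^ i \<notin> Q" using rad_span[OF _ Q(2)] by blast
  obtain s where s: "lfun s" "\<And>x. x \<in> Q \<Longrightarrow> s x = 0" "s (ue ^ i) = 1"
    using functional_extension[OF Q(1) i(2)] by metis
  define \<mu> :: complex where "\<mu> = 2 * of_nat i - of_nat n"
  \<comment> \<open>The roots are the weights of the generators other than the i-th power of
    \<open>e\<close>.\<close>
  define r where "r = (\<Prod>j\<in>{..n} - {i}. [:- (2 * of_nat j - of_nat n), 1 :: complex:])"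
  define t where "t u = s (pev r uh * u)" for u
  have pQ: "pev r uh * x \<in> Q" if "x \<in> Q" for r x by (rule pev_closed[OF Q(1) Qc(1) that])
  have lt: "lfun t"
    unfolding lfun_def t_def by (simp add: distrib_left lfunD[OF s(1)] scal_left_commute[of "pev r uh"])
  have tQ: "t x = 0" if "x \<in> Q" for x using pQ[OF that] s(2) by (simp add: t_def)
  have te: "t (ue ^ i) \<noteq> 0"
  proof -
    have "pev r uh * ue ^ i - scal (poly r \<mu>) * ue ^ i \<in> Q"
      by (rule pev_eigen[OF Q(1) Qc(1)]) (use weight_e[of i] Q(2) in \<open>auto simp: \<mu>_def\<close>)
    then have "t (ue ^ i) = poly r \<mu>" using s(2)[of "pev r uh * ue ^ i - scal (poly r \<mu>) * ue ^ i"] s(3)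
      by (simp add: t_def lfunD[OF s(1)])
    moreover have "poly r \<mu> \<noteq> 0" unfolding r_def poly_prod \<mu>_def by (subst prod_zero_iff) auto
    ultimately show ?thesis by simp
  qed
  have "{u. pev ([:- \<mu>, 1:] * r) uh * u \<in> Q} = UNIV"
  proof (rule rad_span)
    show "rad_stable {u. pev ([:- \<mu>, 1:] * r) uh * u \<in> Q}" (is "rad_stable ?X")
      unfolding rad_stable_def
    proof (intro conjI allI ballI)
      show X: "usubspace ?X"
        unfolding usubspace_def mem_Collect_eq distrib_left scal_left_commute[of "pev _ _"]
        by (auto simp: QD simp del: pev_pCons)
      have QX: "Q \<subseteq> ?X" using pQ by blast
      fix v x assume "x \<in> ?X"
      then have "scal (point z v) * x \<in> ?X" by (rule usubspaceD(3)[OF X])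
      then show "uv v * x \<in> ?X" by (rule usubspace_cong_mem[OF X subsetD[OF QX Q(3)], OF UNIV_I])
    qed
    show "J \<subseteq> {u. pev ([:- \<mu>, 1:] * r) uh * u \<in> Q}" using Q(2) pQ by blast
    fix j assume j: "j \<le> n"
    have "poly ([:- \<mu>, 1:] * r) (2 * of_nat j - of_nat n) = 0"
    proof (cases "j = i")
      case False
      then have "poly r (2 * of_nat j - of_nat n) = 0"
        unfolding r_def poly_prod by (intro prod_zero) (use j in auto)
      then show ?thesis by (simp only: poly_mult) simp
    qed (simp only: poly_mult, simp add: \<mu>_def)
    moreover have "pev ([:- \<mu>, 1:] * r) uh * ue ^ j - scal (poly ([:- \<mu>, 1:] * r) (2 * of_nat j - of_nat n)) * ue ^ j \<in> Q"
      by (rule pev_eigen[OF Q(1) Qc(1)]) (use weight_e[of j] Q(2) in auto)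
    ultimately show "ue ^ j \<in> {u. pev ([:- \<mu>, 1:] * r) uh * u \<in> Q}"
      by (simp only: scal.scalar_zero mult_zero_left diff_zero mem_Collect_eq)
  qed
  then have *: "pev ([:- \<mu>, 1:] * r) uh * u \<in> Q" for u by blast
  have "t (uh * u) = \<mu> * t u" for u
  proof -
    have "pev ([:- \<mu>, 1:] * r) uh * u = pev r uh * (uh * u) - scal \<mu> * (pev r uh * u)"
      by (simp only: pev_mult pev_linear left_diff_distrib mult.assoc)
         (simp only: mult.assoc[symmetric] pev_commute)
    then show ?thesis using s(2)[OF *[of u]] by (simp add: t_def lfunD[OF s(1)])
  qed
  moreover have "t (uv v * u) = point z v * t u" for v u
    using tQ[OF Q(3), of v u] by (simp add: lfunD[OF lt])
  ultimately have "weightfun t \<mu>"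
    using lt tQ Q(2) te by (auto simp: weightfun_def eigenfun_def intro: exI[of _ "ue ^ i"])
  then show ?thesis using i by (auto simp: \<mu>_def)
qed

text \<open>The Weyl group element \<open>exp(e) exp(-f) exp(e)\<close> fixes \<open>point z\<close> and reverses the weight.\<close>

lemma weightfun_flip:
  assumes "weightfun t a"
  shows "\<exists>t. weightfun t (- a)"
proof -
  have 0: "eigenfun t (point z)" "\<And>u. t (uh * u) = a * t u" using assms by (auto simp: weightfun_def)
  interpret t: nil_fun J ue t by (rule nil_funI[OF 0(1)]) simp
  define t1 where "t1 = t.texp 1"
  define p1 where "p1 = (\<lambda>v. poly (orbit_e (point z) v) 1)"
  have 1: "eigenfun t1 p1" using eigenfun_e[OF 0(1), of 1] by (simp add: t1_def p1_def)
  \<comment> \<open>Along the three exponentials the element of \<open>sl2\<close> that acts by the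
    scalar a runs through h, h + 2 e, - h + 2 e and - h.\<close>
  have h1: "t1 (uh * u) + 2 * t1 (ue * u) = a * t1 u" for u
    using t.texp_sl2[of "[:1:]" 0 "[:0, 2:]" a 1 u] 0(2) by (simp add: t1_def pderiv_pCons)
  interpret t1: nil_fun J uf t1 by (rule nil_funI[OF 1]) simp
  define t2 where "t2 = t1.texp (- 1)"
  define p2 where "p2 = (\<lambda>v. poly (orbit_f p1 v) (- 1))"
  have 2: "eigenfun t2 p2" using eigenfun_f[OF 1, of "- 1"] by (simp add: t2_def p2_def)
  have h2: "- t2 (uh * u) + 2 * t2 (ue * u) = a * t2 u" for u
    using t1.texp_sl2[of "[:1, 2:]" "[:0, -2, -2:]" "[:2:]" a "- 1" u] h1
    by (simp add: t2_def pderiv_pCons)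
  interpret t2: nil_fun J ue t2 by (rule nil_funI[OF 2]) simp
  define t3 where "t3 = t2.texp 1"
  define p3 where "p3 = (\<lambda>v. poly (orbit_e p2 v) 1)"
  have 3: "eigenfun t3 p3" using eigenfun_e[OF 2, of 1] by (simp add: t3_def p3_def)
  have h3: "- t3 (uh * u) = a * t3 u" for u
    using t2.texp_sl2[of "[:- 1:]" 0 "[:2, - 2:]" a 1 u] h2 by (simp add: t3_def pderiv_pCons)
  have "p3 = point z"
  proof
    fix v show "p3 v = point z v" by (cases v) (simp_all add: p3_def p2_def p1_def point_def)
  qed
  then have "weightfun t3 (- a)"
    using 3 h3 by (simp add: weightfun_def) (metis add.inverse_inverse)
  then show ?thesis by blast
qed

lemma weightfun_neg: "\<exists>t m. weightfun t (- of_nat m)"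
proof -
  obtain t i where t: "weightfun t (2 * of_nat i - of_nat n)" using weightfun_exists by blast
  show ?thesis
  proof (cases "2 * i \<le> n")
    case True
    have "2 * of_nat i - of_nat n = - (of_nat (n - 2 * i) :: complex)"
      using True by (simp add: of_nat_diff)
    then show ?thesis using t by metis
  next
    case False
    have "- (2 * of_nat i - of_nat n) = - (of_nat (2 * i - n) :: complex)"
      using False by (simp add: of_nat_diff)
    then show ?thesis using weightfun_flip[OF t] by metis
  qed
qed

lemma act_point_0: "act m z (uv v) G 0 0 = point z v * G 0 0"
  by (cases v) (simp_all add: point_def act_v_0 act_Vm4)

text \<open>Frobenius reciprocity: a weight functional t at \<open>point z\<close> maps
  \<open>U/J\<close> to functions, sending x to the function with coefficients
  \<open>t (ue ^ l * uf ^ k * x)\<close>. The image of the generator does not depend on u because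
  \<open>uf\<close> is in \<open>J\<close>, and its weight leaves a single power of s, so it is a
  multiple of \<open>yv j\<close>. Maximality makes the map injective.\<close>

theorem ideal_eq_annB:
  assumes max: "maximal_left_ideal J"
  shows "\<exists>m j. J = annB (of_nat m) z j \<and> n = m + 2 * j"
proof -
  obtain t m where t: "weightfun t (- of_nat m)" using weightfun_neg by blast
  have lt: "lfun t" and tJ: "\<And>u. u \<in> J \<Longrightarrow> t u = 0" and tv: "\<And>v u. t (uv v * u) = point z v * t u"
    and th: "\<And>u. t (uh * u) = - of_nat m * t u" and tn: "\<exists>u. t u \<noteq> 0"
    using t by (auto simp: weightfun_def eigenfun_def)
  have zero: "t (ue ^ l * uf ^ Suc k) = 0" for k l
  proof -
    have "ue ^ l * uf ^ Suc k = (ue ^ l * uf ^ k) * uf" by (simp only: power_Suc2 mult.assoc)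
    then show ?thesis using tJ left_idealD(3)[OF J fJ] by metis
  qed
  have wt: "2 * l + m = n" if "t (ue ^ l) \<noteq> 0" for l
  proof -
    have "t (uh * ue ^ l) = (2 * of_nat l - of_nat n) * t (ue ^ l)"
      using tJ[OF weight_e[of l]] by (simp add: lfunD[OF lt])
    then have "(2 * of_nat l - of_nat n) * t (ue ^ l) = - of_nat m * t (ue ^ l)" by (simp only: th)
    then have "2 * of_nat l - of_nat n = - (of_nat m :: complex)" using that by (metis mult_cancel_right)
    then have "of_nat (2 * l + m) = (of_nat n :: complex)" by (simp add: algebra_simps)
    then show ?thesis by (simp only: of_nat_eq_iff)
  qed
  have "\<exists>l. t (ue ^ l) \<noteq> 0"
  proof (rule ccontr)
    assume no: "\<not> ?thesis"
    have "t (ue ^ l * uf ^ k) = 0" for k l using no zero by (cases k) auto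
    then have "t u = 0" for u by (rule lfun_unique[of t "point z" "- of_nat m", OF lt tv th])
    then show False using tn by blast
  qed
  then obtain j where j: "t (ue ^ j) \<noteq> 0" by blast
  have n: "n = m + 2 * j" using wt[OF j] by simp
  \<comment> \<open>Both functionals satisfy the equations of \<open>lfun_unique\<close> and agree
    on the monomials, so their difference is zero.\<close>
  define s where "s u = t u - t (ue ^ j) * act (of_nat m) z u (yv j) 0 0" for u
  have s0: "s u = 0" for u
  proof (rule lfun_unique[of s "point z" "- of_nat m"])
    show "lfun s" by (simp add: lfun_def s_def act_simps lfunD[OF lt] algebra_simps)
    show "s (uv v * u) = point z v * s u" for v u
      by (simp add: s_def act_simps act_point_0 tv algebra_simps)
    show "s (uh * u) = - of_nat m * s u" for u by (simp add: s_def act_simps act_h th algebra_simps)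
    show "s (ue ^ l * uf ^ k) = 0" for k l
    proof (cases k)
      case 0
      then show ?thesis using wt[of l] n
        by (cases "l = j") (auto simp: s_def act_e_pow_0 yv_def)
    next
      case (Suc i)
      then show ?thesis using zero[of l i] by (simp add: s_def act_coord yv_def del: power_Suc)
    qed
  qed
  have st: "t u = t (ue ^ j) * act (of_nat m) z u (yv j) 0 0" for u
    using s0[of u] unfolding s_def by (simp only: right_minus_eq)
  \<comment> \<open>By \<open>act_coord\<close> a function is zero once all its translates vanish at
    the base point, so the annihilator is the largest left ideal in the kernel of t.\<close>
  have "annB (of_nat m) z j = {u. \<forall>a. t (a * u) = 0}"
  proof (rule Set.set_eqI)
    fix u
    have c: "act (of_nat m) z ((ue ^ l * uf ^ k) * u) (yv j) 0 0 = act (of_nat m) z u (yv j) k l" for k l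
      by (simp only: act_simps(2)[of _ _ "ue ^ l * uf ^ k" u] act_coord)
    have t0: "t (a * u) = 0 \<longleftrightarrow> act (of_nat m) z (a * u) (yv j) 0 0 = 0" for a
      unfolding st[of "a * u"] using j by simp
    show "u \<in> annB (of_nat m) z j \<longleftrightarrow> u \<in> {u. \<forall>a. t (a * u) = 0}"
    proof
      assume "u \<in> annB (of_nat m) z j"
      then have "a * u \<in> annB (of_nat m) z j" for a by (rule left_idealD(3)[OF annB_left_ideal])
      then show "u \<in> {u. \<forall>a. t (a * u) = 0}" unfolding mem_Collect_eq t0 by (simp add: annB_def)
    next
      assume "u \<in> {u. \<forall>a. t (a * u) = 0}"
      then have "act (of_nat m) z u (yv j) k l = 0" for k l unfolding mem_Collect_eq t0 c[symmetric] by blast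
      then show "u \<in> annB (of_nat m) z j" by (simp add: annB_def fun_eq_iff)
    qed
  qed
  moreover have "J \<subseteq> {u. \<forall>a. t (a * u) = 0}" using tJ left_idealD(3)[OF J] by blast
  ultimately have "J \<subseteq> annB (of_nat m) z j" by simp
  then have "annB (of_nat m) z j = J"
    using max annB_left_ideal annB_1 unfolding maximal_left_ideal_def by blast
  then show ?thesis using n by blast
qed

end

subsection \<open>The standard maximal left ideals\<close>

text \<open>All coefficients are values of translates at the base point, and a central element
  commutes with the translations; so it acts by the scalar seen at the base point.\<close>

lemma act_central:
  assumes c: "\<And>u. u * x = x * u" and 0: "\<And>H. act m c x H 0 0 = a * H 0 0"
  shows "act m c x G = (\<lambda>k l. a * G k l)"
proof (intro HOL.ext)
  fix k l
  have "act m c x G k l = act m c (ue ^ l * uf ^ k * x) G 0 0"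
    by (simp only: act_simps(2)[of _ _ "ue ^ l * uf ^ k" x] act_coord)
  also have "\<dots> = act m c x (act m c (ue ^ l * uf ^ k) G) 0 0" by (simp only: c act_simps(2))
  also have "\<dots> = a * G k l" by (simp only: 0 act_coord)
  finally show "act m c x G k l = a * G k l" .
qed

lemma act_C2: "act m c C2 G = (\<lambda>k l. c ^ 2 * G k l)"
proof (rule act_central[OF C2_central])
  fix H show "act m c C2 H 0 0 = c ^ 2 * H 0 0"
    by (simp add: C2_alt act_simps act_diff power2_eq_square act_v_0 act_Vm4)
qed

lemma act_C3: "act m c C3 G = (\<lambda>k l. c ^ 3 * G k l)"
proof (rule act_central[OF C3_central])
  fix H show "act m c C3 H 0 0 = c ^ 3 * H 0 0"
    by (simp add: C3_alt act_simps act_diff power2_eq_square power3_eq_cube act_v_0 act_Vm4)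
qed

lemma annB_C2: "C2 * u - scal (c ^ 2) * u \<in> annB m c j"
  and annB_C3: "C3 * u - scal (c ^ 3) * u \<in> annB m c j"
  by (simp_all add: annB_def act_diff act_simps act_C2 act_C3)

text \<open>At this exponent the factor in \<open>act_f_e_pow_yv\<close> vanishes, so
  \<open>f\<close> kills the vector and only its row k = 0 could be nonzero. There the power of
  \<open>e\<close> shifts s^j away.\<close>

lemma annB_e_pow: "ue ^ Suc (m + 2 * j) \<in> annB (of_nat m) c j"
proof -
  define G where "G = act (of_nat m) c (ue ^ Suc (m + 2 * j)) (yv j)"
  have "act (of_nat m) c uf G = (\<lambda>k l. 0)"
    unfolding G_def act_f_e_pow_yv by simp
  then have "G (Suc k) l = 0" for k l by (rule act_low_row)
  moreover have "G 0 l = 0" for l by (simp add: G_def act_e_pow_0 yv_def del: power_Suc)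
  ultimately have "G k l = 0" for k l by (cases k) simp_all
  then show ?thesis by (simp add: annB_def G_def fun_eq_iff del: power_Suc)
qed

lemma annB_lowest: "lowest_weight (annB (of_nat m) c j) (m + 2 * j)"
  by unfold_locales (use annB_left_ideal annB_f annB_h[of "of_nat m" j c] annB_e_pow annB_1 in auto)

lemma annB_lowest_central: "c \<noteq> 0 \<Longrightarrow> lowest_central (annB (of_nat m) c j) (m + 2 * j) c"
  unfolding lowest_central_def lowest_central_axioms_def
  using annB_lowest annB_C2 annB_C3 by blast

text \<open>For \<open>m = 0\<close> the functions \<open>y\<^sub>j\<close> of even and of odd \<open>j\<close> are separated by the points \<open>(u, s) = (0, 1)\<close> and
  \<open>(1, -1)\<close>, which represent the same quartic with its two roots interchanged.\<close>

context lowest_central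
begin

definition fun1 :: "(l4 uea \<Rightarrow> complex) \<Rightarrow> l4 uea \<Rightarrow> complex" where
  "fun1 t = nil_fun.texp ue t 1"

definition fun2 :: "(l4 uea \<Rightarrow> complex) \<Rightarrow> l4 uea \<Rightarrow> complex" where
  "fun2 t = nil_fun.texp uf (nil_fun.texp ue t (- 1)) 1"

text \<open>Both functionals sit over the same quartic, and such a functional is determined by its
  values on the generators from \<open>rad_span\<close>.\<close>

lemma two_points:
  assumes t: "eigenfun t (point z)" and e: "\<And>k. k \<le> n \<Longrightarrow> fun1 t (ue ^ k) = b * fun2 t (ue ^ k)"
  shows "fun1 t u = b * fun2 t u"
proof -
  define p where "p = (\<lambda>v. poly (orbit_e (point z) v) 1)"
  define q where "q = (\<lambda>v. poly (orbit_e (point z) v) (- 1))"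
  have 1: "eigenfun (fun1 t) p" using eigenfun_e[OF t, of 1] by (simp add: fun1_def p_def)
  have "eigenfun (nil_fun.texp ue t (- 1)) q" using eigenfun_e[OF t, of "- 1"] by (simp add: q_def)
  then have "eigenfun (fun2 t) (\<lambda>v. poly (orbit_f q v) 1)"
    unfolding fun2_def by (rule eigenfun_f)
  moreover have "(\<lambda>v. poly (orbit_f q v) 1) = p"
  proof
    fix v show "poly (orbit_f q v) 1 = p v" by (cases v) (simp_all add: p_def q_def point_def)
  qed
  ultimately have 2: "eigenfun (fun2 t) p" by simp
  have "{u. fun1 t u = b * fun2 t u} = UNIV"
  proof (rule rad_span)
    show "rad_stable {u. fun1 t u = b * fun2 t u}"
      using 1 2 by (auto simp: rad_stable_def usubspace_def eigenfun_def lfunD algebra_simps)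
    show "J \<subseteq> {u. fun1 t u = b * fun2 t u}" using 1 2 by (auto simp: eigenfun_def)
  qed (use e in auto)
  then show ?thesis by blast
qed

end

section \<open>Even and odd functions for m = 0\<close>

lemma parity_eigenfun:
  assumes "c \<noteq> 0" "j < 2"
  shows "lowest_weight.eigenfun (annB 0 c j) (\<lambda>u. act 0 c u (yv j) 0 0) (point c)"
proof -
  interpret lowest_central "annB 0 c j" "2 * j" c
    using annB_lowest_central[of c 0 j] assms by simp
  have "act 0 c (ue ^ j) (yv j) 0 0 \<noteq> 0" by (simp add: act_e_pow_0 yv_def)
  then show ?thesis unfolding eigenfun_def
    by (auto simp: lfun_def act_simps annB_def act_point_0)
qed

lemma texp_e_yv:
  assumes "c \<noteq> 0" "j < 2" and H: "act 0 c u (yv j) = H" "act 0 c (ue ^ 3) H = (\<lambda>k l. 0)"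
  shows "nil_fun.texp ue (\<lambda>u. act 0 c u (yv j) 0 0) a u = H 0 0 + H 0 1 * a + H 0 2 * a\<^sup>2 / 2"
proof -
  interpret lowest_central "annB 0 c j" "2 * j" c
    using annB_lowest_central[of c 0 j] assms by simp
  interpret nil_fun "annB 0 c j" ue "\<lambda>u. act 0 c u (yv j) 0 0"
    by (rule nil_funI[OF parity_eigenfun[OF assms(1,2)]]) simp
  have "ue ^ Suc 2 * u \<in> annB 0 c j"
    unfolding annB_def mem_Collect_eq act_simps(2)[of _ _ "ue ^ Suc 2" u] H(1) using H(2) by simp
  then show ?thesis
    by (subst texp_eval[of 2])
       (simp_all add: act_simps(2)[of _ _ "_ ^ _" u] H(1) act_e_pow_0 act_simps(3) eval_nat_numeral)
qed

lemma texp_f_yv: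
  assumes "c \<noteq> 0" "j < 2" and H: "act 0 c (uf ^ 3 * u) (yv j) = (\<lambda>k l. 0)"
  defines "t \<equiv> nil_fun.texp ue (\<lambda>u. act 0 c u (yv j) 0 0) (- 1)"
  shows "nil_fun.texp uf t 1 u = t u + t (uf * u) + t (uf * (uf * u)) / 2"
proof -
  interpret lowest_central "annB 0 c j" "2 * j" c
    using annB_lowest_central[of c 0 j] assms by simp
  have "eigenfun t (\<lambda>v. poly (orbit_e (point c) v) (- 1))"
    unfolding t_def by (rule eigenfun_e[OF parity_eigenfun[OF assms(1,2)]])
  then interpret nil_fun "annB 0 c j" uf t by (rule nil_funI) simp
  have "uf ^ Suc 2 * u \<in> annB 0 c j"
    unfolding annB_def mem_Collect_eq using H by simp
  then show ?thesis
    by (subst texp_eval[of 2]) (simp_all add: eval_nat_numeral mult.assoc)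
qed

text \<open>The function 1 takes equal values at the two points, hence so does everything it
  generates; but s takes the values 1 and -1.\<close>

lemma parity_0:
  assumes "c \<noteq> 0"
  shows "act 0 c u (yv 0) \<noteq> yv 1"
proof
  assume u: "act 0 c u (yv 0) = yv 1"
  interpret lowest_central "annB 0 c 0" "0" c
    using annB_lowest_central[of c 0 0] assms by simp
  let ?t = "\<lambda>u. act 0 c u (yv 0) 0 0"
  have e1: "act 0 c (ue ^ 3) (yv 1) = (\<lambda>k l. 0)"
    using annB_e_pow[of 0 1 c] by (simp add: annB_def numeral_3_eq_3 del: power_Suc)
  have "act 0 c (ue ^ 2) (act 0 c ue (yv 0)) = (\<lambda>k l. 0)"
    using annB_e_pow[of 0 0 c] by (simp add: annB_def)
  then have e0: "act 0 c (ue ^ 3) (yv 0) = (\<lambda>k l. 0)"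
    by (simp add: numeral_3_eq_3 numeral_2_eq_2 act_simps)
  note E = texp_e_yv[OF assms, of 0, simplified] and F = texp_f_yv[OF assms, of 0, simplified]
  have y: "act 0 c uf (yv i) = (\<lambda>k l. 0)" for i by (rule act_f_yv)
  have E1: "nil_fun.texp ue ?t a 1 = 1" for a
    using E[of 1 "yv 0" a] e0 by (simp add: act_simps(3) yv_def)
  have Eu: "nil_fun.texp ue ?t a u = a" for a
    using E[of u "yv 1" a] e1 u by (simp add: yv_def)
  have E0: "nil_fun.texp ue ?t a x = 0" if "act 0 c x (yv 0) = (\<lambda>k l. 0)" for a x
    using E[of x "\<lambda>k l. 0" a] that by simp
  have "fun1 ?t 1 = 1" "fun1 ?t u = 1" by (simp_all add: fun1_def E1 Eu)
  moreover have "fun2 ?t 1 = 1" "fun2 ?t u = - 1"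
    using F[of 1] F[of u] by (simp_all add: fun2_def E1 Eu E0 act_simps y u numeral_3_eq_3)
  moreover have "fun1 ?t u = 1 * fun2 ?t u"
    by (rule two_points[OF parity_eigenfun[OF assms]]) (use calculation in auto)
  ultimately show False by simp
qed

text \<open>The function s and its \<open>sl2\<close>-translates take opposite values at the two
  points, hence so does everything they generate; but 1 takes equal nonzero values.\<close>

lemma parity_1:
  assumes "c \<noteq> 0"
  shows "act 0 c u (yv 1) \<noteq> yv 0"
proof
  note One_nat_def [simp del]
  assume u: "act 0 c u (yv 1) = yv 0"
  interpret lowest_central "annB 0 c 1" "2" c
    using annB_lowest_central[of c 0 1] assms by (simp add: numeral_2_eq_2)
  let ?t = "\<lambda>u. act 0 c u (yv 1) 0 0"
  have e1: "act 0 c (ue ^ 3) (yv 1) = (\<lambda>k l. 0)"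
    using annB_e_pow[of 0 1 c] by (simp add: annB_def numeral_3_eq_3 del: power_Suc)
  have ek: "act 0 c (ue ^ 3) (act 0 c (ue ^ k) (yv 1)) = (\<lambda>k l. 0)" for k
    by (simp only: act_simps(2)[symmetric] power_add[symmetric] add.commute)
       (simp only: power_add act_simps(2) e1 act_zero)
  have e0: "act 0 c (ue ^ 3) (yv 0) = (\<lambda>k l. 0)"
  proof -
    have "act 0 c (ue ^ 2) (act 0 c ue (yv 0)) = (\<lambda>k l. 0)"
      using annB_e_pow[of 0 0 c] by (simp add: annB_def)
    then show ?thesis by (simp add: numeral_3_eq_3 numeral_2_eq_2 act_simps)
  qed
  note E = texp_e_yv[OF assms, of 1, simplified] and F = texp_f_yv[OF assms, of 1, simplified]
  have y: "act 0 c uf (yv i) = (\<lambda>k l. 0)" for i by (rule act_f_yv)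
  have fe: "act 0 c uf (act 0 c ue (yv 1)) = (\<lambda>k l. 2 * yv 1 k l)"
    "act 0 c uf (act 0 c (ue ^ 2) (yv 1)) = (\<lambda>k l. 2 * act 0 c ue (yv 1) k l)"
    using act_f_e_pow_yv'[of 1 0 c 1] act_f_e_pow_yv'[of 2 0 c 1] by (simp_all add: act_simps(3))
  have E1: "nil_fun.texp ue ?t a 1 = a" for a
    using E[of 1 "yv 1" a] e1 by (simp add: act_simps(3) yv_def)
  have Ee: "nil_fun.texp ue ?t a ue = 1" for a
    using E[of ue _ a, OF refl] ek[of 1] by (simp add: act_e yv_def)
  have Ee2: "nil_fun.texp ue ?t a (ue ^ 2) = 0" for a
    using E[of "ue ^ 2" _ a, OF refl] ek[of 2] by (simp add: act_e_pow_0 yv_def)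
  have Eu: "nil_fun.texp ue ?t a u = 1" for a
    using E[of u "yv 0" a] e0 u by (simp add: yv_def)
  have E0: "nil_fun.texp ue ?t a x = 0" if "act 0 c x (yv 1) = (\<lambda>k l. 0)" for a x
    using E[of x "\<lambda>k l. 0" a] that by simp
  have E2: "nil_fun.texp ue ?t a x = b * nil_fun.texp ue ?t a x'"
    if "act 0 c x (yv 1) = (\<lambda>k l. b * act 0 c x' (yv 1) k l)"
      "act 0 c (ue ^ 3) (act 0 c x' (yv 1)) = (\<lambda>k l. 0)" for a b x x'
    using E[of x _ a, OF refl] E[of x' _ a, OF refl] that by (simp add: act_linear algebra_simps)
  have Efe: "nil_fun.texp ue ?t a (uf * ue) = 2 * a" for a
    using E2[of "uf * ue" 2 1 a] e1 by (simp add: act_simps fe E1)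
  have Efe2: "nil_fun.texp ue ?t a (uf * ue ^ 2) = 2" for a
    using E2[of "uf * ue ^ 2" 2 ue a] ek[of 1]
    by (simp add: act_simps(2)[of _ _ uf "ue ^ 2"] fe Ee)
  have Effe2: "nil_fun.texp ue ?t a (uf * (uf * ue ^ 2)) = 4 * a" for a
    using E2[of "uf * (uf * ue ^ 2)" 4 1 a] e1
    by (simp add: act_simps(2)[of _ _ uf] act_simps(3) fe E1 act_linear)
  have "fun1 ?t 1 = 1" "fun1 ?t ue = 1" "fun1 ?t (ue ^ 2) = 0" "fun1 ?t u = 1"
    by (simp_all add: fun1_def E1 Eu Ee Ee2)
  moreover have "fun2 ?t 1 = - 1" "fun2 ?t u = 1"
    using F[of 1] F[of u] by (simp_all add: fun2_def E1 Eu E0 act_simps y u numeral_3_eq_3)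
  moreover have "fun2 ?t ue = - 1"
    using F[of ue] by (simp add: fun2_def Ee Efe E0 act_simps fe act_linear y numeral_3_eq_3)
  moreover have "fun2 ?t (ue ^ 2) = 0"
    using F[of "ue ^ 2"] by (simp add: fun2_def Ee2 Efe2 Effe2 act_simps(2)[of _ _ uf] fe act_linear y
      numeral_3_eq_3 mult.assoc)
  moreover have "fun1 ?t u = - 1 * fun2 ?t u"
  proof (rule two_points[OF parity_eigenfun[OF assms]])
    fix k :: nat assume "k \<le> 2"
    then consider "k = 0" | "k = 1" | "k = 2" by linarith
    then show "fun1 ?t (ue ^ k) = - 1 * fun2 ?t (ue ^ k)" using calculation by cases auto
  qed simp
  ultimately show False by simp
qed

lemma parity_reach: "c \<noteq> 0 \<Longrightarrow> j < 2 \<Longrightarrow> act 0 c u (yv j) = yv l \<Longrightarrow> l mod 2 = j"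
proof -
  assume c: "c \<noteq> 0" and j: "j < 2" and u: "act 0 c u (yv j) = yv l"
  obtain u' where "act 0 c u' (yv l) = yv (l mod 2)" using reach_parity[OF c] by blast
  then have "act 0 c (u' * u) (yv j) = yv (l mod 2)" by (simp only: act_simps(2) u)
  moreover have "j = 0 \<or> j = 1" "l mod 2 = 0 \<or> l mod 2 = 1" using j by auto
  ultimately show ?thesis using parity_0[OF c, of "u' * u"] parity_1[OF c, of "u' * u"] by metis
qed

lemma annB_maximal_parity: "c \<noteq> 0 \<Longrightarrow> j < 2 \<Longrightarrow> maximal_left_ideal (annB 0 c j)"
  by (rule annB_maximalI) (metis parity_reach reach_parity)

text \<open>\<open>Vm4\<close> is multiplication by c s^2.\<close>

lemma reach_add2:
  assumes "c \<noteq> 0"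
  shows "\<exists>u. act m c u (yv j) = yv (j + 2 * i)"
proof (induction i)
  case 0
  show ?case by (rule exI[of _ 1]) (simp add: act_simps)
next
  case (Suc i)
  then obtain u where u: "act m c u (yv j) = yv (j + 2 * i)" by blast
  have "c * of_nat ((j + 2 * i + 2) * (j + 2 * i + 1)) \<noteq> 0"
    using assms by (simp del: of_nat_mult of_nat_add of_nat_Suc)
  from act_div[OF act_Vm4_yv this] obtain u' where "act m c u' (yv (j + 2 * i)) = yv (j + 2 * i + 2)" by blast
  then have "act m c (u' * u) (yv j) = yv (j + 2 * Suc i)" by (simp add: act_simps(2) u)
  then show ?case by blast
qed

text \<open>Two steps up with \<open>Vm4\<close>, then one down with \<open>low2\<close>, whose
  factor is nonzero for m > 0.\<close>

lemma reach_any: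
  assumes "m > 0" "c \<noteq> 0"
  shows "\<exists>u. act (of_nat m) c u (yv 0) = yv l"
proof (induction l)
  case 0
  show ?case by (rule exI[of _ 1]) (simp add: act_simps)
next
  case (Suc l)
  then obtain u where u: "act (of_nat m) c u (yv 0) = yv l" by blast
  obtain u' where u': "act (of_nat m) c u' (yv l) = yv (l + 2)" using reach_add2[OF assms(2), of _ l 1] by auto
  have "of_nat m + of_nat (l + 2) \<noteq> (0 :: complex)"
    by (metis add_is_0 of_nat_add of_nat_eq_0_iff zero_neq_numeral)
  then have "2 * c * of_nat m * (of_nat m + of_nat (l + 2)) \<noteq> 0" using assms by simp
  from act_div[OF act_low2 this] obtain u'' where "act (of_nat m) c u'' (yv (l + 2)) = yv (l + 2 - 1)" by auto
  then have "act (of_nat m) c (u'' * (u' * u)) (yv 0) = yv (Suc l)" by (simp add: act_simps(2) u u')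
  then show ?case by blast
qed

lemma reach_parity_any:
  assumes "c \<noteq> 0" "j < 2"
  shows "(\<exists>u. act 0 c u (yv j) = yv l) \<longleftrightarrow> l mod 2 = j"
proof
  assume "l mod 2 = j"
  then have "l = j + 2 * (l div 2)" by presburger
  then show "\<exists>u. act 0 c u (yv j) = yv l" using reach_add2[OF assms(1), of 0 j "l div 2"] by simp
qed (use parity_reach[OF assms] in blast)

definition lowest_in :: "l4 uea set \<Rightarrow> nat \<Rightarrow> l4 uea \<Rightarrow> bool" where
  "lowest_in J n u \<longleftrightarrow> u \<notin> J \<and> uf * u \<in> J \<and> (uh + scal (of_nat n)) * u \<in> J"

lemma lowest_in_annB:
  assumes "lowest_in (annB (of_nat m) c j) n u"
  obtains a l where "a \<noteq> 0" "act (of_nat m) c u (yv j) = (\<lambda>k i. a * yv l k i)" "n = m + 2 * l"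
proof -
  define G where "G = act (of_nat m) c u (yv j)"
  have "act (of_nat m) c uf G = (\<lambda>k l. 0)"
    using assms by (simp add: lowest_in_def annB_def act_simps G_def)
  then have row: "G (Suc k) l = 0" for k l by (rule act_low_row)
  have "act (of_nat m) c (uh + scal (of_nat n)) G = (\<lambda>k l. 0)"
    using assms by (simp only: lowest_in_def annB_def act_simps(2) G_def mem_Collect_eq)
  then have h0: "act (of_nat m) c (uh + scal (of_nat n)) G 0 l = 0" for l by simp
  have "(of_nat n - of_nat m - 2 * of_nat l) * G 0 l = act (of_nat m) c (uh + scal (of_nat n)) G 0 l" for l
    by (simp add: act_simps act_h algebra_simps)
  then have wt: "(of_nat n - of_nat m - 2 * of_nat l) * G 0 l = 0" for l by (simp only: h0)
  have n: "n = m + 2 * l" if "G 0 l \<noteq> 0" for l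
  proof -
    have "of_nat n - of_nat m - 2 * of_nat l = (0 :: complex)" using wt[of l] that by (metis mult_eq_0_iff)
    then have "of_nat n = (of_nat (m + 2 * l) :: complex)" by (simp add: algebra_simps)
    then show ?thesis by (simp only: of_nat_eq_iff)
  qed
  have "G \<noteq> (\<lambda>k l. 0)" using assms by (simp add: lowest_in_def annB_def G_def)
  then obtain k l where "G k l \<noteq> 0" by (auto simp: fun_eq_iff)
  then have l: "G 0 l \<noteq> 0" using row by (cases k) auto
  have "G = (\<lambda>k i. G 0 l * yv l k i)"
  proof (intro HOL.ext)
    fix k i
    show "G k i = G 0 l * yv l k i"
    proof (cases k)
      case 0
      then show ?thesis using n[OF l] n[of i] by (cases "G 0 i = 0") (auto simp: yv_def)
    next
      case (Suc k')
      then show ?thesis using row by (simp add: yv_def)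
    qed
  qed
  then show ?thesis using that[OF l _ n[OF l]] G_def by simp
qed

lemma annB_translate:
  assumes "act m c u (yv j) = yv l"
  shows "a * u \<in> annB m c j \<longleftrightarrow> a \<in> annB m c l"
  by (simp add: annB_def act_simps(2) assms)

section \<open>Modules and annihilators\<close>

context lmodule
begin

lemma idem_zero: "x \<in> carrier M \<Longrightarrow> x \<oplus> x = x \<Longrightarrow> x = \<zero>"
proof -
  assume x: "x \<in> carrier M" "x \<oplus> x = x"
  have "x = (\<ominus> x \<oplus> x) \<oplus> x" using x(1) by (simp add: l_neg)
  also have "\<dots> = \<ominus> x \<oplus> (x \<oplus> x)" using x(1) by (simp add: a_assoc)
  also have "\<dots> = \<zero>" using x by (simp add: l_neg)
  finally show "x = \<zero>" .
qed

lemma diff_eq_zero: "x \<in> carrier M \<Longrightarrow> y \<in> carrier M \<Longrightarrow> x \<ominus> y = \<zero> \<longleftrightarrow> x = y"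
proof -
  assume xy: "x \<in> carrier M" "y \<in> carrier M"
  then have "x = (x \<ominus> y) \<oplus> y" by (simp add: a_minus_def a_assoc l_neg)
  then show "x \<ominus> y = \<zero> \<longleftrightarrow> x = y" using xy by (auto simp: a_minus_def r_neg)
qed

lemma smult_0_left: "x \<in> carrier M \<Longrightarrow> 0 \<odot> x = \<zero>"
  using smult_add_left[of x 0 0] by (intro idem_zero) (simp_all add: smult_closed)

lemma smult_0_right: "r \<odot> \<zero> = \<zero>"
  using smult_add_right[of \<zero> \<zero> r] by (intro idem_zero) (simp_all add: smult_closed)

lemma smult_uminus_left: "x \<in> carrier M \<Longrightarrow> (- r) \<odot> x = \<ominus> (r \<odot> x)"
  using smult_add_left[of x "- r" r] by (intro minus_equality[symmetric]) (simp_all add: smult_0_left smult_closed)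

lemma smult_uminus_right: "x \<in> carrier M \<Longrightarrow> r \<odot> (\<ominus> x) = \<ominus> (r \<odot> x)"
  using smult_add_right[of "\<ominus> x" x r] by (intro minus_equality[symmetric]) (simp_all add: l_neg smult_0_right smult_closed)

lemma smult_diff_left: "x \<in> carrier M \<Longrightarrow> (r - s) \<odot> x = r \<odot> x \<ominus> s \<odot> x"
  using smult_add_left[of x r "- s"] by (simp add: smult_uminus_left a_minus_def)

lemma smult_diff_right: "x \<in> carrier M \<Longrightarrow> y \<in> carrier M \<Longrightarrow> r \<odot> (x \<ominus> y) = r \<odot> x \<ominus> r \<odot> y"
  by (simp add: a_minus_def smult_add_right smult_uminus_right)

lemma smult_eq_iff: "x \<in> carrier M \<Longrightarrow> r \<odot> x = s \<odot> x \<longleftrightarrow> (r - s) \<odot> x = \<zero>"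
  by (simp add: smult_diff_left smult_closed diff_eq_zero)

lemma smult_sum: "x \<in> carrier M \<Longrightarrow> sum f A \<odot> x = (\<Oplus>i\<in>A. f i \<odot> x)" if "finite A"
  using that by (induction A) (simp_all add: smult_0_left smult_add_left smult_closed)

lemma smult_finsum: "finite A \<Longrightarrow> (\<And>i. i \<in> A \<Longrightarrow> f i \<in> carrier M) \<Longrightarrow>
    r \<odot> (\<Oplus>i\<in>A. f i) = (\<Oplus>i\<in>A. r \<odot> f i)"
  by (induction A rule: finite_induct) (simp_all add: smult_0_right smult_add_right smult_closed Pi_def)

definition ann where "ann x = {u. u \<odot> x = \<zero>}"

lemma ann_left_ideal: "x \<in> carrier M \<Longrightarrow> left_ideal (ann x)"
  by (auto simp: left_ideal_def ann_def smult_0_left smult_add_left smult_mult smult_0_right)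

lemma ann_1: "x \<in> carrier M \<Longrightarrow> 1 \<in> ann x \<longleftrightarrow> x = \<zero>"
  by (simp add: ann_def smult_one)

lemma ann_smult: "x \<in> carrier M \<Longrightarrow> u \<in> ann (v \<odot> x) \<longleftrightarrow> u * v \<in> ann x"
  by (simp add: ann_def smult_mult)

lemma smult_eq_ann: "x \<in> carrier M \<Longrightarrow> r \<odot> x = s \<odot> x \<longleftrightarrow> r - s \<in> ann x"
  by (simp add: ann_def smult_eq_iff)

lemma cyclic_submodule: "x \<in> carrier M \<Longrightarrow> lsubmodule {u \<odot> x | u. True} M"
  unfolding lsubmodule_def
proof (intro conjI ballI allI)
  assume x: "x \<in> carrier M"
  show "{u \<odot> x | u. True} \<subseteq> carrier M" using x by (auto simp: smult_closed)
  show "\<zero> \<in> {u \<odot> x | u. True}" using smult_0_left[OF x] by (auto intro: exI[of _ 0])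
  show "a \<oplus> b \<in> {u \<odot> x | u. True}" if "a \<in> {u \<odot> x | u. True}" "b \<in> {u \<odot> x | u. True}" for a b
    using that smult_add_left[OF x] by auto metis
  show "r \<odot> a \<in> {u \<odot> x | u. True}" if "a \<in> {u \<odot> x | u. True}" for a r
    using that smult_mult[OF x] by auto metis
qed

end

text \<open>\<open>M\<close> is a copy of the ring modulo \<open>J\<close>, with generator
  \<open>x\<close>. Isomorphism across carrier types reduces to equality of left ideals
  (\<open>cyc_iso\<close>), and simplicity to maximality.\<close>

definition cyc :: "('r::ring_1, 'a) module \<Rightarrow> 'a \<Rightarrow> 'r set \<Rightarrow> bool" where
  "cyc M x J \<longleftrightarrow> lmodule M \<and> x \<in> carrier M \<and> carrier M = {u \<odot>\<^bsub>M\<^esub> x | u. True} \<and>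
    {u. u \<odot>\<^bsub>M\<^esub> x = \<zero>\<^bsub>M\<^esub>} = J"

lemma cycD:
  assumes "cyc M x J"
  shows "lmodule M" "x \<in> carrier M" "y \<in> carrier M \<Longrightarrow> \<exists>u. y = u \<odot>\<^bsub>M\<^esub> x" "lmodule.ann M x = J"
    "u \<odot>\<^bsub>M\<^esub> x = \<zero>\<^bsub>M\<^esub> \<longleftrightarrow> u \<in> J"
  using assms by (auto simp: cyc_def lmodule.ann_def)

lemma cyc_iso:
  assumes M: "cyc M x J" and N: "cyc N y J"
  shows "lmod_iso M N"
proof -
  interpret M: lmodule M by (rule cycD[OF M])
  interpret N: lmodule N by (rule cycD[OF N])
  note x = cycD(2)[OF M] and y = cycD(2)[OF N]
  have eq: "u \<odot>\<^bsub>M\<^esub> x = v \<odot>\<^bsub>M\<^esub> x \<longleftrightarrow> u \<odot>\<^bsub>N\<^esub> y = v \<odot>\<^bsub>N\<^esub> y" for u v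
    using M.smult_eq_ann[OF x] N.smult_eq_ann[OF y] cycD(4)[OF M] cycD(4)[OF N] by simp
  define f where "f a = (SOME u. a = u \<odot>\<^bsub>M\<^esub> x) \<odot>\<^bsub>N\<^esub> y" for a
  have f: "f (u \<odot>\<^bsub>M\<^esub> x) = u \<odot>\<^bsub>N\<^esub> y" for u
    unfolding f_def using someI[of "\<lambda>v. u \<odot>\<^bsub>M\<^esub> x = v \<odot>\<^bsub>M\<^esub> x" u] eq by metis
  have rep: "a \<in> carrier M \<Longrightarrow> \<exists>u. a = u \<odot>\<^bsub>M\<^esub> x" for a using cycD(3)[OF M] .
  show ?thesis unfolding lmod_iso_def
  proof (intro exI[of _ f] conjI ballI allI bij_betw_imageI)
    show "inj_on f (carrier M)"
    proof (rule inj_onI)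
      fix a b assume "a \<in> carrier M" "b \<in> carrier M" "f a = f b"
      moreover obtain u v where "a = u \<odot>\<^bsub>M\<^esub> x" "b = v \<odot>\<^bsub>M\<^esub> x" using rep calculation by metis
      ultimately show "a = b" using f eq by simp
    qed
    show "f ` carrier M = carrier N"
    proof
      show "f ` carrier M \<subseteq> carrier N"
      proof
        fix b assume "b \<in> f ` carrier M"
        then obtain u where "b = f (u \<odot>\<^bsub>M\<^esub> x)" using rep by blast
        then show "b \<in> carrier N" using f y N.smult_closed by simp
      qed
      show "carrier N \<subseteq> f ` carrier M"
      proof
        fix b assume "b \<in> carrier N"
        then obtain u where "b = u \<odot>\<^bsub>N\<^esub> y" using cycD(3)[OF N] by blast
        then have "b = f (u \<odot>\<^bsub>M\<^esub> x)" using f by simp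
        then show "b \<in> f ` carrier M" using x M.smult_closed by blast
      qed
    qed
    fix a assume a: "a \<in> carrier M"
    then obtain u where u: "a = u \<odot>\<^bsub>M\<^esub> x" using rep by blast
    show "f (r \<odot>\<^bsub>M\<^esub> a) = r \<odot>\<^bsub>N\<^esub> f a" for r
      unfolding u M.smult_mult[OF x, symmetric] f by (rule N.smult_mult[OF y])
    fix b assume "b \<in> carrier M"
    then obtain v where v: "b = v \<odot>\<^bsub>M\<^esub> x" using rep by blast
    show "f (a \<oplus>\<^bsub>M\<^esub> b) = f a \<oplus>\<^bsub>N\<^esub> f b"
      unfolding u v M.smult_add_left[OF x, symmetric] f by (rule N.smult_add_left[OF y])
  qed
qed

lemma simple_cyc:
  assumes M: "simple_lmodule M" and x: "x \<in> carrier M" "x \<noteq> \<zero>\<^bsub>M\<^esub>"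
  shows "cyc M x (lmodule.ann M x)" "maximal_left_ideal (lmodule.ann M x)"
proof -
  interpret lmodule M using M by (simp add: simple_lmodule_def)
  have sub: "N = {\<zero>\<^bsub>M\<^esub>} \<or> N = carrier M" if "lsubmodule N M" for N
    using M that by (simp add: simple_lmodule_def)
  have "x \<in> {u \<odot>\<^bsub>M\<^esub> x | u. True}" using smult_one[OF x(1)] by (smt (verit) mem_Collect_eq)
  then have car: "carrier M = {u \<odot>\<^bsub>M\<^esub> x | u. True}"
    using sub[OF cyclic_submodule[OF x(1)]] x(2) by auto
  then show "cyc M x (ann x)" using lmodule_axioms x by (simp add: cyc_def ann_def)
  show "maximal_left_ideal (ann x)"
    unfolding maximal_left_ideal_def
  proof (intro conjI allI impI ann_left_ideal[OF x(1)])
    show "1 \<notin> ann x" using ann_1[OF x(1)] x(2) by simp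
    fix J' assume J': "left_ideal J'" "ann x \<subseteq> J'"
    have "lsubmodule {u \<odot>\<^bsub>M\<^esub> x | u. u \<in> J'} M"
      unfolding lsubmodule_def
    proof (intro conjI ballI allI)
      show "{u \<odot>\<^bsub>M\<^esub> x | u. u \<in> J'} \<subseteq> carrier M" using x by (auto simp: smult_closed)
      show "\<zero>\<^bsub>M\<^esub> \<in> {u \<odot>\<^bsub>M\<^esub> x | u. u \<in> J'}" using smult_0_left[OF x(1)] left_idealD(1)[OF J'(1)] by force
      fix a b assume "a \<in> {u \<odot>\<^bsub>M\<^esub> x | u. u \<in> J'}" "b \<in> {u \<odot>\<^bsub>M\<^esub> x | u. u \<in> J'}"
      then obtain u v where uv: "a = u \<odot>\<^bsub>M\<^esub> x" "u \<in> J'" "b = v \<odot>\<^bsub>M\<^esub> x" "v \<in> J'" by blast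
      then have "a \<oplus>\<^bsub>M\<^esub> b = (u + v) \<odot>\<^bsub>M\<^esub> x" using smult_add_left[OF x(1)] by simp
      then show "a \<oplus>\<^bsub>M\<^esub> b \<in> {u \<odot>\<^bsub>M\<^esub> x | u. u \<in> J'}" using left_idealD(2)[OF J'(1) uv(2,4)] by blast
    next
      fix r a assume "a \<in> {u \<odot>\<^bsub>M\<^esub> x | u. u \<in> J'}"
      then obtain u where uv: "a = u \<odot>\<^bsub>M\<^esub> x" "u \<in> J'" by blast
      then have "r \<odot>\<^bsub>M\<^esub> a = (r * u) \<odot>\<^bsub>M\<^esub> x" using smult_mult[OF x(1)] by simp
      then show "r \<odot>\<^bsub>M\<^esub> a \<in> {u \<odot>\<^bsub>M\<^esub> x | u. u \<in> J'}" using left_idealD(3)[OF J'(1) uv(2)] by blast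
    qed
    then consider "{u \<odot>\<^bsub>M\<^esub> x | u. u \<in> J'} = {\<zero>\<^bsub>M\<^esub>}" | "{u \<odot>\<^bsub>M\<^esub> x | u. u \<in> J'} = carrier M" using sub by blast
    then show "J' = ann x \<or> 1 \<in> J'"
    proof cases
      case 1
      then have "J' \<subseteq> ann x" by (auto simp: ann_def)
      then show ?thesis using J' by blast
    next
      case 2
      then obtain u where u: "u \<in> J'" "u \<odot>\<^bsub>M\<^esub> x = x" using x(1) by (smt (verit) mem_Collect_eq)
      then have "1 - u \<in> ann x" using smult_eq_ann[OF x(1), of 1 u] smult_one[OF x(1)] by simp
      then have "1 - u + u \<in> J'" using J' u(1) left_idealD(2) by blast
      then show ?thesis by simp
    qed
  qed
qed

lemma cyc_simple:
  assumes M: "cyc M x J" and J: "maximal_left_ideal J"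
  shows "simple_lmodule M"
proof -
  interpret lmodule M by (rule cycD[OF M])
  note x = cycD(2)[OF M]
  have "x \<noteq> \<zero>\<^bsub>M\<^esub>" using ann_1[OF x] cycD(4)[OF M] J by (simp add: maximal_left_ideal_def)
  moreover have "N = {\<zero>\<^bsub>M\<^esub>} \<or> N = carrier M" if N: "lsubmodule N M" for N
  proof -
    note ND = N[unfolded lsubmodule_def]
    have "left_ideal {u. u \<odot>\<^bsub>M\<^esub> x \<in> N}"
      using ND x by (auto simp: left_ideal_def smult_0_left smult_add_left smult_mult)
    moreover have "J \<subseteq> {u. u \<odot>\<^bsub>M\<^esub> x \<in> N}"
    proof
      fix u assume "u \<in> J"
      then have "u \<odot>\<^bsub>M\<^esub> x = \<zero>\<^bsub>M\<^esub>" using cycD(5)[OF M] by blast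
      then show "u \<in> {u. u \<odot>\<^bsub>M\<^esub> x \<in> N}" using ND by simp
    qed
    ultimately have "{u. u \<odot>\<^bsub>M\<^esub> x \<in> N} = J \<or> 1 \<in> {u. u \<odot>\<^bsub>M\<^esub> x \<in> N}"
      using J unfolding maximal_left_ideal_def by blast
    then show ?thesis
    proof
      assume a: "{u. u \<odot>\<^bsub>M\<^esub> x \<in> N} = J"
      have "N \<subseteq> {\<zero>\<^bsub>M\<^esub>}"
      proof
        fix y assume "y \<in> N"
        moreover then obtain u where "y = u \<odot>\<^bsub>M\<^esub> x" using cycD(3)[OF M] ND by blast
        ultimately show "y \<in> {\<zero>\<^bsub>M\<^esub>}" using a cycD(5)[OF M] by blast
      qed
      then show ?thesis using ND by blast
    next
      assume "1 \<in> {u. u \<odot>\<^bsub>M\<^esub> x \<in> N}"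
      then have "x \<in> N" using smult_one[OF x] by simp
      have "carrier M \<subseteq> N"
      proof
        fix y assume "y \<in> carrier M"
        then obtain u where "y = u \<odot>\<^bsub>M\<^esub> x" using cycD(3)[OF M] by blast
        then show "y \<in> N" using ND \<open>x \<in> N\<close> by blast
      qed
      then show ?thesis using ND by blast
    qed
  qed
  ultimately show ?thesis using lmodule_axioms x by (auto simp: simple_lmodule_def)
qed

lemma cyc_smult:
  assumes M: "cyc M x J" and J: "maximal_left_ideal J" and u: "u \<notin> J"
  shows "cyc M (u \<odot>\<^bsub>M\<^esub> x) {a. a * u \<in> J}"
proof -
  interpret lmodule M by (rule cycD[OF M])
  note x = cycD(2)[OF M]
  have "u \<odot>\<^bsub>M\<^esub> x \<noteq> \<zero>\<^bsub>M\<^esub>" using u cycD(5)[OF M] by blast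
  then have "cyc M (u \<odot>\<^bsub>M\<^esub> x) (ann (u \<odot>\<^bsub>M\<^esub> x))"
    using simple_cyc(1)[OF cyc_simple[OF M J]] smult_closed[OF x] by blast
  moreover have "ann (u \<odot>\<^bsub>M\<^esub> x) = {a. a * u \<in> J}"
    using ann_smult[OF x] cycD(4)[OF M] by blast
  ultimately show ?thesis by simp
qed

lemma lmod_iso_cyc:
  assumes iso: "lmod_iso M N" and N: "cyc N y J" and M: "lmodule M"
  shows "\<exists>x. cyc M x J"
proof -
  interpret M: lmodule M by (rule M)
  interpret N: lmodule N by (rule cycD[OF N])
  obtain f where f: "bij_betw f (carrier M) (carrier N)"
    and add: "\<And>x y. x \<in> carrier M \<Longrightarrow> y \<in> carrier M \<Longrightarrow> f (x \<oplus>\<^bsub>M\<^esub> y) = f x \<oplus>\<^bsub>N\<^esub> f y"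
    and sm: "\<And>r x. x \<in> carrier M \<Longrightarrow> f (r \<odot>\<^bsub>M\<^esub> x) = r \<odot>\<^bsub>N\<^esub> f x"
    using iso by (auto simp: lmod_iso_def)
  have inj: "f a = f b \<longleftrightarrow> a = b" if "a \<in> carrier M" "b \<in> carrier M" for a b
    using f that by (auto simp: bij_betw_def inj_on_def)
  obtain x where x: "x \<in> carrier M" "f x = y" using f cycD(2)[OF N] unfolding bij_betw_def by (metis imageE)
  have "f \<zero>\<^bsub>M\<^esub> = 0 \<odot>\<^bsub>N\<^esub> y" using sm[OF x(1), of 0] x by (simp add: M.smult_0_left)
  then have f0: "f \<zero>\<^bsub>M\<^esub> = \<zero>\<^bsub>N\<^esub>" using cycD(2)[OF N] by (simp add: N.smult_0_left)
  have "a \<in> {u \<odot>\<^bsub>M\<^esub> x | u. True}" if a: "a \<in> carrier M" for a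
  proof -
    have "f a \<in> carrier N" using f a by (auto simp: bij_betw_def)
    then obtain u where "f a = u \<odot>\<^bsub>N\<^esub> y" using cycD(3)[OF N] by blast
    then have "f a = f (u \<odot>\<^bsub>M\<^esub> x)" using sm x by simp
    then have "a = u \<odot>\<^bsub>M\<^esub> x" using inj a x(1) M.smult_closed by simp
    then show ?thesis by blast
  qed
  moreover have "u \<odot>\<^bsub>M\<^esub> x = \<zero>\<^bsub>M\<^esub> \<longleftrightarrow> u \<in> J" for u
    using inj[of "u \<odot>\<^bsub>M\<^esub> x" "\<zero>\<^bsub>M\<^esub>"] x sm[OF x(1)] f0 cycD(5)[OF N] M.smult_closed[OF x(1)] by simp
  ultimately have "cyc M x J" using M x M.smult_closed by (auto simp: cyc_def)
  then show ?thesis by blast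
qed

subsection \<open>Quotients\<close>

lemma lsubmodule_lmodule:
  assumes "lmodule M" "lsubmodule N M"
  shows "lmodule (lsub M N)"
proof -
  interpret lmodule M by fact
  note N = assms(2)[unfolded lsubmodule_def]
  have "abelian_group (lsub M N)"
  proof (rule abelian_groupI)
    fix x assume x: "x \<in> carrier (lsub M N)"
    have "(- 1) \<odot>\<^bsub>M\<^esub> x \<in> N" using N x by simp
    moreover have "(- 1) \<odot>\<^bsub>M\<^esub> x \<oplus>\<^bsub>M\<^esub> x = \<zero>\<^bsub>M\<^esub>"
      using N x by (auto simp: smult_uminus_left smult_one l_neg)
    ultimately show "\<exists>y\<in>carrier (lsub M N). y \<oplus>\<^bsub>lsub M N\<^esub> x = \<zero>\<^bsub>lsub M N\<^esub>" by auto
  qed (use N in \<open>auto simp: a_assoc subset_iff intro: a_comm\<close>)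
  then show ?thesis
    by (rule lmodule.intro)
      (unfold_locales, use N in \<open>auto simp: subset_iff smult_add_left smult_add_right smult_mult smult_one\<close>)
qed

lemma lsubmodule_trans:
  "lsubmodule N M \<Longrightarrow> lsubmodule K (lsub M N) \<longleftrightarrow> lsubmodule K M \<and> K \<subseteq> N"
  by (auto simp: lsubmodule_def)

locale lquotient = lmodule M for M :: "('r::ring_1, 'a) module" (structure) +
  fixes K
  assumes K: "lsubmodule K M"
begin

lemma K_sub: "K \<subseteq> carrier M" "\<zero> \<in> K" "x \<in> K \<Longrightarrow> y \<in> K \<Longrightarrow> x \<oplus> y \<in> K" "x \<in> K \<Longrightarrow> r \<odot> x \<in> K"
  using K by (auto simp: lsubmodule_def)

lemma K_abelian_subgroup: "abelian_subgroup K M"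
proof (rule abelian_subgroupI3)
  show "additive_subgroup K M"
  proof (rule additive_subgroup.intro, rule add.subgroupI)
    show "K \<subseteq> carrier M" by (rule K_sub)
    show "K \<noteq> {}" using K_sub(2) by blast
    show "\<ominus> x \<in> K" if "x \<in> K" for x
      using K_sub(4)[OF that, of "- 1"] K_sub(1) that by (auto simp: smult_uminus_left smult_one)
  qed (rule K_sub(3))
  show "abelian_group M" by (rule abelian_group_axioms)
qed


lemma mem_coset_iff:
  assumes "x \<in> carrier M" "y \<in> carrier M"
  shows "x \<in> K +> y \<longleftrightarrow> x \<ominus> y \<in> K"
proof
  assume "x \<in> K +> y"
  then obtain k where k: "k \<in> K" "x = k \<oplus> y" by (auto simp: a_r_coset_def')
  then have "x \<ominus> y = k" using assms K_sub(1) by (auto simp: a_minus_def a_assoc r_neg)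
  then show "x \<ominus> y \<in> K" using k by simp
next
  assume "x \<ominus> y \<in> K"
  moreover have "x = (x \<ominus> y) \<oplus> y" using assms by (simp add: a_minus_def a_assoc l_neg)
  ultimately show "x \<in> K +> y" by (auto simp: a_r_coset_def')
qed

lemma coset_eq_iff:
  assumes "x \<in> carrier M" "y \<in> carrier M"
  shows "K +> x = K +> y \<longleftrightarrow> x \<ominus> y \<in> K"
proof -
  interpret abelian_subgroup K M by (rule K_abelian_subgroup)
  have "x \<in> K +> x" using a_rcos_self assms(1) by simp
  then show ?thesis
    using a_repr_independence'[of x y] assms mem_coset_iff[OF assms] by blast
qed

lemma coset_zero: "K +> \<zero> = K"
  using K_sub(1) by (force simp: a_r_coset_def')

lemma coset_eq_zero:
  assumes x: "x \<in> carrier M"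
  shows "K +> x = K \<longleftrightarrow> x \<in> K"
proof -
  have "x \<ominus> \<zero> = (x \<ominus> \<zero>) \<oplus> \<zero>" using x by simp
  also have "\<dots> = x \<oplus> (\<ominus> \<zero> \<oplus> \<zero>)" using x by (simp only: a_minus_def a_assoc a_inv_closed zero_closed)
  also have "\<dots> = x" using x by (simp only: l_neg zero_closed r_zero)
  finally show ?thesis using coset_eq_iff[OF x zero_closed] by (simp only: coset_zero)
qed

lemma lquot_carrier: "carrier (lquot M K) = {K +> x | x. x \<in> carrier M}"
  by (auto simp: lquot_def A_RCOSETS_def')

lemma lquot_zero: "\<zero>\<^bsub>lquot M K\<^esub> = K"
  by (simp add: lquot_def)

lemma lquot_add:
  "x \<in> carrier M \<Longrightarrow> y \<in> carrier M \<Longrightarrow> (K +> x) \<oplus>\<^bsub>lquot M K\<^esub> (K +> y) = K +> (x \<oplus> y)"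
  using abelian_subgroup.a_rcos_sum[OF K_abelian_subgroup] by (simp add: lquot_def)

lemma lquot_smult:
  assumes x: "x \<in> carrier M"
  shows "r \<odot>\<^bsub>lquot M K\<^esub> (K +> x) = K +> (r \<odot> x)"
proof -
  interpret abelian_subgroup K M by (rule K_abelian_subgroup)
  have "K +> (r \<odot> y) = K +> (r \<odot> x)" if y: "y \<in> K +> x" for y
  proof -
    have yc: "y \<in> carrier M" by (rule a_elemrcos_carrier[OF x y])
    have "r \<odot> (y \<ominus> x) \<in> K" using mem_coset_iff[OF yc x] y K_sub(4) by simp
    then show ?thesis using coset_eq_iff yc x by (simp add: smult_closed smult_diff_right)
  qed
  then have "(\<Union>y\<in>K +> x. K +> (r \<odot> y)) = (\<Union>y\<in>K +> x. K +> (r \<odot> x))" by (intro SUP_cong refl)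
  also have "\<dots> = K +> (r \<odot> x)" using a_rcos_self[OF x] by blast
  finally show ?thesis by (simp add: lquot_def)
qed

lemma lquot_lmodule: "lmodule (lquot M K)"
proof -
  let ?Q = "lquot M K"
  have cE: "\<exists>x\<in>carrier M. X = K +> x" if "X \<in> carrier ?Q" for X
    using that by (auto simp: lquot_carrier)
  have cI: "K +> x \<in> carrier ?Q" if "x \<in> carrier M" for x using that by (auto simp: lquot_carrier)
  have z: "\<zero>\<^bsub>?Q\<^esub> = K +> \<zero>" by (simp add: lquot_zero coset_zero)
  have "abelian_group ?Q"
  proof (rule abelian_groupI)
    show "\<zero>\<^bsub>?Q\<^esub> \<in> carrier ?Q" unfolding z by (rule cI) simp
    fix X assume "X \<in> carrier ?Q"
    then obtain x where x: "x \<in> carrier M" "X = K +> x" using cE by blast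
    show "\<zero>\<^bsub>?Q\<^esub> \<oplus>\<^bsub>?Q\<^esub> X = X" unfolding z x(2) using x(1) by (simp add: lquot_add)
    have "(K +> (\<ominus> x)) \<oplus>\<^bsub>?Q\<^esub> X = \<zero>\<^bsub>?Q\<^esub>" unfolding z x(2) using x(1) by (simp add: lquot_add l_neg)
    then show "\<exists>Y\<in>carrier ?Q. Y \<oplus>\<^bsub>?Q\<^esub> X = \<zero>\<^bsub>?Q\<^esub>" using cI[of "\<ominus> x"] x(1) by auto
    fix Y assume "Y \<in> carrier ?Q"
    then obtain y where y: "y \<in> carrier M" "Y = K +> y" using cE by blast
    show "X \<oplus>\<^bsub>?Q\<^esub> Y \<in> carrier ?Q" unfolding x(2) y(2) using x(1) y(1) by (simp add: lquot_add cI)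
    show "X \<oplus>\<^bsub>?Q\<^esub> Y = Y \<oplus>\<^bsub>?Q\<^esub> X" unfolding x(2) y(2) using x(1) y(1) by (simp add: lquot_add a_comm)
    fix Z assume "Z \<in> carrier ?Q"
    then obtain w where w: "w \<in> carrier M" "Z = K +> w" using cE by blast
    show "X \<oplus>\<^bsub>?Q\<^esub> Y \<oplus>\<^bsub>?Q\<^esub> Z = X \<oplus>\<^bsub>?Q\<^esub> (Y \<oplus>\<^bsub>?Q\<^esub> Z)"
      unfolding x(2) y(2) w(2) using x(1) y(1) w(1) by (simp add: lquot_add a_assoc)
  qed
  moreover have "lmodule_axioms ?Q"
  proof
    fix X assume "X \<in> carrier ?Q"
    then obtain x where x: "x \<in> carrier M" "X = K +> x" using cE by blast
    show "r \<odot>\<^bsub>?Q\<^esub> X \<in> carrier ?Q" "(r + s) \<odot>\<^bsub>?Q\<^esub> X = r \<odot>\<^bsub>?Q\<^esub> X \<oplus>\<^bsub>?Q\<^esub> s \<odot>\<^bsub>?Q\<^esub> X"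
      "(r * s) \<odot>\<^bsub>?Q\<^esub> X = r \<odot>\<^bsub>?Q\<^esub> (s \<odot>\<^bsub>?Q\<^esub> X)" "1 \<odot>\<^bsub>?Q\<^esub> X = X" for r s
      unfolding x(2) using x(1)
      by (simp_all add: lquot_smult lquot_add cI smult_closed smult_add_left smult_mult smult_one)
    fix Y assume "Y \<in> carrier ?Q"
    then obtain y where y: "y \<in> carrier M" "Y = K +> y" using cE by blast
    show "r \<odot>\<^bsub>?Q\<^esub> (X \<oplus>\<^bsub>?Q\<^esub> Y) = r \<odot>\<^bsub>?Q\<^esub> X \<oplus>\<^bsub>?Q\<^esub> r \<odot>\<^bsub>?Q\<^esub> Y" for r
      unfolding x(2) y(2) using x(1) y(1) by (simp add: lquot_smult lquot_add smult_closed smult_add_right)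
  qed
  ultimately show ?thesis by (rule lmodule.intro)
qed

end

lemma lmodule_pullback_sl2: "lmodule M \<Longrightarrow> lmodule (pullback sl2_emb M)"
proof -
  assume "lmodule M"
  then interpret lmodule M .
  have "abelian_group (pullback sl2_emb M)"
  proof (rule abelian_groupI)
    fix x assume "x \<in> carrier (pullback sl2_emb M)"
    then show "\<exists>y\<in>carrier (pullback sl2_emb M). y \<oplus>\<^bsub>pullback sl2_emb M\<^esub> x = \<zero>\<^bsub>pullback sl2_emb M\<^esub>"
      by (intro bexI[of _ "\<ominus>\<^bsub>M\<^esub> x"]) (simp_all add: pullback_def l_neg)
  qed (auto simp: pullback_def a_assoc intro: a_comm)
  then show ?thesis
    by (rule lmodule.intro) (unfold_locales, simp_all add: pullback_def sl2_emb_def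
      sl2_emb.uea_lift_add sl2_emb.uea_lift_mult sl2_emb.uea_lift_one
      smult_closed smult_add_left smult_add_right smult_mult smult_one)
qed

section \<open>Linear dependence\<close>

text \<open>Gaussian elimination: the pivot p clears the coordinate y of the other rows, and its own
  coefficient is then chosen to cancel that coordinate.\<close>

lemma linear_dependence:
  fixes a :: "'i \<Rightarrow> 'x \<Rightarrow> 'f::field"
  assumes "finite X" "finite I" "card X < card I"
  shows "\<exists>c. (\<exists>i\<in>I. c i \<noteq> 0) \<and> (\<forall>x\<in>X. (\<Sum>i\<in>I. c i * a i x) = 0)"
  using assms
proof (induction X arbitrary: I a rule: finite_induct)
  case empty
  then have "I \<noteq> {}" by auto
  then show ?case by (intro exI[of _ "\<lambda>_. 1"]) auto
next
  case (insert y X)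
  show ?case
  proof (cases "\<forall>i\<in>I. a i y = 0")
    case True
    have "card X < card I" using insert by simp
    then obtain c where "\<exists>i\<in>I. c i \<noteq> 0" "\<forall>x\<in>X. (\<Sum>i\<in>I. c i * a i x) = 0"
      using insert.IH[OF insert.prems(1)] by blast
    then show ?thesis using True by (intro exI[of _ c]) auto
  next
    case False
    then obtain p where p: "p \<in> I" "a p y \<noteq> 0" by blast
    have "card X < card (I - {p})" using insert p by simp
    then obtain c where c: "\<exists>i\<in>I - {p}. c i \<noteq> 0"
      "\<forall>x\<in>X. (\<Sum>i\<in>I - {p}. c i * (a i x - a i y / a p y * a p x)) = 0"
      using insert.IH[of "I - {p}" "\<lambda>i x. a i x - a i y / a p y * a p x"] insert.prems(1) by blast
    define d where "d = (\<lambda>i. if i = p then - (\<Sum>i\<in>I - {p}. c i * a i y / a p y) else c i)"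
    have d: "(\<Sum>i\<in>I. d i * a i x) = (\<Sum>i\<in>I - {p}. c i * (a i x - a i y / a p y * a p x))" for x
    proof -
      have "(\<Sum>i\<in>I. d i * a i x) = d p * a p x + (\<Sum>i\<in>I - {p}. d i * a i x)"
        by (rule sum.remove[OF insert.prems(1) p(1)])
      also have "(\<Sum>i\<in>I - {p}. d i * a i x) = (\<Sum>i\<in>I - {p}. c i * a i x)"
        by (rule sum.cong) (auto simp: d_def)
      also have "d p * a p x = - (\<Sum>i\<in>I - {p}. c i * a i y / a p y * a p x)"
        by (simp add: d_def sum_distrib_right)
      finally show ?thesis by (simp add: right_diff_distrib sum_subtractf mult.assoc)
    qed
    have "(\<Sum>i\<in>I. d i * a i y) = 0" unfolding d using p(2) by simp
    moreover have "\<exists>i\<in>I. d i \<noteq> 0" using c(1) by (auto simp: d_def)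
    ultimately show ?thesis using c(2) d by (intro exI[of _ d]) simp
  qed
qed

section \<open>Spans in modules over enveloping algebras\<close>

lemma finsum_transfer:
  fixes M :: "('r::ring_1, 'a) module" and N :: "('s::ring_1, 'a) module"
  assumes M: "lmodule M" and N: "lmodule N" and eq: "zero N = zero M" "add N = add M"
    and f: "f \<in> A \<rightarrow> carrier M" "f \<in> A \<rightarrow> carrier N"
  shows "finsum N f A = finsum M f A"
proof -
  interpret M: lmodule M by fact
  interpret N: lmodule N by fact
  show ?thesis
  proof (cases "finite A")
    case True
    then show ?thesis using f
    proof (induction A)
      case empty
      show ?case using M.finsum_empty N.finsum_empty eq by simp
    next
      case (insert a A)
      then have 1: "f \<in> A \<rightarrow> carrier M" "f a \<in> carrier M" "f \<in> A \<rightarrow> carrier N" "f a \<in> carrier N" by auto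
      have "finsum N f (insert a A) = f a \<oplus>\<^bsub>N\<^esub> finsum N f A"
        by (rule N.finsum_insert) (use insert 1 in auto)
      moreover have "finsum M f (insert a A) = f a \<oplus>\<^bsub>M\<^esub> finsum M f A"
        by (rule M.finsum_insert) (use insert 1 in auto)
      ultimately show ?case using insert.IH[OF 1(1,3)] eq by simp
    qed
  next
    case False
    then show ?thesis using M.finsum_infinite N.finsum_infinite eq by simp
  qed
qed

lemma finsum_pullback:
  "lmodule M \<Longrightarrow> f \<in> A \<rightarrow> carrier M \<Longrightarrow> finsum (pullback sl2_emb M) f A = finsum M f A"
  by (rule finsum_transfer[OF _ lmodule_pullback_sl2]) (simp_all add: pullback_def)

lemma finsum_lsub:
  assumes M: "lmodule M" and N: "lsubmodule N M" and f: "f \<in> A \<rightarrow> N"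
  shows "finsum (lsub M N) f A = finsum M f A"
  by (rule finsum_transfer[OF M lsubmodule_lmodule[OF M N]])
    (use N f in \<open>auto simp: lsubmodule_def\<close>)

locale umodule = lmodule M for M :: "('b::lie_basis uea, 'a) module" (structure)
begin

definition lc where "lc X c = (\<Oplus>x\<in>X. scal (c x) \<odot> x)"

lemma lc_fun: "X \<subseteq> carrier M \<Longrightarrow> (\<lambda>x. scal (c x) \<odot> x) \<in> X \<rightarrow> carrier M"
  by (auto simp: smult_closed)

lemma lc_closed: "X \<subseteq> carrier M \<Longrightarrow> lc X c \<in> carrier M"
  unfolding lc_def by (rule finsum_closed[OF lc_fun])

lemma lc_cong: "X \<subseteq> carrier M \<Longrightarrow> (\<And>x. x \<in> X \<Longrightarrow> c x = d x) \<Longrightarrow> lc X c = lc X d"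
  unfolding lc_def by (rule finsum_cong') (auto simp: smult_closed)

lemma lc_add: "X \<subseteq> carrier M \<Longrightarrow> lc X c \<oplus> lc X d = lc X (\<lambda>x. c x + d x)"
proof -
  assume X: "X \<subseteq> carrier M"
  have "lc X (\<lambda>x. c x + d x) = (\<Oplus>x\<in>X. scal (c x) \<odot> x \<oplus> scal (d x) \<odot> x)"
    unfolding lc_def using X
    by (intro finsum_cong') (auto simp: scal.scalar_add smult_add_left smult_closed)
  also have "\<dots> = lc X c \<oplus> lc X d" unfolding lc_def by (rule finsum_addf[OF lc_fun[OF X] lc_fun[OF X]])
  finally show ?thesis ..
qed

lemma lc_scal:
  assumes X: "finite X" "X \<subseteq> carrier M"
  shows "scal a \<odot> lc X c = lc X (\<lambda>x. a * c x)"
proof -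
  have "scal a \<odot> lc X c = (\<Oplus>x\<in>X. scal a \<odot> (scal (c x) \<odot> x))"
    unfolding lc_def by (rule smult_finsum[OF X(1)]) (use X in \<open>auto simp: smult_closed\<close>)
  also have "\<dots> = lc X (\<lambda>x. a * c x)" unfolding lc_def
    by (rule finsum_cong') (use X in \<open>auto simp: scal.scalar_mult smult_mult smult_closed\<close>)
  finally show ?thesis .
qed

lemma lc_zero: "X \<subseteq> carrier M \<Longrightarrow> lc X (\<lambda>x. 0) = \<zero>"
  unfolding lc_def by (rule add.finprod_one_eqI) (auto simp: scal.scalar_zero smult_0_left)

lemma lc_extend:
  assumes "finite B" "A \<subseteq> B" "B \<subseteq> carrier M"
  shows "lc A c = lc B (\<lambda>x. if x \<in> A then c x else 0)"
  unfolding lc_def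
  by (rule add.finprod_mono_neutral_cong_left)
    (use assms in \<open>auto simp: scal.scalar_zero smult_0_left smult_closed subset_iff\<close>)

lemma lc_single: "x \<in> carrier M \<Longrightarrow> lc {x} c = scal (c x) \<odot> x"
proof -
  assume x: "x \<in> carrier M"
  have "lc {x} c = scal (c x) \<odot> x \<oplus> (\<Oplus>x\<in>{}. scal (c x) \<odot> x)"
    unfolding lc_def by (rule finsum_insert) (use x in \<open>auto simp: smult_closed\<close>)
  then show ?thesis using x by (simp add: smult_closed)
qed

lemma cspan_lc: "cspan M X = {lc A c | A c. finite A \<and> A \<subseteq> X}"
  by (simp add: cspan_def lc_def)

lemma cindep_lc: "cindep M X \<longleftrightarrow> (\<forall>A c. finite A \<longrightarrow> A \<subseteq> X \<longrightarrow> lc A c = \<zero> \<longrightarrow> (\<forall>x\<in>A. c x = 0))"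
  by (simp add: cindep_def lc_def)

lemma cspan_finite:
  assumes "finite X" "X \<subseteq> carrier M"
  shows "y \<in> cspan M X \<longleftrightarrow> (\<exists>c. y = lc X c)"
proof
  assume "y \<in> cspan M X"
  then obtain A c where "A \<subseteq> X" "y = lc A c" by (auto simp: cspan_lc)
  then show "\<exists>c. y = lc X c" using lc_extend[OF assms(1) _ assms(2)] by blast
qed (use assms(1) in \<open>auto simp: cspan_lc\<close>)

lemma mem_cspan: "x \<in> X \<Longrightarrow> X \<subseteq> carrier M \<Longrightarrow> x \<in> cspan M X"
proof -
  assume x: "x \<in> X" "X \<subseteq> carrier M"
  then have "lc {x} (\<lambda>_. 1) = x" using lc_single[of x "\<lambda>_. 1"] by (auto simp: scal.scalar_one smult_one)
  then have "\<exists>c. x = lc {x} c" by (intro exI[of _ "\<lambda>_. 1"]) simp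
  then show ?thesis using x unfolding cspan_lc by blast
qed

lemma lc_sum:
  assumes "finite I" "finite X" "X \<subseteq> carrier M"
  shows "(\<Oplus>i\<in>I. scal (c i) \<odot> lc X (a i)) = lc X (\<lambda>x. \<Sum>i\<in>I. c i * a i x)"
  using assms(1)
proof (induction I)
  case empty
  show ?case using lc_zero[OF assms(3)] finsum_empty by simp
next
  case (insert i I)
  have cl: "scal (c j) \<odot> lc X (a j) \<in> carrier M" for j by (intro smult_closed lc_closed assms)
  have "(\<Oplus>i\<in>insert i I. scal (c i) \<odot> lc X (a i)) = scal (c i) \<odot> lc X (a i) \<oplus> (\<Oplus>i\<in>I. scal (c i) \<odot> lc X (a i))"
    by (rule finsum_insert) (use insert cl in auto)
  then show ?case
    unfolding insert.IH unfolding lc_scal[OF assms(2,3)] lc_add[OF assms(3)] using insert.hyps by simp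
qed

lemma span_dependence:
  assumes X: "finite X" "X \<subseteq> carrier M" and I: "finite I" "card X < card I"
    and y: "\<And>i. i \<in> I \<Longrightarrow> y i \<in> cspan M X"
  shows "\<exists>c. (\<exists>i\<in>I. c i \<noteq> 0) \<and> (\<Oplus>i\<in>I. scal (c i) \<odot> y i) = \<zero>"
proof -
  have "\<forall>i\<in>I. \<exists>c. y i = lc X c" using y cspan_finite[OF X] by blast
  then obtain a where a: "\<And>i. i \<in> I \<Longrightarrow> y i = lc X (a i)" by metis
  obtain c where c: "\<exists>i\<in>I. c i \<noteq> 0" "\<forall>x\<in>X. (\<Sum>i\<in>I. c i * a i x) = 0"
    using linear_dependence[OF X(1) I] by blast
  have "(\<Oplus>i\<in>I. scal (c i) \<odot> y i) = (\<Oplus>i\<in>I. scal (c i) \<odot> lc X (a i))"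
    by (rule finsum_cong') (auto simp: a intro!: smult_closed lc_closed X)
  also have "\<dots> = lc X (\<lambda>x. \<Sum>i\<in>I. c i * a i x)" by (rule lc_sum[OF I(1) X])
  also have "\<dots> = lc X (\<lambda>x. 0)" by (rule lc_cong[OF X(2)]) (use c(2) in auto)
  also have "\<dots> = \<zero>" by (rule lc_zero[OF X(2)])
  finally show ?thesis using c(1) by blast
qed

text \<open>There are more iterates of \<open>g\<close> on y than spanning vectors, and a linear
  dependence among them is an annihilating polynomial.\<close>

lemma span_polynomial:
  assumes X: "finite X" "X \<subseteq> carrier M" and y: "y \<in> carrier M"
    and g: "\<And>k. g ^ k \<odot> y \<in> cspan M X"
  shows "\<exists>p. p \<noteq> 0 \<and> pev p g \<odot> y = \<zero>"
proof -
  define n where "n = card X"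
  have n: "card X < card {..n}" by (simp add: n_def)
  obtain c :: "nat \<Rightarrow> complex" where c: "\<exists>i\<in>{..n}. c i \<noteq> 0" "(\<Oplus>i\<in>{..n}. scal (c i) \<odot> (g ^ i \<odot> y)) = \<zero>"
    using span_dependence[OF X finite_atMost n, of "\<lambda>i. g ^ i \<odot> y"] g by blast
  define p where "p = (\<Sum>i\<le>n. monom (c i) i)"
  have coeff: "coeff p k = (if k \<le> n then c k else 0)" for k by (simp add: p_def coeff_sum)
  have "degree p \<le> n" by (rule degree_le) (simp add: coeff)
  then have "pev p g = (\<Sum>i\<le>n. scal (c i) * g ^ i)"
    by (subst pev_bound[of p n]) (auto simp: coeff)
  then have "pev p g \<odot> y = (\<Oplus>i\<in>{..n}. (scal (c i) * g ^ i) \<odot> y)"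
    using smult_sum[OF finite_atMost y] by simp
  also have "\<dots> = (\<Oplus>i\<in>{..n}. scal (c i) \<odot> (g ^ i \<odot> y))"
    by (rule finsum_cong') (auto simp: smult_mult[OF y] intro!: smult_closed y)
  finally have "pev p g \<odot> y = \<zero>" using c(2) by simp
  moreover have "p \<noteq> 0"
  proof
    assume "p = 0"
    then have "c i = 0" if "i \<le> n" for i using coeff[of i] that by simp
    then show False using c(1) by auto
  qed
  ultimately show ?thesis by blast
qed

lemma cindep_card_le:
  assumes X: "cindep M X" "finite X" "X \<subseteq> cspan M Y" and Y: "finite Y" "Y \<subseteq> carrier M"
  shows "card X \<le> card Y"
proof (rule ccontr)
  assume "\<not> card X \<le> card Y"
  then have "card Y < card X" by simp
  then obtain c where "\<exists>x\<in>X. c x \<noteq> 0" "(\<Oplus>x\<in>X. scal (c x) \<odot> x) = \<zero>"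
    using span_dependence[OF Y X(2), of "\<lambda>x. x"] X(3) by blast
  then show False using X(1,2) unfolding cindep_lc lc_def by blast
qed

lemma has_cdim_unique: "has_cdim M W m \<Longrightarrow> has_cdim M W n \<Longrightarrow> m = n"
proof -
  assume "has_cdim M W m" "has_cdim M W n"
  then obtain X Y where X: "finite X" "card X = m" "X \<subseteq> carrier M" "cindep M X" "cspan M X = W"
    and Y: "finite Y" "card Y = n" "Y \<subseteq> carrier M" "cindep M Y" "cspan M Y = W"
    by (auto simp: has_cdim_def)
  have "X \<subseteq> cspan M Y" using mem_cspan[OF _ X(3)] X(5) Y(5) by blast
  moreover have "Y \<subseteq> cspan M X" using mem_cspan[OF _ Y(3)] X(5) Y(5) by blast
  ultimately show "m = n"
    using cindep_card_le[OF X(4,1) _ Y(1,3)] cindep_card_le[OF Y(4,1) _ X(1,3)] X(2) Y(2) by simp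
qed

lemma finite_cdim_span:
  assumes "finite X" "X \<subseteq> carrier M"
  shows "finite_cdim M (cspan M X)"
  using assms
proof (induction X rule: finite_psubset_induct)
  case (psubset X)
  note X = psubset.hyps psubset.prems
  show ?case
  proof (cases "cindep M X")
    case True
    then show ?thesis using X unfolding finite_cdim_def has_cdim_def by blast
  next
    case False
    then obtain A c a where A: "finite A" "A \<subseteq> X" "lc A c = \<zero>" "a \<in> A" "c a \<noteq> 0"
      unfolding cindep_lc by blast
    define c' where "c' = (\<lambda>x. if x \<in> A then c x else 0)"
    have c': "lc X c' = \<zero>" unfolding c'_def using lc_extend[OF X(1) A(2) X(2)] A(3) by simp
    have X': "finite (X - {a})" "X - {a} \<subseteq> carrier M" using X by auto
    have "cspan M X = cspan M (X - {a})"
    proof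
      show "cspan M (X - {a}) \<subseteq> cspan M X" unfolding cspan_lc by blast
      show "cspan M X \<subseteq> cspan M (X - {a})"
      proof
        fix y assume "y \<in> cspan M X"
        then obtain d where d: "y = lc X d" using cspan_finite[OF X] by blast
        define e where "e = (\<lambda>x. d x + (- d a / c a) * c' x)"
        have "lc X e = lc X d \<oplus> scal (- d a / c a) \<odot> lc X c'"
          unfolding lc_scal[OF X] lc_add[OF X(2)] e_def ..
        then have y: "y = lc X e" using d c' lc_closed[OF X(2)] by (simp add: smult_0_right)
        have "e a = 0" using A by (simp add: e_def c'_def)
        then have "lc X e = lc X (\<lambda>x. if x \<in> X - {a} then e x else 0)"
          by (intro lc_cong[OF X(2)]) auto
        also have "\<dots> = lc (X - {a}) e" by (rule lc_extend[OF X(1) _ X(2), symmetric]) blast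
        finally show "y \<in> cspan M (X - {a})" using y cspan_finite[OF X'] by blast
      qed
    qed
    moreover have "finite_cdim M (cspan M (X - {a}))"
      by (rule psubset.IH) (use A X in auto)
    ultimately show ?thesis by simp
  qed
qed

subsection \<open>Eigenvectors\<close>

definition csub where
  "csub S \<longleftrightarrow> S \<subseteq> carrier M \<and> \<zero> \<in> S \<and> (\<forall>x\<in>S. \<forall>y\<in>S. x \<oplus> y \<in> S) \<and> (\<forall>a. \<forall>x\<in>S. scal a \<odot> x \<in> S)"

lemma csub_pev:
  assumes S: "csub S" "\<And>x. x \<in> S \<Longrightarrow> g \<odot> x \<in> S" and y: "y \<in> S"
  shows "pev q g \<odot> y \<in> S"
proof (induction q)
  case 0
  show ?case using S y by (auto simp: csub_def smult_0_left)
next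
  case (pCons a q)
  have yc: "y \<in> carrier M" using S(1) y by (auto simp: csub_def)
  have "scal a \<odot> y \<oplus> g \<odot> (pev q g \<odot> y) \<in> S"
    using S(1) S(2)[OF pCons.IH] y by (simp add: csub_def)
  then show ?case by (simp add: smult_add_left[OF yc] smult_mult[OF yc])
qed

lemma scal_smult_eq_0: "x \<in> carrier M \<Longrightarrow> a \<noteq> 0 \<Longrightarrow> scal a \<odot> x = \<zero> \<Longrightarrow> x = \<zero>"
  using smult_mult[of x "scal (1 / a)" "scal a"] by (simp add: scal.scalar_one smult_one smult_0_right flip: scal.scalar_mult)

lemma eigenvector:
  assumes "p \<noteq> 0" and S: "csub S" "\<And>x. x \<in> S \<Longrightarrow> g \<odot> x \<in> S" and y: "y \<in> S" "y \<noteq> \<zero>"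
    and "pev p g \<odot> y = \<zero>"
  shows "\<exists>a. \<exists>x\<in>S. x \<noteq> \<zero> \<and> (g - scal a) \<odot> x = \<zero>"
  using assms(1,6)
proof (induction p rule: poly_roots_induct)
  case (const a)
  then show ?case using scal_smult_eq_0[of y a] S y by (auto simp: csub_def)
next
  case (root a q)
  have yc: "y \<in> carrier M" using S(1) y by (auto simp: csub_def)
  have "(g - scal a) \<odot> (pev q g \<odot> y) = \<zero>"
    using root.prems by (simp only: pev_mult pev_linear smult_mult[OF yc])
  then show ?case using root.IH csub_pev[OF S y(1)] by blast
qed

lemma last_power:
  assumes y: "y \<in> carrier M" "y \<noteq> \<zero>" and g: "g ^ K \<odot> y = \<zero>"
  obtains k where "g ^ k \<odot> y \<noteq> \<zero>" "g ^ Suc k \<odot> y = \<zero>"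
proof -
  define L where "L = (LEAST k. g ^ k \<odot> y = \<zero>)"
  have L: "g ^ L \<odot> y = \<zero>" unfolding L_def by (rule LeastI[of _ K]) (rule g)
  then have "L \<noteq> 0" using y by (metis power_0 smult_one)
  then obtain k where k: "L = Suc k" by (cases L) auto
  then have "g ^ k \<odot> y \<noteq> \<zero>" using not_less_Least[of k "\<lambda>k. g ^ k \<odot> y = \<zero>"] by (auto simp: L_def)
  then show ?thesis using that L k by blast
qed

end

text \<open>Eigenvectors of \<open>g\<close> modulo \<open>J\<close> with different eigenvalues are
  independent: the polynomial with roots at the other eigenvalues isolates the i-th one.\<close>

lemma eigen_sum:
  assumes J: "left_ideal J" and I: "finite I" "inj_on b I"
    and u: "\<And>i. i \<in> I \<Longrightarrow> g * u i - scal (b i) * u i \<in> J"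
    and sum: "(\<Sum>i\<in>I. u i) \<in> J" and i: "i \<in> I"
  shows "u i \<in> J"
proof -
  define q where "q = (\<Prod>j\<in>I - {i}. [:- b j, 1:])"
  have q: "poly q (b i) \<noteq> 0" using I i by (auto simp: q_def poly_prod inj_on_def)
  have q0: "poly q (b j) = 0" if "j \<in> I" "j \<noteq> i" for j
    unfolding q_def poly_prod using I that by (intro prod_zero) auto
  have "pev q g * u j - scal (poly q (b j)) * u j \<in> J" if "j \<in> I" for j
    by (rule pev_eigen[OF left_ideal_usubspace[OF J] _ u[OF that]]) (rule left_idealD(3)[OF J])
  then have "(\<Sum>j\<in>I. pev q g * u j - scal (poly q (b j)) * u j) \<in> J"
    by (intro usubspace_sum[OF left_ideal_usubspace[OF J]])
  moreover have "(\<Sum>j\<in>I. pev q g * u j - scal (poly q (b j)) * u j)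
      = pev q g * (\<Sum>j\<in>I. u j) - (\<Sum>j\<in>I. scal (poly q (b j)) * u j)"
    by (simp add: sum_subtractf sum_distrib_left)
  moreover have "(\<Sum>j\<in>I. scal (poly q (b j)) * u j) = scal (poly q (b i)) * u i"
    using I(1) i by (subst sum.remove[of _ i]) (auto simp: q0 scal_simps intro!: sum.neutral)
  ultimately have "pev q g * (\<Sum>j\<in>I. u j) - scal (poly q (b i)) * u i \<in> J" by simp
  then have "pev q g * (\<Sum>j\<in>I. u j) - (pev q g * (\<Sum>j\<in>I. u j) - scal (poly q (b i)) * u i) \<in> J"
    by (rule left_idealD(5)[OF J left_idealD(3)[OF J sum]])
  then have "scal (poly q (b i)) * u i \<in> J" by simp
  then show ?thesis using usubspace_scal_iff[OF left_ideal_usubspace[OF J] q] by simp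
qed

lemma weight_pow:
  assumes J: "left_ideal J" "uh - scal a \<in> J"
  shows "uh * uf ^ k - scal (a - 2 * of_nat k) * uf ^ k \<in> J"
    and "uh * ue ^ k - scal (a + 2 * of_nat k) * ue ^ k \<in> J"
proof -
  have "uh * uf ^ k - scal (a - 2 * of_nat k) * uf ^ k = uf ^ k * (uh - scal a)"
    by (simp add: comm_h_f_pow scal_diff right_diff_distrib left_diff_distrib scal_commutes)
  then show "uh * uf ^ k - scal (a - 2 * of_nat k) * uf ^ k \<in> J" using left_idealD(3)[OF J] by simp
  have "uh * ue ^ k - scal (a + 2 * of_nat k) * ue ^ k = ue ^ k * (uh - scal a)"
    by (simp add: comm_h_e_pow scal.scalar_add right_diff_distrib distrib_left distrib_right scal_commutes)
  then show "uh * ue ^ k - scal (a + 2 * of_nat k) * ue ^ k \<in> J" using left_idealD(3)[OF J] by simp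
qed

text \<open>The powers of \<open>g\<close> have different weights modulo \<open>J\<close>, so if
  \<open>J\<close> contains a polynomial in \<open>g\<close> it contains each of its terms, in
  particular the leading one.\<close>

lemma weight_pow_mem:
  assumes J: "left_ideal J" "uh - scal a \<in> J" and g: "g = uf \<or> g = ue"
    and p: "p \<noteq> 0" "pev p g \<in> J"
  shows "g ^ degree p \<in> J"
proof -
  define s :: complex where "s = (if g = uf then - 2 else 2)"
  have s: "s \<noteq> 0" by (simp add: s_def)
  have w: "uh * g ^ k - scal (a + s * of_nat k) * g ^ k \<in> J" for k
    using g weight_pow[OF J, of k] by (auto simp: s_def)
  have "uh * (scal (coeff p i) * g ^ i) - scal (a + s * of_nat i) * (scal (coeff p i) * g ^ i)
      = scal (coeff p i) * (uh * g ^ i - scal (a + s * of_nat i) * g ^ i)" for i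
    by (simp add: right_diff_distrib scal_commutes scal_scal mult.commute)
  then have "scal (coeff p (degree p)) * g ^ degree p \<in> J"
    using eigen_sum[OF J(1), of "{..degree p}" "\<lambda>i. a + s * of_nat i" uh "\<lambda>i. scal (coeff p i) * g ^ i" "degree p"]
      p(2) left_idealD(3)[OF J(1) w] s by (simp add: pev_def inj_on_def)
  then show ?thesis using p(1) usubspace_scal_iff[OF left_ideal_usubspace[OF J(1)]] by simp
qed

text \<open>Moving \<open>f\<close> past the power n + 1 of \<open>e\<close> leaves, up to sign, (n
  + 1) (n + b) times the power n, which is not in \<open>J\<close>.\<close>

lemma lowest_weight_integral:
  assumes J: "left_ideal J" and f: "uf \<in> J" and h: "uh - scal b \<in> J"
    and e: "ue ^ n \<notin> J" "ue ^ Suc n \<in> J"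
  shows "b = - of_nat n"
proof -
  have "uf * ue ^ Suc n \<in> J" by (rule left_idealD(3)[OF J(1) e(2)])
  moreover have "ue ^ Suc n * uf \<in> J" by (rule left_idealD(3)[OF J f])
  ultimately have "ue ^ Suc n * uf - uf * ue ^ Suc n \<in> J" by (intro left_idealD(5)[OF J])
  then have "scal (of_nat (Suc n)) * ue ^ n * (uh + scal (of_nat n)) \<in> J"
    by (simp add: comm_f_e_pow del: power_Suc)
  moreover have "scal (of_nat (Suc n)) * ue ^ n * (uh - scal b) \<in> J" by (rule left_idealD(3)[OF J h])
  ultimately have "scal (of_nat (Suc n)) * ue ^ n * (uh + scal (of_nat n))
      - scal (of_nat (Suc n)) * ue ^ n * (uh - scal b) \<in> J" by (rule left_idealD(5)[OF J])
  moreover have "scal N * ue ^ n * (uh + scal c) - scal N * ue ^ n * (uh - scal b) = scal (N * (c + b)) * ue ^ n" for N c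
  proof -
    have "scal N * ue ^ n * (uh + scal c) - scal N * ue ^ n * (uh - scal b) = scal N * (ue ^ n * scal (c + b))"
      by (simp add: scal.scalar_add algebra_simps)
    also have "ue ^ n * scal (c + b) = scal (c + b) * ue ^ n" by (rule scal.scalar_central[symmetric])
    finally show ?thesis by (simp add: scal.scalar_mult mult.assoc)
  qed
  ultimately have *: "scal (of_nat (Suc n) * (of_nat n + b)) * ue ^ n \<in> J" by simp
  have "of_nat (Suc n) * (of_nat n + b) = 0"
    using * e(1) usubspace_scal_iff[OF left_ideal_usubspace[OF J]] by blast
  then show "b = - of_nat n" by (simp add: eq_neg_iff_add_eq_0 add.commute del: of_nat_Suc)
qed

definition lowest_vec :: "(l4 uea, 'a) module \<Rightarrow> nat \<Rightarrow> 'a \<Rightarrow> bool" where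
  "lowest_vec M n x \<longleftrightarrow> x \<in> carrier M \<and> x \<noteq> \<zero>\<^bsub>M\<^esub> \<and> uf \<odot>\<^bsub>M\<^esub> x = \<zero>\<^bsub>M\<^esub> \<and>
    (uh + scal (of_nat n)) \<odot>\<^bsub>M\<^esub> x = \<zero>\<^bsub>M\<^esub> \<and> ue ^ Suc n \<odot>\<^bsub>M\<^esub> x = \<zero>\<^bsub>M\<^esub>"

lemma lowest_vec_ann:
  assumes "lmodule M" "lowest_vec M n x"
  shows "lowest_weight (lmodule.ann M x) n"
proof -
  interpret lmodule M by fact
  have "x \<in> carrier M" "x \<noteq> \<zero>\<^bsub>M\<^esub>" using assms(2) by (simp_all add: lowest_vec_def)
  then show ?thesis
    by unfold_locales (use assms(2) ann_left_ideal ann_1 in \<open>simp_all add: ann_def lowest_vec_def\<close>)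
qed

text \<open>A polynomial in \<open>h\<close> gives a weight vector, one in \<open>f\<close> a last
  nonzero power of \<open>f\<close> on it, and one in \<open>e\<close> the number n, to which the
  weight is then tied by \<open>lowest_weight_integral\<close>.\<close>

lemma lowest_vec_exists:
  fixes M :: "(l4 uea, 'a) module"
  assumes M: "lmodule M" and S: "umodule.csub M S" "\<And>g x. x \<in> S \<Longrightarrow> gen (Lg g) \<odot>\<^bsub>M\<^esub> x \<in> S"
    and y: "y \<in> S" "y \<noteq> \<zero>\<^bsub>M\<^esub>"
    and alg: "\<And>g x. x \<in> S \<Longrightarrow> \<exists>p. p \<noteq> 0 \<and> pev p (gen (Lg g)) \<odot>\<^bsub>M\<^esub> x = \<zero>\<^bsub>M\<^esub>"
  shows "\<exists>n. \<exists>x\<in>S. lowest_vec M n x"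
proof -
  interpret umodule M using M by (simp add: umodule_def)
  have Sc: "x \<in> S \<Longrightarrow> x \<in> carrier M" for x using S(1) by (auto simp: csub_def)
  have pow: "gen (Lg g) ^ k \<odot>\<^bsub>M\<^esub> x \<in> S" if "x \<in> S" for g k x
  proof (induction k)
    case 0
    then show ?case using that Sc by (simp add: smult_one)
  next
    case (Suc k)
    then show ?case using S(2)[OF Suc] Sc[OF that] by (simp add: smult_mult)
  qed
  obtain p where "p \<noteq> 0" "pev p uh \<odot>\<^bsub>M\<^esub> y = \<zero>\<^bsub>M\<^esub>" using alg[OF y(1)] by blast
  then obtain a x where x: "x \<in> S" "x \<noteq> \<zero>\<^bsub>M\<^esub>" "(uh - scal a) \<odot>\<^bsub>M\<^esub> x = \<zero>\<^bsub>M\<^esub>"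
    using eigenvector[OF _ S(1) S(2) y] by blast
  have J: "left_ideal (ann x)" "uh - scal a \<in> ann x" using ann_left_ideal Sc x by (auto simp: ann_def)
  obtain p where p: "p \<noteq> 0" "pev p uf \<in> ann x" using alg[OF x(1)] by (auto simp: ann_def)
  obtain k where k: "uf ^ k \<odot>\<^bsub>M\<^esub> x \<noteq> \<zero>\<^bsub>M\<^esub>" "uf ^ Suc k \<odot>\<^bsub>M\<^esub> x = \<zero>\<^bsub>M\<^esub>"
    using last_power[OF Sc[OF x(1)] x(2)] weight_pow_mem[OF J _ p] by (auto simp: ann_def)
  define x' where "x' = uf ^ k \<odot>\<^bsub>M\<^esub> x"
  define b where "b = a - 2 * of_nat k"
  have x': "x' \<in> S" "x' \<noteq> \<zero>\<^bsub>M\<^esub>" using k pow x by (auto simp: x'_def)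
  note x'c = Sc[OF x'(1)] and xc = Sc[OF x(1)]
  have J': "left_ideal (ann x')" by (rule ann_left_ideal[OF x'c])
  have f: "uf \<in> ann x'" using k(2) ann_smult[OF xc] by (simp add: x'_def ann_def)
  have h: "uh - scal b \<in> ann x'"
    using weight_pow(1)[OF J, of k] ann_smult[OF xc] by (simp add: x'_def b_def left_diff_distrib)
  obtain p where p: "p \<noteq> 0" "pev p ue \<in> ann x'" using alg[OF x'(1)] by (auto simp: ann_def)
  obtain n where n: "ue ^ n \<odot>\<^bsub>M\<^esub> x' \<noteq> \<zero>\<^bsub>M\<^esub>" "ue ^ Suc n \<odot>\<^bsub>M\<^esub> x' = \<zero>\<^bsub>M\<^esub>"
    using last_power[OF x'c x'(2)] weight_pow_mem[OF J' h _ p] by (auto simp: ann_def)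
  have "ue ^ n \<notin> ann x'" "ue ^ Suc n \<in> ann x'" using n by (simp_all add: ann_def)
  then have "b = - of_nat n" by (intro lowest_weight_integral[OF J' f h])
  then have "uh + scal (of_nat n) \<in> ann x'" using h by (simp add: scal_uminus)
  then have "lowest_vec M n x'" using x' x'c f n(2) by (simp add: lowest_vec_def ann_def)
  then show ?thesis using x'(1) by blast
qed

section \<open>Classification of the simple modules\<close>

text \<open>The pairs (m, j) index the three families: (m, 0) with m > 0 for V(m), (0, 0) for V'(0)
  and (0, 1) for V'(2). For m > 0 all \<open>yv j\<close> generate the same module, so j = 0 is
  fixed.\<close>

definition standard_cyc :: "(l4 uea, 'a) module \<Rightarrow> complex \<Rightarrow> nat \<Rightarrow> nat \<Rightarrow> bool" where
  "standard_cyc M z m j \<longleftrightarrow> (m > 0 \<and> j = 0 \<or> m = 0 \<and> j < 2) \<and> (\<exists>x. cyc M x (annB (of_nat m) z j))"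

lemma standard_maximal:
  assumes "z \<noteq> 0" "m > 0 \<and> j = 0 \<or> m = 0 \<and> j < 2"
  shows "maximal_left_ideal (annB (of_nat m) z j)"
  using annB_maximal_pos[of m z] annB_maximal_parity[of z j] assms by auto

lemma lowest_vec_standard:
  assumes W: "simple_lmodule W" "central_char W z" "z \<noteq> 0" and x: "lowest_vec W n x"
  shows "\<exists>m j. standard_cyc W z m j"
proof -
  interpret lmodule W using W(1) by (simp add: simple_lmodule_def)
  have xc: "x \<in> carrier W" "x \<noteq> \<zero>\<^bsub>W\<^esub>" using x by (auto simp: lowest_vec_def)
  interpret lowest_weight "ann x" n by (rule lowest_vec_ann[OF lmodule_axioms x])
  have "lowest_central (ann x) n z"
  proof
    fix u
    have "C2 \<odot>\<^bsub>W\<^esub> (u \<odot>\<^bsub>W\<^esub> x) = scal (z ^ 2) \<odot>\<^bsub>W\<^esub> (u \<odot>\<^bsub>W\<^esub> x)"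
      "C3 \<odot>\<^bsub>W\<^esub> (u \<odot>\<^bsub>W\<^esub> x) = scal (z ^ 3) \<odot>\<^bsub>W\<^esub> (u \<odot>\<^bsub>W\<^esub> x)"
      using W(2) smult_closed[OF xc(1)] by (auto simp: central_char_def)
    then show "C2 * u - scal (z ^ 2) * u \<in> ann x" "C3 * u - scal (z ^ 3) * u \<in> ann x"
      unfolding smult_mult[OF xc(1), symmetric] smult_eq_ann[OF xc(1)] .
  qed (rule W(3))
  then interpret lowest_central "ann x" n z .
  note cm = simple_cyc[OF W(1) xc]
  obtain m j where mj: "ann x = annB (of_nat m) z j" using ideal_eq_annB[OF cm(2)] by blast
  \<comment> \<open>Another generator of the same simple module: \<open>yv j\<close> is lowered to
    \<open>yv 0\<close>, or for m = 0 to the representative of the parity of j.\<close>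
  define j' where "j' = (if m > 0 then 0 else j mod 2)"
  obtain u where u: "act (of_nat m) z u (yv j) = yv j'"
    using reach_0[of m z j] reach_parity[of z j] W(3) by (cases "m > 0") (auto simp: j'_def)
  have "u \<notin> annB (of_nat m) z j" using u yv_nonzero[of j'] by (simp add: annB_def)
  then have "cyc W (u \<odot>\<^bsub>W\<^esub> x) {a. a * u \<in> annB (of_nat m) z j}"
    using cyc_smult[OF cm] mj by simp
  moreover have "{a. a * u \<in> annB (of_nat m) z j} = annB (of_nat m) z j'"
    using annB_translate[OF u] by blast
  ultimately have "standard_cyc W z m j'" unfolding standard_cyc_def by (auto simp: j'_def)
  then show ?thesis by blast
qed

lemma standard_cycE:
  assumes "standard_cyc W z m j"
  obtains x where "cyc W x (annB (of_nat m) z j)" "m > 0 \<and> j = 0 \<or> m = 0 \<and> j < 2"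
  using assms unfolding standard_cyc_def by blast

lemma standard_cyc_simple: "z \<noteq> 0 \<Longrightarrow> standard_cyc W z m j \<Longrightarrow> simple_lmodule W"
  by (rule standard_cycE, assumption) (rule cyc_simple[OF _ standard_maximal])

lemma standard_cyc_iso:
  assumes "standard_cyc W z m j" "standard_cyc W' z m j"
  shows "lmod_iso W W'"
proof -
  obtain x where x: "cyc W x (annB (of_nat m) z j)" by (rule standard_cycE[OF assms(1)])
  obtain y where y: "cyc W' y (annB (of_nat m) z j)" by (rule standard_cycE[OF assms(2)])
  show ?thesis by (rule cyc_iso[OF x y])
qed

lemma standard_cyc_transfer:
  assumes "lmod_iso M N" "standard_cyc N z m j" "lmodule M"
  shows "standard_cyc M z m j"
proof -
  obtain y where y: "cyc N y (annB (of_nat m) z j)" and mj: "m > 0 \<and> j = 0 \<or> m = 0 \<and> j < 2"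
    by (rule standard_cycE[OF assms(2)])
  have "\<exists>x. cyc M x (annB (of_nat m) z j)" by (rule lmod_iso_cyc[OF assms(1) y assms(3)])
  then show ?thesis unfolding standard_cyc_def using mj by (rule conjI[rotated])
qed

lemma cyc_central_char:
  assumes W: "cyc W x J" and J: "\<And>u. C2 * u - scal (z ^ 2) * u \<in> J" "\<And>u. C3 * u - scal (z ^ 3) * u \<in> J"
  shows "central_char W z"
  unfolding central_char_def
proof
  interpret lmodule W by (rule cycD[OF W])
  note xc = cycD(2)[OF W]
  fix y assume "y \<in> carrier W"
  then obtain u where u: "y = u \<odot>\<^bsub>W\<^esub> x" using cycD(3)[OF W] by blast
  show "C2 \<odot>\<^bsub>W\<^esub> y = scal (z ^ 2) \<odot>\<^bsub>W\<^esub> y \<and> C3 \<odot>\<^bsub>W\<^esub> y = scal (z ^ 3) \<odot>\<^bsub>W\<^esub> y"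
    unfolding u smult_mult[OF xc, symmetric] smult_eq_ann[OF xc] using J cycD(4)[OF W] by simp
qed

lemma standard_cyc_central_char:
  assumes z: "z \<noteq> 0" and W: "standard_cyc W z m j"
  shows "central_char W z"
proof -
  obtain x where x: "cyc W x (annB (of_nat m) z j)" by (rule standard_cycE[OF W])
  interpret lowest_central "annB (of_nat m) z j" "m + 2 * j" z by (rule annB_lowest_central[OF z])
  show ?thesis by (rule cyc_central_char[OF x C2J C3J])
qed

section \<open>Internal direct sums\<close>

lemma internal_direct_sum_indep:
  assumes M: "lmodule M" and D: "internal_direct_sum M D" and F: "finite F" "F \<subseteq> D"
    and x: "\<And>N. N \<in> F \<Longrightarrow> x N \<in> N" and sum: "(\<Oplus>\<^bsub>M\<^esub>N\<in>F. x N) = \<zero>\<^bsub>M\<^esub>" and N: "N \<in> F"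
  shows "x N = \<zero>\<^bsub>M\<^esub>"
proof -
  interpret lmodule M by fact
  have sub: "lsubmodule N M" if "N \<in> D" for N using D that by (simp add: internal_direct_sum_def)
  have xc: "x N \<in> carrier M" if "N \<in> F" for N
  proof -
    have "lsubmodule N M" using F(2) that by (intro sub) auto
    then show ?thesis using x[OF that] by (auto simp: lsubmodule_def)
  qed
  have ex1: "\<exists>!y. y \<in> (\<Pi>\<^sub>E N\<in>D. N) \<and> finite {N \<in> D. y N \<noteq> \<zero>\<^bsub>M\<^esub>} \<and>
      \<zero>\<^bsub>M\<^esub> = (\<Oplus>\<^bsub>M\<^esub>N\<in>{N \<in> D. y N \<noteq> \<zero>\<^bsub>M\<^esub>}. y N)"
    using D by (simp add: internal_direct_sum_def)
  \<comment> \<open>Two families representing zero: \<open>x\<close> extended by zero, and the zero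
    family. Both are \<open>undefined\<close> off \<open>D\<close>, as the extensional product
    demands, so uniqueness equates them.\<close>
  define y where "y = (\<lambda>N. if N \<in> D then if N \<in> F then x N else \<zero>\<^bsub>M\<^esub> else undefined)"
  define w where "w = (\<lambda>N. if N \<in> D then \<zero>\<^bsub>M\<^esub> else undefined)"
  have z0: "\<zero>\<^bsub>M\<^esub> \<in> N" if "N \<in> D" for N using sub[OF that] by (simp add: lsubmodule_def)
  have supp: "{N \<in> D. y N \<noteq> \<zero>\<^bsub>M\<^esub>} \<subseteq> F" by (auto simp: y_def)
  have "(\<Oplus>\<^bsub>M\<^esub>N\<in>{N \<in> D. y N \<noteq> \<zero>\<^bsub>M\<^esub>}. y N) = (\<Oplus>\<^bsub>M\<^esub>N\<in>F. x N)"
    by (rule add.finprod_mono_neutral_cong_left) (use F supp xc in \<open>auto simp: y_def\<close>)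
  then have "y \<in> (\<Pi>\<^sub>E N\<in>D. N) \<and> finite {N \<in> D. y N \<noteq> \<zero>\<^bsub>M\<^esub>} \<and>
      \<zero>\<^bsub>M\<^esub> = (\<Oplus>\<^bsub>M\<^esub>N\<in>{N \<in> D. y N \<noteq> \<zero>\<^bsub>M\<^esub>}. y N)"
    using sum finite_subset[OF supp F(1)] x z0 by (auto simp: y_def PiE_def extensional_def)
  moreover have "w \<in> (\<Pi>\<^sub>E N\<in>D. N) \<and> finite {N \<in> D. w N \<noteq> \<zero>\<^bsub>M\<^esub>} \<and>
      \<zero>\<^bsub>M\<^esub> = (\<Oplus>\<^bsub>M\<^esub>N\<in>{N \<in> D. w N \<noteq> \<zero>\<^bsub>M\<^esub>}. w N)"
  proof -
    have "{N \<in> D. w N \<noteq> \<zero>\<^bsub>M\<^esub>} = {}" by (auto simp: w_def)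
    then show ?thesis using z0 finsum_empty by (auto simp: w_def PiE_def extensional_def)
  qed
  ultimately have "y = w" using ex1 by blast
  then have "y N = w N" by simp
  then show ?thesis using N F(2) by (auto simp: y_def w_def)
qed

lemma internal_direct_sum_repr:
  assumes M: "lmodule M" and D: "internal_direct_sum M D" and m: "m \<in> carrier M"
  obtains F x where "finite F" "F \<subseteq> D" "\<And>N. N \<in> F \<Longrightarrow> x N \<in> N" "m = (\<Oplus>\<^bsub>M\<^esub>N\<in>F. x N)"
proof -
  obtain x where x: "x \<in> (\<Pi>\<^sub>E N\<in>D. N)" "finite {N \<in> D. x N \<noteq> \<zero>\<^bsub>M\<^esub>}"
    "m = (\<Oplus>\<^bsub>M\<^esub>N\<in>{N \<in> D. x N \<noteq> \<zero>\<^bsub>M\<^esub>}. x N)"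
    using D m unfolding internal_direct_sum_def by blast
  show ?thesis by (rule that[of "{N \<in> D. x N \<noteq> \<zero>\<^bsub>M\<^esub>}" x]) (use x in \<open>auto simp: PiE_iff\<close>)
qed

text \<open>The summands come as an indexed family instead of a set of submodules; injectivity of
  the indexing lets independence be checked on indices.\<close>

lemma internal_direct_sumI:
  assumes M: "lmodule M" and sub: "\<And>i. i \<in> I \<Longrightarrow> lsubmodule (N i) M" and inj: "inj_on N I"
    and indep: "\<And>F x i. finite F \<Longrightarrow> F \<subseteq> I \<Longrightarrow> (\<And>i. i \<in> F \<Longrightarrow> x i \<in> N i) \<Longrightarrow>
      (\<Oplus>\<^bsub>M\<^esub>i\<in>F. x i) = \<zero>\<^bsub>M\<^esub> \<Longrightarrow> i \<in> F \<Longrightarrow> x i = \<zero>\<^bsub>M\<^esub>"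
    and span: "\<And>m. m \<in> carrier M \<Longrightarrow>
      \<exists>F x. finite F \<and> F \<subseteq> I \<and> (\<forall>i\<in>F. x i \<in> N i) \<and> m = (\<Oplus>\<^bsub>M\<^esub>i\<in>F. x i)"
  shows "internal_direct_sum M (N ` I)"
  unfolding internal_direct_sum_def
proof (intro conjI ballI)
  interpret lmodule M by fact
  show "lsubmodule K M" if "K \<in> N ` I" for K using that sub by blast
  have Nc: "x \<in> N i \<Longrightarrow> x \<in> carrier M" if "i \<in> I" for i x using sub[OF that] by (auto simp: lsubmodule_def)
  have zN: "\<zero>\<^bsub>M\<^esub> \<in> N i" if "i \<in> I" for i using sub[OF that] by (auto simp: lsubmodule_def)
  fix m assume m: "m \<in> carrier M"
  let ?P = "\<lambda>y. y \<in> (\<Pi>\<^sub>E K\<in>N ` I. K) \<and> finite {K \<in> N ` I. y K \<noteq> \<zero>\<^bsub>M\<^esub>} \<and>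
      m = (\<Oplus>\<^bsub>M\<^esub>K\<in>{K \<in> N ` I. y K \<noteq> \<zero>\<^bsub>M\<^esub>}. y K)"
  have supp: "{K \<in> N ` I. y K \<noteq> \<zero>\<^bsub>M\<^esub>} = N ` {i \<in> I. y (N i) \<noteq> \<zero>\<^bsub>M\<^esub>}" for y by auto
  have sum: "(\<Oplus>\<^bsub>M\<^esub>K\<in>{K \<in> N ` I. y K \<noteq> \<zero>\<^bsub>M\<^esub>}. y K) = (\<Oplus>\<^bsub>M\<^esub>i\<in>F. y (N i))"
    if y: "\<And>i. i \<in> I \<Longrightarrow> y (N i) \<in> N i" and F: "finite F" "F \<subseteq> I" "{i \<in> I. y (N i) \<noteq> \<zero>\<^bsub>M\<^esub>} \<subseteq> F" for y F
  proof -
    have "(\<Oplus>\<^bsub>M\<^esub>K\<in>N ` {i \<in> I. y (N i) \<noteq> \<zero>\<^bsub>M\<^esub>}. y K) = (\<Oplus>\<^bsub>M\<^esub>i\<in>{i \<in> I. y (N i) \<noteq> \<zero>\<^bsub>M\<^esub>}. y (N i))"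
      by (rule finsum_reindex) (use y Nc inj in \<open>auto intro: inj_on_subset\<close>)
    also have "\<dots> = (\<Oplus>\<^bsub>M\<^esub>i\<in>F. y (N i))"
      by (rule add.finprod_mono_neutral_cong_left) (use F y Nc in auto)
    finally show ?thesis using supp[of y] by simp
  qed
  obtain F x where F: "finite F" "F \<subseteq> I" "\<forall>i\<in>F. x i \<in> N i" "m = (\<Oplus>\<^bsub>M\<^esub>i\<in>F. x i)" using span[OF m] by blast
  define y where "y = (\<lambda>K. if K \<in> N ` I then if inv_into I N K \<in> F then x (inv_into I N K) else \<zero>\<^bsub>M\<^esub> else undefined)"
  have yN: "y (N i) = (if i \<in> F then x i else \<zero>\<^bsub>M\<^esub>)" if "i \<in> I" for i
    using that inj by (simp add: y_def)
  have yF: "{i \<in> I. y (N i) \<noteq> \<zero>\<^bsub>M\<^esub>} \<subseteq> F" using yN by (auto split: if_splits)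
  have yi: "y (N i) \<in> N i" if "i \<in> I" for i using that F(3) zN by (simp add: yN)
  have Py: "?P y"
  proof (intro conjI)
    show "y \<in> (\<Pi>\<^sub>E K\<in>N ` I. K)" using yi by (auto simp: PiE_iff extensional_def) (simp add: y_def)
    show "finite {K \<in> N ` I. y K \<noteq> \<zero>\<^bsub>M\<^esub>}" unfolding supp using finite_subset[OF yF F(1)] by simp
    have "(\<Oplus>\<^bsub>M\<^esub>i\<in>F. y (N i)) = (\<Oplus>\<^bsub>M\<^esub>i\<in>F. x i)"
      by (rule finsum_cong') (use F Nc yN in auto)
    then show "m = (\<Oplus>\<^bsub>M\<^esub>K\<in>{K \<in> N ` I. y K \<noteq> \<zero>\<^bsub>M\<^esub>}. y K)" using sum[OF yi F(1,2) yF] F(4) by simp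
  qed
  show "\<exists>!y. ?P y"
  proof (rule ex1I[of ?P y, OF Py])
    fix w assume Pw: "?P w"
    have wi: "w (N i) \<in> N i" if "i \<in> I" for i using Pw that by (auto simp: PiE_iff)
    have "finite (N ` {i \<in> I. w (N i) \<noteq> \<zero>\<^bsub>M\<^esub>})" using Pw supp[of w] by simp
    then have finw: "finite {i \<in> I. w (N i) \<noteq> \<zero>\<^bsub>M\<^esub>}"
      by (rule finite_imageD) (use inj in \<open>auto intro: inj_on_subset\<close>)
    define G where "G = F \<union> {i \<in> I. w (N i) \<noteq> \<zero>\<^bsub>M\<^esub>}"
    have G: "finite G" "G \<subseteq> I" using finw F by (auto simp: G_def)
    have "m = (\<Oplus>\<^bsub>M\<^esub>i\<in>G. w (N i))" using Pw sum[OF wi G] by (auto simp: G_def)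
    moreover have "m = (\<Oplus>\<^bsub>M\<^esub>i\<in>G. y (N i))" using Py sum[OF yi G] yF by (auto simp: G_def)
    moreover have "(\<Oplus>\<^bsub>M\<^esub>i\<in>G. y (N i)) = (\<Oplus>\<^bsub>M\<^esub>i\<in>G. (y (N i) \<ominus>\<^bsub>M\<^esub> w (N i)) \<oplus>\<^bsub>M\<^esub> w (N i))"
      by (rule finsum_cong')
        (use G(2) yi wi Nc in \<open>auto simp: a_minus_def a_assoc l_neg subset_iff\<close>)
    moreover have "\<dots> = (\<Oplus>\<^bsub>M\<^esub>i\<in>G. y (N i) \<ominus>\<^bsub>M\<^esub> w (N i)) \<oplus>\<^bsub>M\<^esub> (\<Oplus>\<^bsub>M\<^esub>i\<in>G. w (N i))"
      by (rule finsum_addf) (use G(2) yi wi Nc in \<open>auto simp: subset_iff\<close>)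
    ultimately have s: "(\<Oplus>\<^bsub>M\<^esub>i\<in>G. y (N i) \<ominus>\<^bsub>M\<^esub> w (N i)) \<oplus>\<^bsub>M\<^esub> m = m" by simp
    have sc: "(\<Oplus>\<^bsub>M\<^esub>i\<in>G. y (N i) \<ominus>\<^bsub>M\<^esub> w (N i)) \<in> carrier M"
      by (rule finsum_closed) (use G(2) yi wi Nc in \<open>auto simp: subset_iff\<close>)
    have s0: "(\<Oplus>\<^bsub>M\<^esub>i\<in>G. y (N i) \<ominus>\<^bsub>M\<^esub> w (N i)) = \<zero>\<^bsub>M\<^esub>"
    proof -
      have "a = \<zero>\<^bsub>M\<^esub>" if a: "a \<in> carrier M" "a \<oplus>\<^bsub>M\<^esub> m = m" for a
      proof -
        have "a = a \<oplus>\<^bsub>M\<^esub> (m \<oplus>\<^bsub>M\<^esub> \<ominus>\<^bsub>M\<^esub> m)" using a m by (simp add: r_neg)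
        also have "\<dots> = (a \<oplus>\<^bsub>M\<^esub> m) \<oplus>\<^bsub>M\<^esub> \<ominus>\<^bsub>M\<^esub> m" using a m by (simp add: a_assoc)
        also have "\<dots> = \<zero>\<^bsub>M\<^esub>" using a m by (simp add: r_neg)
        finally show ?thesis .
      qed
      then show ?thesis using s sc by blast
    qed
    have "y (N i) = w (N i)" if i: "i \<in> I" for i
    proof (cases "i \<in> G")
      case True
      have "y (N i) \<ominus>\<^bsub>M\<^esub> w (N i) = \<zero>\<^bsub>M\<^esub>"
      proof (rule indep[OF G _ s0 True])
        fix j assume "j \<in> G"
        then have j: "j \<in> I" using G by blast
        have "\<ominus>\<^bsub>M\<^esub> w (N j) = (- 1) \<odot>\<^bsub>M\<^esub> w (N j)"
          using smult_uminus_left[of "w (N j)" 1] Nc[OF j wi[OF j]] by (simp add: smult_one)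
        also have "\<dots> \<in> N j" using sub[OF j] wi[OF j] by (simp add: lsubmodule_def)
        finally show "y (N j) \<ominus>\<^bsub>M\<^esub> w (N j) \<in> N j"
          using sub[OF j] yi[OF j] by (simp add: lsubmodule_def a_minus_def)
      qed
      then show ?thesis using diff_eq_zero Nc[OF i] yi[OF i] wi[OF i] by blast
    next
      case False
      then show ?thesis using i yF by (auto simp: G_def)
    qed
    then show "w = y" using Pw Py by (intro PiE_ext[of w "N ` I" "\<lambda>K. K" y]) auto
  qed
qed

section \<open>The restriction to \<open>sl2\<close>\<close>

lemma sl2_emb_simps:
  "sl2_emb (gen g) = gen (Lg g)" "sl2_emb (scal a) = scal a" "sl2_emb (u + v) = sl2_emb u + sl2_emb v"
  "sl2_emb (u * v) = sl2_emb u * sl2_emb v" "sl2_emb 0 = 0" "sl2_emb 1 = 1"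
  using sl2_emb.uea_lift_scal[of 0]
  by (simp_all add: sl2_emb_def sl2_emb.uea_lift_gen sl2_emb.uea_lift_scal sl2_emb.uea_lift_add
    sl2_emb.uea_lift_mult sl2_emb.uea_lift_one scal_simps)

lemma sl2_emb_pow: "sl2_emb (u ^ k) = sl2_emb u ^ k"
  by (induction k) (simp_all add: sl2_emb_simps)

lemma sl2_emb_pev: "sl2_emb (pev p u) = pev p (sl2_emb u)"
  by (induction p) (simp_all add: sl2_emb_simps)

abbreviation "res M \<equiv> pullback sl2_emb M"

lemma res_simps [simp]:
  "carrier (res M) = carrier M" "add (res M) = add M" "zero (res M) = zero M"
  "v \<odot>\<^bsub>res M\<^esub> x = sl2_emb v \<odot>\<^bsub>M\<^esub> x"
  by (simp_all add: pullback_def)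

lemma finite_cdim_algebraic:
  assumes M: "lmodule M" and N: "lsubmodule N (res M)" "finite_cdim (res M) N" and x: "x \<in> N"
  shows "\<exists>p. p \<noteq> 0 \<and> pev p (gen (Lg g)) \<odot>\<^bsub>M\<^esub> x = \<zero>\<^bsub>M\<^esub>"
proof -
  interpret umodule "res M" using lmodule_pullback_sl2[OF M] by (simp add: umodule_def)
  obtain X where X: "finite X" "X \<subseteq> carrier M" "cspan (res M) X = N"
    using N(2) by (auto simp: finite_cdim_def has_cdim_def)
  have xc: "x \<in> carrier M" using N(1) x by (auto simp: lsubmodule_def)
  have "gen g ^ k \<odot>\<^bsub>res M\<^esub> x \<in> cspan (res M) X" for k
    unfolding X(3) using N(1) x unfolding lsubmodule_def by blast
  then obtain p where "p \<noteq> 0" "pev p (gen g) \<odot>\<^bsub>res M\<^esub> x = \<zero>\<^bsub>res M\<^esub>"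
    using span_polynomial[OF X(1), of x "gen g"] X(2) xc by auto
  then show ?thesis by (auto simp: sl2_emb_pev sl2_emb_simps)
qed

lemma res_submodule_csub:
  assumes "lmodule M" "lsubmodule N (res M)"
  shows "umodule.csub M N" "x \<in> N \<Longrightarrow> gen (Lg g) \<odot>\<^bsub>M\<^esub> x \<in> N"
proof -
  interpret umodule M using assms(1) by (simp add: umodule_def)
  have N: "N \<subseteq> carrier M" "\<zero>\<^bsub>M\<^esub> \<in> N" "\<And>x y. x \<in> N \<Longrightarrow> y \<in> N \<Longrightarrow> x \<oplus>\<^bsub>M\<^esub> y \<in> N"
    "\<And>r x. x \<in> N \<Longrightarrow> sl2_emb r \<odot>\<^bsub>M\<^esub> x \<in> N"
    using assms(2) by (auto simp: lsubmodule_def)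
  show "csub N" unfolding csub_def using N N(4)[of _ "scal _"] by (auto simp: sl2_emb_simps)
  show "x \<in> N \<Longrightarrow> gen (Lg g) \<odot>\<^bsub>M\<^esub> x \<in> N" using N(4)[of x "gen g"] by (simp add: sl2_emb_simps)
qed

lemma res_lowest_vec_exists:
  assumes M: "lmodule M" and N: "lsubmodule N (res M)" and K: "lsubmodule K (res M)" "finite_cdim (res M) K" "N \<subseteq> K"
    and y: "y \<in> N" "y \<noteq> \<zero>\<^bsub>M\<^esub>"
  shows "\<exists>n. \<exists>x\<in>N. lowest_vec M n x"
proof (rule lowest_vec_exists[OF M res_submodule_csub[OF M N] y])
  show "\<exists>p. p \<noteq> 0 \<and> pev p (gen (Lg g)) \<odot>\<^bsub>M\<^esub> x = \<zero>\<^bsub>M\<^esub>" if "x \<in> N" for g x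
    using finite_cdim_algebraic[OF M K(1,2)] K(3) that by blast
qed assumption

context lowest_weight
begin

text \<open>The powers of \<open>e\<close> have different weights, and up to exponent n none is
  zero, because \<open>f\<close> sends each to a nonzero multiple of the previous one.\<close>

lemma e_pow_indep:
  assumes "(\<Sum>k\<le>n. scal (c k) * ue ^ k) \<in> J" "k \<le> n"
  shows "c k = 0"
proof -
  have "scal (c k) * ue ^ k \<in> J"
  proof (rule eigen_sum[OF J, of "{..n}" "\<lambda>k. 2 * of_nat k - of_nat n" uh])
    show "uh * (scal (c i) * ue ^ i) - scal (2 * of_nat i - of_nat n) * (scal (c i) * ue ^ i) \<in> J" for i
    proof -
      have "uh * (scal (c i) * ue ^ i) - scal (2 * of_nat i - of_nat n) * (scal (c i) * ue ^ i)
          = scal (c i) * (uh * ue ^ i - scal (2 * of_nat i - of_nat n) * ue ^ i)"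
        by (simp add: right_diff_distrib scal_commutes scal_scal mult.commute)
      then show ?thesis using left_idealD(3)[OF J weight_e] by simp
    qed
  qed (use assms in \<open>auto simp: inj_on_def\<close>)
  moreover have "ue ^ k \<notin> J"
    using assms(2)
  proof (induction k)
    case 0
    then show ?case using J1 by simp
  next
    case (Suc k)
    show ?case
    proof
      assume "ue ^ Suc k \<in> J"
      then have "uf * ue ^ Suc k \<in> J" by (rule left_idealD(3)[OF J])
      then have "uf * ue ^ Suc k - (uf * ue ^ Suc k - scal (of_nat (Suc k) * (of_nat n - of_nat k)) * ue ^ k) \<in> J"
        by (rule left_idealD(5)[OF J _ f_e])
      then have "scal (of_nat (Suc k) * (of_nat n - of_nat k)) * ue ^ k \<in> J" by simp
      moreover have "of_nat (Suc k) * (of_nat n - of_nat k :: complex) \<noteq> 0"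
        using Suc.prems by (simp del: of_nat_Suc)
      ultimately have "ue ^ k \<in> J" using usubspace_scal_iff[OF left_ideal_usubspace[OF J]] by blast
      then show False using Suc by simp
    qed
  qed
  ultimately show ?thesis using usubspace_scal_iff[OF left_ideal_usubspace[OF J]] by blast
qed

lemma f_e_pow_pow:
  assumes "k \<le> n"
  shows "\<exists>a. a \<noteq> 0 \<and> uf ^ k * ue ^ k - scal a \<in> J"
  using assms
proof (induction k)
  case 0
  then show ?case by (intro exI[of _ 1]) (simp add: scal_simps left_idealD(1)[OF J])
next
  case (Suc k)
  then obtain a where a: "a \<noteq> 0" "uf ^ k * ue ^ k - scal a \<in> J" by auto
  define b :: complex where "b = of_nat (Suc k) * (of_nat n - of_nat k)"
  have "b \<noteq> 0" using Suc.prems by (simp add: b_def del: of_nat_Suc)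
  have "uf ^ k * (uf * ue ^ Suc k - scal b * ue ^ k) \<in> J" unfolding b_def by (rule left_idealD(3)[OF J f_e])
  moreover have "scal b * (uf ^ k * ue ^ k - scal a) \<in> J" by (rule left_idealD(3)[OF J a(2)])
  ultimately have "uf ^ k * (uf * ue ^ Suc k - scal b * ue ^ k) + scal b * (uf ^ k * ue ^ k - scal a) \<in> J"
    by (rule left_idealD(2)[OF J])
  moreover have "uf ^ k * (uf * ue ^ Suc k - scal b * ue ^ k) + scal b * (uf ^ k * ue ^ k - scal a)
      = uf ^ Suc k * ue ^ Suc k - scal (b * a)"
    unfolding power_Suc2[of uf k] right_diff_distrib scal.scalar_mult
    by (simp add: mult.assoc scal_commutes)
  ultimately show ?case using a(1) \<open>b \<noteq> 0\<close> by (intro exI[of _ "b * a"]) simp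
qed

lemma sl2_span: "\<exists>c. sl2_emb v - (\<Sum>k\<le>n. scal (c k) * ue ^ k) \<in> J"
proof -
  define E where "E = {u. \<exists>c. u - (\<Sum>k\<le>n. scal (c k) * ue ^ k) \<in> J}"
  have E: "usubspace E"
    unfolding usubspace_def
  proof (intro conjI ballI allI)
    show "0 \<in> E" unfolding E_def mem_Collect_eq
      by (rule exI[of _ "\<lambda>_. 0"]) (simp add: scal_simps left_idealD(1)[OF J])
    fix x assume "x \<in> E"
    then obtain c where c: "x - (\<Sum>k\<le>n. scal (c k) * ue ^ k) \<in> J" by (auto simp: E_def)
    show "scal a * x \<in> E" for a
    proof -
      have "scal a * (x - (\<Sum>k\<le>n. scal (c k) * ue ^ k)) \<in> J" by (rule left_idealD(3)[OF J c])
      moreover have "scal a * (x - (\<Sum>k\<le>n. scal (c k) * ue ^ k)) = scal a * x - (\<Sum>k\<le>n. scal (a * c k) * ue ^ k)"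
        by (simp add: right_diff_distrib sum_distrib_left scal_scal)
      ultimately show ?thesis unfolding E_def by auto
    qed
    fix y assume "y \<in> E"
    then obtain d where d: "y - (\<Sum>k\<le>n. scal (d k) * ue ^ k) \<in> J" by (auto simp: E_def)
    have "(x - (\<Sum>k\<le>n. scal (c k) * ue ^ k)) + (y - (\<Sum>k\<le>n. scal (d k) * ue ^ k)) \<in> J"
      by (rule left_idealD(2)[OF J c d])
    moreover have "(x - (\<Sum>k\<le>n. scal (c k) * ue ^ k)) + (y - (\<Sum>k\<le>n. scal (d k) * ue ^ k))
        = x + y - (\<Sum>k\<le>n. scal (c k + d k) * ue ^ k)"
      by (simp add: scal.scalar_add distrib_right sum.distrib)
    ultimately show "x + y \<in> E" unfolding E_def by auto
  qed
  have JE: "J \<subseteq> E" unfolding E_def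
    by (auto simp: scal_simps intro!: exI[of _ "\<lambda>_. 0"])
  have pow: "ue ^ k \<in> E" for k
  proof (cases "k \<le> n")
    case True
    have "(\<Sum>i\<le>n. scal (if i = k then 1 else 0) * ue ^ i) = (\<Sum>i\<le>n. if i = k then ue ^ k else 0)"
      by (intro sum.cong refl) (auto simp: scal_simps)
    then have "ue ^ k - (\<Sum>i\<le>n. scal (if i = k then 1 else 0) * ue ^ i) \<in> J"
      using True by (simp add: left_idealD(1)[OF J])
    then show ?thesis unfolding E_def mem_Collect_eq by (rule exI[of _ "\<lambda>i. if i = k then 1 else 0"])
  next
    case False
    then show ?thesis using e_pow_mem[of k] JE by auto
  qed
  have closed_pow: "gen (Lg g) * ue ^ k \<in> E" for g k
  proof (cases g)
    case sl2_e
    then show ?thesis using pow[of "Suc k"] by simp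
  next
    case sl2_h
    have "uh * ue ^ k - scal (2 * of_nat k - of_nat n) * ue ^ k \<in> E" using weight_e JE by blast
    then show ?thesis using usubspace_cong_mem[OF E _ usubspaceD(3)[OF E pow]] sl2_h by simp
  next
    case sl2_f
    show ?thesis
    proof (cases k)
      case 0
      then show ?thesis using fJ JE sl2_f by auto
    next
      case (Suc i)
      have "uf * ue ^ Suc i - scal (of_nat (Suc i) * (of_nat n - of_nat i)) * ue ^ i \<in> E" using f_e JE by blast
      then show ?thesis using usubspace_cong_mem[OF E _ usubspaceD(3)[OF E pow]] sl2_f Suc by simp
    qed
  qed
  have closed: "gen (Lg g) * u \<in> E" if "u \<in> E" for g u
  proof -
    obtain c where c: "u - (\<Sum>k\<le>n. scal (c k) * ue ^ k) \<in> J" using \<open>u \<in> E\<close> by (auto simp: E_def)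
    have "gen (Lg g) * (u - (\<Sum>k\<le>n. scal (c k) * ue ^ k)) \<in> E" using left_idealD(3)[OF J c] JE by blast
    moreover have "gen (Lg g) * (u - (\<Sum>k\<le>n. scal (c k) * ue ^ k))
        = gen (Lg g) * u - (\<Sum>k\<le>n. scal (c k) * (gen (Lg g) * ue ^ k))"
      by (simp add: right_diff_distrib sum_distrib_left scal_commutes)
    moreover have "(\<Sum>k\<le>n. scal (c k) * (gen (Lg g) * ue ^ k)) \<in> E"
      by (intro usubspace_sum[OF E] usubspaceD(3)[OF E] closed_pow)
    ultimately show ?thesis using usubspace_cong_mem[OF E] by simp
  qed
  have "left_ideal {v. sl2_emb v \<in> E}"
    by (rule usubspace_left_idealI)
      (use E closed in \<open>auto simp: usubspace_def sl2_emb_simps\<close>)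
  moreover have "1 \<in> {v. sl2_emb v \<in> E}" using pow[of 0] by (simp add: sl2_emb_simps)
  ultimately have "{v. sl2_emb v \<in> E} = UNIV" by (rule left_ideal_1)
  then have "sl2_emb v \<in> E" by blast
  then show ?thesis by (simp add: E_def)
qed

end

definition sl2_gen :: "(l4 uea, 'a) module \<Rightarrow> 'a \<Rightarrow> 'a set" where
  "sl2_gen M x = {sl2_emb v \<odot>\<^bsub>M\<^esub> x | v. True}"

lemma sl2_gen_submodule: "lmodule M \<Longrightarrow> x \<in> carrier M \<Longrightarrow> lsubmodule (sl2_gen M x) (res M)"
  using lmodule.cyclic_submodule[OF lmodule_pullback_sl2, of M x] by (simp add: sl2_gen_def)

text \<open>The first n + 1 powers of \<open>e\<close> on x form a basis. A nonzero submodule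
  contains a lowest weight vector, and among combinations of the basis only multiples of x are
  killed by \<open>f\<close>.\<close>

lemma sl2_gen_is_L:
  assumes M: "lmodule M" and x: "lowest_vec M n x"
  shows "is_L n (lsub (res M) (sl2_gen M x))" "finite_cdim (res M) (sl2_gen M x)"
proof -
  interpret M: lmodule M by fact
  have xc: "x \<in> carrier M" "x \<noteq> \<zero>\<^bsub>M\<^esub>" using x by (auto simp: lowest_vec_def)
  interpret lowest_weight "M.ann x" n by (rule lowest_vec_ann[OF M x])
  let ?R = "res M" and ?L = "sl2_gen M x"
  have R: "lmodule ?R" by (rule lmodule_pullback_sl2[OF M])
  interpret R: umodule ?R using R by (simp add: umodule_def)
  note L = sl2_gen_submodule[OF M xc(1)]
  have LR: "lmodule (lsub ?R ?L)" by (rule lsubmodule_lmodule[OF R L])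
  interpret L: umodule "lsub ?R ?L" using LR by (simp add: umodule_def)
  define b where "b k = ue ^ k \<odot>\<^bsub>M\<^esub> x" for k
  have bL: "b k \<in> ?L" for k
    unfolding b_def sl2_gen_def by (rule CollectI, rule exI[of _ "gen sl2_e ^ k"]) (simp add: sl2_emb_pow sl2_emb_simps)
  have bc: "b k \<in> carrier M" for k by (simp add: b_def M.smult_closed xc)
  have comb: "(\<Sum>k\<le>n. scal (c k) * ue ^ k) \<odot>\<^bsub>M\<^esub> x = (\<Oplus>\<^bsub>M\<^esub>k\<in>{..n}. scal (c k) \<odot>\<^bsub>M\<^esub> b k)" for c
    unfolding M.smult_sum[OF finite_atMost xc(1)] b_def
    by (rule M.finsum_cong') (auto simp: M.smult_mult[OF xc(1)] intro!: M.smult_closed xc)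
  have inj: "inj_on b {..n}"
  proof (rule inj_onI, rule ccontr)
    fix i k assume ik: "i \<in> {..n}" "k \<in> {..n}" "b i = b k" "i \<noteq> k"
    define c :: "nat \<Rightarrow> complex" where "c = (\<lambda>j. if j = i then 1 else if j = k then - 1 else 0)"
    have "(\<Sum>j\<le>n. scal (c j) * ue ^ j) = (\<Sum>j\<in>{i, k}. scal (c j) * ue ^ j)"
      by (rule sum.mono_neutral_right) (use ik in \<open>auto simp: c_def scal_simps\<close>)
    also have "\<dots> = ue ^ i - ue ^ k" using ik by (simp add: c_def scal_simps scal_uminus)
    finally have "(\<Sum>j\<le>n. scal (c j) * ue ^ j) \<in> M.ann x"
      using ik(3) M.smult_eq_ann[OF xc(1)] by (simp add: b_def)
    from e_pow_indep[OF this, of i] show False using ik by (simp add: c_def)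
  qed
  let ?X = "b ` {..n}"
  have X: "finite ?X" "?X \<subseteq> carrier M" "?X \<subseteq> ?L" "card ?X = Suc n"
    using bc bL inj by (auto simp: card_image)
  have lc: "(\<Oplus>\<^bsub>M\<^esub>y\<in>?X. scal (d y) \<odot>\<^bsub>M\<^esub> y) = (\<Sum>k\<le>n. scal (d (b k)) * ue ^ k) \<odot>\<^bsub>M\<^esub> x" for d
    unfolding comb by (rule M.finsum_reindex) (use inj bc M.smult_closed in auto)
  have lcR: "R.lc ?X d = (\<Sum>k\<le>n. scal (d (b k)) * ue ^ k) \<odot>\<^bsub>M\<^esub> x" for d
    unfolding lc[symmetric] R.lc_def using finsum_pullback[OF M, of "\<lambda>y. scal (d y) \<odot>\<^bsub>M\<^esub> y" ?X] X(2) M.smult_closed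
    by (auto simp: sl2_emb_simps)
  have lcL: "L.lc ?X d = R.lc ?X d" for d
  proof -
    have "(\<lambda>y. scal (d y) \<odot>\<^bsub>?R\<^esub> y) \<in> ?X \<rightarrow> ?L"
    proof
      fix y assume "y \<in> ?X"
      then have "y \<in> ?L" using X(3) by blast
      then show "scal (d y) \<odot>\<^bsub>?R\<^esub> y \<in> ?L" using L unfolding lsubmodule_def by blast
    qed
    from finsum_lsub[OF R L this] show ?thesis unfolding L.lc_def R.lc_def by simp
  qed
  have ex: "\<exists>d. y = R.lc ?X d" if y: "y \<in> ?L" for y
  proof -
    obtain v where v: "y = sl2_emb v \<odot>\<^bsub>M\<^esub> x" using y by (auto simp: sl2_gen_def)
    obtain c where "sl2_emb v - (\<Sum>k\<le>n. scal (c k) * ue ^ k) \<in> M.ann x" using sl2_span by blast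
    then have y: "y = (\<Sum>k\<le>n. scal (c k) * ue ^ k) \<odot>\<^bsub>M\<^esub> x" using v M.smult_eq_ann[OF xc(1)] by simp
    have "(\<Sum>k\<le>n. scal (c (inv_into {..n} b (b k))) * ue ^ k) = (\<Sum>k\<le>n. scal (c k) * ue ^ k)"
      by (rule sum.cong) (use inj in auto)
    then have "y = R.lc ?X (\<lambda>z. c (inv_into {..n} b z))" unfolding lcR y by simp
    then show ?thesis by blast
  qed
  have RX: "finite ?X" "?X \<subseteq> carrier ?R" using X by auto
  have span: "cspan ?R ?X = ?L"
  proof
    show "cspan ?R ?X \<subseteq> ?L"
    proof
      fix y assume "y \<in> cspan ?R ?X"
      then obtain d where "y = R.lc ?X d" using R.cspan_finite[OF RX] by blast
      moreover have "L.lc ?X d \<in> ?L" using L.lc_closed[of ?X d] X(3) by simp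
      ultimately show "y \<in> ?L" using lcL by simp
    qed
    show "?L \<subseteq> cspan ?R ?X" using ex R.cspan_finite[OF RX] by blast
  qed
  show fin: "finite_cdim ?R ?L" using R.finite_cdim_span[OF RX] span by simp
  have LX: "finite ?X" "?X \<subseteq> carrier (lsub ?R ?L)" using X by auto
  have "cspan (lsub ?R ?L) ?X = ?L"
  proof
    show "cspan (lsub ?R ?L) ?X \<subseteq> ?L" using L.cspan_finite[OF LX] L.lc_closed[OF LX(2)] by auto
    show "?L \<subseteq> cspan (lsub ?R ?L) ?X"
    proof
      fix y assume "y \<in> ?L"
      then obtain d where "y = R.lc ?X d" using ex by blast
      then have "y = L.lc ?X d" by (simp only: lcL)
      then have "\<exists>d. y = L.lc ?X d" by (intro exI[of _ d])
      then show "y \<in> cspan (lsub ?R ?L) ?X" using L.cspan_finite[OF LX] by simp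
    qed
  qed
  moreover have "cindep (lsub ?R ?L) ?X"
    unfolding L.cindep_lc
  proof (intro allI impI ballI)
    fix A c y assume A: "finite A" "A \<subseteq> ?X" "L.lc A c = \<zero>\<^bsub>lsub ?R ?L\<^esub>" "y \<in> A"
    define d where "d = (\<lambda>y. if y \<in> A then c y else 0)"
    have "L.lc ?X d = \<zero>\<^bsub>M\<^esub>" using L.lc_extend[OF LX(1) A(2) LX(2)] A(3) by (simp add: d_def)
    then have "(\<Sum>k\<le>n. scal (d (b k)) * ue ^ k) \<in> M.ann x" by (simp add: lcL lcR M.ann_def)
    then have "d (b k) = 0" if "k \<le> n" for k using e_pow_indep[of "\<lambda>k. d (b k)" k] that by simp
    moreover obtain k where "k \<le> n" "y = b k" using A(2,4) by auto
    ultimately have "d y = 0" by simp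
    then show "c y = 0" using A(4) by (simp add: d_def)
  qed
  ultimately have dim: "has_cdim (lsub ?R ?L) (carrier (lsub ?R ?L)) (n + 1)"
    unfolding has_cdim_def using LX X(4) by (intro exI[of _ ?X]) simp
  have "simple_lmodule (lsub ?R ?L)"
    unfolding simple_lmodule_def
  proof (intro conjI allI impI LR)
    have "x \<in> ?L" using bL[of 0] M.smult_one[OF xc(1)] by (simp add: b_def)
    then show "carrier (lsub ?R ?L) \<noteq> {\<zero>\<^bsub>lsub ?R ?L\<^esub>}" using xc(2) by auto
    fix K assume "lsubmodule K (lsub ?R ?L)"
    then have K: "lsubmodule K ?R" "K \<subseteq> ?L" unfolding lsubmodule_trans[OF L] by auto
    show "K = {\<zero>\<^bsub>lsub ?R ?L\<^esub>} \<or> K = carrier (lsub ?R ?L)"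
    proof (cases "K = {\<zero>\<^bsub>M\<^esub>}")
      case False
      then obtain y where "y \<in> K" "y \<noteq> \<zero>\<^bsub>M\<^esub>" using K(1) by (auto simp: lsubmodule_def)
      then obtain n' w where w: "w \<in> K" "lowest_vec M n' w"
        using res_lowest_vec_exists[OF M K(1) L fin K(2)] by blast
      obtain v where v: "w = sl2_emb v \<odot>\<^bsub>M\<^esub> x" using w(1) K(2) by (auto simp: sl2_gen_def)
      obtain c where c: "sl2_emb v - (\<Sum>k\<le>n. scal (c k) * ue ^ k) \<in> M.ann x" using sl2_span by blast
      have "uf * sl2_emb v \<in> M.ann x" using w(2) v M.smult_mult[OF xc(1)] by (simp add: lowest_vec_def M.ann_def)
      then have "uf * sl2_emb v - uf * (sl2_emb v - (\<Sum>k\<le>n. scal (c k) * ue ^ k)) \<in> M.ann x"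
        by (rule left_idealD(5)[OF J _ left_idealD(3)[OF J c]])
      then have "uf * (\<Sum>k\<le>n. scal (c k) * ue ^ k) \<in> M.ann x" by (simp add: right_diff_distrib)
      also have "uf * (\<Sum>k\<le>n. scal (c k) * ue ^ k) = (\<Sum>k\<le>n. scal (c k) * (uf * ue ^ k))"
        by (simp add: sum_distrib_left scal_commutes)
      also have "(\<Sum>k\<le>n. scal (c k) * (uf * ue ^ k)) = scal (c 0) * uf + (\<Sum>k<n. scal (c (Suc k)) * (uf * ue ^ Suc k))"
        by (simp add: sum.atMost_shift)
      finally have f1: "scal (c 0) * uf + (\<Sum>k<n. scal (c (Suc k)) * (uf * ue ^ Suc k)) \<in> M.ann x" .
      \<comment> \<open>The coefficient with which \<open>f\<close> lowers the power k + 1 of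
        \<open>e\<close>. It is nonzero for k < n and zero for k = n, so the sum may be extended to
        k = n.\<close>
      define g :: "nat \<Rightarrow> complex" where "g k = of_nat (Suc k) * (of_nat n - of_nat k)" for k
      have "(\<Sum>k<n. scal (c (Suc k)) * (uf * ue ^ Suc k - scal (g k) * ue ^ k)) \<in> M.ann x"
        unfolding g_def by (intro usubspace_sum[OF left_ideal_usubspace[OF J]] left_idealD(3)[OF J] f_e)
      then have "scal (c 0) * uf + (\<Sum>k<n. scal (c (Suc k)) * (uf * ue ^ Suc k))
          - (scal (c 0) * uf + (\<Sum>k<n. scal (c (Suc k)) * (uf * ue ^ Suc k - scal (g k) * ue ^ k))) \<in> M.ann x"
        by (intro left_idealD(5)[OF J f1] left_idealD(2)[OF J] left_idealD(3)[OF J fJ])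
      then have "(\<Sum>k<n. scal (c (Suc k) * g k) * ue ^ k) \<in> M.ann x"
        by (simp add: right_diff_distrib sum_subtractf scal_scal)
      also have "(\<Sum>k<n. scal (c (Suc k) * g k) * ue ^ k) = (\<Sum>k\<le>n. scal (c (Suc k) * g k) * ue ^ k)"
        by (simp add: lessThan_Suc_atMost[symmetric] g_def scal_simps)
      finally have cg: "c (Suc k) * g k = 0" if "k \<le> n" for k
        using e_pow_indep[of "\<lambda>k. c (Suc k) * g k" k] that by simp
      have c0: "c (Suc k) = 0" if "k < n" for k
      proof -
        have "g k \<noteq> 0" using that by (simp add: g_def del: of_nat_Suc)
        then show ?thesis using cg[of k] that by simp
      qed
      have "(\<Sum>k\<le>n. scal (c k) * ue ^ k) = scal (c 0)"
        by (simp add: sum.atMost_shift c0 scal_simps)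
      then have w0: "w = scal (c 0) \<odot>\<^bsub>M\<^esub> x" using c v M.smult_eq_ann[OF xc(1)] by simp
      then have "c 0 \<noteq> 0" using w(2) M.smult_0_left[OF xc(1)] by (auto simp: lowest_vec_def scal_simps)
      then have "scal (1 / c 0) \<odot>\<^bsub>M\<^esub> w = x"
        unfolding w0 using M.smult_mult[OF xc(1), of "scal (1 / c 0)" "scal (c 0)"] M.smult_one[OF xc(1)]
        by (simp add: scal.scalar_one flip: scal.scalar_mult)
      moreover have "scal (1 / c 0) \<odot>\<^bsub>?R\<^esub> w \<in> K" using K(1) w(1) unfolding lsubmodule_def by blast
      ultimately have "x \<in> K" by (simp add: sl2_emb_simps)
      then have "?L \<subseteq> K" using K(1) by (auto simp: sl2_gen_def lsubmodule_def)
      then show ?thesis using K(2) by simp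
    qed simp
  qed
  then show "is_L n (lsub ?R ?L)" using dim by (simp add: is_L_def)
qed

lemma lowest_vec_is_L:
  assumes M: "lmodule M" and N: "lsubmodule N (res M)" "simple_lmodule (lsub (res M) N)"
    and x: "x \<in> N" "lowest_vec M n x"
  shows "is_L n (lsub (res M) N)"
proof -
  have xc: "x \<in> carrier M" "x \<noteq> \<zero>\<^bsub>M\<^esub>" using x by (auto simp: lowest_vec_def)
  have "sl2_gen M x \<subseteq> N" using N(1) x(1) by (auto simp: sl2_gen_def lsubmodule_def)
  then have "lsubmodule (sl2_gen M x) (lsub (res M) N)"
    unfolding lsubmodule_trans[OF N(1)] using sl2_gen_submodule[OF M xc(1)] by auto
  then have "sl2_gen M x = {\<zero>\<^bsub>M\<^esub>} \<or> sl2_gen M x = N"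
    using N(2) by (auto simp: simple_lmodule_def)
  moreover have "x \<in> sl2_gen M x"
    unfolding sl2_gen_def using lmodule.smult_one[OF M xc(1)]
    by (intro CollectI exI[of _ 1]) (simp add: sl2_emb_simps)
  ultimately have "sl2_gen M x = N" using xc(2) by blast
  then show ?thesis using sl2_gen_is_L(1)[OF M x(2)] by simp
qed

section \<open>The \<open>sl2\<close>-types of the simple modules\<close>

lemma lowest_vecI:
  assumes "lmodule M" "x \<in> carrier M" "lowest_weight (lmodule.ann M x) n"
  shows "lowest_vec M n x"
proof -
  interpret lmodule M by fact
  interpret lowest_weight "ann x" n by fact
  show ?thesis using assms(2) fJ hJ eJ J1 ann_1[OF assms(2)] by (simp add: lowest_vec_def ann_def)
qed

lemma res_decomposition_lowest_vec:
  assumes M: "lmodule M" and N: "lsubmodule N (res M)" "simple_lmodule (lsub (res M) N)" "finite_cdim (res M) N"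
  shows "\<exists>n. \<exists>x\<in>N. lowest_vec M n x"
proof -
  have "N \<noteq> {\<zero>\<^bsub>M\<^esub>}" "\<zero>\<^bsub>M\<^esub> \<in> N" using N by (auto simp: simple_lmodule_def lsubmodule_def)
  then obtain y where "y \<in> N" "y \<noteq> \<zero>\<^bsub>M\<^esub>" by blast
  then show ?thesis using res_lowest_vec_exists[OF M N(1) N(1,3) order_refl] by blast
qed

lemma harish_chandra_lowest_vec:
  assumes W: "simple_lmodule W" "harish_chandra W"
  shows "\<exists>n x. lowest_vec W n x"
proof -
  interpret lmodule W using W(1) by (simp add: simple_lmodule_def)
  note R = lmodule_pullback_sl2[OF lmodule_axioms]
  obtain D where D: "internal_direct_sum (res W) D"
    "\<And>N. N \<in> D \<Longrightarrow> simple_lmodule (lsub (res W) N)" "\<And>N. N \<in> D \<Longrightarrow> finite_cdim (res W) N"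
    using W(2) by (auto simp: harish_chandra_def sl2_decomposition_def Let_def)
  have "D \<noteq> {}"
  proof
    assume "D = {}"
    have "carrier W \<subseteq> {\<zero>\<^bsub>W\<^esub>}"
    proof
      fix m assume "m \<in> carrier W"
      then have "m \<in> carrier (res W)" by simp
      then obtain F x where "F \<subseteq> D" "m = (\<Oplus>\<^bsub>res W\<^esub>N\<in>F. x N)"
        by (rule internal_direct_sum_repr[OF R D(1)])
      then show "m \<in> {\<zero>\<^bsub>W\<^esub>}" using \<open>D = {}\<close> abelian_monoid.finsum_empty[of "res W"] R
        by (simp add: lmodule_def abelian_group_def)
    qed
    then show False using W(1) by (auto simp: simple_lmodule_def)
  qed
  then obtain N where N: "N \<in> D" by blast
  then have "lsubmodule N (res W)" using D(1) by (simp add: internal_direct_sum_def)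
  then show ?thesis using res_decomposition_lowest_vec[OF lmodule_axioms _ D(2,3)[OF N]] by blast
qed

text \<open>This makes the set of types independent of the decomposition. The components of a lowest
  weight vector along \<open>D\<close> satisfy the same equations because the sum is direct, and a
  nonzero component determines the type of its summand.\<close>

lemma sl2_types_lowest_vec:
  assumes M: "lmodule M" and T: "sl2_types_once M T"
  shows "T = {n. \<exists>x. lowest_vec M n x}"
proof -
  interpret lmodule M by fact
  note R = lmodule_pullback_sl2[OF M]
  interpret R: lmodule "res M" by (rule R)
  obtain D where D: "internal_direct_sum (res M) D"
    "\<And>N. N \<in> D \<Longrightarrow> simple_lmodule (lsub (res M) N)" "\<And>N. N \<in> D \<Longrightarrow> finite_cdim (res M) N"
    and card: "\<And>n. card (sl2_isotypic M D n) = (if n \<in> T then 1 else 0)"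
    and fin: "\<And>n. finite (sl2_isotypic M D n)"
    using T by (auto simp: sl2_types_once_def sl2_decomposition_def Let_def)
  have sub: "lsubmodule N (res M)" if "N \<in> D" for N using D(1) that by (simp add: internal_direct_sum_def)
  show ?thesis
  proof (intro Set.set_eqI iffI)
    fix n assume "n \<in> T"
    then have "sl2_isotypic M D n \<noteq> {}" using card[of n] by auto
    then obtain N where N: "N \<in> D" "is_L n (lsub (res M) N)" by (auto simp: sl2_isotypic_def)
    obtain n' x where x: "x \<in> N" "lowest_vec M n' x"
      using res_decomposition_lowest_vec[OF M sub[OF N(1)] D(2,3)[OF N(1)]] by blast
    have "is_L n' (lsub (res M) N)" by (rule lowest_vec_is_L[OF M sub[OF N(1)] D(2)[OF N(1)] x])
    then have "n = n'"
      using N(2) umodule.has_cdim_unique[OF umodule.intro[OF lsubmodule_lmodule[OF R sub[OF N(1)]]]]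
      by (auto simp: is_L_def)
    then show "n \<in> {n. \<exists>x. lowest_vec M n x}" using x(2) by blast
  next
    fix n assume "n \<in> {n. \<exists>x. lowest_vec M n x}"
    then obtain x where x: "lowest_vec M n x" by blast
    have xc: "x \<in> carrier (res M)" "x \<noteq> \<zero>\<^bsub>M\<^esub>" using x by (simp_all add: lowest_vec_def)
    have "\<exists>F y. finite F \<and> F \<subseteq> D \<and> (\<forall>N\<in>F. y N \<in> N) \<and> x = (\<Oplus>\<^bsub>res M\<^esub>N\<in>F. y N)"
      by (rule internal_direct_sum_repr[OF R D(1) xc(1)]) (intro exI conjI ballI, assumption+)
    then obtain F y where F0: "finite F \<and> F \<subseteq> D \<and> (\<forall>N\<in>F. y N \<in> N) \<and> x = (\<Oplus>\<^bsub>res M\<^esub>N\<in>F. y N)"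
      by (elim exE)
    then have F: "finite F" "F \<subseteq> D" "\<And>N. N \<in> F \<Longrightarrow> y N \<in> N" "x = (\<Oplus>\<^bsub>res M\<^esub>N\<in>F. y N)"
      by simp_all
    have yc: "y N \<in> carrier M" if "N \<in> F" for N
    proof -
      have "lsubmodule N (res M)" using that F(2) by (intro sub) auto
      then show ?thesis using F(3)[OF that] by (auto simp: lsubmodule_def)
    qed
    have comp: "sl2_emb v \<odot>\<^bsub>M\<^esub> y N = \<zero>\<^bsub>M\<^esub>" if v: "sl2_emb v \<odot>\<^bsub>M\<^esub> x = \<zero>\<^bsub>M\<^esub>" and N: "N \<in> F" for v N
    proof -
      have "(\<Oplus>\<^bsub>res M\<^esub>N\<in>F. v \<odot>\<^bsub>res M\<^esub> y N) = v \<odot>\<^bsub>res M\<^esub> x"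
        unfolding F(4) by (rule R.smult_finsum[OF F(1), symmetric]) (use yc in simp)
      then have "(\<Oplus>\<^bsub>res M\<^esub>N\<in>F. v \<odot>\<^bsub>res M\<^esub> y N) = \<zero>\<^bsub>res M\<^esub>" using v by simp
      moreover have "v \<odot>\<^bsub>res M\<^esub> y N \<in> N" if "N \<in> F" for N
      proof -
        have "lsubmodule N (res M)" using that F(2) by (intro sub) auto
        then show ?thesis using F(3)[OF that] unfolding lsubmodule_def by blast
      qed
      ultimately have "v \<odot>\<^bsub>res M\<^esub> y N = \<zero>\<^bsub>res M\<^esub>"
        using internal_direct_sum_indep[OF R D(1) F(1,2), of "\<lambda>N. v \<odot>\<^bsub>res M\<^esub> y N" N] N by blast
      then show ?thesis by simp
    qed
    have "\<exists>N\<in>F. y N \<noteq> \<zero>\<^bsub>M\<^esub>"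
    proof (rule ccontr)
      assume "\<not> (\<exists>N\<in>F. y N \<noteq> \<zero>\<^bsub>M\<^esub>)"
      then have "(\<Oplus>\<^bsub>res M\<^esub>N\<in>F. y N) = \<zero>\<^bsub>res M\<^esub>" by (intro R.add.finprod_one_eqI) simp
      then show False using F(4) xc(2) by simp
    qed
    then obtain N where N: "N \<in> F" "y N \<noteq> \<zero>\<^bsub>M\<^esub>" by blast
    have "lowest_vec M n (y N)"
      using comp[of "gen sl2_f", OF _ N(1)] comp[of "gen sl2_h + scal (of_nat n)", OF _ N(1)]
        comp[of "gen sl2_e ^ Suc n", OF _ N(1)] x N(2) yc[OF N(1)]
      unfolding lowest_vec_def sl2_emb_simps sl2_emb_pow by blast
    moreover have ND: "N \<in> D" using N(1) F(2) by blast
    ultimately have "is_L n (lsub (res M) N)"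
      using lowest_vec_is_L[OF M sub D(2) F(3)[OF N(1)]] by blast
    then have "N \<in> sl2_isotypic M D n" using ND by (simp add: sl2_isotypic_def)
    then have "card (sl2_isotypic M D n) \<noteq> 0" using fin[of n] by auto
    then show "n \<in> T" using card[of n] by (simp split: if_splits)
  qed
qed

section \<open>The Casimir element and the decomposition of the models into
  \<open>sl2\<close>-types\<close>

definition casimir :: "l4 uea" where
  "casimir = uf * ue + uf * ue + uf * ue + uf * ue + uh * uh + uh + uh"

lemma casimir_commute: "casimir * gen (Lg g) = gen (Lg g) * casimir"
proof -
  have ef: "ue * uf = uf * ue + uh" by (rule comm_ef)
  have eh: "ue * uh = uh * ue - ue - ue" and hf: "uh * uf = uf * uh - uf - uf"
    using comm_he comm_hf by (simp_all add: mult_2 algebra_simps)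
  have ef': "ue * (uf * t) = uf * (ue * t) + uh * t" and eh': "ue * (uh * t) = uh * (ue * t) - ue * t - ue * t"
    and hf': "uh * (uf * t) = uf * (uh * t) - uf * t - uf * t" for t
    by (simp_all add: ef eh hf left_diff_distrib distrib_right flip: mult.assoc)
  show ?thesis unfolding casimir_def
    by (cases g) (simp_all add: distrib_left distrib_right right_diff_distrib left_diff_distrib mult.assoc
      ef eh hf ef' eh' hf' add.assoc diff_add_eq add_diff_eq)
qed

lemma casimir_sl2_emb: "casimir * sl2_emb v = sl2_emb v * casimir"
proof (induction v rule: uea_induct)
  case (mult u v)
  then show ?case by (metis mult.assoc sl2_emb_simps(4))
qed (simp_all add: sl2_emb_simps casimir_commute distrib_left distrib_right scal.scalar_central)

text \<open>Rewriting \<open>uf * ue\<close> as \<open>ue * uf - uh\<close> leaves a polynomial in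
  \<open>h\<close> on a lowest weight vector. Its value n^2 + 2 n determines n.\<close>

lemma casimir_lowest:
  assumes "left_ideal J" "uf * u \<in> J" "(uh + scal (of_nat n)) * u \<in> J"
  shows "casimir * u - scal (of_nat (n * n + n + n)) * u \<in> J"
proof -
  have "casimir = ue * uf + ue * uf + ue * uf + ue * uf + uh * uh - uh - uh"
    using comm_ef by (simp add: casimir_def algebra_simps)
  moreover have "(a - s - 1 - 1) * (a + s) = a * a - a - a - (s * s + s + s)" if "a * s = s * a" for a s :: "l4 uea"
    unfolding left_diff_distrib distrib_left mult_1_left that by (simp add: algebra_simps)
  then have "(uh - scal (of_nat n) - 1 - 1) * (uh + scal (of_nat n)) =
      uh * uh - uh - uh - (scal (of_nat n) * scal (of_nat n) + scal (of_nat n) + scal (of_nat n))"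
    using scal_commutes(1) by blast
  then have "(uh - scal (of_nat n) - 1 - 1) * (uh + scal (of_nat n)) =
      uh * uh - uh - uh - scal (of_nat (n * n + n + n))"
    by (simp only: of_nat_add of_nat_mult scal.scalar_add scal.scalar_mult)
  ultimately have *: "casimir - scal (of_nat (n * n + n + n)) =
      (ue + ue + ue + ue) * uf + (uh - scal (of_nat n) - 1 - 1) * (uh + scal (of_nat n))"
    unfolding distrib_right by (simp add: add_diff_eq)
  have "casimir * u - scal (of_nat (n * n + n + n)) * u =
      (ue + ue + ue + ue) * (uf * u) + (uh - scal (of_nat n) - 1 - 1) * ((uh + scal (of_nat n)) * u)"
    unfolding left_diff_distrib[symmetric, of casimir] * by (simp only: distrib_right mult.assoc)
  then show ?thesis using assms by (simp add: left_idealD)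
qed

text \<open>\<open>\<Lambda>\<close> lists the lowest weight vectors \<open>yv l\<close> of the
  model and \<open>U l\<close> produces \<open>yv l\<close> from the generator. The
  \<open>sl2\<close>-submodules generated by the \<open>U l\<close> are shown to decompose the
  quotient by \<open>J\<close>.\<close>

context
  fixes m j :: nat and z :: complex and J :: "l4 uea set" and \<Lambda> :: "nat set" and U :: "nat \<Rightarrow> l4 uea"
  assumes J_def: "J = annB (of_nat m) z j"
    and \<Lambda>_def: "\<Lambda> = {l. \<exists>u. act (of_nat m) z u (yv j) = yv l}"
    and U: "\<And>l. l \<in> \<Lambda> \<Longrightarrow> act (of_nat m) z (U l) (yv j) = yv l"
begin

lemma LJ: "left_ideal J" unfolding J_def by (rule annB_left_ideal)

lemma U_translate: "l \<in> \<Lambda> \<Longrightarrow> a * U l \<in> J \<longleftrightarrow> a \<in> annB (of_nat m) z l"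
  unfolding J_def by (rule annB_translate[OF U])

definition span where
  "span = {u. \<exists>F w. finite F \<and> F \<subseteq> \<Lambda> \<and> u - (\<Sum>l\<in>F. sl2_emb (w l) * U l) \<in> J}"

lemma span_J: "u \<in> J \<Longrightarrow> u \<in> span"
  unfolding span_def by (intro CollectI exI[of _ "{}"]) simp

lemma span_U: "l \<in> \<Lambda> \<Longrightarrow> sl2_emb w * U l \<in> span"
  unfolding span_def by (intro CollectI exI[of _ "{l}"] exI[of _ "\<lambda>_. w"]) (simp add: left_idealD[OF LJ])

lemma span_add:
  assumes "u \<in> span" "v \<in> span"
  shows "u + v \<in> span"
proof -
  obtain F w where F: "finite F" "F \<subseteq> \<Lambda>" "u - (\<Sum>l\<in>F. sl2_emb (w l) * U l) \<in> J"
    using assms(1) by (auto simp: span_def)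
  obtain G x where G: "finite G" "G \<subseteq> \<Lambda>" "v - (\<Sum>l\<in>G. sl2_emb (x l) * U l) \<in> J"
    using assms(2) by (auto simp: span_def)
  define y where "y l = (if l \<in> F then w l else 0) + (if l \<in> G then x l else 0)" for l
  have "(\<Sum>l\<in>F \<union> G. sl2_emb (y l) * U l) =
      (\<Sum>l\<in>F \<union> G. if l \<in> F then sl2_emb (w l) * U l else 0) + (\<Sum>l\<in>F \<union> G. if l \<in> G then sl2_emb (x l) * U l else 0)"
    unfolding sum.distrib[symmetric] by (rule sum.cong) (auto simp: y_def sl2_emb_simps distrib_right)
  also have "(\<Sum>l\<in>F \<union> G. if l \<in> F then sl2_emb (w l) * U l else 0) = (\<Sum>l\<in>F. sl2_emb (w l) * U l)"
    by (rule sum.mono_neutral_cong_right) (use F(1) G(1) in auto)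
  also have "(\<Sum>l\<in>F \<union> G. if l \<in> G then sl2_emb (x l) * U l else 0) = (\<Sum>l\<in>G. sl2_emb (x l) * U l)"
    by (rule sum.mono_neutral_cong_right) (use F(1) G(1) in auto)
  finally have y: "(\<Sum>l\<in>F \<union> G. sl2_emb (y l) * U l) =
      (\<Sum>l\<in>F. sl2_emb (w l) * U l) + (\<Sum>l\<in>G. sl2_emb (x l) * U l)" .
  have "u + v - (\<Sum>l\<in>F \<union> G. sl2_emb (y l) * U l) =
      (u - (\<Sum>l\<in>F. sl2_emb (w l) * U l)) + (v - (\<Sum>l\<in>G. sl2_emb (x l) * U l))" unfolding y by simp
  then have "u + v - (\<Sum>l\<in>F \<union> G. sl2_emb (y l) * U l) \<in> J" using left_idealD(2)[OF LJ F(3) G(3)] by (simp only:)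
  then show ?thesis unfolding span_def using F G by (intro CollectI exI[of _ "F \<union> G"] exI[of _ y]) simp
qed

text \<open>Otherwise no power of \<open>e\<close> would kill \<open>u\<close>, since \<open>f\<^bsup>K+i\<^esup> e\<^bsup>i\<^esup> u\<close> is a nonzero multiple
  of \<open>f\<^bsup>K\<^esup> u\<close>.\<close>

lemma lowering_bound:
  assumes u: "uh * u - scal b * u \<in> J" and w: "uf ^ K * u \<notin> J" "uf * (uf ^ K * u) \<in> J"
    and b: "b = 2 * of_nat K - of_nat n"
  shows "K \<le> n"
proof (rule ccontr)
  assume "\<not> K \<le> n"
  interpret lowest_weight J "m + 2 * j" unfolding J_def by (rule annB_lowest)
  have "\<exists>a. a \<noteq> 0 \<and> uf ^ (K + i) * (ue ^ i * u) - scal a * (uf ^ K * u) \<in> J" for i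
  proof (induction i)
    case 0
    show ?case by (intro exI[of _ 1]) (simp add: scal_simps left_idealD(1)[OF LJ])
  next
    case (Suc i)
    define E w k where "E = ue ^ i * u" and "w = uf ^ K * u" and "k = K + i"
    obtain a where a: "a \<noteq> 0" "uf ^ k * E - scal a * w \<in> J" using Suc by (auto simp: E_def w_def k_def)
    define \<beta> where "\<beta> = b + 2 * of_nat i"
    have "uh * E - scal \<beta> * E = ue ^ i * (uh * u - scal b * u)"
      unfolding E_def \<beta>_def mult.assoc[symmetric] comm_h_e_pow
      by (simp add: scal.scalar_add distrib_left distrib_right right_diff_distrib mult.assoc scal_commutes)
    then have E: "uh * E - scal \<beta> * E \<in> J" using left_idealD(3)[OF LJ u] by simp
    have "uf * (scal a * w) \<in> J" using w(2) left_idealD(3)[OF LJ, of "uf * (uf ^ K * u)" "scal a"]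
      by (simp add: w_def scal_commutes)
    then have "uf * (uf ^ k * E - scal a * w) + uf * (scal a * w) \<in> J"
      by (intro left_idealD(2)[OF LJ] left_idealD(3)[OF LJ a(2)])
    then have 1: "uf ^ Suc k * E \<in> J" by (simp add: right_diff_distrib mult.assoc)
    define N \<gamma> where "N = (of_nat (Suc k) :: complex)" and "\<gamma> = \<beta> - of_nat k"
    have e: "uf ^ Suc k * ue = ue * uf ^ Suc k - scal N * uf ^ k * (uh - scal (of_nat k))"
      unfolding N_def comm_e_f_pow by simp
    have "uf ^ Suc k * (ue * E) - scal (- N * \<gamma> * a) * w
        = ue * (uf ^ Suc k * E) - scal N * (uf ^ k * (uh * E - scal \<beta> * E)) - scal (N * \<gamma>) * (uf ^ k * E - scal a * w)"
    proof -
      have "uf ^ Suc k * (ue * E) = (uf ^ Suc k * ue) * E" by (simp only: mult.assoc)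
      also have "\<dots> = ue * (uf ^ Suc k * E) - scal N * (uf ^ k * ((uh - scal (of_nat k)) * E))"
        by (simp only: e left_diff_distrib[of "ue * uf ^ Suc k"] mult.assoc)
      also have "(uh - scal (of_nat k)) * E = (uh * E - scal \<beta> * E) + scal \<gamma> * E"
        by (simp add: \<gamma>_def left_diff_distrib scal_diff)
      finally have "uf ^ Suc k * (ue * E) = ue * (uf ^ Suc k * E) -
          (scal N * (uf ^ k * (uh * E - scal \<beta> * E)) + scal (N * \<gamma>) * (uf ^ k * E))"
        by (simp only: distrib_left scal_commutes(4) scal_scal)
      moreover have "scal (- N * \<gamma> * a) * w = - (scal (N * \<gamma>) * (scal a * w))"
        by (simp add: scal_scal scal_uminus)
      ultimately show ?thesis by (simp only: right_diff_distrib[of "scal (N * \<gamma>)"]) simp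
    qed
    moreover have "ue * (uf ^ Suc k * E) - scal N * (uf ^ k * (uh * E - scal \<beta> * E)) - scal (N * \<gamma>) * (uf ^ k * E - scal a * w) \<in> J"
      by (intro left_idealD(3,5)[OF LJ] 1 E a(2))
    ultimately have "uf ^ Suc k * (ue * E) - scal (- N * \<gamma> * a) * w \<in> J" by simp
    moreover have "\<gamma> = of_nat (K + i - n)"
      using \<open>\<not> K \<le> n\<close> by (simp add: \<gamma>_def \<beta>_def b k_def of_nat_diff)
    then have "- N * \<gamma> * a \<noteq> 0" using a(1) \<open>\<not> K \<le> n\<close> by (simp add: N_def del: of_nat_Suc of_nat_add of_nat_diff)
    ultimately show ?case
      by (intro exI[of _ "- N * \<gamma> * a"]) (simp add: E_def w_def k_def mult.assoc)
  qed
  moreover obtain N where N: "ue ^ N * u \<in> J" using nilp_e by blast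
  ultimately obtain a where a: "a \<noteq> 0" "uf ^ (K + N) * (ue ^ N * u) - scal a * (uf ^ K * u) \<in> J" by blast
  have "uf ^ (K + N) * (ue ^ N * u) - (uf ^ (K + N) * (ue ^ N * u) - scal a * (uf ^ K * u)) \<in> J"
    by (intro left_idealD(5)[OF LJ left_idealD(3)[OF LJ N] a(2)])
  then have "scal a * (uf ^ K * u) \<in> J" by simp
  then show False using w(1) usubspace_scal_iff[OF left_ideal_usubspace[OF LJ] a(1)] by simp
qed

text \<open>Induction on the number of applications of \<open>f\<close> that kill u. The last
  nonzero one is a lowest weight vector, hence a multiple of some \<open>U l\<close>. As K is at
  most the n of its type, a multiple of \<open>ue ^ K * U l\<close> has the same image under
  \<open>uf ^ K\<close> and can be subtracted.\<close>

lemma span_weight: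
  assumes "uh * u - scal b * u \<in> J" "uf ^ K * u \<in> J"
  shows "u \<in> span"
  using assms
proof (induction K arbitrary: u b)
  case 0
  then show ?case by (simp add: span_J)
next
  case (Suc K)
  interpret lowest_weight J "m + 2 * j" unfolding J_def by (rule annB_lowest)
  define w where "w = uf ^ K * u"
  show ?case
  proof (cases "w \<in> J")
    case True
    then show ?thesis using Suc.IH[OF Suc.prems(1)] by (simp add: w_def)
  next
    case False
    have fw: "uf * w \<in> J" using Suc.prems(2) by (simp add: w_def mult.assoc)
    have hw: "(uh - scal (b - 2 * of_nat K)) * w = uf ^ K * (uh * u - scal b * u)"
      unfolding w_def left_diff_distrib mult.assoc[symmetric] comm_h_f_pow
      by (simp add: scal_diff left_diff_distrib right_diff_distrib mult.assoc scal_commutes)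
    then have hw: "(uh - scal (b - 2 * of_nat K)) * w \<in> J" using left_idealD(3)[OF LJ Suc.prems(1)] by simp
    define J' where "J' = {a. a * w \<in> J}"
    have J': "left_ideal J'" using LJ by (auto simp: J'_def left_ideal_def distrib_right mult.assoc)
    define L where "L = (LEAST i. ue ^ i * w \<in> J)"
    have "ue ^ L * w \<in> J" unfolding L_def using nilp_e by (rule LeastI_ex)
    moreover have "L \<noteq> 0" using False calculation by (cases L) simp_all
    then obtain n where n: "L = Suc n" by (cases L) auto
    moreover have "ue ^ n * w \<notin> J" using not_less_Least[of n "\<lambda>i. ue ^ i * w \<in> J"] n by (simp add: L_def)
    ultimately have "b - 2 * of_nat K = - of_nat n"
      by (intro lowest_weight_integral[OF J']) (use fw hw in \<open>simp_all add: J'_def del: power_Suc\<close>)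
    then have b: "b = 2 * of_nat K - of_nat n" by (simp add: algebra_simps)
    have "lowest_in (annB (of_nat m) z j) n w"
      using False fw hw b by (simp add: lowest_in_def J_def scal_uminus)
    then obtain a l where al: "a \<noteq> 0" "act (of_nat m) z w (yv j) = (\<lambda>k i. a * yv l k i)" "n = m + 2 * l"
      by (rule lowest_in_annB)
    have l: "l \<in> \<Lambda>" unfolding \<Lambda>_def using act_div[OF al(2,1)] by blast
    have wa: "w - scal a * U l \<in> J"
      using al(2) U[OF l] by (simp add: J_def annB_def act_diff act_simps fun_eq_iff)
    have "K \<le> n" by (rule lowering_bound[OF Suc.prems(1) _ _ b]) (use False fw in \<open>simp_all add: w_def\<close>)
    interpret l: lowest_weight "annB (of_nat m) z l" n unfolding al(3) by (rule annB_lowest)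
    obtain q where q: "q \<noteq> 0" "uf ^ K * ue ^ K - scal q \<in> annB (of_nat m) z l"
      using l.f_e_pow_pow[OF \<open>K \<le> n\<close>] by blast
    define t where "t = sl2_emb (scal (a / q) * gen sl2_e ^ K) * U l"
    have t: "t = scal (a / q) * (ue ^ K * U l)" by (simp add: t_def sl2_emb_simps sl2_emb_pow mult.assoc)
    have tS: "t \<in> span" unfolding t_def by (rule span_U[OF l])
    have "(uf ^ K * ue ^ K - scal q) * U l \<in> J" using U_translate[OF l] q(2) by simp
    then have "scal (a / q) * ((uf ^ K * ue ^ K - scal q) * U l) \<in> J" by (rule left_idealD(3)[OF LJ])
    then have "(w - scal a * U l) - scal (a / q) * ((uf ^ K * ue ^ K - scal q) * U l) \<in> J"
      by (rule left_idealD(5)[OF LJ wa])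
    moreover have "(w - scal a * U l) - scal (a / q) * ((uf ^ K * ue ^ K - scal q) * U l) = uf ^ K * (u - t)"
      using q(1) by (simp add: w_def t left_diff_distrib right_diff_distrib mult.assoc scal_commutes scal_scal)
    ultimately have 1: "uf ^ K * (u - t) \<in> J" by simp
    have "(uh * ue ^ K - scal (2 * of_nat K - of_nat n) * ue ^ K) * U l \<in> J"
      using U_translate[OF l] l.weight_e[of K] by simp
    then have "scal (a / q) * ((uh * ue ^ K - scal b * ue ^ K) * U l) \<in> J" unfolding b by (rule left_idealD(3)[OF LJ])
    moreover have "scal (a / q) * ((uh * ue ^ K - scal b * ue ^ K) * U l) = uh * t - scal b * t"
      by (simp add: t left_diff_distrib right_diff_distrib mult.assoc scal_commutes scal_scal mult.commute)
    ultimately have "(uh * u - scal b * u) - (uh * t - scal b * t) \<in> J"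
      using left_idealD(5)[OF LJ Suc.prems(1)] by simp
    then have "uh * (u - t) - scal b * (u - t) \<in> J" by (simp add: right_diff_distrib algebra_simps)
    from Suc.IH[OF this 1] have "u - t \<in> span" .
    from span_add[OF this tS] show ?thesis by simp
  qed
qed

lemma span_UNIV: "u \<in> span"
proof -
  interpret lowest_weight J "m + 2 * j" unfolding J_def by (rule annB_lowest)
  have "uh - scal (- of_nat (m + 2 * j)) \<in> J" using hJ by (simp add: scal_uminus del: of_nat_add)
  then have "u \<in> wspan J" by (rule wspan_all[OF LJ])
  then show ?thesis
  proof (induction rule: wspan.induct)
    case (wspan_weight u a)
    then show ?case using span_weight nilp_f by blast
  next
    case (wspan_add u v)
    then show ?case by (intro span_add)
  qed
qed

text \<open>The Casimir element commutes with \<open>sl2\<close> and has different eigenvalues on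
  the summands.\<close>

lemma span_indep:
  assumes F: "finite F" "F \<subseteq> \<Lambda>" and sum: "(\<Sum>l\<in>F. sl2_emb (w l) * U l) \<in> J" and l: "l \<in> F"
  shows "sl2_emb (w l) * U l \<in> J"
proof (rule eigen_sum[OF LJ F(1) _ _ sum l, of "\<lambda>l. of_nat ((m + 2 * l) * (m + 2 * l) + (m + 2 * l) + (m + 2 * l))" casimir])
  have inj: "inj (\<lambda>n::nat. n * n + n + n)"
  proof (rule strict_mono_imp_inj_on, rule strict_monoI)
    fix x y :: nat assume "x < y"
    then have "x * x \<le> y * y" by (simp add: mult_le_mono)
    then show "x * x + x + x < y * y + y + y" using \<open>x < y\<close> by linarith
  qed
  show "inj_on (\<lambda>l. of_nat ((m + 2 * l) * (m + 2 * l) + (m + 2 * l) + (m + 2 * l)) :: complex) F"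
  proof (rule inj_onI)
    fix x y
    assume "(of_nat ((m + 2 * x) * (m + 2 * x) + (m + 2 * x) + (m + 2 * x)) :: complex)
        = of_nat ((m + 2 * y) * (m + 2 * y) + (m + 2 * y) + (m + 2 * y))"
    then have "m + 2 * x = m + 2 * y" unfolding of_nat_eq_iff by (rule injD[OF inj])
    then show "x = y" by simp
  qed
next
  fix i assume "i \<in> F"
  then have i: "i \<in> \<Lambda>" using F(2) by blast
  define n where "n = m + 2 * i"
  interpret i: lowest_weight "annB (of_nat m) z i" n unfolding n_def by (rule annB_lowest)
  have "casimir * U i - scal (of_nat (n * n + n + n)) * U i \<in> J"
    using U_translate[OF i] i.fJ i.hJ by (intro casimir_lowest[OF LJ]) auto
  then have "sl2_emb (w i) * (casimir * U i - scal (of_nat (n * n + n + n)) * U i) \<in> J"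
    by (rule left_idealD(3)[OF LJ])
  moreover have "sl2_emb (w i) * (casimir * U i - scal b * U i) = casimir * (sl2_emb (w i) * U i) - scal b * (sl2_emb (w i) * U i)" for b
    by (simp only: right_diff_distrib scal_left_commute[of "sl2_emb (w i)"])
      (simp only: mult.assoc[symmetric] casimir_sl2_emb)
  ultimately show "casimir * (sl2_emb (w i) * U i) - scal (of_nat ((m + 2 * i) * (m + 2 * i) + (m + 2 * i) + (m + 2 * i))) * (sl2_emb (w i) * U i) \<in> J"
    by (simp add: n_def)
qed

lemma cyc_types:
  fixes V :: "(l4 uea, 'a) module"
  assumes V: "cyc V x J"
  shows "sl2_types_once V {m + 2 * l | l. l \<in> \<Lambda>}"
proof -
  interpret lmodule V by (rule cycD[OF V])
  note M = lmodule_axioms and xc = cycD(2)[OF V]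
  note R = lmodule_pullback_sl2[OF M]
  interpret R: lmodule "res V" by (rule R)
  define X where "X l = U l \<odot>\<^bsub>V\<^esub> x" for l
  have Xc: "X l \<in> carrier V" for l by (simp add: X_def smult_closed xc)
  have low: "lowest_vec V (m + 2 * l) (X l)" if l: "l \<in> \<Lambda>" for l
  proof (rule lowest_vecI[OF M Xc])
    have "ann (X l) = annB (of_nat m) z l"
      using ann_smult[OF xc] U_translate[OF l] cycD(4)[OF V] by (auto simp: X_def)
    then show "lowest_weight (ann (X l)) (m + 2 * l)" using annB_lowest by simp
  qed
  define N where "N l = sl2_gen V (X l)" for l
  have sub: "lsubmodule (N l) (res V)" for l unfolding N_def by (rule sl2_gen_submodule[OF M Xc])
  have L: "is_L (m + 2 * l) (lsub (res V) (N l))" "finite_cdim (res V) (N l)" if "l \<in> \<Lambda>" for l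
    unfolding N_def by (rule sl2_gen_is_L[OF M low[OF that]])+
  have dim: "n = n'" if "is_L n (lsub (res V) (N l))" "is_L n' (lsub (res V) (N l))" for n n' l
    using umodule.has_cdim_unique[OF umodule.intro[OF lsubmodule_lmodule[OF R sub[of l]]]] that
    by (auto simp: is_L_def)
  have inj: "inj_on N \<Lambda>"
  proof (rule inj_onI)
    fix l l' assume "l \<in> \<Lambda>" "l' \<in> \<Lambda>" "N l = N l'"
    then show "l = l'" using dim[of "m + 2 * l" l "m + 2 * l'"] L(1)[of l] L(1)[of l'] by simp
  qed
  have sum: "(\<Oplus>\<^bsub>res V\<^esub>l\<in>F. (sl2_emb (w l) * U l) \<odot>\<^bsub>V\<^esub> x) = (\<Sum>l\<in>F. sl2_emb (w l) * U l) \<odot>\<^bsub>V\<^esub> x"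
    if "finite F" for F w
    using finsum_pullback[OF M, of "\<lambda>l. (sl2_emb (w l) * U l) \<odot>\<^bsub>V\<^esub> x" F] smult_sum[OF that xc] smult_closed[OF xc]
    by simp
  have "internal_direct_sum (res V) (N ` \<Lambda>)"
  proof (rule internal_direct_sumI[OF R sub inj])
    fix F y l assume F: "finite F" "F \<subseteq> \<Lambda>" "\<And>i. i \<in> F \<Longrightarrow> y i \<in> N i" "(\<Oplus>\<^bsub>res V\<^esub>i\<in>F. y i) = \<zero>\<^bsub>res V\<^esub>" "l \<in> F"
    have "\<forall>i\<in>F. \<exists>v. y i = (sl2_emb v * U i) \<odot>\<^bsub>V\<^esub> x"
      using F(3) smult_mult[OF xc] by (fastforce simp: N_def sl2_gen_def X_def)
    then obtain w where w: "\<And>i. i \<in> F \<Longrightarrow> y i = (sl2_emb (w i) * U i) \<odot>\<^bsub>V\<^esub> x" by metis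
    have "(\<Oplus>\<^bsub>res V\<^esub>i\<in>F. y i) = (\<Oplus>\<^bsub>res V\<^esub>i\<in>F. (sl2_emb (w i) * U i) \<odot>\<^bsub>V\<^esub> x)"
      by (rule R.finsum_cong') (simp_all add: w smult_closed xc)
    then have "(\<Sum>l\<in>F. sl2_emb (w l) * U l) \<odot>\<^bsub>V\<^esub> x = \<zero>\<^bsub>V\<^esub>"
      using sum[OF F(1), of w] F(4) by (simp only: res_simps)
    then have "(\<Sum>l\<in>F. sl2_emb (w l) * U l) \<in> J" by (rule cycD(5)[OF V, THEN iffD1])
    then have "sl2_emb (w l) * U l \<in> J" by (rule span_indep[OF F(1,2) _ F(5)])
    then show "y l = \<zero>\<^bsub>res V\<^esub>" using w[OF F(5)] cycD(5)[OF V] by simp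
  next
    fix y assume "y \<in> carrier (res V)"
    then obtain u where u: "y = u \<odot>\<^bsub>V\<^esub> x" using cycD(3)[OF V] by auto
    obtain F w where F: "finite F" "F \<subseteq> \<Lambda>" "u - (\<Sum>l\<in>F. sl2_emb (w l) * U l) \<in> J"
      using span_UNIV[of u] by (auto simp: span_def)
    have "y = (\<Sum>l\<in>F. sl2_emb (w l) * U l) \<odot>\<^bsub>V\<^esub> x"
      using F(3) smult_eq_ann[OF xc] cycD(4)[OF V] by (simp add: u)
    then have "y = (\<Oplus>\<^bsub>res V\<^esub>l\<in>F. (sl2_emb (w l) * U l) \<odot>\<^bsub>V\<^esub> x)" using sum[OF F(1)] by simp
    moreover have "(sl2_emb (w l) * U l) \<odot>\<^bsub>V\<^esub> x \<in> N l" for l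
      unfolding N_def sl2_gen_def X_def using smult_mult[OF xc] by blast
    ultimately show "\<exists>F y'. finite F \<and> F \<subseteq> \<Lambda> \<and> (\<forall>i\<in>F. y' i \<in> N i) \<and> y = (\<Oplus>\<^bsub>res V\<^esub>i\<in>F. y' i)"
      using F(1,2) by (intro exI[of _ F] exI[of _ "\<lambda>l. (sl2_emb (w l) * U l) \<odot>\<^bsub>V\<^esub> x"]) simp
  qed
  then have dec: "sl2_decomposition V (N ` \<Lambda>)"
    unfolding sl2_decomposition_def Let_def using L by (auto simp: is_L_def)
  have "sl2_isotypic V (N ` \<Lambda>) n = N ` {l \<in> \<Lambda>. m + 2 * l = n}" for n
    unfolding sl2_isotypic_def using L(1) dim by blast
  moreover have "{l \<in> \<Lambda>. m + 2 * l = n} = (if n \<in> {m + 2 * l | l. l \<in> \<Lambda>} then {(n - m) div 2} else {})" for n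
    by auto
  ultimately have "finite (sl2_isotypic V (N ` \<Lambda>) n) \<and>
      card (sl2_isotypic V (N ` \<Lambda>) n) = (if n \<in> {m + 2 * l | l. l \<in> \<Lambda>} then 1 else 0)" for n
    by (simp split: if_splits)
  then show ?thesis unfolding sl2_types_once_def using dec by (intro exI[of _ "N ` \<Lambda>"]) blast
qed

end

definition std_types :: "nat \<Rightarrow> nat \<Rightarrow> nat set" where
  "std_types m j = (if m > 0 then {m + 2 * k | k. True} else {2 * j + 4 * k | k. True})"

lemma standard_cyc_types:
  assumes z: "z \<noteq> 0" and V: "standard_cyc V z m j"
  shows "sl2_types_once V (std_types m j)"
proof -
  obtain x where x: "cyc V x (annB (of_nat m) z j)" and mj: "m > 0 \<and> j = 0 \<or> m = 0 \<and> j < 2"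
    by (rule standard_cycE[OF V])
  define \<Lambda> where "\<Lambda> = {l. \<exists>u. act (of_nat m) z u (yv j) = yv l}"
  have "\<forall>l\<in>\<Lambda>. \<exists>u. act (of_nat m) z u (yv j) = yv l" by (simp add: \<Lambda>_def)
  from bchoice[OF this] obtain U where U: "\<forall>l\<in>\<Lambda>. act (of_nat m) z (U l) (yv j) = yv l" by blast
  have "sl2_types_once V {m + 2 * l | l. l \<in> \<Lambda>}" by (rule cyc_types[OF refl \<Lambda>_def _ x]) (use U in blast)
  moreover have "{m + 2 * l | l. l \<in> \<Lambda>} = std_types m j"
  proof (cases "m > 0")
    case True
    then have "\<Lambda> = UNIV" using mj reach_any[OF True z] by (auto simp: \<Lambda>_def)
    then show ?thesis using True by (simp add: std_types_def)
  next
    case False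
    then have mj: "m = 0" "j < 2" using mj by auto
    then have \<Lambda>: "\<Lambda> = {l. l mod 2 = j}" using reach_parity_any[OF z, of j] by (simp add: \<Lambda>_def)
    have "{2 * l | l. l mod 2 = j} = {2 * j + 4 * k | k. True}"
    proof (intro Set.set_eqI iffI)
      fix n assume "n \<in> {2 * l | l. l mod 2 = j}"
      then obtain l where "n = 2 * l" "l mod 2 = j" by blast
      then have "n = 2 * j + 4 * (l div 2)" by presburger
      then show "n \<in> {2 * j + 4 * k | k. True}" by blast
    next
      fix n assume "n \<in> {2 * j + 4 * k | k. True}"
      then obtain k where "n = 2 * (j + 2 * k)" by auto
      moreover have "(j + 2 * k) mod 2 = j" using mj(2) by presburger
      ultimately show "n \<in> {2 * l | l. l mod 2 = j}" by blast
    qed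
    then show ?thesis using mj(1) \<Lambda> by (simp add: std_types_def)
  qed
  ultimately show ?thesis by simp
qed

lemma std_types_inj:
  assumes "m > 0 \<and> j = 0 \<or> m = 0 \<and> j < 2" "m' > 0 \<and> j' = 0 \<or> m' = 0 \<and> j' < 2"
    and eq: "std_types m j = std_types m' j'"
  shows "m = m' \<and> j = j'"
proof -
  have mem: "n \<in> std_types m j \<longleftrightarrow> (if m > 0 then m \<le> n \<and> (n - m) mod 2 = 0 else 2 * j \<le> n \<and> (n - 2 * j) mod 4 = 0)" for n m j
  proof (cases "m > 0")
    case True
    have "(\<exists>k. n = m + 2 * k) \<longleftrightarrow> m \<le> n \<and> (n - m) mod 2 = 0" by presburger
    then show ?thesis using True by (simp add: std_types_def)
  next
    case False
    have "(\<exists>k. n = 2 * j + 4 * k) \<longleftrightarrow> 2 * j \<le> n \<and> (n - 2 * j) mod 4 = 0" by presburger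
    then show ?thesis using False by (simp add: std_types_def)
  qed
  have e: "n \<in> std_types m j \<longleftrightarrow> n \<in> std_types m' j'" for n using eq by simp
  \<comment> \<open>The smallest elements of the two sets, and 0, 2 and 4, tell steps of two from
    steps of four.\<close>
  show ?thesis
    using assms(1,2) e[of m] e[of m'] e[of 0] e[of 2] e[of 4] e[of "2 * j"] e[of "2 * j'"] unfolding mem
    by (cases "m > 0"; cases "m' > 0") auto
qed

section \<open>Detecting nonzero tensors by additive functions\<close>

section \<open>Functions on tensor products\<close>

text \<open>The additive extension of \<beta> to the free abelian group. If \<beta> is biadditive
  and balanced it descends to the tensor product, so a vanishing tensor forces vanishing values
  (\<open>pure_eq_zero_eval\<close>).\<close>

definition tens_eval :: "('a \<Rightarrow> complex) \<Rightarrow> ('a \<Rightarrow>\<^sub>0 int) \<Rightarrow> complex" where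
  "tens_eval \<beta> p = (\<Sum>y\<in>Poly_Mapping.keys p. of_int (Poly_Mapping.lookup p y) * \<beta> y)"

lemma tens_eval_superset:
  "finite K \<Longrightarrow> Poly_Mapping.keys p \<subseteq> K \<Longrightarrow>
    tens_eval \<beta> p = (\<Sum>y\<in>K. of_int (Poly_Mapping.lookup p y) * \<beta> y)"
  unfolding tens_eval_def by (rule sum.mono_neutral_left) (auto simp: in_keys_iff)

lemma tens_eval_diff: "tens_eval \<beta> (p - q) = tens_eval \<beta> p - tens_eval \<beta> q"
proof -
  let ?K = "Poly_Mapping.keys p \<union> Poly_Mapping.keys q"
  have "Poly_Mapping.keys (p - q) \<subseteq> ?K" by (auto simp: in_keys_iff lookup_minus)
  then show ?thesis
    by (simp add: tens_eval_superset[of ?K] lookup_minus left_diff_distrib sum_subtractf)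
qed

lemma tens_eval_frag_of: "tens_eval \<beta> (frag_of x) = \<beta> x"
  by (simp add: tens_eval_def)

lemma tens_eval_rel:
  assumes "p \<in> tensor_rel B M"
    and "\<And>x x' y. x \<in> carrier B \<Longrightarrow> x' \<in> carrier B \<Longrightarrow> y \<in> carrier M \<Longrightarrow>
      \<beta> (x \<oplus>\<^bsub>B\<^esub> x', y) = \<beta> (x, y) + \<beta> (x', y)"
    and "\<And>x y y'. x \<in> carrier B \<Longrightarrow> y \<in> carrier M \<Longrightarrow> y' \<in> carrier M \<Longrightarrow>
      \<beta> (x, y \<oplus>\<^bsub>M\<^esub> y') = \<beta> (x, y) + \<beta> (x, y')"
    and "\<And>x y r. x \<in> carrier B \<Longrightarrow> y \<in> carrier M \<Longrightarrow> \<beta> (rsmult B x r, y) = \<beta> (x, r \<odot>\<^bsub>M\<^esub> y)"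
  shows "tens_eval \<beta> p = 0"
  using assms(1)
  by (induction rule: tensor_rel.induct)
    (simp_all add: tens_eval_diff tens_eval_frag_of assms(2-4), simp add: tens_eval_def)

context bimodule
begin

lemma tensor_carrier: "X \<in> carrier (tensor B M) \<longleftrightarrow>
    (\<exists>p. X = tensor_class B M p \<and> Poly_Mapping.keys p \<subseteq> carrier B \<times> carrier M)"
  by (auto simp: tensor_def)

lemma tensor_zero: "\<zero>\<^bsub>tensor B M\<^esub> = tensor_class B M 0"
  by (simp add: tensor_def)

abbreviation pure where "pure M x y \<equiv> tensor_class B M (frag_of (x, y))"

lemma pure_carrier: "x \<in> carrier B \<Longrightarrow> y \<in> carrier M \<Longrightarrow> pure M x y \<in> carrier (tensor B M)"
  unfolding tensor_carrier by (rule exI[of _ "frag_of (x, y)"]) simp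

lemma pure_smult: "s \<odot>\<^bsub>tensor B M\<^esub> pure M x y = pure M (s \<odot> x) y"
  by (simp add: tensor_smult_class tensor_smult_def)

lemma pure_balanced: "x \<in> carrier B \<Longrightarrow> y \<in> carrier M \<Longrightarrow> pure M (rsmult B x r) y = pure M x (r \<odot>\<^bsub>M\<^esub> y)"
  unfolding tensor_class_eq_iff by (rule tensor_rel_balanced)

lemma pure_add_left: "x \<in> carrier B \<Longrightarrow> x' \<in> carrier B \<Longrightarrow> y \<in> carrier M \<Longrightarrow>
    pure M (x \<oplus> x') y = pure M x y \<oplus>\<^bsub>tensor B M\<^esub> pure M x' y"
  unfolding tensor_add_class tensor_class_eq_iff
  using tensor_rel_left[of x B x' y M] by (simp add: diff_diff_add)

lemma pure_add_right: "x \<in> carrier B \<Longrightarrow> y \<in> carrier M \<Longrightarrow> y' \<in> carrier M \<Longrightarrow>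
    pure M x (y \<oplus>\<^bsub>M\<^esub> y') = pure M x y \<oplus>\<^bsub>tensor B M\<^esub> pure M x y'"
  unfolding tensor_add_class tensor_class_eq_iff
  using tensor_rel_right[of x B y M y'] by (simp add: diff_diff_add)

lemma pure_zero_left:
  assumes "y \<in> carrier M"
  shows "pure M \<zero> y = \<zero>\<^bsub>tensor B M\<^esub>"
proof -
  interpret T: lmodule "tensor B M" by (rule tensor_lmodule)
  have "pure M \<zero> y \<oplus>\<^bsub>tensor B M\<^esub> pure M \<zero> y = pure M \<zero> y"
    using pure_add_left[of \<zero> \<zero> y M] assms by simp
  then show ?thesis by (intro T.idem_zero pure_carrier assms) simp_all
qed

lemma tensor_induct [consumes 1, case_names zero pure diff]:
  assumes "X \<in> carrier (tensor B M)"
    and "P \<zero>\<^bsub>tensor B M\<^esub>"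
    and "\<And>x y. x \<in> carrier B \<Longrightarrow> y \<in> carrier M \<Longrightarrow> P (pure M x y)"
    and "\<And>X Y. X \<in> carrier (tensor B M) \<Longrightarrow> Y \<in> carrier (tensor B M) \<Longrightarrow> P X \<Longrightarrow> P Y \<Longrightarrow> P (X \<ominus>\<^bsub>tensor B M\<^esub> Y)"
  shows "P X"
proof -
  interpret T: lmodule "tensor B M" by (rule tensor_lmodule)
  obtain p where p: "X = tensor_class B M p" "Poly_Mapping.keys p \<subseteq> carrier B \<times> carrier M"
    using assms(1) tensor_carrier by blast
  have "tensor_class B M p \<in> carrier (tensor B M) \<and> P (tensor_class B M p)"
    using p(2)
  proof (induction p rule: frag_induction)
    case zero
    then show ?case using assms(2) by (simp flip: tensor_zero)
  next
    case (one xy)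
    then show ?case using assms(3) pure_carrier by (cases xy) auto
  next
    case (diff p q)
    have "tensor_class B M p = tensor_class B M (p - q) \<oplus>\<^bsub>tensor B M\<^esub> tensor_class B M q"
      unfolding tensor_add_class by simp
    moreover have "tensor_class B M (p - q) \<in> carrier (tensor B M)"
    proof -
      have "tensor_class B M (- q) \<oplus>\<^bsub>tensor B M\<^esub> tensor_class B M q = \<zero>\<^bsub>tensor B M\<^esub>"
        unfolding tensor_add_class tensor_zero by simp
      moreover have "tensor_class B M (- q) = (- 1) \<odot>\<^bsub>tensor B M\<^esub> tensor_class B M q"
      proof -
        obtain q' where q': "tensor_class B M q = tensor_class B M q'" "Poly_Mapping.keys q' \<subseteq> carrier B \<times> carrier M"
          using diff.IH tensor_carrier by blast
        have "tensor_class B M (- q') \<in> carrier (tensor B M)"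
          unfolding tensor_carrier by (rule exI[of _ "- q'"]) (use q' in simp)
        moreover have e: "tensor_class B M (- q) = tensor_class B M (- q')"
          using q'(1) tensor_rel_uminus[of "q - q'" B M] unfolding tensor_class_eq_iff by simp
        moreover have "tensor_class B M (- q) \<oplus>\<^bsub>tensor B M\<^esub> tensor_class B M q = \<zero>\<^bsub>tensor B M\<^esub>"
          unfolding tensor_add_class tensor_zero by simp
        ultimately have "\<ominus>\<^bsub>tensor B M\<^esub> tensor_class B M q = tensor_class B M (- q)"
          using diff.IH by (intro T.minus_equality) simp_all
        then show ?thesis using T.smult_uminus_left[of "tensor_class B M q" 1] diff.IH by (simp add: T.smult_one)
      qed
      ultimately have "tensor_class B M (- q) \<in> carrier (tensor B M)" using diff.IH T.smult_closed by simp
      moreover have "tensor_class B M (p - q) = tensor_class B M p \<oplus>\<^bsub>tensor B M\<^esub> tensor_class B M (- q)"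
        unfolding tensor_add_class by simp
      ultimately show ?thesis using diff.IH by simp
    qed
    ultimately have "tensor_class B M (p - q) = tensor_class B M p \<ominus>\<^bsub>tensor B M\<^esub> tensor_class B M q"
      using diff.IH by (simp add: a_minus_def T.a_assoc T.r_neg)
    then show ?case using assms(4) diff.IH by simp
  qed
  then show ?thesis using p(1) by simp
qed

lemma pure_eq_zero_eval:
  assumes "pure M x y = \<zero>\<^bsub>tensor B M\<^esub>"
    and "\<And>x x' y. x \<in> carrier B \<Longrightarrow> x' \<in> carrier B \<Longrightarrow> y \<in> carrier M \<Longrightarrow>
      \<beta> (x \<oplus> x', y) = \<beta> (x, y) + \<beta> (x', y)"
    and "\<And>x y y'. x \<in> carrier B \<Longrightarrow> y \<in> carrier M \<Longrightarrow> y' \<in> carrier M \<Longrightarrow>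
      \<beta> (x, y \<oplus>\<^bsub>M\<^esub> y') = \<beta> (x, y) + \<beta> (x, y')"
    and "\<And>x y r. x \<in> carrier B \<Longrightarrow> y \<in> carrier M \<Longrightarrow> \<beta> (rsmult B x r, y) = \<beta> (x, r \<odot>\<^bsub>M\<^esub> y)"
  shows "\<beta> (x, y) = (0 :: complex)"
proof -
  have "frag_of (x, y) \<in> tensor_rel B M"
    using assms(1) unfolding tensor_zero tensor_class_eq_iff by simp
  then have "tens_eval \<beta> (frag_of (x, y)) = 0" by (rule tens_eval_rel) (rule assms(2-4), assumption+)+
  then show ?thesis by (simp add: tens_eval_frag_of)
qed

end

lemma (in lquotient) lquot_cyc:
  assumes w: "w \<in> carrier M" "\<And>x. x \<in> carrier M \<Longrightarrow> \<exists>u. x = u \<odot> w"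
  shows "cyc (lquot M K) (K +> w) {u. u \<odot> w \<in> K}"
proof -
  have "carrier (lquot M K) = {u \<odot>\<^bsub>lquot M K\<^esub> (K +> w) | u. True}"
    unfolding lquot_smult[OF w(1)] lquot_carrier using w(2) smult_closed[OF w(1)] by blast
  moreover have "{u. u \<odot>\<^bsub>lquot M K\<^esub> (K +> w) = \<zero>\<^bsub>lquot M K\<^esub>} = {u. u \<odot> w \<in> K}"
    unfolding lquot_smult[OF w(1)] lquot_zero using coset_eq_zero smult_closed[OF w(1)] by simp
  moreover have "K +> w \<in> carrier (lquot M K)" unfolding lquot_carrier using w(1) by blast
  ultimately show ?thesis unfolding cyc_def using lquot_lmodule by simp
qed

section \<open>Highest weight modules as delta functions along u = 0, and their maximal
  submodules\<close>

section \<open>Highest weight modules\<close>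

text \<open>The highest weight module of weight \<open>(a, c)\<close> is realised on the coefficients with \<open>k < 0\<close>, with
  highest weight vector \<open>hwv\<close>.\<close>

definition hwv :: "int \<Rightarrow> int \<Rightarrow> complex" where
  "hwv k l = (if k = - 1 \<and> l = 0 then 1 else 0)"

definition hw_fun :: "complex \<Rightarrow> complex \<Rightarrow> l4 uea \<Rightarrow> int \<Rightarrow> int \<Rightarrow> complex" where
  "hw_fun a c u = actI (- a - 2) c u hwv"

lemma hw_fun_simps:
  "hw_fun a c (u + v) k l = hw_fun a c u k l + hw_fun a c v k l"
  "hw_fun a c (u * v) = actI (- a - 2) c u (hw_fun a c v)"
  "hw_fun a c 1 = hwv" "hw_fun a c 0 = (\<lambda>k l. 0)"
  "hw_fun a c (scal b * u) k l = b * hw_fun a c u k l"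
  by (simp_all add: hw_fun_def actI_simps actI_0)

lemma agreeI: "(\<And>k l. l \<ge> 0 \<Longrightarrow> G k l = H k l) \<Longrightarrow> agree False G H"
  by (simp add: agree_def)

text \<open>On the half plane \<open>l \<ge> 0\<close> the vector \<open>hwv\<close> spans a line on
  which the Borel-like subalgebra acts by the weight (a, c); the parameter m = - a - 2 is what gives
  \<open>h\<close> the eigenvalue a at k = -1.\<close>

lemma hwv_bor: "agree False (actI (- a - 2) c (bor_emb b) hwv) (\<lambda>k l. bor_char a c b * hwv k l)"
proof (induction b rule: uea_induct)
  case (scal z)
  then show ?case by (simp add: bor_emb_def bor_emb.uea_lift_scal bor_char_def bor_char.uea_lift_scal actI_simps agree_def)
next
  case (gen x)
  have "agree False (opI (- a - 2) c (bor_incl x) hwv) (\<lambda>k l. bor_weight a c x * hwv k l)"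
    by (rule agreeI, cases x) (auto simp: hwv_def algebra_simps)
  then show ?case by (simp add: bor_emb_def bor_emb.uea_lift_gen bor_char_def bor_char.uea_lift_gen actI_simps)
next
  case (add u v)
  then show ?case
    by (simp add: bor_emb_def bor_emb.uea_lift_add bor_char_def bor_char.uea_lift_add actI_simps agree_def algebra_simps)
next
  case (mult u v)
  have "agree False (actI (- a - 2) c (bor_emb u) (actI (- a - 2) c (bor_emb v) hwv))
      (actI (- a - 2) c (bor_emb u) (\<lambda>k l. bor_char a c v * hwv k l))"
    by (rule agree_act[OF mult(2)])
  moreover have "bor_emb (u * v) = bor_emb u * bor_emb v" "bor_char a c (u * v) = bor_char a c v * bor_char a c u"
    by (simp_all add: bor_emb_def bor_emb.uea_lift_mult bor_char_def bor_char.uea_lift_mult)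
  ultimately have "actI (- a - 2) c (bor_emb (u * v)) hwv k l = bor_char a c (u * v) * hwv k l" if "l \<ge> 0" for k l
    using mult(1) that by (simp add: actI_simps actI_linear(2) agree_def)
  then show ?case by (rule agreeI)
qed

lemma hw_fun_bor: "l \<ge> 0 \<Longrightarrow> hw_fun a c (u * bor_emb b) k l = bor_char a c b * hw_fun a c u k l"
  using agree_act[OF hwv_bor, of "- a - 2" c u a c b]
  by (simp add: hw_fun_def actI_simps actI_linear agree_def)

text \<open>The coefficients in the quadrant form a quotient module, in which \<open>hwv\<close> is
  zero. This is what later kills U inside its localization.\<close>

lemma hw_fun_nonneg: "k \<ge> 0 \<Longrightarrow> l \<ge> 0 \<Longrightarrow> hw_fun a c u k l = 0"
proof -
  have "agree True hwv (\<lambda>k l. 0)" by (simp add: agree_def hwv_def)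
  then have "agree True (actI (- a - 2) c u hwv) (actI (- a - 2) c u (\<lambda>k l. 0))" by (rule agree_act)
  then show "k \<ge> 0 \<Longrightarrow> l \<ge> 0 \<Longrightarrow> hw_fun a c u k l = 0" by (simp add: agree_def hw_fun_def actI_zero)
qed

definition hw_ker :: "complex \<Rightarrow> complex \<Rightarrow> l4 uea set" where
  "hw_ker a c = {u. agree False (hw_fun a c u) (\<lambda>k l. 0)}"

lemma hw_ker_left_ideal: "left_ideal (hw_ker a c)"
  unfolding left_ideal_def
proof (intro conjI ballI allI)
  fix r x assume "x \<in> hw_ker a c"
  then have "agree False (actI (- a - 2) c r (hw_fun a c x)) (actI (- a - 2) c r (\<lambda>k l. 0))"
    by (intro agree_act) (simp add: hw_ker_def)
  then show "r * x \<in> hw_ker a c" by (simp add: hw_ker_def hw_fun_simps actI_zero)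
qed (auto simp: hw_ker_def agree_def hw_fun_simps)

lemma hw_ker_1: "1 \<notin> hw_ker a c"
  by (auto simp: hw_ker_def hw_fun_simps agree_def hwv_def dest: spec[of _ "- 1"])

lemma hw_fun_pev_h: "hw_fun a c (pev p uh * u) k l = poly p (2 * of_int k - 2 * of_int l + a + 2) * hw_fun a c u k l"
proof (induction p)
  case 0
  then show ?case by (simp add: hw_fun_simps)
next
  case (pCons b p)
  have "hw_fun a c (pev (pCons b p) uh * u) k l = hw_fun a c (scal b * u + uh * (pev p uh * u)) k l"
    by (simp add: distrib_right mult.assoc)
  then show ?case using pCons.IH by (simp add: hw_fun_simps actI_simps algebra_simps)
qed

lemma bounded_below_act:
  "\<exists>K. \<forall>k l. l \<ge> 0 \<longrightarrow> k < K \<longrightarrow> G k l = 0 \<Longrightarrow> \<exists>K. \<forall>k l. l \<ge> 0 \<longrightarrow> k < K \<longrightarrow> actI m c u G k l = 0"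
proof (induction u arbitrary: G rule: uea_induct)
  case (scal b)
  then show ?case by (auto simp: actI_simps)
next
  case (gen x)
  then obtain K where K: "\<And>k l. l \<ge> 0 \<Longrightarrow> k < K \<Longrightarrow> G k l = 0" by blast
  define G' where "G' k l = (if l \<ge> 0 then G k l else 0)" for k l
  have K': "G' k l = 0" if "k < K" for k l using that K by (simp add: G'_def)
  have "agree False (opI m c x G) (opI m c x G')" by (rule agree_op) (simp add: agree_def G'_def)
  moreover have "opI m c x G' k l = 0" if k: "k < K - 1" for k l
  proof (rule l4_sl2_cases[of _ x])
    fix v
    show "opI m c (Lr v) G' k l = 0" by (cases v) (use k in \<open>simp_all add: K'\<close>)
  qed (use k in \<open>simp_all add: K'\<close>)
  ultimately have "opI m c x G k l = 0" if "l \<ge> 0" "k < K - 1" for k l using that by (simp add: agree_def)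
  then show ?case unfolding actI_simps by blast
next
  case (add u v)
  obtain K L where "\<forall>k l. l \<ge> 0 \<longrightarrow> k < K \<longrightarrow> actI m c u G k l = 0" "\<forall>k l. l \<ge> 0 \<longrightarrow> k < L \<longrightarrow> actI m c v G k l = 0"
    using add.IH[OF add.prems] by blast
  then show ?case by (intro exI[of _ "min K L"]) (simp add: actI_simps)
next
  case (mult u v)
  then show ?case by (simp add: actI_simps)
qed

lemma reach_hwv_0:
  assumes "\<And>k l. l \<ge> 0 \<Longrightarrow> k < - 1 \<Longrightarrow> G k l = 0" "G (- 1) (int l) \<noteq> 0"
  shows "\<exists>u. actI m c u G (- 1) 0 \<noteq> 0"
  using assms
proof (induction l arbitrary: G)
  case 0
  then show ?case by (intro exI[of _ 1]) (simp add: actI_simps)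
next
  case (Suc l)
  have "\<exists>u. actI m c u (actI m c ue G) (- 1) 0 \<noteq> 0"
    by (rule Suc.IH) (use Suc.prems in \<open>simp_all add: actI_simps algebra_simps\<close>)
  then show ?case by (auto simp flip: actI_simps(2))
qed

text \<open>\<open>V2\<close> shifts the lowest nonzero row one step towards k = -1, multiplied by a
  nonzero constant. Once in that row, \<open>e\<close> lowers l to 0.\<close>

lemma reach_hwv:
  assumes "c \<noteq> 0" "\<And>k l. l \<ge> 0 \<Longrightarrow> k < - 1 - int n \<Longrightarrow> G k l = 0" "G (- 1 - int n) l \<noteq> 0" "l \<ge> 0"
  shows "\<exists>u. actI m c u G (- 1) 0 \<noteq> 0"
  using assms(2-4)
proof (induction n arbitrary: G)
  case 0
  then show ?case using reach_hwv_0[of G "nat l"] by simp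
next
  case (Suc n)
  have z: "b * G k l = 0" if "l < 0 \<Longrightarrow> b = 0" "k < - 1 - int (Suc n)" for b k l
    using that Suc.prems(1)[of l k] by (cases "l < 0") auto
  have "\<exists>u. actI m c u (actI m c (uv V2) G) (- 1) 0 \<noteq> 0"
  proof (rule Suc.IH)
    show "actI m c (uv V2) G k l = 0" if "l \<ge> 0" "k < - 1 - int n" for k l
    proof -
      have "of_int (2 * k) * G (k - 1) l = 0" "of_int (6 * k * (k - 1) * l) * G (k - 2) (l - 1) = 0"
        "of_int (4 * k * (k - 1) * (k - 2) * l * (l - 1)) * G (k - 3) (l - 2) = 0"
        by (rule z; use that in auto)+
      then show ?thesis unfolding actI_simps opI.simps by (simp only: add_0 mult_zero_right)
    qed
    have "of_int (6 * k * (k - 1) * l) * G (k - 2) (l - 1) = 0"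
        "of_int (4 * k * (k - 1) * (k - 2) * l * (l - 1)) * G (k - 3) (l - 2) = 0" if "k = - 1 - int n" for k
      by (rule z; use that Suc.prems in auto)+
    then have "actI m c (uv V2) G (- 1 - int n) l = c * (of_int (2 * (- 1 - int n)) * G (- 1 - int (Suc n)) l)"
      unfolding actI_simps opI.simps by (simp only: add_0_right) (simp add: algebra_simps)
    moreover have "(of_int (2 * (- 1 - int n)) :: complex) \<noteq> 0" unfolding of_int_eq_0_iff by simp
    ultimately show "actI m c (uv V2) G (- 1 - int n) l \<noteq> 0" using assms(1) Suc.prems(2) by (simp del: of_int_mult)
  qed (rule Suc.prems)
  then show ?case by (auto simp flip: actI_simps(2))
qed

lemma hw_fun_reach:
  assumes "c \<noteq> 0" "u \<notin> hw_ker a c"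
  shows "\<exists>b. hw_fun a c (b * u) (- 1) 0 \<noteq> 0"
proof -
  define G where "G = hw_fun a c u"
  obtain k0 l0 where kl: "l0 \<ge> 0" "G k0 l0 \<noteq> 0" using assms(2) by (auto simp: hw_ker_def agree_def G_def)
  have "\<exists>K. \<forall>k l. l \<ge> 0 \<longrightarrow> k < K \<longrightarrow> G k l = 0"
    unfolding G_def hw_fun_def by (rule bounded_below_act) (auto simp: hwv_def intro: exI[of _ "- 1"])
  then obtain K where K: "\<And>k l. l \<ge> 0 \<Longrightarrow> k < K \<Longrightarrow> G k l = 0" by blast
  define P where "P i \<longleftrightarrow> (\<exists>l\<ge>0. G (K + int i) l \<noteq> 0)" for i
  have "k0 \<ge> K" using K[of l0 k0] kl by force
  then have "P (nat (k0 - K))" using kl by (auto simp: P_def)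
  define i where "i = (LEAST i. P i)"
  have i: "P i" unfolding i_def by (rule LeastI) fact
  have least: "\<not> P j" if "j < i" for j using not_less_Least that by (simp add: i_def)
  obtain l where l: "l \<ge> 0" "G (K + int i) l \<noteq> 0" using i by (auto simp: P_def)
  have "K + int i < 0" using l hw_fun_nonneg[of "K + int i" l a c u] by (force simp: G_def)
  define n where "n = nat (- 1 - (K + int i))"
  have n: "K + int i = - 1 - int n" using \<open>K + int i < 0\<close> by (simp add: n_def)
  have "G k l' = 0" if "l' \<ge> 0" "k < - 1 - int n" for k l'
  proof (cases "k < K")
    case False
    then have "nat (k - K) < i" "K + int (nat (k - K)) = k" using that(2) n by auto
    then show ?thesis using least[of "nat (k - K)"] that(1) by (auto simp: P_def)
  qed (use K that in auto)
  then obtain b where "actI (- a - 2) c b G (- 1) 0 \<noteq> 0"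
    using reach_hwv[OF assms(1), of n G l "- a - 2"] l n by auto
  then show ?thesis by (auto simp: G_def hw_fun_simps)
qed

subsection \<open>The maximal ideal\<close>

lemma sc_weight: "sc x y z \<noteq> 0 \<Longrightarrow> l4wt z = l4wt x + l4wt y"
proof -
  have g: "rad_act g v w \<noteq> 0 \<Longrightarrow> rwt w = l4wt (Lg g) + rwt v" for g v w
    by (cases g; cases v; cases w; simp)
  have s: "sl2_sc g g' g'' \<noteq> 0 \<Longrightarrow> l4wt (Lg g'') = l4wt (Lg g) + l4wt (Lg g')" for g g' g''
    by (cases g; cases g'; cases g''; simp)
  show "sc x y z \<noteq> 0 \<Longrightarrow> l4wt z = l4wt x + l4wt y"
    by (cases x; cases y; cases z) (use g s in \<open>auto simp: sc_l4_def\<close>)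
qed

text \<open>\<open>(n, u)\<close> means that, modulo \<open>J\<close>, u is a combination of
  products of lowering generators of total weight n; elements of \<open>J\<close> have every degree.
  This grading takes the place of a basis of monomials.\<close>

inductive_set DD :: "complex \<Rightarrow> l4 uea set \<Rightarrow> (int \<times> l4 uea) set" for a J where
  DD_J: "u \<in> J \<Longrightarrow> (n, u) \<in> DD a J"
| DD_1: "(0, scal b) \<in> DD a J"
| DD_low: "(n, u) \<in> DD a J \<Longrightarrow> l4wt y < 0 \<Longrightarrow> (n + l4wt y, gen y * u) \<in> DD a J"
| DD_add: "(n, u) \<in> DD a J \<Longrightarrow> (n, v) \<in> DD a J \<Longrightarrow> (n, u + v) \<in> DD a J"

inductive_set DS :: "complex \<Rightarrow> l4 uea set \<Rightarrow> l4 uea set" for a J where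
  DS_D: "(n, u) \<in> DD a J \<Longrightarrow> u \<in> DS a J"
| DS_add: "u \<in> DS a J \<Longrightarrow> v \<in> DS a J \<Longrightarrow> u + v \<in> DS a J"

locale highest_weight =
  fixes J :: "l4 uea set" and a c :: complex
  assumes J: "left_ideal J" and J1: "1 \<notin> J"
    and pos: "l4wt x > 0 \<Longrightarrow> gen x \<in> J" and hJ: "uh - scal a \<in> J" and vJ: "uv V0 - scal c \<in> J"
begin

lemma DD_scal: "(n, u) \<in> DD a J \<Longrightarrow> (n, scal b * u) \<in> DD a J"
proof (induction rule: DD.induct)
  case (DD_J u n)
  then show ?case by (intro DD.DD_J left_idealD(3)[OF J])
next
  case (DD_1 b')
  show ?case using DD.DD_1[of "b * b'"] by (simp add: scal.scalar_mult)
next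
  case (DD_low n u y)
  then show ?case using DD.DD_low[of n "scal b * u" a J y] by (simp add: scal_commutes)
next
  case (DD_add n u v)
  then show ?case by (simp add: distrib_left DD.DD_add)
qed

lemma DD_sum: "finite I \<Longrightarrow> (\<And>i. i \<in> I \<Longrightarrow> (n, f i) \<in> DD a J) \<Longrightarrow> (n, sum f I) \<in> DD a J"
  by (induction I rule: finite_induct) (auto intro: DD.DD_add DD.DD_J left_idealD(1)[OF J])

lemma gen_diff_mem: "gen x - scal b \<in> J \<Longrightarrow> (0, gen x * scal b') \<in> DD a J"
proof -
  assume "gen x - scal b \<in> J"
  then have "scal b' * (gen x - scal b) \<in> J" by (rule left_idealD(3)[OF J])
  then have "(0, scal b' * (gen x - scal b) + scal (b' * b)) \<in> DD a J"
    by (intro DD.DD_add DD.DD_J DD.DD_1)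
  then show ?thesis by (simp add: right_diff_distrib scal_commutes flip: scal.scalar_mult)
qed

lemma DD_gen: "(n, u) \<in> DD a J \<Longrightarrow> (n + l4wt x, gen x * u) \<in> DD a J"
proof (induction arbitrary: x rule: DD.induct)
  case (DD_J u n)
  then show ?case by (intro DD.DD_J left_idealD(3)[OF J])
next
  case (DD_1 b)
  consider "l4wt x < 0" | "l4wt x = 0" | "l4wt x > 0" by linarith
  then show ?case
  proof cases
    case 1
    then show ?thesis using DD.DD_low[OF DD.DD_1 1, of b a J] by simp
  next
    case 2
    have "x = Lg sl2_h \<or> x = Lr V0"
    proof (cases x)
      case (Lg g)
      then show ?thesis using 2 by (cases g) simp_all
    next
      case (Lr v)
      then show ?thesis using 2 by (cases v) simp_all
    qed
    then show ?thesis using 2 gen_diff_mem[OF hJ] gen_diff_mem[OF vJ] by auto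
  next
    case 3
    then have "scal b * gen x \<in> J" by (intro left_idealD(3)[OF J] pos)
    then show ?thesis by (intro DD.DD_J) (simp add: scal_commutes)
  qed
next
  case (DD_low n u y)
  have "gen x * (gen y * u) = gen y * (gen x * u) + (\<Sum>z\<in>UNIV. scal (sc x y z) * (gen z * u))"
  proof -
    have "gen x * gen y = gen y * gen x + (\<Sum>z\<in>UNIV. scal (sc x y z) * gen z)"
      using gen_commutator[of x y] by (simp add: algebra_simps)
    then show ?thesis by (simp add: distrib_right sum_distrib_right mult.assoc flip: mult.assoc[of "gen x"])
  qed
  moreover have "(n + l4wt y + l4wt x, gen y * (gen x * u)) \<in> DD a J"
    using DD.DD_low[OF DD_low.IH DD_low.hyps(2), of x] by (simp add: ac_simps)
  moreover have "(n + l4wt y + l4wt x, \<Sum>z\<in>UNIV. scal (sc x y z) * (gen z * u)) \<in> DD a J"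
  proof (rule DD_sum)
    fix z
    show "(n + l4wt y + l4wt x, scal (sc x y z) * (gen z * u)) \<in> DD a J"
    proof (cases "sc x y z = 0")
      case True
      then show ?thesis by (intro DD.DD_J) (simp add: scal_simps left_idealD(1)[OF J])
    next
      case False
      then have "n + l4wt y + l4wt x = n + l4wt z" using sc_weight by simp
      then show ?thesis using DD_scal[OF DD_low.IH[of z]] by (simp only:)
    qed
  qed simp
  ultimately show ?case by (simp add: DD.DD_add)
next
  case (DD_add n u v)
  then show ?case by (simp add: distrib_left DD.DD_add)
qed

lemma DS_UNIV: "u \<in> DS a J"
proof -
  have "left_ideal (DS a J)"
  proof (rule usubspace_left_idealI)
    have "scal b * u \<in> DS a J" if "u \<in> DS a J" for b u
      using that by (induction rule: DS.induct) (auto simp: distrib_left intro: DS.intros DD_scal)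
    then show "usubspace (DS a J)"
      unfolding usubspace_def using DS_D[OF DD_J[OF left_idealD(1)[OF J]]] by (auto intro: DS_add)
    show "gen x * y \<in> DS a J" if "y \<in> DS a J" for x y
      using that by (induction rule: DS.induct) (auto simp: distrib_left intro: DS.intros DD_gen)
  qed
  moreover have "1 \<in> DS a J" using DS_D[OF DD_1[of 1 a J]] by (simp add: scal.scalar_one)
  ultimately show ?thesis using left_ideal_1 by blast
qed

lemma DD_low_weight:
  "(n, u) \<in> DD a J \<Longrightarrow> (n > 0 \<longrightarrow> u \<in> J) \<and> (n = 0 \<longrightarrow> (\<exists>b. u - scal b \<in> J)) \<and>
    uh * u - scal (a + of_int n) * u \<in> J"
proof (induction rule: DD.induct)
  case (DD_J u n)
  then have "\<exists>b. u - scal b \<in> J" by (intro exI[of _ 0]) (simp add: scal_simps)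
  then show ?case using DD_J by (simp add: left_idealD[OF J])
next
  case (DD_1 b)
  have "scal b * (uh - scal a) \<in> J" by (rule left_idealD(3)[OF J hJ])
  then have "uh * scal b - scal a * scal b \<in> J"
    by (simp add: right_diff_distrib scal_commutes mult.commute flip: scal.scalar_mult)
  moreover have "\<exists>b'. scal b - scal b' \<in> J" by (intro exI[of _ b]) (simp add: left_idealD(1)[OF J])
  ultimately show ?case by simp
next
  case (DD_low n u y)
  have "gen y * (uh * u - scal (a + of_int n) * u) \<in> J" using DD_low.IH left_idealD(3)[OF J] by blast
  moreover have "gen y * (uh * u - scal (a + of_int n) * u)
      = uh * (gen y * u) - scal (a + of_int (n + l4wt y)) * (gen y * u)"
  proof -
    have "uh * (gen y * u) = gen y * (uh * u) + scal (of_int (l4wt y)) * (gen y * u)"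
      using comm_left[OF comm_h_gen, of y u] by (simp add: mult.assoc)
    then show ?thesis
      by (simp add: right_diff_distrib scal.scalar_add distrib_right distrib_left scal_commutes)
  qed
  moreover have "gen y * u \<in> J" if "n + l4wt y \<ge> 0"
    using DD_low.IH DD_low.hyps(2) that by (intro left_idealD(3)[OF J]) simp
  moreover have "\<exists>b. gen y * u - scal b \<in> J" if "gen y * u \<in> J"
    by (intro exI[of _ 0]) (simp add: scal_simps that)
  ultimately show ?case by simp
next
  case (DD_add n u v)
  have "\<exists>b. u + v - scal b \<in> J" if n: "n = 0"
  proof -
    obtain b b' where "u - scal b \<in> J" "v - scal b' \<in> J" using DD_add n by auto
    then have "u - scal b + (v - scal b') \<in> J" by (rule left_idealD(2)[OF J])
    then show ?thesis by (intro exI[of _ "b + b'"]) (simp add: scal.scalar_add algebra_simps)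
  qed
  moreover have "uh * (u + v) - scal (a + of_int n) * (u + v)
      = (uh * u - scal (a + of_int n) * u) + (uh * v - scal (a + of_int n) * v)" by (simp add: distrib_left)
  ultimately show ?case using DD_add by (simp add: left_idealD(2)[OF J])
qed

text \<open>The highest weight space is spanned by the generator: u differs from a scalar by vectors
  of other weights, and a product of linear factors in \<open>h\<close> that is nonzero at a kills
  these.\<close>

lemma highest_component: "\<exists>b p. poly p a \<noteq> 0 \<and> pev p uh * (u - scal b) \<in> J"
  using DS_UNIV[of u]
proof (induction rule: DS.induct)
  case (DS_D n u)
  note D = DD_low_weight[OF DS_D]
  consider "n > 0" | "n = 0" | "n < 0" by linarith
  then show ?case
  proof cases
    case 1
    then show ?thesis using D by (intro exI[of _ 0] exI[of _ 1]) (simp add: scal_simps)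
  next
    case 2
    then obtain b where "u - scal b \<in> J" using D by blast
    then show ?thesis by (intro exI[of _ b] exI[of _ 1]) simp
  next
    case 3
    have "pev [:- (a + of_int n), 1:] uh * (u - scal 0) \<in> J"
      using D by (simp only: pev_linear) (simp add: scal_simps left_diff_distrib)
    then show ?thesis using 3 by (intro exI[of _ 0] exI[of _ "[:- (a + of_int n), 1:]"]) simp
  qed
next
  case (DS_add u v)
  then obtain b p b' p' where p: "poly p a \<noteq> 0" "pev p uh * (u - scal b) \<in> J"
    and p': "poly p' a \<noteq> 0" "pev p' uh * (v - scal b') \<in> J" by blast
  have "pev p' uh * (pev p uh * (u - scal b)) + pev p uh * (pev p' uh * (v - scal b')) \<in> J"
    by (intro left_idealD(2)[OF J] left_idealD(3)[OF J] p p')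
  moreover have "pev p' uh * pev p uh = pev (p * p') uh" by (metis pev_mult mult.commute)
  then have "pev p' uh * (pev p uh * x) = pev (p * p') uh * x" "pev p uh * (pev p' uh * x) = pev (p * p') uh * x" for x
    by (simp_all add: pev_mult flip: mult.assoc)
  ultimately have "pev (p * p') uh * (u + v - scal (b + b')) \<in> J"
    by (simp add: scal.scalar_add algebra_simps)
  then show ?case using p(1) p'(1) by (intro exI[of _ "b + b'"] exI[of _ "p * p'"]) simp
qed

definition top_ker where "top_ker = {u. \<exists>p. poly p a \<noteq> 0 \<and> pev p uh * u \<in> J}"

text \<open>The largest proper submodule of a highest weight module: the vectors none of whose
  translates has a component of highest weight.\<close>

definition max_ideal where "max_ideal = {u. \<forall>b. b * u \<in> top_ker}"

text \<open>A polynomial in \<open>h\<close> isolates the component of highest weight, which would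
  put 1 into the ideal if it were nonzero.\<close>

lemma proper_le:
  assumes J': "left_ideal J'" "J \<subseteq> J'" "1 \<notin> J'"
  shows "J' \<subseteq> max_ideal"
proof -
  have "u \<in> top_ker" if u: "u \<in> J'" for u
  proof -
    obtain b p where p: "poly p a \<noteq> 0" "pev p uh * (u - scal b) \<in> J" using highest_component by blast
    have "pev p uh * u - pev p uh * (u - scal b) \<in> J'"
      using left_idealD(5)[OF J'(1) left_idealD(3)[OF J'(1) u]] p(2) J'(2) by blast
    then have 1: "pev p uh * scal b \<in> J'" by (simp add: right_diff_distrib)
    have "pev p uh * 1 - scal (poly p a) * 1 \<in> J'"
      by (rule pev_eigen[OF left_ideal_usubspace[OF J'(1)]]) (use hJ J'(2) left_idealD(3)[OF J'(1)] in auto)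
    then have "scal b * (pev p uh * 1 - scal (poly p a) * 1) \<in> J'" by (rule left_idealD(3)[OF J'(1)])
    from left_idealD(5)[OF J'(1) 1 this]
    have "pev p uh * scal b - scal b * (pev p uh * 1 - scal (poly p a) * 1) \<in> J'" .
    moreover have "pev p uh * scal b = scal b * pev p uh" by (rule scal.scalar_central[symmetric])
    ultimately have "scal (b * poly p a) * 1 \<in> J'"
      by (simp add: right_diff_distrib scal.scalar_mult)
    then have "b = 0" using p(1) J'(3) usubspace_scal_iff[OF left_ideal_usubspace[OF J'(1)], of "b * poly p a" 1] by auto
    then show ?thesis using p unfolding top_ker_def by (auto simp: scal_simps)
  qed
  then show ?thesis using left_idealD(3)[OF J'(1)] by (auto simp: max_ideal_def)
qed

lemma max_ideal: "left_ideal max_ideal" "J \<subseteq> max_ideal" "1 \<notin> max_ideal"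
proof -
  have add: "u + v \<in> top_ker" if uv: "u \<in> top_ker" "v \<in> top_ker" for u v
  proof -
    obtain p p' where p: "poly p a \<noteq> 0" "pev p uh * u \<in> J" "poly p' a \<noteq> 0" "pev p' uh * v \<in> J"
      using uv by (auto simp: top_ker_def)
    have "pev p' uh * (pev p uh * u) + pev p uh * (pev p' uh * v) \<in> J"
      by (intro left_idealD(2)[OF J] left_idealD(3)[OF J] p)
    moreover have "pev p' uh * pev p uh = pev (p * p') uh" by (metis pev_mult mult.commute)
    then have "pev p' uh * (pev p uh * x) = pev (p * p') uh * x" "pev p uh * (pev p' uh * x) = pev (p * p') uh * x" for x
      by (simp_all add: pev_mult flip: mult.assoc)
    ultimately have "pev (p * p') uh * (u + v) \<in> J" by (simp add: distrib_left)
    then show ?thesis using p unfolding top_ker_def by (intro CollectI exI[of _ "p * p'"]) simp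
  qed
  have J_top: "J \<subseteq> top_ker" unfolding top_ker_def by (auto intro!: exI[of _ 1])
  then show "left_ideal max_ideal"
    unfolding left_ideal_def max_ideal_def using add left_idealD(1)[OF J]
    by (auto simp: distrib_left simp flip: mult.assoc)
  show "J \<subseteq> max_ideal" using J_top left_idealD(3)[OF J] by (auto simp: max_ideal_def)
  show "1 \<notin> max_ideal"
  proof
    assume "1 \<in> max_ideal"
    then have "1 * 1 \<in> top_ker" unfolding max_ideal_def by blast
    then obtain p where p: "poly p a \<noteq> 0" "pev p uh * 1 \<in> J" by (auto simp: top_ker_def)
    have "pev p uh * 1 - scal (poly p a) * 1 \<in> J"
      by (rule pev_eigen[OF left_ideal_usubspace[OF J]]) (use hJ left_idealD(3)[OF J] in auto)
    from left_idealD(5)[OF J p(2) this] have "scal (poly p a) * 1 \<in> J" by simp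
    then show False using p(1) J1 usubspace_scal_iff[OF left_ideal_usubspace[OF J]] by blast
  qed
qed

lemma max_ideal_maximal: "maximal_left_ideal max_ideal"
  unfolding maximal_left_ideal_def using max_ideal proper_le by blast

lemma max_ideal_unique:
  assumes "maximal_left_ideal J'" "J \<subseteq> J'"
  shows "J' = max_ideal"
  using assms proper_le[of J'] max_ideal(1,3) unfolding maximal_left_ideal_def by blast

end

section \<open>Verma modules and their simple quotients\<close>

definition verma_gen where "verma_gen a c = bimodule.pure U_bimodule (C_weight a c) 1 1"

definition verma_ann :: "complex \<Rightarrow> complex \<Rightarrow> l4 uea set" where
  "verma_ann a c = lmodule.ann (verma a c) (verma_gen a c)"

lemma U_bimodule_simps [simp]:
  "carrier U_bimodule = UNIV" "\<zero>\<^bsub>U_bimodule\<^esub> = 0" "x \<oplus>\<^bsub>U_bimodule\<^esub> y = x + y"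
  "u \<odot>\<^bsub>U_bimodule\<^esub> x = u * x" "rsmult U_bimodule x b = x * bor_emb b"
  by (simp_all add: U_bimodule_def)

lemma C_weight_simps [simp]:
  "carrier (C_weight a c) = UNIV" "\<zero>\<^bsub>C_weight a c\<^esub> = 0" "x \<oplus>\<^bsub>C_weight a c\<^esub> y = x + y"
  "b \<odot>\<^bsub>C_weight a c\<^esub> x = bor_char a c b * x"
  by (simp_all add: C_weight_def)

lemma verma_gen:
  "verma_gen a c \<in> carrier (verma a c)"
  "u \<odot>\<^bsub>verma a c\<^esub> verma_gen a c = bimodule.pure U_bimodule (C_weight a c) u 1"
  unfolding verma_def verma_gen_def
  by (simp_all add: bimodule.pure_carrier[OF bimodule_U] bimodule.pure_smult[OF bimodule_U])

lemma verma_cyclic: "X \<in> carrier (verma a c) \<Longrightarrow> \<exists>u. X = u \<odot>\<^bsub>verma a c\<^esub> verma_gen a c"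
proof -
  interpret B: bimodule U_bimodule by (rule bimodule_U)
  interpret V: lmodule "verma a c" by (rule lmodule_verma)
  assume "X \<in> carrier (verma a c)"
  then show ?thesis
    unfolding verma_def
  proof (induction X rule: B.tensor_induct)
    case zero
    show ?case unfolding verma_def[symmetric] using V.smult_0_left[OF verma_gen(1)] by metis
  next
    case (pure x y)
    have "bor_char a c (scal y) = y" by (simp add: bor_char_def bor_char.uea_lift_scal)
    then have "B.pure (C_weight a c) x y = B.pure (C_weight a c) (x * bor_emb (scal y)) 1"
      using B.pure_balanced[of x 1 "C_weight a c" "scal y"] by simp
    then show ?case unfolding verma_def[symmetric] verma_gen(2) by (rule exI)
  next
    case (diff X Y)
    then obtain u v where "X = u \<odot>\<^bsub>verma a c\<^esub> verma_gen a c" "Y = v \<odot>\<^bsub>verma a c\<^esub> verma_gen a c"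
      by (auto simp: verma_def)
    then show ?case unfolding verma_def[symmetric] using V.smult_diff_left[OF verma_gen(1)] by metis
  qed
qed

text \<open>The Verma module maps to the half plane model by sending (u, y) to y times
  \<open>hw_fun a c u\<close>, which is balanced by \<open>hw_fun_bor\<close>.\<close>

lemma verma_ann_hw_ker: "verma_ann a c \<subseteq> hw_ker a c"
proof
  interpret B: bimodule U_bimodule by (rule bimodule_U)
  interpret V: lmodule "verma a c" by (rule lmodule_verma)
  fix u assume "u \<in> verma_ann a c"
  then have "B.pure (C_weight a c) u 1 = \<zero>\<^bsub>tensor U_bimodule (C_weight a c)\<^esub>"
    using verma_gen(2)[of a c u] by (simp add: verma_ann_def V.ann_def) (simp add: verma_def)
  then have "(\<lambda>(u, y). y * hw_fun a c u k l) (u, 1) = 0" if "l \<ge> 0" for k l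
    by (rule B.pure_eq_zero_eval) (use that in \<open>simp_all add: hw_fun_simps(1) hw_fun_bor algebra_simps\<close>)
  then show "u \<in> hw_ker a c" by (simp add: hw_ker_def agree_def)
qed

lemma bor_gen_ann: "gen (bor_incl x) - scal (bor_weight a c x) \<in> verma_ann a c"
proof -
  interpret B: bimodule U_bimodule by (rule bimodule_U)
  interpret V: lmodule "verma a c" by (rule lmodule_verma)
  have "bor_emb (gen x) = gen (bor_incl x)" "bor_emb (scal b) = scal b"
    "bor_char a c (gen x) = bor_weight a c x" "bor_char a c (scal b) = b" for b
    by (simp_all add: bor_emb_def bor_char_def bor_emb.uea_lift_gen bor_emb.uea_lift_scal
      bor_char.uea_lift_gen bor_char.uea_lift_scal)
  then have "B.pure (C_weight a c) (gen (bor_incl x)) 1 = B.pure (C_weight a c) (scal (bor_weight a c x)) 1"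
    using B.pure_balanced[of 1 1 "C_weight a c" "gen x"]
      B.pure_balanced[of 1 1 "C_weight a c" "scal (bor_weight a c x)"] by simp
  then show ?thesis
    unfolding verma_gen(2)[symmetric] V.smult_eq_ann[OF verma_gen(1)] verma_ann_def .
qed

interpretation verma: highest_weight "verma_ann a c" a c for a c
proof
  interpret V: lmodule "verma a c" by (rule lmodule_verma)
  show "left_ideal (verma_ann a c)" unfolding verma_ann_def by (rule V.ann_left_ideal[OF verma_gen(1)])
  show "1 \<notin> verma_ann a c" using verma_ann_hw_ker hw_ker_1 by blast
  show "uh - scal a \<in> verma_ann a c" "uv V0 - scal c \<in> verma_ann a c"
    using bor_gen_ann[of Bh a c] bor_gen_ann[of B0 a c] by simp_all
  fix x assume x: "l4wt x > 0"
  have "x = Lg sl2_e \<or> x = Lr V2 \<or> x = Lr V4"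
  proof (cases x)
    case (Lg g)
    then show ?thesis using x by (cases g) simp_all
  next
    case (Lr v)
    then show ?thesis using x by (cases v) simp_all
  qed
  then show "gen x \<in> verma_ann a c"
    using bor_gen_ann[of Be a c] bor_gen_ann[of B2 a c] bor_gen_ann[of B4 a c] by (auto simp: scal_simps)
qed

abbreviation "hw_ideal a c \<equiv> highest_weight.max_ideal (verma_ann a c) a"

lemma hw_ideal_mem:
  "ue \<in> hw_ideal a c" "uh - scal a \<in> hw_ideal a c" "uv V0 - scal c \<in> hw_ideal a c"
  "uv V2 \<in> hw_ideal a c" "uv V4 \<in> hw_ideal a c"
  by (rule subsetD[OF verma.max_ideal(2)], rule verma.pos verma.hJ verma.vJ, simp?)+

text \<open>For c = 0 the radical acts by zero in the half plane model, whose annihilator is a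
  proper left ideal and so lies in the maximal one.\<close>

lemma hw_ideal_rad: "gen (Lr v) * u \<in> hw_ideal a 0"
proof -
  have "hw_ker a 0 \<subseteq> hw_ideal a 0"
    by (rule verma.proper_le[OF hw_ker_left_ideal verma_ann_hw_ker hw_ker_1])
  moreover have "opI m 0 (Lr v) G = (\<lambda>k l. 0)" for m G by (cases v) (simp_all add: fun_eq_iff)
  then have "gen (Lr v) * u \<in> hw_ker a 0" by (simp add: hw_ker_def hw_fun_simps actI_simps agree_def)
  ultimately show ?thesis by blast
qed

text \<open>For c nonzero every nonzero vector of the model has a translate with a component of
  highest weight (\<open>hw_fun_reach\<close>), which the definition of \<open>max_ideal\<close>
  excludes.\<close>

lemma hw_ideal_hw_ker:
  assumes c: "c \<noteq> 0"
  shows "hw_ideal a c \<subseteq> hw_ker a c"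
proof (rule ccontr)
  assume "\<not> hw_ideal a c \<subseteq> hw_ker a c"
  then obtain u where u: "u \<in> hw_ideal a c" "u \<notin> hw_ker a c" by blast
  obtain b where b: "hw_fun a c (b * u) (- 1) 0 \<noteq> 0" using hw_fun_reach[OF c u(2)] by blast
  have "b * u \<in> highest_weight.top_ker (verma_ann a c) a" using u(1) by (simp add: verma.max_ideal_def)
  then obtain p where p: "poly p a \<noteq> 0" "pev p uh * (b * u) \<in> hw_ker a c"
    using verma_ann_hw_ker by (auto simp: verma.top_ker_def)
  then have "hw_fun a c (pev p uh * (b * u)) (- 1) 0 = 0" by (simp add: hw_ker_def agree_def)
  then show False using p(1) b unfolding hw_fun_pev_h by simp
qed

text \<open>Submodules of the cyclic Verma module correspond to left ideals containing
  \<open>verma_ann\<close>, so uniqueness of the maximal one justifies the definite description in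
  \<open>simple_hw\<close>.\<close>

lemma simple_hw_cyc: "\<exists>w. cyc (simple_hw a c) w (hw_ideal a c)"
proof -
  let ?V = "verma a c" and ?w = "verma_gen a c"
  interpret V: lmodule ?V by (rule lmodule_verma)
  note w = verma_gen(1)[of a c]
  define N where "N = {u \<odot>\<^bsub>?V\<^esub> ?w | u. u \<in> hw_ideal a c}"
  have N: "lsubmodule N ?V"
    unfolding lsubmodule_def
  proof (intro conjI ballI allI)
    note I = left_idealD[OF verma.max_ideal(1)[of a c]]
    show "N \<subseteq> carrier ?V" using V.smult_closed[OF w] by (auto simp: N_def)
    show "\<zero>\<^bsub>?V\<^esub> \<in> N" unfolding N_def using V.smult_0_left[OF w] I(1) by (intro CollectI exI[of _ 0]) simp
    fix x y assume "x \<in> N" "y \<in> N"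
    then obtain u v where "x = u \<odot>\<^bsub>?V\<^esub> ?w" "u \<in> hw_ideal a c" "y = v \<odot>\<^bsub>?V\<^esub> ?w" "v \<in> hw_ideal a c"
      by (auto simp: N_def)
    then show "x \<oplus>\<^bsub>?V\<^esub> y \<in> N"
      unfolding N_def using V.smult_add_left[OF w] I(2) by (intro CollectI exI[of _ "u + v"]) simp
  next
    note I = left_idealD[OF verma.max_ideal(1)[of a c]]
    fix r x assume "x \<in> N"
    then obtain u where "x = u \<odot>\<^bsub>?V\<^esub> ?w" "u \<in> hw_ideal a c" by (auto simp: N_def)
    then show "r \<odot>\<^bsub>?V\<^esub> x \<in> N"
      unfolding N_def using V.smult_mult[OF w] I(3) by (intro CollectI exI[of _ "r * u"]) simp
  qed
  have cyc: "cyc (lquot ?V K) (K +>\<^bsub>?V\<^esub> ?w) {u. u \<odot>\<^bsub>?V\<^esub> ?w \<in> K}" if K: "lsubmodule K ?V" for K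
    by (rule lquotient.lquot_cyc[OF _ w verma_cyclic])
      (use K in \<open>simp_all add: lquotient_def lquotient_axioms_def V.lmodule_axioms\<close>)
  have ideal: "{u. u \<odot>\<^bsub>?V\<^esub> ?w \<in> N} = hw_ideal a c"
  proof (intro Set.set_eqI iffI)
    fix u assume "u \<in> {u. u \<odot>\<^bsub>?V\<^esub> ?w \<in> N}"
    then obtain v where v: "u \<odot>\<^bsub>?V\<^esub> ?w = v \<odot>\<^bsub>?V\<^esub> ?w" "v \<in> hw_ideal a c" by (auto simp: N_def)
    then have "u - v \<in> hw_ideal a c"
      using V.smult_eq_ann[OF w] verma.max_ideal(2)[of a c] by (auto simp: verma_ann_def)
    from left_idealD(2)[OF verma.max_ideal(1) this v(2)] show "u \<in> hw_ideal a c" by simp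
  qed (auto simp: N_def)
  have "(THE N. lsubmodule N ?V \<and> simple_lmodule (lquot ?V N)) = N"
  proof (rule the_equality)
    show "lsubmodule N ?V \<and> simple_lmodule (lquot ?V N)"
      using N cyc_simple[OF cyc[OF N]] verma.max_ideal_maximal unfolding ideal by blast
    fix K assume K: "lsubmodule K ?V \<and> simple_lmodule (lquot ?V K)"
    then have cK: "cyc (lquot ?V K) (K +>\<^bsub>?V\<^esub> ?w) {u. u \<odot>\<^bsub>?V\<^esub> ?w \<in> K}" using cyc by blast
    have nz: "K +>\<^bsub>?V\<^esub> ?w \<noteq> \<zero>\<^bsub>lquot ?V K\<^esub>"
    proof
      assume z: "K +>\<^bsub>?V\<^esub> ?w = \<zero>\<^bsub>lquot ?V K\<^esub>"
      interpret Q: lmodule "lquot ?V K" by (rule cycD(1)[OF cK])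
      have "carrier (lquot ?V K) = {\<zero>\<^bsub>lquot ?V K\<^esub>}"
      proof
        show "carrier (lquot ?V K) \<subseteq> {\<zero>\<^bsub>lquot ?V K\<^esub>}"
        proof
          fix y assume "y \<in> carrier (lquot ?V K)"
          then obtain u where "y = u \<odot>\<^bsub>lquot ?V K\<^esub> (K +>\<^bsub>?V\<^esub> ?w)" using cycD(3)[OF cK] by blast
          then show "y \<in> {\<zero>\<^bsub>lquot ?V K\<^esub>}" unfolding z by (simp add: Q.smult_0_right)
        qed
      qed simp
      then show False using K by (simp add: simple_lmodule_def)
    qed
    have "maximal_left_ideal {u. u \<odot>\<^bsub>?V\<^esub> ?w \<in> K}"
      using simple_cyc(2)[OF conjunct2[OF K] cycD(2)[OF cK] nz] unfolding cycD(4)[OF cK] .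
    moreover have "verma_ann a c \<subseteq> {u. u \<odot>\<^bsub>?V\<^esub> ?w \<in> K}"
      using K by (auto simp: verma_ann_def V.ann_def lsubmodule_def)
    ultimately have KJ: "{u. u \<odot>\<^bsub>?V\<^esub> ?w \<in> K} = hw_ideal a c" by (rule verma.max_ideal_unique)
    show "K = N"
    proof
      show "K \<subseteq> N"
      proof
        fix x assume x: "x \<in> K"
        then have "x \<in> carrier ?V" using K by (auto simp: lsubmodule_def)
        then obtain u where "x = u \<odot>\<^bsub>?V\<^esub> ?w" using verma_cyclic by blast
        then show "x \<in> N" using x KJ unfolding N_def by blast
      qed
      show "N \<subseteq> K" unfolding N_def using KJ by blast
    qed
  qed
  then have "simple_hw a c = lquot ?V N" by (simp add: simple_hw_def)
  then show ?thesis using cyc[OF N] unfolding ideal by auto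
qed

section \<open>Inverting \<open>f\<close>: shifts in k\<close>

section \<open>The Ore localization acting on functions\<close>

lemma hw_fun_f: "hw_fun a c (uf * x) k l = hw_fun a c x (k + 1) l"
  by (simp add: hw_fun_simps(2) actI_simps)

lemma hw_fun_f_pow: "hw_fun a c (uf ^ i * x) k l = hw_fun a c x (k + int i) l"
proof (induction i arbitrary: k)
  case (Suc i)
  have "hw_fun a c (uf ^ Suc i * x) k l = hw_fun a c (uf ^ i * x) (k + 1) l"
    by (simp only: power_Suc mult.assoc hw_fun_f)
  then show ?case by (simp add: Suc.IH add.commute add.left_commute)
qed simp

lemma actI_f_pow: "actI m c (uf ^ i) G k l = G (k + int i) l"
  by (induction i arbitrary: k) (simp_all add: actI_simps add.commute add.left_commute)

text \<open>The fraction p applied to \<open>u\<close> times \<open>hwv\<close>. On functions of all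
  integers k the operator \<open>f\<close> is a shift and so invertible; by
  \<open>loc_fun_fr\<close> the chosen fraction does not matter.\<close>

definition loc_fun :: "complex \<Rightarrow> complex \<Rightarrow> uloc \<Rightarrow> l4 uea \<Rightarrow> int \<Rightarrow> int \<Rightarrow> complex" where
  "loc_fun a c p u k l = (let nv = (SOME nv. p = fr (fst nv) (snd nv)) in hw_fun a c (snd nv * u) (k - int (fst nv)) l)"

lemma loc_fun_fr: "loc_fun a c (fr n v) u k l = hw_fun a c (v * u) (k - int n) l"
proof -
  define nv where "nv = (SOME nv. fr n v = fr (fst nv) (snd nv))"
  have "fr n v = fr (fst nv) (snd nv)"
    unfolding nv_def by (rule someI[of "\<lambda>nv. fr n v = fr (fst nv) (snd nv)" "(n, v)"]) simp
  then obtain i where i: "uf ^ (i + fst nv) * v = uf ^ (i + n) * snd nv" unfolding fr_eq_iff by blast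
  define k' where "k' = k - int n - int (fst nv) - int i"
  have "hw_fun a c (uf ^ (i + fst nv) * (v * u)) k' l = hw_fun a c (uf ^ (i + n) * (snd nv * u)) k' l"
    by (simp only: mult.assoc[symmetric] i)
  then have "hw_fun a c (v * u) (k - int n) l = hw_fun a c (snd nv * u) (k - int (fst nv)) l"
    unfolding hw_fun_f_pow by (simp add: k'_def)
  then show ?thesis by (simp add: loc_fun_def nv_def Let_def)
qed

lemma loc_fun_add: "loc_fun a c (p + q) u k l = loc_fun a c p u k l + loc_fun a c q u k l"
proof -
  obtain n v w where "p = fr n v" "q = fr n w" by (rule fr_common)
  then show ?thesis by (simp add: add_fr loc_fun_fr distrib_right hw_fun_simps(1))
qed

lemma loc_fun_add_right: "loc_fun a c p (u + v) k l = loc_fun a c p u k l + loc_fun a c p v k l"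
proof -
  obtain n w where "p = fr n w" by (rule fr_cases)
  then show ?thesis by (simp add: loc_fun_fr distrib_left hw_fun_simps(1))
qed

lemma loc_fun_range: "p \<in> range loc \<Longrightarrow> k \<ge> 0 \<Longrightarrow> l \<ge> 0 \<Longrightarrow> loc_fun a c p u k l = 0"
  by (auto simp: loc_def loc_fun_fr hw_fun_nonneg)

lemma fr_loc: "fr n v * loc r = fr n (v * r)"
  by (metis fr_eq_quotient(2) loc_mult mult.assoc)

lemma loc_fun_rmult: "loc_fun a c (p * loc r) u = loc_fun a c p (r * u)"
proof -
  obtain n v where "p = fr n v" by (rule fr_cases)
  then show ?thesis by (simp add: fr_loc loc_fun_fr fun_eq_iff mult.assoc)
qed

lemma loc_fun_lmult: "loc_fun a c (loc r * p) u = actI (- a - 2) c r (loc_fun a c p u)"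
proof -
  obtain n v where p: "p = fr n v" by (rule fr_cases)
  obtain i r' where r': "uf ^ i * r = r' * uf ^ n" using ore_left by blast
  define H where "H = loc_fun a c p u"
  have H: "actI (- a - 2) c (uf ^ n) H = hw_fun a c (v * u)"
    by (simp add: fun_eq_iff actI_f_pow H_def p loc_fun_fr)
  have "loc r * p = fr i (r' * v)" unfolding p loc_def using mult_fr[OF r', of 0 v] by simp
  then have 1: "loc_fun a c (loc r * p) u k l = hw_fun a c (r' * (v * u)) (k - int i) l" for k l
    by (simp add: loc_fun_fr mult.assoc)
  have "hw_fun a c (r' * (v * u)) = actI (- a - 2) c (uf ^ i) (actI (- a - 2) c r H)"
    unfolding hw_fun_simps(2)[of a c r'] H[symmetric] actI_simps(2)[symmetric] r' ..
  then show ?thesis by (simp add: 1 fun_eq_iff actI_f_pow H_def)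
qed

lemma loc_fun_hw_ideal:
  assumes "c \<noteq> 0" "u - v \<in> hw_ideal a c" "l \<ge> 0"
  shows "loc_fun a c p u k l = loc_fun a c p v k l"
proof -
  obtain n w where p: "p = fr n w" by (rule fr_cases)
  have "w * (u - v) \<in> hw_ker a c"
    using hw_ideal_hw_ker[OF assms(1)] assms(2) left_idealD(3)[OF hw_ker_left_ideal] by blast
  then have "loc_fun a c p (u - v) k l = 0" using assms(3) by (simp add: p loc_fun_fr hw_ker_def agree_def)
  then show ?thesis using loc_fun_add_right[of a c p "u - v" v k l] by simp
qed

text \<open>Restriction to the quadrant kills the functions coming from U
  (\<open>loc_fun_range\<close>), so this depends on the class in the quotient bimodule
  only.\<close>

definition sf_fun :: "complex \<Rightarrow> complex \<Rightarrow> sf \<Rightarrow> l4 uea \<Rightarrow> nat \<Rightarrow> nat \<Rightarrow> complex" where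
  "sf_fun a c s u = restr (loc_fun a c (SOME p. s = abs_sf p) u)"

lemma sf_fun_abs: "sf_fun a c (abs_sf p) u = restr (loc_fun a c p u)"
proof -
  define p' where "p' = (SOME p'. abs_sf p = abs_sf p')"
  have "abs_sf p = abs_sf p'" unfolding p'_def by (rule someI[of _ p]) simp
  then have "p' - p \<in> range loc" using sf.abs_eq_iff[of p' p] by simp
  then have "loc_fun a c (p' - p) u (int k) (int l) = 0" for k l by (simp add: loc_fun_range)
  then have "loc_fun a c p' u (int k) (int l) = loc_fun a c p u (int k) (int l)" for k l
    using loc_fun_add[of a c "p' - p" p u "int k" "int l"] by simp
  then show ?thesis by (simp add: sf_fun_def p'_def restr_def fun_eq_iff)
qed

lemma sf_fun_simps:
  "sf_fun a c (s + t) u k l = sf_fun a c s u k l + sf_fun a c t u k l"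
  "sf_fun a c s (u + v) k l = sf_fun a c s u k l + sf_fun a c s v k l"
  "sf_fun a c (sf_rmult s r) u = sf_fun a c s (r * u)"
  "sf_fun a c (sf_lmult r s) u = act (- a - 2) c r (sf_fun a c s u)"
proof -
  obtain p where p: "s = abs_sf p" using sf_repr by blast
  obtain q where q: "t = abs_sf q" using sf_repr by blast
  show "sf_fun a c (s + t) u k l = sf_fun a c s u k l + sf_fun a c t u k l"
    "sf_fun a c s (u + v) k l = sf_fun a c s u k l + sf_fun a c s v k l"
    "sf_fun a c (sf_rmult s r) u = sf_fun a c s (r * u)"
    "sf_fun a c (sf_lmult r s) u = act (- a - 2) c r (sf_fun a c s u)"
    unfolding p q sf_mult_abs sf_fun_abs loc_fun_rmult loc_fun_lmult act_restr
    by (simp_all add: restr_def loc_fun_add loc_fun_add_right)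
qed

section \<open>The completion of a simple highest weight module\<close>

definition hw_gen where "hw_gen a c = (SOME w. cyc (simple_hw a c) w (hw_ideal a c))"

lemma hw_gen_cyc: "cyc (simple_hw a c) (hw_gen a c) (hw_ideal a c)"
  unfolding hw_gen_def by (rule someI_ex[OF simple_hw_cyc])

lemma Sf_simps [simp]:
  "carrier Sf_bimodule = UNIV" "\<zero>\<^bsub>Sf_bimodule\<^esub> = 0" "x \<oplus>\<^bsub>Sf_bimodule\<^esub> y = x + y"
  "u \<odot>\<^bsub>Sf_bimodule\<^esub> x = sf_lmult u x" "rsmult Sf_bimodule x u = sf_rmult x u"
  by (simp_all add: Sf_bimodule_def)

locale completion =
  fixes a c :: complex
begin

abbreviation "L \<equiv> simple_hw a c"
abbreviation "T \<equiv> tensor Sf_bimodule L"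
abbreviation "I \<equiv> hw_ideal a c"
abbreviation "act_L u \<equiv> u \<odot>\<^bsub>L\<^esub> hw_gen a c"

text \<open>The tensor of the inverse n-th power of \<open>f\<close> with u times the highest weight
  vector. By \<open>T_induct\<close> these generate the tensor product additively.\<close>

definition tau where "tau n u = bimodule.pure Sf_bimodule L (abs_sf (fr n 1)) (act_L u)"

sublocale B: bimodule Sf_bimodule by (rule bimodule_Sf)
sublocale L: lmodule L by (rule cycD(1)[OF hw_gen_cyc])
sublocale T: lmodule T by (rule B.tensor_lmodule)

lemma I: "left_ideal I" by (rule verma.max_ideal)

lemma act_L: "act_L u \<in> carrier L"
  by (rule L.smult_closed[OF cycD(2)[OF hw_gen_cyc]])

lemma act_L_eq: "u - v \<in> I \<Longrightarrow> act_L u = act_L v"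
  using L.smult_eq_ann[OF cycD(2)[OF hw_gen_cyc]] cycD(4)[OF hw_gen_cyc] by simp

lemma act_L_eq_iff: "act_L u = act_L v \<longleftrightarrow> u - v \<in> I"
  using L.smult_eq_ann[OF cycD(2)[OF hw_gen_cyc]] cycD(4)[OF hw_gen_cyc] by simp

lemma act_L_mult: "act_L (u * v) = u \<odot>\<^bsub>L\<^esub> act_L v"
  by (rule L.smult_mult[OF cycD(2)[OF hw_gen_cyc]])

lemma act_L_add: "act_L (u + v) = act_L u \<oplus>\<^bsub>L\<^esub> act_L v"
  by (rule L.smult_add_left[OF cycD(2)[OF hw_gen_cyc]])

lemma L_cases: "y \<in> carrier L \<Longrightarrow> \<exists>u. y = act_L u"
  by (rule cycD(3)[OF hw_gen_cyc])

lemma tau_carrier: "tau n u \<in> carrier T"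
  unfolding tau_def by (rule B.pure_carrier) (simp_all add: act_L)

lemma tau_cong: "u - v \<in> I \<Longrightarrow> tau n u = tau n v"
  unfolding tau_def by (simp add: act_L_eq)

lemma tau_add: "tau n (u + v) = tau n u \<oplus>\<^bsub>T\<^esub> tau n v"
  unfolding tau_def act_L_add by (rule B.pure_add_right) (simp_all add: act_L)

lemma pure_fr: "B.pure L (abs_sf (fr n v)) (act_L u) = tau n (v * u)"
proof -
  have "abs_sf (fr n v) = rsmult Sf_bimodule (abs_sf (fr n 1)) v"
    by (simp add: sf_mult_abs fr_eq_quotient)
  then show ?thesis
    using B.pure_balanced[of "abs_sf (fr n 1)" "act_L u" L v] act_L by (simp add: tau_def act_L_mult)
qed

lemma tau_smult: "uf ^ k * r = r' * uf ^ n \<Longrightarrow> r \<odot>\<^bsub>T\<^esub> tau n u = tau k (r' * u)"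
proof -
  assume r: "uf ^ k * r = r' * uf ^ n"
  have "loc r * fr n 1 = fr k r'" unfolding loc_def using mult_fr[OF r, of 0 1] by simp
  moreover have "r \<odot>\<^bsub>T\<^esub> tau n u = B.pure L (abs_sf (loc r * fr n 1)) (act_L u)"
    unfolding tau_def B.pure_smult by (simp only: Sf_simps sf_mult_abs)
  ultimately show ?thesis using pure_fr[of k r' u] by (simp only:)
qed

lemma tau_0: "tau 0 u = \<zero>\<^bsub>T\<^esub>"
proof -
  have "abs_sf (fr 0 1) = abs_sf 0" unfolding sf.abs_eq_iff loc_def[symmetric] by simp
  then have "abs_sf (fr 0 1) = \<zero>\<^bsub>Sf_bimodule\<^esub>" by (simp add: zero_sf.abs_eq)
  then show ?thesis unfolding tau_def using B.pure_zero_left[OF act_L] by simp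
qed

lemma tau_ideal: "u \<in> I \<Longrightarrow> tau n u = \<zero>\<^bsub>T\<^esub>"
proof -
  assume "u \<in> I"
  then have "tau n (u + u) = tau n u" by (intro tau_cong) simp
  then show ?thesis unfolding tau_add by (rule T.idem_zero[OF tau_carrier])
qed

lemma tau_scal: "scal b \<odot>\<^bsub>T\<^esub> tau n u = tau n (scal b * u)"
  by (rule tau_smult[of n "scal b" "scal b" n u]) (rule scal.scalar_central[symmetric])

lemma tau_f_pow: "uf ^ n \<odot>\<^bsub>T\<^esub> tau n u = \<zero>\<^bsub>T\<^esub>"
  using tau_smult[of 0 "uf ^ n" 1 n u] by (simp add: tau_0)

lemma tau_h: "uh \<odot>\<^bsub>T\<^esub> tau n u = tau n ((uh + scal (2 * of_nat n)) * u)"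
proof (rule tau_smult)
  have "(uh + scal (2 * of_nat n)) * uf ^ n = uf ^ n * uh"
    by (simp add: distrib_right right_diff_distrib comm_h_f_pow scal_commutes)
  then show "uf ^ n * uh = (uh + scal (2 * of_nat n)) * uf ^ n" ..
qed

text \<open>The usual formula for \<open>e\<close> on powers of \<open>f\<close> applied to a vector
  of weight b killed by \<open>e\<close>, continued to negative exponents.\<close>

lemma tau_e:
  assumes e: "ue * u \<in> I" and h: "uh * u - scal b * u \<in> I"
  shows "ue \<odot>\<^bsub>T\<^esub> tau n u = scal (- of_nat n * (b + of_nat n + 1)) \<odot>\<^bsub>T\<^esub> tau (Suc n) u"
proof -
  define N :: complex where "N = of_nat n"
  define r where "r = ue * uf - scal (N + 1) * (uh + scal N)"
  have N2: "scal (2 * N) = scal N + scal N" by (simp only: mult_2 scal.scalar_add)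
  have "(uh + scal N) * uf ^ n = uf ^ n * (uh - scal (2 * N)) + uf ^ n * scal N"
    by (simp only: distrib_right comm_h_f_pow N_def scal.scalar_central)
  also have "\<dots> = uf ^ n * (uh - scal N)" unfolding N2 by (simp flip: distrib_left)
  finally have "scal (N + 1) * ((uh + scal N) * uf ^ n) = scal (N + 1) * (uf ^ n * (uh - scal N))" by simp
  moreover have "uf ^ Suc n * ue = ue * (uf * uf ^ n) - scal (N + 1) * (uf ^ n * (uh - scal N))"
    using comm_e_f_pow[of n] by (simp add: N_def mult.assoc add.commute)
  ultimately have "uf ^ Suc n * ue = r * uf ^ n"
    by (simp add: r_def left_diff_distrib mult.assoc)
  then have "ue \<odot>\<^bsub>T\<^esub> tau n u = tau (Suc n) (r * u)" by (rule tau_smult)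
  also have "\<dots> = tau (Suc n) (scal (- N * (b + N + 1)) * u)"
  proof (rule tau_cong)
    have r: "r = uf * ue - scal N * uh - scal ((N + 1) * N)"
      by (simp add: r_def comm_ef scal.scalar_add scal.scalar_mult scal.scalar_one algebra_simps)
    have "- N * (b + N + 1) = - (N * b) - (N + 1) * N" by (simp add: algebra_simps)
    then have s: "scal (- N * (b + N + 1)) = - scal (N * b) - scal ((N + 1) * N)"
      by (simp only: scal_diff scal_uminus)
    have "r * u - scal (- N * (b + N + 1)) * u = uf * (ue * u) - scal N * (uh * u - scal b * u)"
      unfolding r s unfolding left_diff_distrib right_diff_distrib mult_minus_left mult.assoc scal_scal by simp
    then show "r * u - scal (- N * (b + N + 1)) * u \<in> I"
      using left_idealD(5)[OF I left_idealD(3)[OF I e] left_idealD(3)[OF I h]] by simp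
  qed
  also have "\<dots> = scal (- N * (b + N + 1)) \<odot>\<^bsub>T\<^esub> tau (Suc n) u" by (rule tau_scal[symmetric])
  finally show ?thesis by (simp add: N_def)
qed

lemma tau_e_pow:
  assumes "ue * u \<in> I" "uh * u - scal b * u \<in> I"
  shows "ue ^ i \<odot>\<^bsub>T\<^esub> tau 1 u =
    scal (\<Prod>j<i. - of_nat (Suc j) * (b + of_nat (Suc j) + 1)) \<odot>\<^bsub>T\<^esub> tau (Suc i) u"
proof (induction i)
  case 0
  then show ?case by (simp add: scal.scalar_one)
next
  case (Suc i)
  define p where "p = (\<Prod>j<i. - of_nat (Suc j) * (b + of_nat (Suc j) + 1))"
  define q where "q = - of_nat (Suc i) * (b + of_nat (Suc i) + 1)"
  have "ue ^ Suc i \<odot>\<^bsub>T\<^esub> tau 1 u = ue \<odot>\<^bsub>T\<^esub> (scal p \<odot>\<^bsub>T\<^esub> tau (Suc i) u)"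
    unfolding p_def Suc.IH[symmetric] by (simp add: T.smult_mult[OF tau_carrier])
  also have "\<dots> = scal p \<odot>\<^bsub>T\<^esub> (ue \<odot>\<^bsub>T\<^esub> tau (Suc i) u)"
    by (simp add: scal_commutes flip: T.smult_mult[OF tau_carrier])
  also have "\<dots> = scal p \<odot>\<^bsub>T\<^esub> (scal q \<odot>\<^bsub>T\<^esub> tau (Suc (Suc i)) u)" unfolding q_def tau_e[OF assms] ..
  also have "\<dots> = scal (p * q) \<odot>\<^bsub>T\<^esub> tau (Suc (Suc i)) u"
    by (simp add: scal.scalar_mult T.smult_mult[OF tau_carrier])
  finally show ?case by (simp add: p_def q_def)
qed

lemma tau_e_pow_zero:
  assumes "ue * u \<in> I" "uh * u + scal (of_nat (m + 2)) * u \<in> I"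
  shows "ue ^ Suc m \<odot>\<^bsub>T\<^esub> tau 1 u = \<zero>\<^bsub>T\<^esub>"
proof -
  have "uh * u - scal (- of_nat (m + 2)) * u \<in> I" using assms(2)
    by (simp only: scal_uminus mult_minus_left diff_minus_eq_add)
  from tau_e_pow[OF assms(1) this, of "Suc m"] show ?thesis
    by (simp add: scal_simps T.smult_0_left tau_carrier)
qed

lemma T_induct [consumes 1, case_names zero tau diff]:
  assumes "X \<in> carrier T" "P \<zero>\<^bsub>T\<^esub>" "\<And>n u. P (tau n u)"
    "\<And>X Y. X \<in> carrier T \<Longrightarrow> Y \<in> carrier T \<Longrightarrow> P X \<Longrightarrow> P Y \<Longrightarrow> P (X \<ominus>\<^bsub>T\<^esub> Y)"
  shows "P X"
  using assms(1)
proof (induction X rule: B.tensor_induct)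
  case (pure s y)
  obtain p where p: "s = abs_sf p" using sf_repr by blast
  obtain n v where "p = fr n v" by (rule fr_cases)
  moreover obtain u where "y = act_L u" using L_cases pure(2) by blast
  ultimately show ?case using p pure_fr assms(3) by simp
qed (use assms in auto)

lemma T_f_nilpotent: "X \<in> carrier T \<Longrightarrow> \<exists>n. uf ^ n \<odot>\<^bsub>T\<^esub> X = \<zero>\<^bsub>T\<^esub>"
proof (induction X rule: T_induct)
  case (diff X Y)
  then obtain n m where "uf ^ n \<odot>\<^bsub>T\<^esub> X = \<zero>\<^bsub>T\<^esub>" "uf ^ m \<odot>\<^bsub>T\<^esub> Y = \<zero>\<^bsub>T\<^esub>" by blast
  then have "uf ^ (m + n) \<odot>\<^bsub>T\<^esub> X = \<zero>\<^bsub>T\<^esub>" "uf ^ (n + m) \<odot>\<^bsub>T\<^esub> Y = \<zero>\<^bsub>T\<^esub>"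
    by (simp_all add: power_add T.smult_mult diff T.smult_0_right)
  then have "uf ^ (n + m) \<odot>\<^bsub>T\<^esub> (X \<ominus>\<^bsub>T\<^esub> Y) = \<zero>\<^bsub>T\<^esub>"
    using diff T.diff_eq_zero[of "\<zero>\<^bsub>T\<^esub>" "\<zero>\<^bsub>T\<^esub>"] by (simp add: T.smult_diff_right add.commute)
  then show ?case by blast
next
  case zero
  show ?case by (rule exI[of _ 0]) (rule T.smult_0_right)
next
  case (tau n u)
  show ?case by (rule exI[of _ n]) (rule tau_f_pow)
qed

lemma pev_zero_add:
  assumes "X \<in> carrier T" "Y \<in> carrier T" "p \<noteq> 0" "q \<noteq> 0" "pev p g \<odot>\<^bsub>T\<^esub> X = \<zero>\<^bsub>T\<^esub>" "pev q g \<odot>\<^bsub>T\<^esub> Y = \<zero>\<^bsub>T\<^esub>"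
  shows "p * q \<noteq> 0" "pev (p * q) g \<odot>\<^bsub>T\<^esub> X = \<zero>\<^bsub>T\<^esub>" "pev (p * q) g \<odot>\<^bsub>T\<^esub> Y = \<zero>\<^bsub>T\<^esub>"
proof -
  show "p * q \<noteq> 0" using assms by simp
  have "pev (q * p) g \<odot>\<^bsub>T\<^esub> X = \<zero>\<^bsub>T\<^esub>" by (simp add: pev_mult T.smult_mult assms T.smult_0_right)
  then show "pev (p * q) g \<odot>\<^bsub>T\<^esub> X = \<zero>\<^bsub>T\<^esub>" by (simp add: mult.commute)
  show "pev (p * q) g \<odot>\<^bsub>T\<^esub> Y = \<zero>\<^bsub>T\<^esub>" by (simp add: pev_mult T.smult_mult assms T.smult_0_right)
qed

lemma tau_h_algebraic: "\<exists>p. p \<noteq> 0 \<and> pev p uh \<odot>\<^bsub>T\<^esub> tau n u = \<zero>\<^bsub>T\<^esub>"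
proof -
  have "u \<in> wspan I" by (rule wspan_all[OF I hw_ideal_mem(2)])
  then show ?thesis
  proof (induction rule: wspan.induct)
    case (wspan_weight u b)
    have "uh \<odot>\<^bsub>T\<^esub> tau n u = scal (b + 2 * of_nat n) \<odot>\<^bsub>T\<^esub> tau n u"
      unfolding tau_h tau_scal
      by (rule tau_cong) (use wspan_weight in \<open>simp add: distrib_right scal.scalar_add\<close>)
    then have "(uh - scal (b + 2 * of_nat n)) \<odot>\<^bsub>T\<^esub> tau n u = \<zero>\<^bsub>T\<^esub>"
      using T.smult_eq_iff[OF tau_carrier] by blast
    then show ?case unfolding pev_linear[symmetric] by (intro exI[of _ "[:- (b + 2 * of_nat n), 1:]"]) simp
  next
    case (wspan_add u v)
    then obtain p q where pq: "p \<noteq> 0" "q \<noteq> 0" "pev p uh \<odot>\<^bsub>T\<^esub> tau n u = \<zero>\<^bsub>T\<^esub>" "pev q uh \<odot>\<^bsub>T\<^esub> tau n v = \<zero>\<^bsub>T\<^esub>"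
      by blast
    note z = pev_zero_add[OF tau_carrier tau_carrier pq]
    have "pev (p * q) uh \<odot>\<^bsub>T\<^esub> tau n (u + v) = \<zero>\<^bsub>T\<^esub>"
      unfolding tau_add by (simp add: T.smult_add_right tau_carrier z)
    then show ?case using z(1) by blast
  qed
qed

lemma T_h_algebraic: "X \<in> carrier T \<Longrightarrow> \<exists>p. p \<noteq> 0 \<and> pev p uh \<odot>\<^bsub>T\<^esub> X = \<zero>\<^bsub>T\<^esub>"
proof (induction X rule: T_induct)
  case zero
  then show ?case by (intro exI[of _ 1]) (simp add: T.smult_0_right)
next
  case (tau n u)
  then show ?case by (rule tau_h_algebraic)
next
  case (diff X Y)
  then obtain p q where pq: "p \<noteq> 0" "q \<noteq> 0" "pev p uh \<odot>\<^bsub>T\<^esub> X = \<zero>\<^bsub>T\<^esub>" "pev q uh \<odot>\<^bsub>T\<^esub> Y = \<zero>\<^bsub>T\<^esub>" by blast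
  note z = pev_zero_add[OF diff(1,2) pq]
  have "pev (p * q) uh \<odot>\<^bsub>T\<^esub> (X \<ominus>\<^bsub>T\<^esub> Y) = \<zero>\<^bsub>T\<^esub>"
    using T.diff_eq_zero[of "\<zero>\<^bsub>T\<^esub>" "\<zero>\<^bsub>T\<^esub>"] by (simp add: T.smult_diff_right diff z)
  then show ?case using z(1) by blast
qed

lemma T_central:
  assumes z: "\<And>u. z * u = u * z" "z - scal b \<in> I" and X: "X \<in> carrier T"
  shows "z \<odot>\<^bsub>T\<^esub> X = scal b \<odot>\<^bsub>T\<^esub> X"
  using X
proof (induction X rule: T_induct)
  case zero
  then show ?case by (simp add: T.smult_0_right)
next
  case (tau n u)
  have "z \<odot>\<^bsub>T\<^esub> tau n u = tau n (z * u)" by (rule tau_smult) (rule z(1)[symmetric])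
  also have "\<dots> = tau n (scal b * u)"
  proof (rule tau_cong)
    have "z * u - scal b * u = u * (z - scal b)" by (simp add: z(1) right_diff_distrib scal.scalar_central)
    then show "z * u - scal b * u \<in> I" using left_idealD(3)[OF I z(2)] by simp
  qed
  finally show ?case unfolding tau_scal .
next
  case (diff X Y)
  then show ?case by (simp add: T.smult_diff_right)
qed

lemma I_C2: "C2 - scal (c ^ 2) \<in> I"
proof -
  have "C2 - scal (c ^ 2) = (uv V0 + scal c) * (uv V0 - scal c) + (- (3 * uv Vm2)) * uv V2 + (12 * uv Vm4) * uv V4"
    by (simp add: C2_def power2_eq_square scal.scalar_mult algebra_simps scal_commutes)
  also have "\<dots> \<in> I" by (intro left_idealD(2)[OF I] left_idealD(3)[OF I] hw_ideal_mem)
  finally show ?thesis .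
qed

lemma I_C3: "C3 - scal (c ^ 3) \<in> I"
proof -
  have "C3 - scal (c ^ 3) = (uv V0 * uv V0 + scal c * uv V0 + scal (c * c)) * (uv V0 - scal c)
      + (- (scal (9/2) * uv Vm2 * uv V0)) * uv V2 + (scal (27/2) * uv Vm2 ^ 2) * uv V4
      + (scal (27/2) * uv Vm4 * uv V2) * uv V2 + (- (36 * uv Vm4 * uv V0)) * uv V4"
    by (simp add: C3_def power2_eq_square power3_eq_cube scal.scalar_mult algebra_simps scal_commutes)
  also have "\<dots> \<in> I" by (intro left_idealD(2)[OF I] left_idealD(3)[OF I] hw_ideal_mem)
  finally show ?thesis .
qed

lemma T_C2: "X \<in> carrier T \<Longrightarrow> C2 \<odot>\<^bsub>T\<^esub> X = scal (c ^ 2) \<odot>\<^bsub>T\<^esub> X"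
  by (rule T_central[OF C2_central[symmetric] I_C2])

lemma T_C3: "X \<in> carrier T \<Longrightarrow> C3 \<odot>\<^bsub>T\<^esub> X = scal (c ^ 3) \<odot>\<^bsub>T\<^esub> X"
  by (rule T_central[OF C3_central[symmetric] I_C3])

text \<open>An induction that keeps the element produced by the Ore condition inside
  \<open>R\<close>: commuting \<open>f\<close> past v brings in the next lower weight vector w of
  the radical, for which this is known.\<close>

lemma rad_ore_step:
  assumes R: "left_ideal R" and w: "\<And>n. \<exists>r\<in>R. uf ^ (n + d) * w = r * uf ^ n"
    and v: "uf * v = v * uf + scal s * w" "v \<in> R"
  shows "\<exists>r\<in>R. uf ^ (n + Suc d) * v = r * uf ^ n"
proof (induction n)
  case 0
  show ?case using left_idealD(3)[OF R v(2)] by simp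
next
  case (Suc n)
  then obtain r where r: "r \<in> R" "uf ^ (n + Suc d) * v = r * uf ^ n" by blast
  obtain r' where r': "r' \<in> R" "uf ^ (Suc n + d) * w = r' * uf ^ Suc n" using w by blast
  have "uf ^ (Suc n + Suc d) * v = uf ^ (n + Suc d) * (uf * v)"
    by (simp only: add_Suc power_Suc2 mult.assoc)
  also have "\<dots> = (uf ^ (n + Suc d) * v) * uf + scal s * (uf ^ (Suc n + d) * w)"
    unfolding v(1) distrib_left scal_commutes by (simp add: mult.assoc)
  also have "\<dots> = (r + scal s * r') * uf ^ Suc n"
    unfolding r(2) r'(2) by (simp only: distrib_right mult.assoc power_Suc2)
  finally show ?case using left_idealD(2)[OF R r(1) left_idealD(3)[OF R r'(1)]] by blast
qed

text \<open>The radical acts by zero on the highest weight module by \<open>hw_ideal_rad\<close>.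
  That this survives localization is followed through the weights of the radical, upwards from
  \<open>Vm4\<close>.\<close>

lemma T_rad_trivial:
  assumes c: "c = 0" and X: "X \<in> carrier T"
  shows "gen (Lr v) \<odot>\<^bsub>T\<^esub> X = \<zero>\<^bsub>T\<^esub>"
proof -
  define R where "R = {r. \<forall>u. r * u \<in> I}"
  have R: "left_ideal R"
    using I by (auto simp: R_def left_ideal_def distrib_right mult.assoc)
  have Rv: "uv v \<in> R" for v using hw_ideal_rad c by (simp add: R_def)
  have 0: "\<exists>r\<in>R. uf ^ (n + 0) * uv Vm4 = r * uf ^ n" for n
    by (rule bexI[OF _ Rv[of Vm4]], induction n) (simp_all add: mult.assoc comm_fv(5), metis comm_fv(5) mult.assoc)
  have 1: "\<exists>r\<in>R. uf ^ (n + Suc 0) * uv Vm2 = r * uf ^ n" for n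
    by (rule rad_ore_step[OF R 0 _ Rv, of _ 4]) (simp add: comm_fv scal_numeral)
  have 2: "\<exists>r\<in>R. uf ^ (n + Suc (Suc 0)) * uv V0 = r * uf ^ n" for n
    by (rule rad_ore_step[OF R 1 _ Rv, of _ 3]) (simp add: comm_fv scal_numeral)
  have 3: "\<exists>r\<in>R. uf ^ (n + Suc (Suc (Suc 0))) * uv V2 = r * uf ^ n" for n
    by (rule rad_ore_step[OF R 2 _ Rv, of _ 2]) (simp add: comm_fv scal_numeral)
  have 4: "\<exists>r\<in>R. uf ^ (n + Suc (Suc (Suc (Suc 0)))) * uv V4 = r * uf ^ n" for n
    by (rule rad_ore_step[OF R 3 _ Rv, of _ 1]) (simp add: comm_fv scal.scalar_one)
  have ore: "\<exists>k. \<exists>r\<in>R. uf ^ k * uv v = r * uf ^ n" for n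
    using 0[of n] 1[of n] 2[of n] 3[of n] 4[of n] by (cases v) blast+
  show ?thesis
    using X
  proof (induction X rule: T_induct)
    case (tau n u)
    obtain k r where r: "r \<in> R" "uf ^ k * uv v = r * uf ^ n" using ore by blast
    have "uv v \<odot>\<^bsub>T\<^esub> tau n u = tau k (r * u)" by (rule tau_smult[OF r(2)])
    also have "\<dots> = \<zero>\<^bsub>T\<^esub>" using r(1) by (intro tau_ideal) (simp add: R_def)
    finally show ?case .
  next
    case (diff X Y)
    then show ?case using T.diff_eq_zero[of "\<zero>\<^bsub>T\<^esub>" "\<zero>\<^bsub>T\<^esub>"] by (simp add: T.smult_diff_right)
  qed (simp add: T.smult_0_right)
qed

section \<open>Elements and subquotients of the completion\<close>

lemma EA_eq: "EA L = lsub T {X \<in> carrier T. finite_cdim T (cspan T (range (\<lambda>k. ue ^ k \<odot>\<^bsub>T\<^esub> X)))}"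
  by (simp add: EA_def Let_def)

lemma EA_carrierI:
  assumes X: "X \<in> carrier T" and e: "ue ^ K \<odot>\<^bsub>T\<^esub> X = \<zero>\<^bsub>T\<^esub>"
  shows "X \<in> carrier (EA L)"
proof -
  interpret umodule T using T.lmodule_axioms by (simp add: umodule_def)
  have "ue ^ k \<odot>\<^bsub>T\<^esub> X \<in> (\<lambda>k. ue ^ k \<odot>\<^bsub>T\<^esub> X) ` {..K}" for k
  proof (cases "k \<le> K")
    case False
    have "ue ^ k = ue ^ (k - K) * ue ^ K" using False by (simp flip: power_add)
    then have "ue ^ k \<odot>\<^bsub>T\<^esub> X = ue ^ K \<odot>\<^bsub>T\<^esub> X" using e by (simp add: T.smult_mult[OF X] T.smult_0_right)
    then show ?thesis by auto
  qed auto
  then have "range (\<lambda>k. ue ^ k \<odot>\<^bsub>T\<^esub> X) \<subseteq> (\<lambda>k. ue ^ k \<odot>\<^bsub>T\<^esub> X) ` {..K}" by blast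
  then have "finite (range (\<lambda>k. ue ^ k \<odot>\<^bsub>T\<^esub> X))" by (rule finite_subset) simp
  then have "finite_cdim T (cspan T (range (\<lambda>k. ue ^ k \<odot>\<^bsub>T\<^esub> X)))"
    by (rule finite_cdim_span) (use T.smult_closed[OF X] in auto)
  then show ?thesis unfolding EA_eq using X by simp
qed

lemma EA_carrierD: "X \<in> carrier (EA L) \<Longrightarrow> X \<in> carrier T"
  by (simp add: EA_eq)

lemma EA_algebraic:
  assumes "X \<in> carrier (EA L)"
  shows "\<exists>p. p \<noteq> 0 \<and> pev p (gen (Lg g)) \<odot>\<^bsub>T\<^esub> X = \<zero>\<^bsub>T\<^esub>"
proof (cases g)
  case sl2_e
  interpret umodule T using T.lmodule_axioms by (simp add: umodule_def)
  have X: "X \<in> carrier T" "finite_cdim T (cspan T (range (\<lambda>k. ue ^ k \<odot>\<^bsub>T\<^esub> X)))"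
    using assms by (simp_all add: EA_eq)
  obtain Y where Y: "finite Y" "Y \<subseteq> carrier T" "cspan T Y = cspan T (range (\<lambda>k. ue ^ k \<odot>\<^bsub>T\<^esub> X))"
    using X(2) by (auto simp: finite_cdim_def has_cdim_def)
  have "ue ^ k \<odot>\<^bsub>T\<^esub> X \<in> cspan T Y" for k
    unfolding Y(3) by (rule mem_cspan) (use T.smult_closed[OF X(1)] in auto)
  then show ?thesis unfolding sl2_e by (rule span_polynomial[OF Y(1,2) X(1)])
next
  case sl2_h
  then show ?thesis using T_h_algebraic[OF EA_carrierD[OF assms]] by simp
next
  case sl2_f
  obtain n where n: "uf ^ n \<odot>\<^bsub>T\<^esub> X = \<zero>\<^bsub>T\<^esub>" using T_f_nilpotent[OF EA_carrierD[OF assms]] by blast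
  have "pev (monom 1 n) uf = uf ^ n" by (induction n) (simp_all add: monom_Suc scal_simps monom_0)
  then show ?thesis unfolding sl2_f using n by (intro exI[of _ "monom 1 n"]) simp
qed

text \<open>By \<open>nilpotent_all\<close> a power of \<open>e\<close> kills every element
  generated by X, so the submodule of X lies in the completion. Its quotient by the multiples of X
  with coefficients in \<open>J\<close> is cyclic with annihilator \<open>J\<close>.\<close>

lemma cyclic_subquotient:
  assumes X: "X \<in> carrier T" and e: "ue ^ n \<odot>\<^bsub>T\<^esub> X = \<zero>\<^bsub>T\<^esub>"
    and J: "left_ideal J" "\<And>u. u \<odot>\<^bsub>T\<^esub> X = \<zero>\<^bsub>T\<^esub> \<Longrightarrow> u \<in> J"
  shows "\<exists>N K x. lsubmodule N (EA L) \<and> lsubmodule K (lsub (EA L) N) \<and> cyc (lquot (lsub (EA L) N) K) x J"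
proof -
  define N where "N = {u \<odot>\<^bsub>T\<^esub> X | u. True}"
  define K where "K = {u \<odot>\<^bsub>T\<^esub> X | u. u \<in> J}"
  have NT: "lsubmodule N T" unfolding N_def by (rule T.cyclic_submodule[OF X])
  have KN: "K \<subseteq> N" by (auto simp: K_def N_def)
  have KT: "lsubmodule K T"
    unfolding lsubmodule_def
  proof (intro conjI ballI allI)
    show "K \<subseteq> carrier T" using KN NT by (auto simp: lsubmodule_def)
    show "\<zero>\<^bsub>T\<^esub> \<in> K" unfolding K_def using T.smult_0_left[OF X] left_idealD(1)[OF J(1)] by (intro CollectI exI[of _ 0]) simp
    fix x y assume "x \<in> K" "y \<in> K"
    then obtain u v where "x = u \<odot>\<^bsub>T\<^esub> X" "u \<in> J" "y = v \<odot>\<^bsub>T\<^esub> X" "v \<in> J" by (auto simp: K_def)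
    then show "x \<oplus>\<^bsub>T\<^esub> y \<in> K"
      unfolding K_def using T.smult_add_left[OF X] left_idealD(2)[OF J(1)] by (intro CollectI exI[of _ "u + v"]) simp
  next
    fix r x assume "x \<in> K"
    then obtain u where "x = u \<odot>\<^bsub>T\<^esub> X" "u \<in> J" by (auto simp: K_def)
    then show "r \<odot>\<^bsub>T\<^esub> x \<in> K"
      unfolding K_def using T.smult_mult[OF X] left_idealD(3)[OF J(1)] by (intro CollectI exI[of _ "r * u"]) simp
  qed
  have NE: "N \<subseteq> carrier (EA L)"
  proof
    fix y assume "y \<in> N"
    then obtain u where y: "y = u \<odot>\<^bsub>T\<^esub> X" by (auto simp: N_def)
    have "ue ^ n \<in> T.ann X" using e by (simp add: T.ann_def)
    then obtain k where "ue ^ k * u \<in> T.ann X"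
      by (rule nilpotent_all[OF T.ann_left_ideal[OF X], of ue n u, OF disjI1[OF refl]])
    then have "ue ^ k \<odot>\<^bsub>T\<^esub> y = \<zero>\<^bsub>T\<^esub>" by (simp add: y T.ann_def T.smult_mult[OF X])
    then show "y \<in> carrier (EA L)" using NT \<open>y \<in> N\<close> by (intro EA_carrierI) (auto simp: lsubmodule_def)
  qed
  have NEA: "lsubmodule N (EA L)" using NT NE unfolding EA_eq by (auto simp: lsubmodule_def)
  have eq: "lsub (EA L) N = lsub T N" by (simp add: EA_eq)
  have KEA: "lsubmodule K (lsub (EA L) N)" unfolding eq lsubmodule_trans[OF NT] using KT KN by simp
  interpret Q: lquotient "lsub T N" K
    unfolding lquotient_def lquotient_axioms_def
    using lsubmodule_lmodule[OF T.lmodule_axioms NT] KEA eq by simp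
  have XN: "X \<in> N" unfolding N_def using T.smult_one[OF X] by (intro CollectI exI[of _ 1]) simp
  have "cyc (lquot (lsub T N) K) (K +>\<^bsub>lsub T N\<^esub> X) {u. u \<odot>\<^bsub>lsub T N\<^esub> X \<in> K}"
    by (rule Q.lquot_cyc) (use XN in \<open>auto simp: N_def\<close>)
  moreover have "{u. u \<odot>\<^bsub>lsub T N\<^esub> X \<in> K} = J"
  proof (intro Set.set_eqI iffI)
    fix u assume "u \<in> {u. u \<odot>\<^bsub>lsub T N\<^esub> X \<in> K}"
    then obtain v where v: "u \<odot>\<^bsub>T\<^esub> X = v \<odot>\<^bsub>T\<^esub> X" "v \<in> J" by (auto simp: K_def)
    then have "(u - v) \<odot>\<^bsub>T\<^esub> X = \<zero>\<^bsub>T\<^esub>" using T.smult_eq_iff[OF X] by blast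
    then have "u - v \<in> J" by (rule J(2))
    from left_idealD(2)[OF J(1) this v(2)] show "u \<in> J" by simp
  qed (auto simp: K_def)
  ultimately have "cyc (lquot (lsub (EA L) N) K) (K +>\<^bsub>lsub T N\<^esub> X) J" unfolding eq by (simp only:)
  then show ?thesis using NEA KEA by blast
qed

text \<open>The tensor product maps to functions on the quadrant through \<open>sf_fun\<close>. This
  is well defined on the simple module because \<open>hw_ideal\<close> lies in \<open>hw_ker\<close>
  for c nonzero, and the inverse of \<open>f\<close> becomes the shift by one in k.\<close>

lemma tau_eval:
  assumes c: "c \<noteq> 0" and u: "u \<odot>\<^bsub>T\<^esub> tau 1 v = \<zero>\<^bsub>T\<^esub>"
  shows "act (- a - 2) c u (\<lambda>k l. hw_fun a c v (int k - 1) (int l)) = (\<lambda>k l. 0)"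
proof -
  define rep where "rep y = (SOME u. y = act_L u)" for y
  have rep: "y = act_L (rep y)" if "y \<in> carrier L" for y
    unfolding rep_def by (rule someI_ex[OF L_cases[OF that]])
  have cong: "sf_fun a c s u k l = sf_fun a c s v k l" if "u - v \<in> I" for s u v k l
    using loc_fun_hw_ideal[OF c that] sf_repr[of s] by (auto simp: sf_fun_abs restr_def)
  have rep_eq: "rep y - v \<in> I" if "y = act_L v" for y v
    using rep[of y] that act_L act_L_eq_iff by metis
  define \<beta> where "\<beta> = (\<lambda>k l (s, y). sf_fun a c s (rep y) k l)"
  have z: "B.pure L (sf_lmult u (abs_sf (fr 1 1))) (act_L v) = \<zero>\<^bsub>T\<^esub>"
    using u unfolding tau_def B.pure_smult by simp
  have "\<beta> k l (sf_lmult u (abs_sf (fr 1 1)), act_L v) = 0" for k l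
  proof (rule B.pure_eq_zero_eval[OF z])
    show "\<beta> k l (s \<oplus>\<^bsub>Sf_bimodule\<^esub> s', y) = \<beta> k l (s, y) + \<beta> k l (s', y)" for s s' y
      by (simp add: \<beta>_def sf_fun_simps)
    show "\<beta> k l (s, y \<oplus>\<^bsub>L\<^esub> y') = \<beta> k l (s, y) + \<beta> k l (s, y')" if "y \<in> carrier L" "y' \<in> carrier L" for s y y'
    proof -
      have "y \<oplus>\<^bsub>L\<^esub> y' = act_L (rep y + rep y')" using rep that unfolding act_L_add by simp
      from cong[OF rep_eq[OF this], of s k l] show ?thesis by (simp add: \<beta>_def sf_fun_simps)
    qed
    show "\<beta> k l (rsmult Sf_bimodule s r, y) = \<beta> k l (s, r \<odot>\<^bsub>L\<^esub> y)" if "y \<in> carrier L" for s y r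
    proof -
      have "r \<odot>\<^bsub>L\<^esub> y = act_L (r * rep y)" using rep that unfolding act_L_mult by simp
      from cong[OF rep_eq[OF this], of s k l] show ?thesis by (simp add: \<beta>_def sf_fun_simps)
    qed
  qed
  then have "sf_fun a c (sf_lmult u (abs_sf (fr 1 1))) v = (\<lambda>k l. 0)"
    using cong[OF rep_eq[OF refl]] by (simp add: \<beta>_def fun_eq_iff)
  moreover have "sf_fun a c (abs_sf (fr 1 1)) v = (\<lambda>k l. hw_fun a c v (int k - 1) (int l))"
    by (simp add: sf_fun_abs restr_def loc_fun_fr fun_eq_iff)
  ultimately show ?thesis by (simp add: sf_fun_simps(4))
qed

end

text \<open>With a = - m - 2 the inverse of \<open>f\<close> on the highest weight vector maps to
  \<open>yv 0\<close>, and the power m + 1 of \<open>e\<close> kills it. For the odd functions a =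
  -2, and the highest weight vector is replaced by v of weight -4, whose shifted function is a
  multiple of s.\<close>

lemma EA_standard:
  assumes z: "z \<noteq> 0" and mj: "m > 0 \<and> j = 0 \<or> m = 0 \<and> j < 2"
  shows "\<exists>a N K. lsubmodule N (EA (simple_hw a z)) \<and> lsubmodule K (lsub (EA (simple_hw a z)) N) \<and>
    standard_cyc (lquot (lsub (EA (simple_hw a z)) N) K) z m j"
proof (cases "j = 0")
  case True
  define a :: complex where "a = - of_nat (m + 2)"
  interpret completion a z .
  have m: "- a - 2 = of_nat m" by (simp add: a_def)
  have "\<exists>N K x. lsubmodule N (EA L) \<and> lsubmodule K (lsub (EA L) N) \<and> cyc (lquot (lsub (EA L) N) K) x (annB (of_nat m) z 0)"
  proof (rule cyclic_subquotient[OF tau_carrier _ annB_left_ideal])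
    show "ue ^ Suc m \<odot>\<^bsub>T\<^esub> tau 1 1 = \<zero>\<^bsub>T\<^esub>"
    proof (rule tau_e_pow_zero)
      show "ue * 1 \<in> I" using hw_ideal_mem(1) by simp
      have "uh - scal a = uh * 1 + scal (of_nat (m + 2)) * 1"
        by (simp only: a_def scal_uminus diff_minus_eq_add mult_1_right)
      then show "uh * 1 + scal (of_nat (m + 2)) * 1 \<in> I" using hw_ideal_mem(2)[of a z] by (simp only:)
    qed
    fix u assume "u \<odot>\<^bsub>T\<^esub> tau 1 1 = \<zero>\<^bsub>T\<^esub>"
    from tau_eval[OF z this] have "act (of_nat m) z u (\<lambda>k l. hw_fun a z 1 (int k - 1) (int l)) = (\<lambda>k l. 0)"
      unfolding m .
    moreover have "(\<lambda>k l. hw_fun a z 1 (int k - 1) (int l)) = yv 0"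
      by (simp add: fun_eq_iff hw_fun_simps hwv_def yv_def)
    ultimately show "u \<in> annB (of_nat m) z 0" by (simp add: annB_def)
  qed
  then show ?thesis unfolding standard_cyc_def using mj True by blast
next
  case False
  then have mj: "m = 0" "j = 1" using mj by auto
  define a :: complex where "a = - 2"
  interpret completion a z .
  have m: "- a - 2 = of_nat m" by (simp add: a_def mj)
  \<comment> \<open>The coefficient of \<open>f\<close> makes \<open>e\<close> kill v modulo the
    ideal: the contributions 2 z of \<open>V0\<close> and -2 z of \<open>h\<close> cancel.\<close>
  define v where "v = uv Vm2 + scal z * uf"
  note I0 = hw_ideal_mem[where a = a and c = z]
  have e: "ue * v = uv Vm2 * ue + 2 * uv V0 + scal z * (uf * ue + uh)"
    by (simp add: v_def distrib_left scal_commutes comm_ef comm_ev)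
  have "ue * v = (uv Vm2 + scal z * uf) * ue + 2 * (uv V0 - scal z) + scal z * (uh - scal a)"
    unfolding e a_def by (simp add: algebra_simps scal_uminus scal_numeral numeral_central scal.scalar_mult)
  also have "\<dots> \<in> I" by (intro left_idealD(2)[OF I] left_idealD(3)[OF I] I0)
  finally have 1: "ue * v \<in> I" .
  have "uh * v = v * uh - 2 * v"
    by (simp add: v_def mult_2 distrib_left distrib_right right_diff_distrib left_diff_distrib scal_commutes
      comm_hf comm_hv mult.assoc algebra_simps)
  moreover have "scal (of_nat (2 + 2)) * v = 2 * v + 2 * v" by (simp add: scal_numeral flip: distrib_right)
  moreover have "v * (uh - scal a) = v * uh + 2 * v"
    by (simp add: a_def scal_uminus scal_numeral distrib_left numeral_central)
  ultimately have "uh * v + scal (of_nat (2 + 2)) * v = v * (uh - scal a)" by simp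
  then have 2: "uh * v + scal (of_nat (2 + 2)) * v \<in> I" using left_idealD(3)[OF I I0(2)] by simp
  have "\<exists>N K x. lsubmodule N (EA L) \<and> lsubmodule K (lsub (EA L) N) \<and> cyc (lquot (lsub (EA L) N) K) x (annB (of_nat m) z 1)"
  proof (rule cyclic_subquotient[OF tau_carrier _ annB_left_ideal])
    show "ue ^ Suc 2 \<odot>\<^bsub>T\<^esub> tau 1 v = \<zero>\<^bsub>T\<^esub>" by (rule tau_e_pow_zero[OF 1 2])
    fix u assume "u \<odot>\<^bsub>T\<^esub> tau 1 v = \<zero>\<^bsub>T\<^esub>"
    from tau_eval[OF z this] have "act (of_nat m) z u (\<lambda>k l. hw_fun a z v (int k - 1) (int l)) = (\<lambda>k l. 0)"
      unfolding m .
    moreover have "(\<lambda>k l. hw_fun a z v (int k - 1) (int l)) = (\<lambda>k l. 2 * z * yv 1 k l)"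
    proof (intro HOL.ext)
      fix k l
      have "hw_fun a z uf (int k - 1) (int l) = 0" using hw_fun_f[of a z 1 "int k - 1" "int l"] by (simp add: hw_fun_simps hwv_def)
      then have "hw_fun a z v (int k - 1) (int l) = hw_fun a z (uv Vm2) (int k - 1) (int l)"
        unfolding v_def hw_fun_simps(1,5) by simp
      also have "\<dots> = 2 * z * yv 1 k l"
        by (auto simp: hw_fun_def actI_simps hwv_def yv_def)
      finally show "hw_fun a z v (int k - 1) (int l) = 2 * z * yv 1 k l" .
    qed
    ultimately show "u \<in> annB (of_nat m) z 1" using z by (simp add: annB_def act_linear fun_eq_iff)
  qed
  then show ?thesis unfolding standard_cyc_def using mj by (intro exI[of _ a]) auto
qed

text \<open>Whatever kills a lift of s kills s, so annihilating polynomials and central characters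
  pass to subquotients.\<close>

lemma subquotient_element:
  assumes S: "lmodule S" and M: "lmodule M" "lsubmodule N M" "lsubmodule K (lsub M N)"
    and iso: "lmod_iso S (lquot (lsub M N) K)" and s: "s \<in> carrier S"
  shows "\<exists>t\<in>N. \<forall>u. u \<odot>\<^bsub>M\<^esub> t = \<zero>\<^bsub>M\<^esub> \<longrightarrow> u \<odot>\<^bsub>S\<^esub> s = \<zero>\<^bsub>S\<^esub>"
proof -
  interpret S: lmodule S by fact
  interpret Q: lquotient "lsub M N" K
    using lsubmodule_lmodule[OF M(1,2)] M(3) by (simp add: lquotient_def lquotient_axioms_def)
  interpret Q': lmodule "lquot (lsub M N) K" by (rule Q.lquot_lmodule)
  obtain f where f: "bij_betw f (carrier S) (carrier (lquot (lsub M N) K))"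
    and sm: "\<And>r x. x \<in> carrier S \<Longrightarrow> f (r \<odot>\<^bsub>S\<^esub> x) = r \<odot>\<^bsub>lquot (lsub M N) K\<^esub> f x"
    using iso by (auto simp: lmod_iso_def)
  have fc: "f x \<in> carrier (lquot (lsub M N) K)" if "x \<in> carrier S" for x using f that by (auto simp: bij_betw_def)
  have f0: "f \<zero>\<^bsub>S\<^esub> = \<zero>\<^bsub>lquot (lsub M N) K\<^esub>"
    using sm[OF s, of 0] Q'.smult_0_left[OF fc[OF s]] S.smult_0_left[OF s] by simp
  obtain t where t: "t \<in> N" "f s = K +>\<^bsub>lsub M N\<^esub> t"
    using fc[OF s] unfolding Q.lquot_carrier by auto
  have "u \<odot>\<^bsub>S\<^esub> s = \<zero>\<^bsub>S\<^esub>" if u: "u \<odot>\<^bsub>M\<^esub> t = \<zero>\<^bsub>M\<^esub>" for u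
  proof -
    have "f (u \<odot>\<^bsub>S\<^esub> s) = K +>\<^bsub>lsub M N\<^esub> (u \<odot>\<^bsub>lsub M N\<^esub> t)"
      unfolding sm[OF s] t(2) using t(1) by (intro Q.lquot_smult) simp
    also have "\<dots> = \<zero>\<^bsub>lquot (lsub M N) K\<^esub>" using u Q.coset_zero by (simp add: Q.lquot_zero)
    finally have "f (u \<odot>\<^bsub>S\<^esub> s) = f \<zero>\<^bsub>S\<^esub>" using f0 by simp
    then show ?thesis
      by (rule inj_onD[OF bij_betw_imp_inj_on[OF f]]) (simp_all add: S.smult_closed s)
  qed
  then show ?thesis using t(1) by blast
qed

text \<open>Inherited from the completion through \<open>subquotient_element\<close>: annihilating
  polynomials of e, h and f give the lowest weight vector, and the center acts by the scalars of the
  highest weight module.\<close>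

lemma F_generator_properties:
  assumes S: "F_generator S"
  shows "\<exists>n x. lowest_vec S n x" "\<exists>c. central_char S c \<and> (c = 0 \<longrightarrow> rad_trivial S)"
proof -
  have simple: "simple_lmodule S" using S by (simp add: F_generator_def)
  then interpret S: umodule S by (simp add: simple_lmodule_def umodule_def)
  obtain a c N K where NK: "lsubmodule N (EA (simple_hw a c))" "lsubmodule K (lsub (EA (simple_hw a c)) N)"
    "lmod_iso S (lquot (lsub (EA (simple_hw a c)) N) K)"
    using S by (auto simp: F_generator_def is_subquotient_def)
  interpret completion a c .
  have eq: "lsub (EA L) N = lsub T N" by (simp add: EA_eq)
  have NE: "N \<subseteq> carrier (EA L)" using NK(1) by (simp add: lsubmodule_def)
  have NT: "lsubmodule N T" using NK(1) by (auto simp: EA_eq lsubmodule_def)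
  have elt: "\<exists>t. t \<in> carrier (EA L) \<and> (\<forall>u. u \<odot>\<^bsub>T\<^esub> t = \<zero>\<^bsub>T\<^esub> \<longrightarrow> u \<odot>\<^bsub>S\<^esub> s = \<zero>\<^bsub>S\<^esub>)" if "s \<in> carrier S" for s
    using subquotient_element[OF S.lmodule_axioms T.lmodule_axioms NT NK(2,3)[unfolded eq] that] NE by blast
  have tr: "P \<odot>\<^bsub>S\<^esub> s = Q \<odot>\<^bsub>S\<^esub> s" if "s \<in> carrier S" "\<And>t. t \<in> carrier T \<Longrightarrow> P \<odot>\<^bsub>T\<^esub> t = Q \<odot>\<^bsub>T\<^esub> t" for s P Q
    using elt[OF that(1)] EA_carrierD that(2) T.smult_eq_iff S.smult_eq_iff[OF that(1)] by metis
  have "central_char S c" unfolding central_char_def using tr T_C2 T_C3 by blast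
  moreover have "rad_trivial S" if "c = 0"
    unfolding rad_trivial_def using elt EA_carrierD T_rad_trivial[OF that] by blast
  ultimately show "\<exists>c. central_char S c \<and> (c = 0 \<longrightarrow> rad_trivial S)" by blast
  have car: "carrier S \<noteq> {\<zero>\<^bsub>S\<^esub>}" using simple by (simp add: simple_lmodule_def)
  then obtain y where y: "y \<in> carrier S" "y \<noteq> \<zero>\<^bsub>S\<^esub>" using S.zero_closed by blast
  have "\<exists>n. \<exists>x\<in>carrier S. lowest_vec S n x"
  proof (rule lowest_vec_exists[OF S.lmodule_axioms _ _ y])
    show "S.csub (carrier S)" by (auto simp: S.csub_def S.smult_closed)
    show "gen (Lg g) \<odot>\<^bsub>S\<^esub> x \<in> carrier S" if "x \<in> carrier S" for g x by (rule S.smult_closed[OF that])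
    show "\<exists>p. p \<noteq> 0 \<and> pev p (gen (Lg g)) \<odot>\<^bsub>S\<^esub> x = \<zero>\<^bsub>S\<^esub>" if "x \<in> carrier S" for g x
      using elt[OF that] EA_algebraic by blast
  qed
  then show "\<exists>n x. lowest_vec S n x" by blast
qed

section \<open>The category\<close>

lemma simple_nonzero_summand:
  assumes W: "simple_lmodule W" and D: "internal_direct_sum W D" and N: "\<And>N. N \<in> D \<Longrightarrow> simple_lmodule (lsub W N)"
  shows "carrier W \<in> D"
proof -
  have M: "lmodule W" using W by (simp add: simple_lmodule_def)
  interpret lmodule W by (rule M)
  have "D \<noteq> {}"
  proof
    assume "D = {}"
    have "carrier W \<subseteq> {\<zero>\<^bsub>W\<^esub>}"
    proof
      fix m assume "m \<in> carrier W"
      then obtain F x where "F \<subseteq> D" "m = (\<Oplus>\<^bsub>W\<^esub>N\<in>F. x N)"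
        by (rule internal_direct_sum_repr[OF M D])
      then show "m \<in> {\<zero>\<^bsub>W\<^esub>}" using \<open>D = {}\<close> finsum_empty by simp
    qed
    then show False using W by (auto simp: simple_lmodule_def)
  qed
  then obtain N where ND: "N \<in> D" by blast
  have "lsubmodule N W" using D ND by (simp add: internal_direct_sum_def)
  moreover have "N \<noteq> {\<zero>\<^bsub>W\<^esub>}" using N[OF ND] by (simp add: simple_lmodule_def)
  ultimately have "N = carrier W" using W by (auto simp: simple_lmodule_def)
  then show ?thesis using ND by simp
qed

lemma lsub_carrier: "lsub M (carrier M) = M"
  by simp

lemma in_F_simple: "simple_lmodule W \<Longrightarrow> in_F W \<Longrightarrow> F_generator W"
proof -
  assume W: "simple_lmodule W" "in_F W"
  then obtain D where D: "internal_direct_sum W D" "\<And>N. N \<in> D \<Longrightarrow> F_generator (lsub W N)"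
    by (auto simp: in_F_def)
  have "carrier W \<in> D"
    by (rule simple_nonzero_summand[OF W(1) D(1)]) (use D(2) in \<open>simp add: F_generator_def\<close>)
  from D(2)[OF this] show "F_generator W" unfolding lsub_carrier .
qed

lemma F_generator_in_F: "F_generator W \<Longrightarrow> in_F W"
proof -
  assume W: "F_generator W"
  then have M: "lmodule W" by (simp add: F_generator_def simple_lmodule_def)
  interpret lmodule W by (rule M)
  have "internal_direct_sum W ((\<lambda>_::unit. carrier W) ` UNIV)"
  proof (rule internal_direct_sumI[OF M])
    show "lsubmodule (carrier W) W" by (auto simp: lsubmodule_def smult_closed)
    show "inj_on (\<lambda>_::unit. carrier W) UNIV" by (simp add: inj_on_def)
  next
    fix F :: "unit set" and x i
    assume x: "\<And>i. i \<in> F \<Longrightarrow> x i \<in> carrier W" "(\<Oplus>\<^bsub>W\<^esub>i\<in>F. x i) = \<zero>\<^bsub>W\<^esub>" "i \<in> F"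
    then have F: "F = {i}" by auto
    have "(\<Oplus>\<^bsub>W\<^esub>j\<in>insert i {}. x j) = x i \<oplus>\<^bsub>W\<^esub> (\<Oplus>\<^bsub>W\<^esub>j\<in>{}. x j)"
      by (rule finsum_insert) (use x in auto)
    then show "x i = \<zero>\<^bsub>W\<^esub>" using x F finsum_empty by simp
  next
    fix m assume m: "m \<in> carrier W"
    then have "m = (\<Oplus>\<^bsub>W\<^esub>j\<in>{()}. m)"
      using finsum_insert[of "{}" "()" "\<lambda>_. m"] finsum_empty by simp
    then show "\<exists>(F :: unit set) x. finite F \<and> F \<subseteq> UNIV \<and> (\<forall>i\<in>F. x i \<in> carrier W) \<and> m = (\<Oplus>\<^bsub>W\<^esub>i\<in>F. x i)"
      using m by (intro exI[of _ "{()}"] exI[of _ "\<lambda>_. m"]) simp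
  qed
  then have "internal_direct_sum W {carrier W}" by simp
  then show "in_F W" unfolding in_F_def using M W
    by (intro conjI exI[of _ "{carrier W}"]) (simp_all add: lsub_carrier)
qed

lemma standard_F_generator:
  assumes z: "z \<noteq> 0" and W: "standard_cyc W z m j"
  shows "F_generator W"
proof -
  have mj: "m > 0 \<and> j = 0 \<or> m = 0 \<and> j < 2" using W by (simp add: standard_cyc_def)
  obtain a N K where "lsubmodule N (EA (simple_hw a z))" "lsubmodule K (lsub (EA (simple_hw a z)) N)"
    "standard_cyc (lquot (lsub (EA (simple_hw a z)) N) K) z m j"
    using EA_standard[OF z mj] by blast
  then have "is_subquotient W (EA (simple_hw a z))"
    unfolding is_subquotient_def using standard_cyc_iso[OF W] by blast
  then show ?thesis unfolding F_generator_def using standard_cyc_simple[OF z W] by blast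
qed

lemma standard_in_F: "z \<noteq> 0 \<Longrightarrow> standard_cyc W z m j \<Longrightarrow> in_F W"
  by (rule F_generator_in_F[OF standard_F_generator])

lemma standard_F_simple:
  assumes "z \<noteq> 0" "standard_cyc W z m j"
  shows "F_simple z (std_types m j) W"
  unfolding F_simple_def
  using standard_in_F[OF assms] standard_cyc_simple[OF assms] standard_cyc_central_char[OF assms]
    standard_cyc_types[OF assms] by (intro conjI)

text \<open>W is a standard module for some pair, and its types determine the pair.\<close>

lemma F_simple_standard:
  assumes z: "z \<noteq> 0" and mj: "m > 0 \<and> j = 0 \<or> m = 0 \<and> j < 2" and W: "F_simple z (std_types m j) W"
  shows "standard_cyc W z m j"
proof -
  have S: "in_F W" "simple_lmodule W" "central_char W z" "sl2_types_once W (std_types m j)"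
    using W by (simp_all add: F_simple_def)
  have M: "lmodule W" using S(2) by (simp add: simple_lmodule_def)
  obtain n x where "lowest_vec W n x" using F_generator_properties(1)[OF in_F_simple[OF S(2,1)]] by blast
  then obtain m' j' where W': "standard_cyc W z m' j'" using lowest_vec_standard[OF S(2,3) z] by blast
  have mj': "m' > 0 \<and> j' = 0 \<or> m' = 0 \<and> j' < 2" using W' by (simp add: standard_cyc_def)
  have "std_types m j = std_types m' j'"
    using sl2_types_lowest_vec[OF M S(4)] sl2_types_lowest_vec[OF M standard_cyc_types[OF z W']] by simp
  then have "m = m' \<and> j = j'" by (rule std_types_inj[OF mj mj'])
  then show ?thesis using W' by simp
qed

lemma in_F_standard:
  assumes W: "in_F W" "simple_lmodule W" "\<not> rad_trivial W"
  shows "\<exists>z m j. z \<noteq> 0 \<and> standard_cyc W z m j"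
proof -
  note g = in_F_simple[OF W(2,1)]
  obtain c where c: "central_char W c" "c = 0 \<longrightarrow> rad_trivial W" using F_generator_properties(2)[OF g] by blast
  then have c0: "c \<noteq> 0" using W(3) by blast
  obtain n x where "lowest_vec W n x" using F_generator_properties(1)[OF g] by blast
  then show ?thesis using lowest_vec_standard[OF W(2) c(1) c0] c0 by blast
qed

lemma harish_chandra_in_F:
  assumes z: "z \<noteq> 0" and W: "simple_lmodule W" "harish_chandra W" "central_char W z"
  shows "in_F W"
proof -
  obtain n x where "lowest_vec W n x" using harish_chandra_lowest_vec[OF W(1,2)] by blast
  then obtain m j where "standard_cyc W z m j" using lowest_vec_standard[OF W(1,3) z] by blast
  then show ?thesis by (rule standard_in_F[OF z])
qed

lemma central_char_unique:
  assumes W: "simple_lmodule W" "central_char W z" "central_char W z'" and z: "z \<noteq> 0"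
  shows "z = z'"
proof -
  interpret umodule W using W(1) by (simp add: simple_lmodule_def umodule_def)
  have "carrier W \<noteq> {\<zero>\<^bsub>W\<^esub>}" using W(1) by (simp add: simple_lmodule_def)
  then obtain x where x: "x \<in> carrier W" "x \<noteq> \<zero>\<^bsub>W\<^esub>" using zero_closed by blast
  have eq: "b = b'" if "scal b \<odot>\<^bsub>W\<^esub> x = scal b' \<odot>\<^bsub>W\<^esub> x" for b b'
  proof (rule ccontr)
    assume "b \<noteq> b'"
    have "scal (b - b') \<odot>\<^bsub>W\<^esub> x = \<zero>\<^bsub>W\<^esub>" using that smult_eq_iff[OF x(1)] by (simp add: scal_diff)
    then show False using scal_smult_eq_0[OF x(1), of "b - b'"] x(2) \<open>b \<noteq> b'\<close> by simp
  qed
  have "z ^ 2 = z' ^ 2" "z ^ 3 = z' ^ 3"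
    using W(2,3) x(1) by (auto simp: central_char_def intro!: eq)
  then have "z' ^ 2 * z = z' ^ 2 * z'" by (simp add: power2_eq_square power3_eq_cube)
  moreover have "z' ^ 2 \<noteq> 0" using \<open>z ^ 2 = z' ^ 2\<close> z by (metis power_not_zero)
  ultimately show ?thesis by simp
qed

lemma standard_cyc_unique:
  assumes "z \<noteq> 0" "z' \<noteq> 0" "standard_cyc V z m j" "standard_cyc V' z' m' j'" "lmod_iso V V'"
  shows "z = z' \<and> m = m' \<and> j = j'"
proof -
  have V: "simple_lmodule V" by (rule standard_cyc_simple[OF assms(1,3)])
  have M: "lmodule V" using V by (simp add: simple_lmodule_def)
  have V': "standard_cyc V z' m' j'" by (rule standard_cyc_transfer[OF assms(5,4) M])
  have z: "z = z'"
    by (rule central_char_unique[OF V standard_cyc_central_char[OF assms(1,3)] standard_cyc_central_char[OF assms(2) V'] assms(1)])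
  have mj: "m > 0 \<and> j = 0 \<or> m = 0 \<and> j < 2" "m' > 0 \<and> j' = 0 \<or> m' = 0 \<and> j' < 2"
    using assms(3) V' by (simp_all add: standard_cyc_def)
  have "std_types m j = std_types m' j'"
    using sl2_types_lowest_vec[OF M standard_cyc_types[OF assms(1,3)]]
      sl2_types_lowest_vec[OF M standard_cyc_types[OF assms(2) V']] by simp
  then show ?thesis using std_types_inj[OF mj] z by blast
qed

text \<open>The representatives live on the carrier type of subquotients of completions, where
  \<open>EA_standard\<close> provides one.\<close>

definition std_module :: "nat \<Rightarrow> nat \<Rightarrow> complex \<Rightarrow> (l4 uea, ea_elt set) module" where
  "std_module m j z = (SOME V. standard_cyc V z m j)"

lemma std_module:
  "z \<noteq> 0 \<Longrightarrow> m > 0 \<and> j = 0 \<or> m = 0 \<and> j < 2 \<Longrightarrow> standard_cyc (std_module m j z) z m j"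
  unfolding std_module_def by (rule someI_ex) (use EA_standard in blast)

lemma std_types_sets:
  "i > 0 \<Longrightarrow> std_types i 0 = {i + 2 * k | k. True}" "std_types 0 0 = {4 * k | k. True}"
  "std_types 0 1 = {2 + 4 * k | k. True}"
  by (simp_all add: std_types_def)

theorem theorem67:
  "\<exists>(V :: nat \<Rightarrow> complex \<Rightarrow> (l4 uea, ea_elt set) module)
     (V0' :: complex \<Rightarrow> (l4 uea, ea_elt set) module)
     (V2' :: complex \<Rightarrow> (l4 uea, ea_elt set) module).
    (\<forall>i z. i > 0 \<longrightarrow> z \<noteq> 0 \<longrightarrow>
      F_simple z {i + 2 * k | k. True} (V i z) \<and>
      (\<forall>W :: (l4 uea, 'a) module. F_simple z {i + 2 * k | k. True} W \<longrightarrow> lmod_iso W (V i z))) \<and>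
    (\<forall>z. z \<noteq> 0 \<longrightarrow>
      F_simple z {4 * k | k. True} (V0' z) \<and>
      (\<forall>W :: (l4 uea, 'a) module. F_simple z {4 * k | k. True} W \<longrightarrow> lmod_iso W (V0' z))) \<and>
    (\<forall>z. z \<noteq> 0 \<longrightarrow>
      F_simple z {2 + 4 * k | k. True} (V2' z) \<and>
      (\<forall>W :: (l4 uea, 'a) module. F_simple z {2 + 4 * k | k. True} W \<longrightarrow> lmod_iso W (V2' z))) \<and>
    (\<forall>W :: (l4 uea, 'a) module. in_F W \<longrightarrow> simple_lmodule W \<longrightarrow> \<not> rad_trivial W \<longrightarrow>
      (\<exists>i z. i > 0 \<and> z \<noteq> 0 \<and> lmod_iso W (V i z)) \<or>
      (\<exists>z. z \<noteq> 0 \<and> lmod_iso W (V0' z)) \<or>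
      (\<exists>z. z \<noteq> 0 \<and> lmod_iso W (V2' z))) \<and>
    (\<forall>i j z w. i > 0 \<longrightarrow> j > 0 \<longrightarrow> z \<noteq> 0 \<longrightarrow> w \<noteq> 0 \<longrightarrow>
      lmod_iso (V i z) (V j w) \<longrightarrow> i = j \<and> z = w) \<and>
    (\<forall>z w. z \<noteq> 0 \<longrightarrow> w \<noteq> 0 \<longrightarrow> lmod_iso (V0' z) (V0' w) \<longrightarrow> z = w) \<and>
    (\<forall>z w. z \<noteq> 0 \<longrightarrow> w \<noteq> 0 \<longrightarrow> lmod_iso (V2' z) (V2' w) \<longrightarrow> z = w) \<and>
    (\<forall>i z w. i > 0 \<longrightarrow> z \<noteq> 0 \<longrightarrow> w \<noteq> 0 \<longrightarrow>
      \<not> lmod_iso (V i z) (V0' w) \<and> \<not> lmod_iso (V i z) (V2' w)) \<and>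
    (\<forall>z w. z \<noteq> 0 \<longrightarrow> w \<noteq> 0 \<longrightarrow> \<not> lmod_iso (V0' z) (V2' w)) \<and>
    (\<forall>(W :: (l4 uea, 'a) module) z. z \<noteq> 0 \<longrightarrow> simple_lmodule W \<longrightarrow> harish_chandra W \<longrightarrow>
      central_char W z \<longrightarrow> in_F W)"
proof (rule exI[of _ "\<lambda>i. std_module i 0"], rule exI[of _ "std_module 0 0"],
    rule exI[of _ "std_module 0 1"], intro conjI allI impI)
  fix i :: nat and z :: complex
  assume i: "i > 0" and z: "z \<noteq> 0"
  have std: "standard_cyc (std_module i 0 z) z i 0" using std_module[OF z] i by simp
  show "F_simple z {i + 2 * k | k. True} (std_module i 0 z)"
    using standard_F_simple[OF z std] std_types_sets(1)[OF i] by simp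
  show "lmod_iso W (std_module i 0 z)" if "F_simple z {i + 2 * k | k. True} W" for W :: "(l4 uea, 'a) module"
  proof (rule standard_cyc_iso[OF F_simple_standard[OF z] std])
    show "i > 0 \<and> 0 = (0::nat) \<or> i = 0 \<and> (0::nat) < 2" using i by simp
    show "F_simple z (std_types i 0) W" using that std_types_sets(1)[OF i] by simp
  qed
next
  fix z :: complex
  assume z: "z \<noteq> 0"
  have std: "standard_cyc (std_module 0 0 z) z 0 0" using std_module[OF z] by simp
  show "F_simple z {4 * k | k. True} (std_module 0 0 z)"
    using standard_F_simple[OF z std] std_types_sets(2) by simp
  show "lmod_iso W (std_module 0 0 z)" if "F_simple z {4 * k | k. True} W" for W :: "(l4 uea, 'a) module"
    by (rule standard_cyc_iso[OF F_simple_standard[OF z] std]) (use that std_types_sets(2) in simp_all)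
next
  fix z :: complex
  assume z: "z \<noteq> 0"
  have std: "standard_cyc (std_module 0 1 z) z 0 1" using std_module[OF z] by simp
  show "F_simple z {2 + 4 * k | k. True} (std_module 0 1 z)"
    using standard_F_simple[OF z std] std_types_sets(3) by simp
  show "lmod_iso W (std_module 0 1 z)" if "F_simple z {2 + 4 * k | k. True} W" for W :: "(l4 uea, 'a) module"
  proof (rule standard_cyc_iso[OF F_simple_standard[OF z] std])
    show "0 > (0::nat) \<and> 1 = (0::nat) \<or> 0 = (0::nat) \<and> (1::nat) < 2" by simp
    show "F_simple z (std_types 0 1) W" using that unfolding std_types_sets(3) .
  qed
next
  fix W :: "(l4 uea, 'a) module"
  assume "in_F W" "simple_lmodule W" "\<not> rad_trivial W"
  then obtain z m j where zmj: "z \<noteq> 0" "standard_cyc W z m j" using in_F_standard by blast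
  then have mj: "m > 0 \<and> j = 0 \<or> m = 0 \<and> j < 2" by (simp add: standard_cyc_def)
  have iso: "lmod_iso W (std_module m j z)" by (rule standard_cyc_iso[OF zmj(2) std_module[OF zmj(1) mj]])
  from mj consider "m > 0" "j = 0" | "m = 0" "j = 0" | "m = 0" "j = 1" by linarith
  then show "(\<exists>i z. i > 0 \<and> z \<noteq> 0 \<and> lmod_iso W (std_module i 0 z)) \<or>
      (\<exists>z. z \<noteq> 0 \<and> lmod_iso W (std_module 0 0 z)) \<or> (\<exists>z. z \<noteq> 0 \<and> lmod_iso W (std_module 0 1 z))"
    using iso zmj(1) by cases blast+
next
  fix i j :: nat and z w :: complex
  assume ij: "i > 0" "j > 0" and zw: "z \<noteq> 0" "w \<noteq> 0" and iso: "lmod_iso (std_module i 0 z) (std_module j 0 w)"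
  have "standard_cyc (std_module i 0 z) z i 0" "standard_cyc (std_module j 0 w) w j 0"
    using std_module[OF zw(1), of i 0] std_module[OF zw(2), of j 0] ij by simp_all
  from standard_cyc_unique[OF zw this iso] show "i = j" "z = w" by simp_all
next
  fix z w :: complex
  assume zw: "z \<noteq> 0" "w \<noteq> 0" and iso: "lmod_iso (std_module 0 0 z) (std_module 0 0 w)"
  have "standard_cyc (std_module 0 0 z) z 0 0" "standard_cyc (std_module 0 0 w) w 0 0"
    using std_module[OF zw(1), of 0 0] std_module[OF zw(2), of 0 0] by simp_all
  from standard_cyc_unique[OF zw this iso] show "z = w" by simp
next
  fix z w :: complex
  assume zw: "z \<noteq> 0" "w \<noteq> 0" and iso: "lmod_iso (std_module 0 1 z) (std_module 0 1 w)"
  have "standard_cyc (std_module 0 1 z) z 0 1" "standard_cyc (std_module 0 1 w) w 0 1"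
    using std_module[OF zw(1), of 0 1] std_module[OF zw(2), of 0 1] by simp_all
  from standard_cyc_unique[OF zw this iso] show "z = w" by simp
next
  fix i :: nat and z w :: complex
  assume i: "i > 0" and zw: "z \<noteq> 0" "w \<noteq> 0"
  have V: "standard_cyc (std_module i 0 z) z i 0" using std_module[OF zw(1), of i 0] i by simp
  have V': "standard_cyc (std_module 0 0 w) w 0 0" "standard_cyc (std_module 0 1 w) w 0 1"
    using std_module[OF zw(2), of 0 0] std_module[OF zw(2), of 0 1] by simp_all
  show "\<not> lmod_iso (std_module i 0 z) (std_module 0 0 w)"
    using standard_cyc_unique[OF zw V V'(1)] i by auto
  show "\<not> lmod_iso (std_module i 0 z) (std_module 0 1 w)"
    using standard_cyc_unique[OF zw V V'(2)] by auto
next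
  fix z w :: complex
  assume zw: "z \<noteq> 0" "w \<noteq> 0"
  have "standard_cyc (std_module 0 0 z) z 0 0" "standard_cyc (std_module 0 1 w) w 0 1"
    using std_module[OF zw(1), of 0 0] std_module[OF zw(2), of 0 1] by simp_all
  from standard_cyc_unique[OF zw this] show "\<not> lmod_iso (std_module 0 0 z) (std_module 0 1 w)" by auto
next
  fix W :: "(l4 uea, 'a) module" and z :: complex
  assume "z \<noteq> 0" "simple_lmodule W" "harish_chandra W" "central_char W z"
  then show "in_F W" by (rule harish_chandra_in_F)
qed

end
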